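(* Let $D$ be the open unit ball of $Z=\mathbf C^d$, let $n\in\mathbf N$ and let $\nu$ be sufficiently large so that the Hilbert spaces below contain all polynomial maps. For each integer $0\le\lambda\le n$ the operator $$\mathcal I_\lambda=\sum_{k=0}^{n-\lambda}\frac{(-1)^k}{(2\lambda+\nu)_k}\binom{n-\lambda}{k}(\zeta|\overline\partial)^k=\sum_{k=0}^{n-\lambda}\frac{(\lambda-n)_k}{(2\lambda+\nu)_k}\frac{(\zeta|\overline\partial)^k}{k!}=\sum_{k=0}^{n-\lambda}\frac{(\lambda-n)_k}{(2\lambda+\nu)_k}\mathcal E^k(\zeta,\overline\partial)$$ is an intertwiner $H^2_\nu(D,\mathcal P_\lambda Z)\to H^2_\nu(D,\mathcal P^nZ)$, i.e. $g^{\beta_\nu}\mathcal I_\lambda=\mathcal I_\lambda g^{\alpha_\nu}$ for all $g\in G$.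
   Context: $D=\{z\in\mathbf C^d:(z|z)<1\}$, where $(u|v)$ is the standard inner product (linear in $u$, conjugate-linear in $v$); $G$ is the identity component of the biholomorphic automorphism group of $D$, $K$ the stabilizer of $0$; the genus is $p=d+1$. $\Delta_{z,w}=1-(z|w)$; $B_{z,w}\zeta=(1-(z|w))(\zeta-(\zeta|w)z)$; quasi-inverse $z^w=z/(1-(z|w))$; $d\mu(x)=c\,\Delta_{x,x}^{-p}dx$ is a $G$-invariant measure ($c>0$). $\mathcal P_\lambda Z$ is the space of $\lambda$-homogeneous holomorphic polynomials in $\zeta\in Z$, $\mathcal P^nZ$ the space of polynomials of degree $\le n$. $(\phi|\psi)_F=\int_Z\pi^{-d}e^{-(\omega|\omega)}\overline{\phi(\omega)}\psi(\omega)\,d\omega$. $(s)_k=s(s+1)\cdots(s+k-1)$. $\zeta^\partial=(\zeta|\overline\partial):=\sum_{i=1}^d(\zeta|u_i)\,u_i^\partial$, where $(u_i)$ is an orthonormal basis and $u_i^\partial$ is the holomorphic directional derivative along $u_i$ in the variable $z$ (with $\zeta$ treated as a parameter: $(\zeta|\overline\partial)^k$ maps $f(z)\psi(\zeta)$ to $\psi(\zeta)\,\frac{d^k}{dt^k}\big|_{t=0}f(z+t\zeta)$); $\mathcal E^k(\zeta,\omega)=(\zeta|\omega)^k/k!$, so $\mathcal E^k(\zeta,\overline\partial)=(\zeta|\overline\partial)^k/k!$. $H^2_\nu(D,\mathcal P_\lambda Z)$: holomorphic maps $z\mapsto\Phi_z(\zeta)\in\mathcal P_\lambda Z$ on $D$,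 square-integrable for $(\Phi|\Psi)=\int_Dd\mu(x)\Delta_{x,x}^\nu(\Phi_x|\Psi_x\circ B_{x,x})_F$, with (projective) unitary $G$-action $(g^{-\alpha_\nu}\Phi)_z(\zeta)=\det(\partial_zg)^{\nu/p}\Phi_{g(z)}((\partial_zg)\zeta)$. $H^2_\nu(D,\mathcal P^nZ)$: fix any $K$-invariant inner product on $\mathcal P^nZ$; holomorphic maps $z\mapsto\Phi_z(\zeta)\in\mathcal P^nZ$ square-integrable for $(\Phi|\Psi)=\int_Dd\mu(x)\Delta_{x,x}^\nu\big(\Delta_{\zeta,-x}^n\Phi_x(B_{x,x}^{1/2}\zeta^{-x})\,|\,\Delta_{\zeta,-x}^n\Psi_x(B_{x,x}^{1/2}\zeta^{-x})\big)$, with (projective) unitary $G$-action $(g^{-\beta_\nu}\Phi)_z(\zeta)=\det(\partial_zg)^{(\nu+n)/p}\det(\partial_{z+\zeta}g)^{-n/p}\Phi_{g(z)}(g(z+\zeta)-g(z))$ (the right side is polynomial in $\zeta$ of degree $\le n$). $\partial_zg$ is the complex derivative; $g^{-\alpha_\nu}$, $g^{-\beta_\nu}$ denote the inverses of $g^{\alpha_\nu}$, $g^{\beta_\nu}$; for each $g$ one branch of $\log\det(\partial_zg)$ is used for all powers. *)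

theory Defs
  imports "HOL-Analysis.Analysis"
begin

section \<open>The unit ball and its automorphism group\<close>

definition hprod :: "complex^'d \<Rightarrow> complex^'d \<Rightarrow> complex" where
  "hprod u v = (\<Sum>i\<in>UNIV. u $ i * cnj (v $ i))"

definition unit_ball :: "(complex^'d) set" where
  "unit_ball = {z. Re (hprod z z) < 1}"

lemma unit_ball_eq_ball: "(unit_ball :: (complex^'d) set) = ball 0 1"
proof -
  have "Re (hprod z z) = (norm z)\<^sup>2" for z :: "complex^'d"
    by (simp add: hprod_def norm_vec_def L2_set_def sum_nonneg complex_mult_cnj cmod_power2)
  then show ?thesis
    by (auto simp: unit_ball_def abs_square_less_1)
qed

text \<open>Holomorphy is complex Frechet differentiability, for maps into
  \<open>complex^'d\<close> componentwise.\<close>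

definition holo_on :: "(complex^'d) set \<Rightarrow> (complex^'d \<Rightarrow> complex) \<Rightarrow> bool" where
  "holo_on S f \<longleftrightarrow> (\<forall>z\<in>S. \<exists>f'. (f has_derivative f') (at z) \<and> (\<forall>a v. f' (a *s v) = a * f' v))"

definition holo_map_on :: "(complex^'d) set \<Rightarrow> (complex^'d \<Rightarrow> complex^'d) \<Rightarrow> bool" where
  "holo_map_on S g \<longleftrightarrow> (\<forall>i. holo_on S (\<lambda>z. g z $ i))"

definition ball_auts :: "(complex^'d \<Rightarrow> complex^'d) set" where
  "ball_auts = {g \<in> extensional unit_ball. bij_betw g unit_ball unit_ball \<and>
     holo_map_on unit_ball g \<and> holo_map_on unit_ball (inv_into unit_ball g)}"

definition aut_topology :: "(complex^'d \<Rightarrow> complex^'d) topology" where \<comment> \<open>compact-open\<close>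
  "aut_topology = topology_generated_by
     {{g \<in> ball_auts. g ` C \<subseteq> U} | C U. compact C \<and> C \<subseteq> unit_ball \<and> open U}"

definition G_group :: "(complex^'d \<Rightarrow> complex^'d) set" where
  "G_group = connected_component_of_set aut_topology (restrict id unit_ball)"

definition K_group :: "(complex^'d \<Rightarrow> complex^'d) set" where
  "K_group = {k \<in> G_group. k 0 = 0}"

definition jac_det :: "(complex^'d \<Rightarrow> complex^'d) \<Rightarrow> complex^'d \<Rightarrow> complex" where
  "jac_det g z = det (matrix (frechet_derivative g (at z)))"

definition log_branch :: "(complex^'d \<Rightarrow> complex^'d) \<Rightarrow> (complex^'d \<Rightarrow> complex) \<Rightarrow> bool" where
  "log_branch g L \<longleftrightarrow> continuous_on unit_ball L \<and> (\<forall>z\<in>unit_ball. exp (L z) = jac_det g z)"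

definition genus :: "'d::finite itself \<Rightarrow> real" where
  "genus _ = real CARD('d) + 1"

section \<open>Jordan-theoretic data and the invariant measure\<close>

definition Delta :: "complex^'d \<Rightarrow> complex^'d \<Rightarrow> complex" where
  "Delta z w = 1 - hprod z w"

definition Bergman_op :: "complex^'d \<Rightarrow> complex^'d \<Rightarrow> complex^'d \<Rightarrow> complex^'d" where
  "Bergman_op z w \<zeta> = (1 - hprod z w) *s (\<zeta> - hprod \<zeta> w *s z)"

definition pos_sqrt :: "(complex^'d \<Rightarrow> complex^'d) \<Rightarrow> complex^'d \<Rightarrow> complex^'d" where
  "pos_sqrt A = (THE T. (\<forall>u v. T (u + v) = T u + T v) \<and> (\<forall>a u. T (a *s u) = a *s T u) \<and>
     (\<forall>u v. hprod (T u) v = hprod u (T v)) \<and> (\<forall>u. 0 \<le> Re (hprod (T u) u)) \<and> T \<circ> T = A)"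

definition quasi_inverse :: "complex^'d \<Rightarrow> complex^'d \<Rightarrow> complex^'d" where
  "quasi_inverse z w = (1 / (1 - hprod z w)) *s z"

definition inv_measure :: "real \<Rightarrow> (complex^'d) measure" where
  "inv_measure c = density (restrict_space lborel unit_ball)
     (\<lambda>x. ennreal (c * Re (Delta x x) powr (- genus TYPE('d))))"

section \<open>Polynomials\<close>

text \<open>Polynomials are polynomial functions; a multi-index is a function \<open>'d \<Rightarrow> nat\<close>.\<close>

definition mpolys :: "('d \<Rightarrow> nat) set \<Rightarrow> (complex^'d \<Rightarrow> complex) set" where
  "mpolys M = {\<phi>. \<exists>a. \<phi> = (\<lambda>\<zeta>. \<Sum>m\<in>M. a m * (\<Prod>i\<in>UNIV. \<zeta> $ i ^ m i))}"

definition hom_polys :: "nat \<Rightarrow> (complex^'d \<Rightarrow> complex) set" where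
  "hom_polys l = mpolys {m. (\<Sum>i\<in>UNIV. m i) = l}"

definition deg_polys :: "nat \<Rightarrow> (complex^'d \<Rightarrow> complex) set" where
  "deg_polys n = mpolys {m. (\<Sum>i\<in>UNIV. m i) \<le> n}"

text \<open>Some expressions in \<open>\<zeta>\<close> below are polynomial of degree at most \<open>n\<close>, but the formula
  makes sense only on a dense or open set \<open>S\<close>; they denote the polynomial extension from
  \<open>S\<close> (on whose complement the total functions of HOL would give junk values).\<close>

definition poly_extension ::
  "nat \<Rightarrow> (complex^'d) set \<Rightarrow> (complex^'d \<Rightarrow> complex) \<Rightarrow> complex^'d \<Rightarrow> complex" where
  "poly_extension n S f = (THE q. q \<in> deg_polys n \<and> (\<forall>\<zeta>\<in>S. q \<zeta> = f \<zeta>))"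

definition fischer :: "(complex^'d \<Rightarrow> complex) \<Rightarrow> (complex^'d \<Rightarrow> complex) \<Rightarrow> complex" where
  "fischer \<phi> \<psi> = (LINT \<omega>|lborel.
     of_real (pi powr (- real CARD('d)) * exp (- Re (hprod \<omega> \<omega>))) * cnj (\<phi> \<omega>) * \<psi> \<omega>)"

text \<open>Inner products on polynomials are conjugate-linear in the first argument, like
  \<^const>\<open>fischer\<close>. The elements of \<open>K\<close> are (restrictions of) linear maps, so \<open>k\<close> acts on
  polynomials through its derivative at \<open>0\<close>.\<close>

definition K_invariant_inner ::
  "nat \<Rightarrow> ((complex^'d \<Rightarrow> complex) \<Rightarrow> (complex^'d \<Rightarrow> complex) \<Rightarrow> complex) \<Rightarrow> bool" where
  "K_invariant_inner n ip \<longleftrightarrow>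
     (\<forall>\<phi>\<in>deg_polys n. \<forall>\<psi>\<in>deg_polys n. \<forall>\<rho>\<in>deg_polys n.
        ip \<phi> (\<lambda>\<zeta>. \<psi> \<zeta> + \<rho> \<zeta>) = ip \<phi> \<psi> + ip \<phi> \<rho>) \<and>
     (\<forall>\<phi>\<in>deg_polys n. \<forall>\<psi>\<in>deg_polys n. \<forall>a. ip \<phi> (\<lambda>\<zeta>. a * \<psi> \<zeta>) = a * ip \<phi> \<psi>) \<and>
     (\<forall>\<phi>\<in>deg_polys n. \<forall>\<psi>\<in>deg_polys n. ip \<psi> \<phi> = cnj (ip \<phi> \<psi>)) \<and>
     (\<forall>\<phi>\<in>deg_polys n. \<phi> \<noteq> (\<lambda>_. 0) \<longrightarrow> 0 < Re (ip \<phi> \<phi>)) \<and>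
     (\<forall>k\<in>K_group. \<forall>\<phi>\<in>deg_polys n. \<forall>\<psi>\<in>deg_polys n.
        ip (\<phi> \<circ> frechet_derivative k (at 0)) (\<psi> \<circ> frechet_derivative k (at 0)) = ip \<phi> \<psi>)"

section \<open>Hilbert spaces of polynomial-valued holomorphic maps\<close>

text \<open>A map \<open>z \<mapsto> \<Phi> z\<close> on the ball is represented by a total function vanishing for \<open>z\<close>
  outside the ball, so that equality of maps is equality in HOL. Since the polynomial spaces
  are finite-dimensional and spanned dually by the point evaluations, holomorphic (polynomial)
  dependence on \<open>z\<close> may be tested at each \<open>\<zeta>\<close>.\<close>

definition holo_maps ::
  "(complex^'d \<Rightarrow> complex) set \<Rightarrow> (complex^'d \<Rightarrow> complex^'d \<Rightarrow> complex) set" where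
  "holo_maps V = {\<Phi>. (\<forall>z\<in>unit_ball. \<Phi> z \<in> V) \<and> (\<forall>z. z \<notin> unit_ball \<longrightarrow> \<Phi> z = (\<lambda>_. 0)) \<and>
     (\<forall>\<zeta>. holo_on unit_ball (\<lambda>z. \<Phi> z \<zeta>))}"

definition polynomial_maps ::
  "(complex^'d \<Rightarrow> complex) set \<Rightarrow> (complex^'d \<Rightarrow> complex^'d \<Rightarrow> complex) set" where
  "polynomial_maps V = {\<Phi>. (\<forall>z\<in>unit_ball. \<Phi> z \<in> V) \<and> (\<forall>z. z \<notin> unit_ball \<longrightarrow> \<Phi> z = (\<lambda>_. 0)) \<and>
     (\<exists>N. \<forall>\<zeta>. \<exists>q\<in>deg_polys N. \<forall>z\<in>unit_ball. \<Phi> z \<zeta> = q z)}"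

text \<open>The integrands, with respect to \<^const>\<open>inv_measure\<close>, of the two inner products. For
  \<open>\<Phi> = \<Psi>\<close> they are real and nonnegative, so square-integrability is integrability of the
  diagonal integrand.\<close>

definition hom_integrand ::
  "real \<Rightarrow> (complex^'d \<Rightarrow> complex^'d \<Rightarrow> complex) \<Rightarrow> (complex^'d \<Rightarrow> complex^'d \<Rightarrow> complex) \<Rightarrow>
   complex^'d \<Rightarrow> complex" where
  "hom_integrand \<nu> \<Phi> \<Psi> x =
     of_real (Re (Delta x x) powr \<nu>) * fischer (\<Phi> x) (\<Psi> x \<circ> Bergman_op x x)"

definition H2_hom :: "real \<Rightarrow> real \<Rightarrow> nat \<Rightarrow> (complex^'d \<Rightarrow> complex^'d \<Rightarrow> complex) set" where
  "H2_hom c \<nu> l = {\<Phi> \<in> holo_maps (hom_polys l). integrable (inv_measure c) (hom_integrand \<nu> \<Phi> \<Phi>)}"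

definition translate_poly ::
  "nat \<Rightarrow> complex^'d \<Rightarrow> (complex^'d \<Rightarrow> complex) \<Rightarrow> complex^'d \<Rightarrow> complex" where
  "translate_poly n x \<phi> = poly_extension n {\<zeta>. Delta \<zeta> (- x) \<noteq> 0}
     (\<lambda>\<zeta>. Delta \<zeta> (- x) ^ n * \<phi> (pos_sqrt (Bergman_op x x) (quasi_inverse \<zeta> (- x))))"

definition deg_integrand ::
  "((complex^'d \<Rightarrow> complex) \<Rightarrow> (complex^'d \<Rightarrow> complex) \<Rightarrow> complex) \<Rightarrow> real \<Rightarrow> nat \<Rightarrow>
   (complex^'d \<Rightarrow> complex^'d \<Rightarrow> complex) \<Rightarrow> (complex^'d \<Rightarrow> complex^'d \<Rightarrow> complex) \<Rightarrow>
   complex^'d \<Rightarrow> complex" where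
  "deg_integrand ip \<nu> n \<Phi> \<Psi> x =
     of_real (Re (Delta x x) powr \<nu>) * ip (translate_poly n x (\<Phi> x)) (translate_poly n x (\<Psi> x))"

definition H2_deg ::
  "real \<Rightarrow> ((complex^'d \<Rightarrow> complex) \<Rightarrow> (complex^'d \<Rightarrow> complex) \<Rightarrow> complex) \<Rightarrow> real \<Rightarrow> nat \<Rightarrow>
   (complex^'d \<Rightarrow> complex^'d \<Rightarrow> complex) set" where
  "H2_deg c ip \<nu> n = {\<Phi> \<in> holo_maps (deg_polys n).
     integrable (inv_measure c) (deg_integrand ip \<nu> n \<Phi> \<Phi>)}"

section \<open>The group actions\<close>

text \<open>Here \<open>L\<close> is the chosen branch of \<open>log det (\<partial>\<^sub>z g)\<close>; the operators \<open>alpha_inv\<close> and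
  \<open>beta_inv\<close> are \<open>g\<close> to the powers \<open>-\<alpha>\<^sub>\<nu>\<close> and \<open>-\<beta>\<^sub>\<nu>\<close>.\<close>

definition alpha_inv ::
  "real \<Rightarrow> (complex^'d \<Rightarrow> complex^'d) \<Rightarrow> (complex^'d \<Rightarrow> complex) \<Rightarrow>
   (complex^'d \<Rightarrow> complex^'d \<Rightarrow> complex) \<Rightarrow> complex^'d \<Rightarrow> complex^'d \<Rightarrow> complex" where
  "alpha_inv \<nu> g L \<Phi> = (\<lambda>z. if z \<in> unit_ball
     then (\<lambda>\<zeta>. exp (of_real (\<nu> / genus TYPE('d)) * L z) * \<Phi> (g z) (frechet_derivative g (at z) \<zeta>))
     else (\<lambda>_. 0))"

definition beta_inv ::
  "real \<Rightarrow> nat \<Rightarrow> (complex^'d \<Rightarrow> complex^'d) \<Rightarrow> (complex^'d \<Rightarrow> complex) \<Rightarrow>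
   (complex^'d \<Rightarrow> complex^'d \<Rightarrow> complex) \<Rightarrow> complex^'d \<Rightarrow> complex^'d \<Rightarrow> complex" where
  "beta_inv \<nu> n g L \<Phi> = (\<lambda>z. if z \<in> unit_ball
     then poly_extension n {\<zeta>. z + \<zeta> \<in> unit_ball}
       (\<lambda>\<zeta>. exp (of_real ((\<nu> + real n) / genus TYPE('d)) * L z) *
             exp (of_real (- real n / genus TYPE('d)) * L (z + \<zeta>)) *
             \<Phi> (g z) (g (z + \<zeta>) - g z))
     else (\<lambda>_. 0))"

definition alpha ::
  "real \<Rightarrow> real \<Rightarrow> nat \<Rightarrow> (complex^'d \<Rightarrow> complex^'d) \<Rightarrow> (complex^'d \<Rightarrow> complex) \<Rightarrow>
   (complex^'d \<Rightarrow> complex^'d \<Rightarrow> complex) \<Rightarrow> complex^'d \<Rightarrow> complex^'d \<Rightarrow> complex" where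
  "alpha c \<nu> l g L = the_inv_into (H2_hom c \<nu> l) (alpha_inv \<nu> g L)"

definition beta ::
  "real \<Rightarrow> ((complex^'d \<Rightarrow> complex) \<Rightarrow> (complex^'d \<Rightarrow> complex) \<Rightarrow> complex) \<Rightarrow> real \<Rightarrow> nat \<Rightarrow>
   (complex^'d \<Rightarrow> complex^'d) \<Rightarrow> (complex^'d \<Rightarrow> complex) \<Rightarrow>
   (complex^'d \<Rightarrow> complex^'d \<Rightarrow> complex) \<Rightarrow> complex^'d \<Rightarrow> complex^'d \<Rightarrow> complex" where
  "beta c ip \<nu> n g L = the_inv_into (H2_deg c ip \<nu> n) (beta_inv \<nu> n g L)"

definition intertwiner ::
  "(complex^'d \<Rightarrow> complex^'d \<Rightarrow> complex) set \<Rightarrow> (complex^'d \<Rightarrow> complex^'d \<Rightarrow> complex) set \<Rightarrow>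
   ((complex^'d \<Rightarrow> complex^'d) \<Rightarrow> (complex^'d \<Rightarrow> complex) \<Rightarrow>
     (complex^'d \<Rightarrow> complex^'d \<Rightarrow> complex) \<Rightarrow> (complex^'d \<Rightarrow> complex^'d \<Rightarrow> complex)) \<Rightarrow>
   ((complex^'d \<Rightarrow> complex^'d) \<Rightarrow> (complex^'d \<Rightarrow> complex) \<Rightarrow>
     (complex^'d \<Rightarrow> complex^'d \<Rightarrow> complex) \<Rightarrow> (complex^'d \<Rightarrow> complex^'d \<Rightarrow> complex)) \<Rightarrow>
   ((complex^'d \<Rightarrow> complex^'d \<Rightarrow> complex) \<Rightarrow> (complex^'d \<Rightarrow> complex^'d \<Rightarrow> complex)) \<Rightarrow> bool" where
  "intertwiner H H' act act' T \<longleftrightarrow>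
     (\<forall>\<Phi>\<in>H. T \<Phi> \<in> H') \<and>
     (\<forall>\<Phi>\<in>H. \<forall>\<Psi>\<in>H. T (\<lambda>z \<zeta>. \<Phi> z \<zeta> + \<Psi> z \<zeta>) = (\<lambda>z \<zeta>. T \<Phi> z \<zeta> + T \<Psi> z \<zeta>)) \<and>
     (\<forall>\<Phi>\<in>H. \<forall>a. T (\<lambda>z \<zeta>. a * \<Phi> z \<zeta>) = (\<lambda>z \<zeta>. a * T \<Phi> z \<zeta>)) \<and>
     (\<forall>g\<in>G_group. \<forall>L. log_branch g L \<longrightarrow> (\<forall>\<Phi>\<in>H. act' g L (T \<Phi>) = T (act g L \<Phi>)))"

section \<open>The operators\<close>

text \<open>\<open>zeta_d \<zeta>\<close> is the constant-coefficient operator \<open>(\<zeta>|\<partial>)\<close>, acting on functions of \<open>z\<close>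
  with the parameter \<open>\<zeta>\<close> frozen; it is written in the standard orthonormal basis.\<close>

definition zeta_d :: "complex^'d \<Rightarrow> (complex^'d \<Rightarrow> complex) \<Rightarrow> complex^'d \<Rightarrow> complex" where
  "zeta_d \<zeta> f z = (\<Sum>i\<in>UNIV. hprod \<zeta> (axis i 1) * frechet_derivative f (at z) (axis i 1))"

definition zeta_d_pow ::
  "nat \<Rightarrow> (complex^'d \<Rightarrow> complex^'d \<Rightarrow> complex) \<Rightarrow> complex^'d \<Rightarrow> complex^'d \<Rightarrow> complex" where
  "zeta_d_pow k \<Phi> z \<zeta> = (zeta_d \<zeta> ^^ k) (\<lambda>w. \<Phi> w \<zeta>) z"

definition cal_E ::
  "nat \<Rightarrow> (complex^'d \<Rightarrow> complex^'d \<Rightarrow> complex) \<Rightarrow> complex^'d \<Rightarrow> complex^'d \<Rightarrow> complex" where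
  "cal_E k \<Phi> z \<zeta> = zeta_d_pow k \<Phi> z \<zeta> / fact k"

definition I_op ::
  "real \<Rightarrow> nat \<Rightarrow> nat \<Rightarrow> (complex^'d \<Rightarrow> complex^'d \<Rightarrow> complex) \<Rightarrow>
   complex^'d \<Rightarrow> complex^'d \<Rightarrow> complex" where
  "I_op \<nu> n l \<Phi> = (\<lambda>z \<zeta>. if z \<in> unit_ball
     then (\<Sum>k=0..n - l. (-1) ^ k / of_real (pochhammer (2 * real l + \<nu>) k) *
             of_nat ((n - l) choose k) * zeta_d_pow k \<Phi> z \<zeta>)
     else 0)"

end

theory Submission
  imports Defs "HOL-Complex_Analysis.Complex_Analysis"
begin

text \<open>By the Schwarz lemma every automorphism \<open>g\<close> of the ball is a unitary map followed by a Moebius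
  map, and such a map sends complex lines to complex lines:
  \<open>g (z + t \<zeta>) = g z + t / (1 + \<gamma> t) \<cdot> (\<partial>\<^sub>z g) \<zeta>\<close>, where the power \<open>- 1 / (d + 1)\<close> of the Jacobian
  determinant of \<open>g\<close> at \<open>z + t \<zeta>\<close> is a constant multiple of \<open>1 + \<gamma> t\<close>. The intertwining relation thereby
  becomes an identity about functions of one variable: the derivatives at \<open>t = 0\<close> of
  \<open>(1 + \<gamma> t)\<^bsup>- (2 \<lambda> + \<nu>)\<^esup> f (t / (1 + \<gamma> t))\<close> are explicit combinations of those of \<open>f\<close>, as in Bol's
  lemma, and with the coefficients of \<open>\<I>\<^sub>\<lambda>\<close> the binomial theorem collapses these combinations
  to the factors \<open>(1 + \<gamma>)\<^bsup>n - \<lambda> - k\<^esup>\<close>.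

  For square integrability, Cauchy's inequality and the mean value property bound \<open>(\<I>\<^sub>\<lambda> \<Phi>)\<^sub>0\<close> by the
  norm of \<open>\<Phi>\<close> over a ball about \<open>0\<close>. The intertwining relation moves this estimate to every
  point \<open>x\<close>, and it is then integrated over \<open>x\<close> with Tonelli's theorem.\<close>

section \<open>Moebius transformations of the ball\<close>

text \<open>The actions \<open>alpha\<close> and \<open>beta\<close> are inverses formed inside the
  Hilbert spaces. A relation between \<open>alpha_inv\<close> and \<open>beta_inv\<close> therefore
  says something about them only after three facts: \<open>alpha_inv\<close> is bijective on
  \<open>H2_hom\<close>, \<open>beta_inv\<close> is injective, and the operator maps
  \<open>H2_hom\<close> into \<open>H2_deg\<close>. The last one is the main obstacle, because the
  target norm comes from an arbitrary invariant inner product. The estimates are therefore made for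
  one fixed \<zeta> at a time: finitely many values determine a polynomial of bounded degree, and
  these values bound every inner product. In the source norm the Fischer product carries the Bergman
  operator on one side only and is not visibly a square; diagonalising its square root moves half of
  it to the other side. The resulting density of the transformed map at \<open>x\<close> is the
  density of the original map at \<open>g x\<close>, so invariance of the norm reduces to invariance
  of the measure. The size of \<nu> enters as \<open>0 < \<nu>\<close>, read off from the square
  integrability of the constant map; it keeps the Pochhammer denominators away from zero.\<close>

lemma hprod_add_left: "hprod (u + v) w = hprod u w + hprod v w"
  by (simp add: hprod_def distrib_right sum.distrib)

lemma hprod_diff_left: "hprod (u - v) w = hprod u w - hprod v w"
  by (simp add: hprod_def left_diff_distrib sum_subtractf)

lemma hprod_scale_left: "hprod (a *s u) w = a * hprod u w"
  by (simp add: hprod_def sum_distrib_left mult.assoc)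

lemma hprod_minus_left: "hprod (- u) w = - hprod u w"
  by (simp add: hprod_def sum_negf)

lemma hprod_commute: "hprod u v = cnj (hprod v u)"
  by (simp add: hprod_def mult.commute)

lemma hprod_add_right: "hprod w (u + v) = hprod w u + hprod w v"
  by (simp add: hprod_def distrib_left sum.distrib)

lemma hprod_diff_right: "hprod w (u - v) = hprod w u - hprod w v"
  by (simp add: hprod_def right_diff_distrib sum_subtractf)

lemma hprod_scale_right: "hprod w (a *s u) = cnj a * hprod w u"
  by (simp add: hprod_def sum_distrib_left mult.left_commute)

lemma hprod_minus_right: "hprod w (- u) = - hprod w u"
  by (simp add: hprod_def sum_negf)

lemma hprod_zero [simp]: "hprod 0 w = 0" "hprod w 0 = 0"
  by (simp_all add: hprod_def)

lemmas hprod_simps = hprod_add_left hprod_diff_left hprod_scale_left hprod_minus_left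
  hprod_add_right hprod_diff_right hprod_scale_right hprod_minus_right

lemma hprod_self: "hprod z z = of_real ((norm z)\<^sup>2)"
  by (simp add: hprod_def norm_vec_def L2_set_def sum_nonneg complex_mult_cnj cmod_power2)

lemma Re_hprod: "Re (hprod u v) = u \<bullet> v"
  by (simp add: hprod_def inner_vec_def inner_complex_def)

lemma norm_scale [simp]: "norm (a *s (u :: complex^'d)) = cmod a * norm u"
  by (simp add: norm_vec_def L2_set_def norm_mult power_mult_distrib
      sum_distrib_left[symmetric] real_sqrt_mult)

text \<open>A unimodular factor \<open>a\<close> turns \<open>hprod u v\<close> into its modulus;
  the real Cauchy-Schwarz inequality then applies, since the real part of \<open>hprod\<close> is
  the Euclidean inner product.\<close>

lemma norm_hprod_le: "cmod (hprod u v) \<le> norm u * norm v"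
proof (cases "hprod u v = 0")
  case False
  define a where "a = cnj (hprod u v) / of_real (cmod (hprod u v))"
  have a: "cmod a = 1" using False by (simp add: a_def norm_divide)
  have "hprod (a *s u) v = of_real (cmod (hprod u v))"
    using False unfolding a_def hprod_scale_left
    by (simp add: mult.commute complex_norm_square[symmetric] power2_eq_square)
  then have "cmod (hprod u v) = (a *s u) \<bullet> v" by (metis Re_hprod Re_complex_of_real)
  also have "\<dots> \<le> norm (a *s u) * norm v" by (rule norm_cauchy_schwarz)
  finally show ?thesis by (simp add: a)
qed simp

lemma ball_iff: "z \<in> unit_ball \<longleftrightarrow> norm z < 1"
  by (simp add: unit_ball_eq_ball)

lemma hprod_less_1: "z \<in> unit_ball \<Longrightarrow> norm b \<le> 1 \<Longrightarrow> cmod (hprod z b) < 1"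
  using norm_hprod_le[of z b] mult_left_le[of "norm b" "norm z"] by (auto simp: ball_iff)

lemma one_plus_hprod_nonzero: "z \<in> unit_ball \<Longrightarrow> norm b \<le> 1 \<Longrightarrow> 1 + hprod z b \<noteq> 0"
  using hprod_less_1[of z b]
  by (metis add_eq_0_iff2 norm_minus_cancel norm_one order_less_irrefl add.commute)

text \<open>The square root of \<open>Delta b b\<close>. Its powers give the eigenvalues of the
  Bergman square root and the modulus of the Jacobian of a Moebius map.\<close>

definition defect :: "complex^'d \<Rightarrow> real" where
  "defect b = sqrt (1 - (norm b)\<^sup>2)"

lemma defect_pos: "b \<in> unit_ball \<Longrightarrow> 0 < defect b"
  by (simp add: defect_def ball_iff abs_square_less_1)

lemma defect_sq: "b \<in> unit_ball \<Longrightarrow> (defect b)\<^sup>2 = 1 - (norm b)\<^sup>2"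
  by (simp add: defect_def ball_iff abs_square_less_1 less_imp_le)

lemma hprod_self_defect: "b \<in> unit_ball \<Longrightarrow> hprod b b = 1 - (of_real (defect b))\<^sup>2"
  unfolding of_real_power[symmetric] by (simp only: defect_sq hprod_self) simp

lemma Re_Delta: "Re (Delta x x) = 1 - (norm x)\<^sup>2"
  by (simp add: Delta_def hprod_self)

text \<open>The square root of the Bergman operator in closed form. With \<open>s = defect b\<close>
  its eigenvalue is \<open>s\<^sup>2\<close> on \<open>b\<close> and \<open>s\<close> on the
  orthogonal complement. The coefficient \<open>s / (1 + s)\<close> is
  \<open>(s - s\<^sup>2) / (norm b)\<^sup>2\<close> after cancelling \<open>1 - s\<close>, which
  makes the formula valid at \<open>b = 0\<close> as well.\<close>

definition msqrt :: "complex^'d \<Rightarrow> complex^'d \<Rightarrow> complex^'d" where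
  "msqrt b \<zeta> = of_real (defect b) *s \<zeta> - (of_real (defect b / (1 + defect b)) * hprod \<zeta> b) *s b"

text \<open>This is \<open>b\<close> plus the Bergman square root applied to the quasi-inverse of
  \<open>z\<close> with respect to \<open>- b\<close>: the transvection carrying 0 to
  \<open>b\<close> with derivative \<open>msqrt b\<close> at 0.\<close>

definition mob :: "complex^'d \<Rightarrow> complex^'d \<Rightarrow> complex^'d" where
  "mob b z = b + (1 / (1 + hprod z b)) *s msqrt b z"

lemma msqrt_add: "msqrt b (u + v) = msqrt b u + msqrt b v"
  by (simp add: msqrt_def hprod_simps vec_eq_iff algebra_simps add_divide_distrib)

lemma msqrt_diff: "msqrt b (u - v) = msqrt b u - msqrt b v"
  by (simp add: msqrt_def hprod_simps vec_eq_iff algebra_simps diff_divide_distrib)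

lemma msqrt_scale: "msqrt b (a *s u) = a *s msqrt b u"
  by (simp add: msqrt_def hprod_simps vec_eq_iff algebra_simps)

lemma msqrt_minus_point: "msqrt (- b) = msqrt b"
  by (simp add: msqrt_def defect_def hprod_simps fun_eq_iff)

lemma msqrt_self_adjoint: "hprod (msqrt b u) v = hprod u (msqrt b v)"
proof -
  have "cnj (hprod v b) = hprod b v" by (rule hprod_commute[symmetric])
  then show ?thesis by (simp add: msqrt_def hprod_simps)
qed

lemma msqrt_point: "b \<in> unit_ball \<Longrightarrow> msqrt b b = (of_real (defect b))\<^sup>2 *s b"
proof -
  assume b: "b \<in> unit_ball"
  have "1 + complex_of_real (defect b) \<noteq> 0"
    using defect_pos[OF b] by (metis add_pos_pos of_real_1 of_real_add of_real_eq_0_iff order_less_irrefl zero_less_one)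
  then show ?thesis
    unfolding msqrt_def hprod_self_defect[OF b]
    by (simp add: vec_eq_iff field_simps power2_eq_square)
qed

lemma hprod_msqrt_point: "b \<in> unit_ball \<Longrightarrow> hprod (msqrt b z) b = (of_real (defect b))\<^sup>2 * hprod z b"
  by (simp add: msqrt_self_adjoint msqrt_point hprod_simps)

lemma msqrt_msqrt:
  assumes b: "b \<in> unit_ball"
  shows "msqrt b (msqrt b z) = (of_real (defect b))\<^sup>2 *s (z - hprod z b *s b)"
proof -
  have nz: "1 + complex_of_real (defect b) \<noteq> 0"
    using defect_pos[OF b] by (metis add_pos_pos of_real_1 of_real_add of_real_eq_0_iff order_less_irrefl zero_less_one)
  have "msqrt b (msqrt b z) = of_real (defect b) *s msqrt b z
      - (of_real (defect b / (1 + defect b)) * ((of_real (defect b))\<^sup>2 * hprod z b)) *s b"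
    unfolding msqrt_def[of b "msqrt b z"] hprod_msqrt_point[OF b] ..
  also have "\<dots> = (of_real (defect b))\<^sup>2 *s (z - hprod z b *s b)"
  proof (subst vec_eq_iff, rule allI)
    fix i
    define s where "s = complex_of_real (defect b)"
    have "s * (s * x - s / (1 + s) * h * y) - s / (1 + s) * (s\<^sup>2 * h) * y = s\<^sup>2 * (x - h * y)" for x y h
      using nz unfolding s_def[symmetric] by (simp add: divide_simps) (simp add: algebra_simps power2_eq_square)
    from this[of "z $ i" "hprod z b" "b $ i"]
    show "(of_real (defect b) *s msqrt b z
      - (of_real (defect b / (1 + defect b)) * ((of_real (defect b))\<^sup>2 * hprod z b)) *s b) $ i =
      ((of_real (defect b))\<^sup>2 *s (z - hprod z b *s b)) $ i"
      by (simp only: msqrt_def s_def vector_minus_component vector_smult_component of_real_divide of_real_add of_real_1)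
  qed
  finally show ?thesis .
qed

lemma Bergman_op_eq: "b \<in> unit_ball \<Longrightarrow> Bergman_op b b = msqrt b \<circ> msqrt b"
  by (rule ext) (simp add: Bergman_op_def msqrt_msqrt hprod_self_defect)

text \<open>With \<open>q = 1 + hprod z b\<close> and \<open>s = defect b\<close> the denominator of
  the outer map is \<open>s\<^sup>2 / q\<close>, and the two square roots compose to the Bergman
  operator. What remains is scalar algebra in each coordinate.\<close>

lemma mob_mob_minus:
  assumes b: "b \<in> unit_ball" and z: "z \<in> unit_ball"
  shows "mob (- b) (mob b z) = z"
proof -
  define q where "q = 1 + hprod z b"
  define s where "s = complex_of_real (defect b)"
  have q: "q \<noteq> 0" using one_plus_hprod_nonzero[OF z, of b] b by (auto simp: q_def ball_iff)
  have s: "s \<noteq> 0" using defect_pos[OF b] by (auto simp: s_def)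
  have hz: "hprod z b = q - 1" by (simp add: q_def)
  have "hprod (mob b z) b = 1 - s\<^sup>2 + s\<^sup>2 * (q - 1) / q"
    by (simp add: mob_def hprod_simps hprod_msqrt_point[OF b] hprod_self_defect[OF b] s_def[symmetric] hz)
  then have 1: "1 + hprod (mob b z) (- b) = s\<^sup>2 / q"
    using q by (simp add: hprod_simps field_simps)
  have 2: "msqrt b (mob b z) = s\<^sup>2 *s b + (1 / q) *s (s\<^sup>2 *s (z - (q - 1) *s b))"
    by (simp add: mob_def msqrt_add msqrt_scale msqrt_point[OF b] msqrt_msqrt[OF b] s_def[symmetric] q_def)
  have "- x + 1 / (s\<^sup>2 / q) * (s\<^sup>2 * x + 1 / q * (s\<^sup>2 * (y - (q - 1) * x))) = y" for x y
    using q s by (simp add: divide_simps) (simp add: algebra_simps)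
  then show ?thesis
    unfolding mob_def[of "- b"] 1 msqrt_minus_point 2 using q s by (simp add: vec_eq_iff)
qed

text \<open>Quasi-invariance of \<open>Delta\<close>. It shows that the ball is preserved, compares
  the weights at \<open>x\<close> and \<open>g x\<close>, and later identifies Bergman balls with
  images of Euclidean balls about 0.\<close>

lemma Delta_mob:
  assumes b: "b \<in> unit_ball" and z: "z \<in> unit_ball"
  shows "1 - (norm (mob b z))\<^sup>2 = (defect b)\<^sup>2 * (1 - (norm z)\<^sup>2) / (cmod (1 + hprod z b))\<^sup>2"
proof -
  define q where "q = 1 + hprod z b"
  define s where "s = complex_of_real (defect b)"
  have "q \<noteq> 0" using one_plus_hprod_nonzero[OF z, of b] b by (auto simp: q_def ball_iff)
  then have q: "q \<noteq> 0" "cnj q \<noteq> 0" by (simp_all only: complex_cnj_zero_iff not_False_eq_True)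
  have hz: "hprod z b = q - 1" by (simp add: q_def)
  have hb: "hprod b z = cnj q - 1" by (subst hprod_commute) (simp add: hz)
  have cs: "cnj s = s" by (simp add: s_def)
  have m: "hprod (msqrt b z) b = s\<^sup>2 * (q - 1)" "hprod b (msqrt b z) = s\<^sup>2 * (cnj q - 1)"
    using hprod_msqrt_point[OF b, of z] hprod_commute[of b "msqrt b z"]
    by (simp_all add: hz s_def)
  have mm: "hprod (msqrt b z) (msqrt b z) = s\<^sup>2 * (hprod z z - (cnj q - 1) * (q - 1))"
    unfolding msqrt_self_adjoint msqrt_msqrt[OF b] by (simp add: hprod_simps hz hb s_def algebra_simps)
  have "hprod (mob b z) (mob b z) = (1 - s\<^sup>2) + 1 / cnj q * (s\<^sup>2 * (cnj q - 1)) + 1 / q * (s\<^sup>2 * (q - 1)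
      + 1 / cnj q * (s\<^sup>2 * (hprod z z - (cnj q - 1) * (q - 1))))"
    unfolding mob_def q_def[symmetric]
    by (simp add: hprod_simps m mm hprod_self_defect[OF b] s_def[symmetric] distrib_left mult.left_commute)
  also have "1 - \<dots> = s\<^sup>2 * (1 - hprod z z) / (q * cnj q)"
    using q by (simp add: divide_simps) (simp add: algebra_simps)
  finally have "1 - hprod (mob b z) (mob b z) = s\<^sup>2 * (1 - hprod z z) / (q * cnj q)" .
  also have "s\<^sup>2 * (1 - hprod z z) / (q * cnj q) = of_real ((defect b)\<^sup>2 * (1 - (norm z)\<^sup>2) / (cmod q)\<^sup>2)"
    by (simp add: hprod_self s_def complex_norm_square[symmetric])
  finally have "complex_of_real (1 - (norm (mob b z))\<^sup>2)
      = of_real ((defect b)\<^sup>2 * (1 - (norm z)\<^sup>2) / (cmod q)\<^sup>2)"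
    by (simp add: hprod_self)
  then show ?thesis unfolding q_def of_real_eq_iff .
qed

lemma mob_in_ball:
  assumes b: "b \<in> unit_ball" and z: "z \<in> unit_ball"
  shows "mob b z \<in> unit_ball"
proof -
  have "0 < (defect b)\<^sup>2 * (1 - (norm z)\<^sup>2) / (cmod (1 + hprod z b))\<^sup>2"
    using one_plus_hprod_nonzero[OF z, of b] b z defect_pos[OF b]
    by (auto simp: ball_iff abs_square_less_1 intro!: divide_pos_pos mult_pos_pos)
  then have "(norm (mob b z))\<^sup>2 < 1" using Delta_mob[OF assms] by linarith
  then show ?thesis by (simp add: ball_iff abs_square_less_1)
qed

lemma mob_0 [simp]: "mob b 0 = b"
  by (simp add: mob_def msqrt_def vec_eq_iff)

lemma uminus_in_ball [simp]: "- b \<in> unit_ball \<longleftrightarrow> b \<in> unit_ball"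
  by (simp add: ball_iff)

lemma zero_in_ball [simp]: "0 \<in> unit_ball"
  by (simp add: ball_iff)

lemma mob_minus_mob: "b \<in> unit_ball \<Longrightarrow> z \<in> unit_ball \<Longrightarrow> mob b (mob (- b) z) = z"
  using mob_mob_minus[of "- b" z] by simp

text \<open>Uniqueness of the positive square root without spectral theory: any candidate
  \<open>T\<close> commutes with \<open>msqrt b\<close>, so the sum of the two annihilates their
  difference. Both forms are nonnegative and that of \<open>msqrt b\<close> is definite, hence the
  difference is zero.\<close>

lemma pos_sqrt_Bergman:
  assumes b: "b \<in> unit_ball"
  shows "pos_sqrt (Bergman_op b b) = msqrt b"
proof -
  have pos: "0 \<le> Re (hprod (msqrt b u) u) \<and> (Re (hprod (msqrt b u) u) = 0 \<longrightarrow> u = 0)" for u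
  proof -
    define s where "s = defect b"
    have s: "0 < s" "s \<le> 1" using defect_pos[OF b] by (auto simp: s_def defect_def)
    have "hprod (msqrt b u) u = of_real (s * (norm u)\<^sup>2 - s / (1 + s) * (cmod (hprod u b))\<^sup>2)"
      unfolding msqrt_def hprod_simps hprod_self s_def[symmetric]
      by (subst hprod_commute[of b u]) (simp add: complex_norm_square[symmetric] mult.assoc)
    then have *: "Re (hprod (msqrt b u) u) = s * (norm u)\<^sup>2 - s / (1 + s) * (cmod (hprod u b))\<^sup>2"
      by simp
    have "(cmod (hprod u b))\<^sup>2 \<le> (norm u)\<^sup>2 * (norm b)\<^sup>2"
      using power_mono[OF norm_hprod_le[of u b], of 2] by (simp add: power_mult_distrib)
    also have "(norm b)\<^sup>2 = (1 + s) * (1 - s)" using defect_sq[OF b] by (simp add: s_def algebra_simps power2_eq_square)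
    finally have "s / (1 + s) * (cmod (hprod u b))\<^sup>2 \<le> s / (1 + s) * ((norm u)\<^sup>2 * ((1 + s) * (1 - s)))"
      using s by (intro mult_left_mono) auto
    also have "\<dots> = (s - s\<^sup>2) * (norm u)\<^sup>2" using s by (simp add: field_simps power2_eq_square)
    finally have "s\<^sup>2 * (norm u)\<^sup>2 \<le> Re (hprod (msqrt b u) u)" unfolding * by (simp add: algebra_simps)
    moreover have "0 \<le> s\<^sup>2 * (norm u)\<^sup>2" by simp
    ultimately show ?thesis using s
      by (metis (no_types, lifting) mult_eq_0_iff norm_eq_zero order.trans order_antisym power_eq_0_iff order_less_irrefl)
  qed
  show ?thesis
    unfolding pos_sqrt_def
  proof (rule the_equality)
    show "(\<forall>u v. msqrt b (u + v) = msqrt b u + msqrt b v) \<and> (\<forall>a u. msqrt b (a *s u) = a *s msqrt b u) \<and>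
     (\<forall>u v. hprod (msqrt b u) v = hprod u (msqrt b v)) \<and> (\<forall>u. 0 \<le> Re (hprod (msqrt b u) u)) \<and>
     msqrt b \<circ> msqrt b = Bergman_op b b"
      using pos by (auto simp: msqrt_add msqrt_scale msqrt_self_adjoint Bergman_op_eq[OF b])
  next
    fix T :: "complex^'a \<Rightarrow> complex^'a"
    assume T: "(\<forall>u v. T (u + v) = T u + T v) \<and> (\<forall>a u. T (a *s u) = a *s T u) \<and>
     (\<forall>u v. hprod (T u) v = hprod u (T v)) \<and> (\<forall>u. 0 \<le> Re (hprod (T u) u)) \<and> T \<circ> T = Bergman_op b b"
    then have add: "\<And>u v. T (u + v) = T u + T v" and sc: "\<And>a u. T (a *s u) = a *s T u"
      and TT: "\<And>u. T (T u) = msqrt b (msqrt b u)" and Tpos: "\<And>u. 0 \<le> Re (hprod (T u) u)"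
      by (auto simp: Bergman_op_eq[OF b] fun_eq_iff)
    have dif: "T (u - v) = T u - T v" for u v using add[of "u - v" v] by (simp add: algebra_simps)
    define s where "s = complex_of_real (defect b)"
    have s: "s \<noteq> 0" using defect_pos[OF b] by (auto simp: s_def)
    \<comment> \<open>\<open>T\<close> commutes with its square. Up to the scalar
      \<open>s\<^sup>2\<close> this square is the identity minus the rank-one map built from
      \<open>b\<close>, so \<open>T\<close> commutes with that rank-one map and hence with
      \<open>msqrt b\<close>.\<close>
    have "s\<^sup>2 *s (T z - hprod (T z) b *s b) = s\<^sup>2 *s (T z - hprod z b *s T b)" for z
    proof -
      have "T (s\<^sup>2 *s (z - hprod z b *s b)) = s\<^sup>2 *s (T z - hprod (T z) b *s b)"
        using TT[of "T z"] TT[of z] by (simp add: msqrt_msqrt[OF b] s_def)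
      then show ?thesis by (simp add: sc dif)
    qed
    then have c0: "hprod (T z) b *s b = hprod z b *s T b" for z
      using s by (auto simp: vec_eq_iff)
    have comm: "T (msqrt b z) = msqrt b (T z)" for z
      unfolding msqrt_def dif sc using c0[of z] by (auto simp: vec_eq_iff)
    show "T = msqrt b"
    proof
      fix v
      define u where "u = T v - msqrt b v"
      \<comment> \<open>For commuting operators the sum times the difference is the difference of
        the squares, which vanishes here.\<close>
      have "T u + msqrt b u = 0"
        by (simp add: u_def dif msqrt_diff TT comm)
      then have "hprod (T u) u + hprod (msqrt b u) u = 0"
        by (metis hprod_add_left hprod_zero(1))
      then have "Re (hprod (T u) u) + Re (hprod (msqrt b u) u) = 0"
        by (metis plus_complex.sel(1) zero_complex.sel(1))
      then have "u = 0" using pos[of u] Tpos[of u] by linarith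
      then show "T v = msqrt b v" by (simp add: u_def)
    qed
  qed
qed

section \<open>Polynomials and their coefficients\<close>

definition zmonom :: "('d \<Rightarrow> nat) \<Rightarrow> complex^'d \<Rightarrow> complex" where
  "zmonom m \<zeta> = (\<Prod>i\<in>UNIV. \<zeta> $ i ^ m i)"

lemma mpolys_iff: "\<phi> \<in> mpolys M \<longleftrightarrow> (\<exists>a. \<phi> = (\<lambda>\<zeta>. \<Sum>m\<in>M. a m * zmonom m \<zeta>))"
  by (simp add: mpolys_def zmonom_def)

lemma multi_index_le: "m i \<le> (\<Sum>i\<in>UNIV. m i)" for m :: "'d::finite \<Rightarrow> nat"
  by (rule member_le_sum) auto

lemma finite_multi_index_le: "finite {m :: 'd::finite \<Rightarrow> nat. (\<Sum>i\<in>UNIV. m i) \<le> n}"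
proof (rule finite_subset)
  show "{m :: 'd \<Rightarrow> nat. (\<Sum>i\<in>UNIV. m i) \<le> n} \<subseteq> PiE UNIV (\<lambda>_. {..n})"
    by (auto simp: PiE_def intro: order.trans[OF multi_index_le])
  show "finite (PiE (UNIV :: 'd set) (\<lambda>_. {..n}))"
    by (intro finite_PiE) auto
qed

lemma finite_multi_index_eq [simp]: "finite {m :: 'd::finite \<Rightarrow> nat. (\<Sum>i\<in>UNIV. m i) = n}"
  by (rule finite_subset[OF _ finite_multi_index_le[of n]]) auto

lemma mpolys_add: "\<phi> \<in> mpolys M \<Longrightarrow> \<psi> \<in> mpolys M \<Longrightarrow> (\<lambda>\<zeta>. \<phi> \<zeta> + \<psi> \<zeta>) \<in> mpolys M"
  unfolding mpolys_iff
  by (elim exE, rule_tac x="\<lambda>m. a m + aa m" in exI) (auto simp: sum.distrib distrib_right)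

lemma mpolys_scale: "\<phi> \<in> mpolys M \<Longrightarrow> (\<lambda>\<zeta>. a * \<phi> \<zeta>) \<in> mpolys M"
  unfolding mpolys_iff
  by (elim exE, rule_tac x="\<lambda>m. a * aa m" in exI) (auto simp: sum_distrib_left mult.assoc)

lemma mpolys_zero: "(\<lambda>_. 0) \<in> mpolys M"
  unfolding mpolys_iff by (rule exI[of _ "\<lambda>_. 0"]) auto

lemma mpolys_sum: "(\<And>x. x \<in> X \<Longrightarrow> f x \<in> mpolys M) \<Longrightarrow> (\<lambda>\<zeta>. \<Sum>x\<in>X. f x \<zeta>) \<in> mpolys M"
  by (induction X rule: infinite_finite_induct) (auto intro: mpolys_zero mpolys_add)

lemma zmonom_in_mpolys: "finite M \<Longrightarrow> m \<in> M \<Longrightarrow> zmonom m \<in> mpolys M"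
  unfolding mpolys_iff
  by (rule exI[of _ "\<lambda>m'. if m' = m then 1 else 0"], rule ext)
    (simp add: if_distrib[where f="\<lambda>a. a * _"] cong: if_cong)

lemma mpolys_mono: "finite M' \<Longrightarrow> M \<subseteq> M' \<Longrightarrow> mpolys M \<subseteq> mpolys M'"
proof
  fix \<phi> assume M: "finite M'" "M \<subseteq> M'" and "\<phi> \<in> mpolys M"
  then obtain a where a: "\<phi> = (\<lambda>\<zeta>. \<Sum>m\<in>M. a m * zmonom m \<zeta>)" by (auto simp: mpolys_iff)
  show "\<phi> \<in> mpolys M'" unfolding a
    using M by (intro mpolys_sum mpolys_scale zmonom_in_mpolys) auto
qed

lemmas hom_polys_add = mpolys_add[of _ "{m. (\<Sum>i\<in>UNIV. m i) = l}" for l, folded hom_polys_def]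
lemmas hom_polys_scale = mpolys_scale[of _ "{m. (\<Sum>i\<in>UNIV. m i) = l}" for l, folded hom_polys_def]
lemmas hom_polys_sum = mpolys_sum[of _ _ "{m. (\<Sum>i\<in>UNIV. m i) = l}" for l, folded hom_polys_def]
lemmas deg_polys_add = mpolys_add[of _ "{m. (\<Sum>i\<in>UNIV. m i) \<le> n}" for n, folded deg_polys_def]
lemmas deg_polys_scale = mpolys_scale[of _ "{m. (\<Sum>i\<in>UNIV. m i) \<le> n}" for n, folded deg_polys_def]
lemmas deg_polys_sum = mpolys_sum[of _ _ "{m. (\<Sum>i\<in>UNIV. m i) \<le> n}" for n, folded deg_polys_def]

lemma zmonom_in_hom_polys: "(\<Sum>i\<in>UNIV. m i) = l \<Longrightarrow> zmonom m \<in> hom_polys l"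
  unfolding hom_polys_def by (rule zmonom_in_mpolys) auto

lemma zmonom_in_deg_polys: "(\<Sum>i\<in>UNIV. m i) \<le> n \<Longrightarrow> zmonom m \<in> deg_polys n"
  unfolding deg_polys_def by (rule zmonom_in_mpolys) (auto intro: finite_multi_index_le)

lemma hom_polys_subset_deg_polys: "l \<le> n \<Longrightarrow> hom_polys l \<subseteq> deg_polys n"
  unfolding deg_polys_def hom_polys_def by (rule mpolys_mono) (auto intro: finite_multi_index_le)

lemma zmonom_mult: "zmonom m \<zeta> * zmonom m' \<zeta> = zmonom (\<lambda>i. m i + m' i) \<zeta>"
  by (simp add: zmonom_def power_add prod.distrib)

lemma zmonom_zero_index [simp]: "zmonom (\<lambda>_. 0) = (\<lambda>_. 1)"
  by (simp add: zmonom_def fun_eq_iff)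

lemma hom_polys_mult:
  assumes "\<phi> \<in> hom_polys a" "\<psi> \<in> hom_polys b"
  shows "(\<lambda>\<zeta>. \<phi> \<zeta> * \<psi> \<zeta>) \<in> hom_polys (a + b)"
proof -
  obtain f g where f: "\<phi> = (\<lambda>\<zeta>. \<Sum>m | (\<Sum>i\<in>UNIV. m i) = a. f m * zmonom m \<zeta>)"
    and g: "\<psi> = (\<lambda>\<zeta>. \<Sum>m | (\<Sum>i\<in>UNIV. m i) = b. g m * zmonom m \<zeta>)"
    using assms by (auto simp: hom_polys_def mpolys_iff)
  have "(\<lambda>\<zeta>. \<phi> \<zeta> * \<psi> \<zeta>) = (\<lambda>\<zeta>. \<Sum>m | (\<Sum>i\<in>UNIV. m i) = a. \<Sum>m' | (\<Sum>i\<in>UNIV. m' i) = b.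
      (f m * g m') * zmonom (\<lambda>i. m i + m' i) \<zeta>)"
    unfolding f g sum_product zmonom_mult[symmetric] by (simp add: mult_ac)
  then show ?thesis
    by (auto intro!: hom_polys_sum hom_polys_scale zmonom_in_hom_polys simp: sum.distrib)
qed

lemma deg_polys_mult:
  assumes "\<phi> \<in> deg_polys a" "\<psi> \<in> deg_polys b"
  shows "(\<lambda>\<zeta>. \<phi> \<zeta> * \<psi> \<zeta>) \<in> deg_polys (a + b)"
proof -
  obtain f g where f: "\<phi> = (\<lambda>\<zeta>. \<Sum>m | (\<Sum>i\<in>UNIV. m i) \<le> a. f m * zmonom m \<zeta>)"
    and g: "\<psi> = (\<lambda>\<zeta>. \<Sum>m | (\<Sum>i\<in>UNIV. m i) \<le> b. g m * zmonom m \<zeta>)"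
    using assms by (auto simp: deg_polys_def mpolys_iff)
  have "(\<lambda>\<zeta>. \<phi> \<zeta> * \<psi> \<zeta>) = (\<lambda>\<zeta>. \<Sum>m | (\<Sum>i\<in>UNIV. m i) \<le> a. \<Sum>m' | (\<Sum>i\<in>UNIV. m' i) \<le> b.
      (f m * g m') * zmonom (\<lambda>i. m i + m' i) \<zeta>)"
    unfolding f g sum_product zmonom_mult[symmetric] by (simp add: mult_ac)
  then show ?thesis
    by (auto intro!: deg_polys_sum deg_polys_scale zmonom_in_deg_polys simp: sum.distrib)
qed

lemma hom_polys_one: "(\<lambda>_. 1) \<in> hom_polys 0"
  using zmonom_in_hom_polys[of "\<lambda>_. 0" 0] by simp

lemma hom_polys_power: "\<phi> \<in> hom_polys a \<Longrightarrow> (\<lambda>\<zeta>. \<phi> \<zeta> ^ k) \<in> hom_polys (k * a)"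
proof (induction k)
  case (Suc k)
  show ?case using hom_polys_mult[OF Suc.prems Suc.IH[OF Suc.prems]] by simp
qed (simp add: hom_polys_one)

lemma deg_polys_power: "\<phi> \<in> deg_polys a \<Longrightarrow> (\<lambda>\<zeta>. \<phi> \<zeta> ^ k) \<in> deg_polys (k * a)"
proof (induction k)
  case (Suc k)
  show ?case using deg_polys_mult[OF Suc.prems Suc.IH[OF Suc.prems]] by simp
qed (use hom_polys_one hom_polys_subset_deg_polys[of 0 0] in auto)

lemma hom_polys_prod:
  "finite I \<Longrightarrow> (\<And>i. i \<in> I \<Longrightarrow> f i \<in> hom_polys (a i)) \<Longrightarrow> (\<lambda>\<zeta>. \<Prod>i\<in>I. f i \<zeta>) \<in> hom_polys (\<Sum>i\<in>I. a i)"
proof (induction I rule: finite_induct)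
  case (insert x F)
  then have "(\<lambda>\<zeta>. f x \<zeta> * (\<Prod>i\<in>F. f i \<zeta>)) \<in> hom_polys (a x + (\<Sum>i\<in>F. a i))"
    by (intro hom_polys_mult) auto
  then show ?case using insert.hyps by simp
qed (simp add: hom_polys_one)

lemma hom_polys_component: "(\<lambda>\<zeta>. \<zeta> $ i) \<in> hom_polys 1"
proof -
  have "zmonom (\<lambda>j. if j = i then 1 else 0) = (\<lambda>\<zeta>. \<zeta> $ i)"
    by (simp add: zmonom_def fun_eq_iff if_distrib cong: if_cong)
  moreover have "zmonom (\<lambda>j. if j = i then 1 else 0) \<in> hom_polys 1"
    by (intro zmonom_in_hom_polys) auto
  ultimately show ?thesis by simp
qed

section \<open>Complex-linear maps and their substitution into polynomials\<close>

abbreviation clinear :: "(complex^'a \<Rightarrow> complex^'b) \<Rightarrow> bool" where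
  "clinear \<equiv> Vector_Spaces.linear (*s) (*s)"

lemma clinearI: "(\<And>u v. A (u + v) = A u + A v) \<Longrightarrow> (\<And>a u. A (a *s u) = a *s A u) \<Longrightarrow> clinear A"
  unfolding Vector_Spaces.linear_def module_hom_def module_hom_axioms_def
  by (auto intro: vec.vector_space_axioms vec.module_axioms)

lemma clinear_add: "clinear A \<Longrightarrow> A (u + v) = A u + A v"
  unfolding Vector_Spaces.linear_def module_hom_def module_hom_axioms_def by blast

lemma clinear_scale: "clinear A \<Longrightarrow> A (a *s v) = a *s A v"
  unfolding Vector_Spaces.linear_def module_hom_def module_hom_axioms_def by blast

lemma clinear_component_hom_poly:
  fixes A :: "complex^'d \<Rightarrow> complex^'e"
  assumes "clinear A"
  shows "(\<lambda>\<zeta>. A \<zeta> $ i) \<in> hom_polys 1"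
proof -
  have "A \<zeta> $ i = (\<Sum>j\<in>UNIV. matrix A $ i $ j * \<zeta> $ j)" for \<zeta>
    using arg_cong[OF matrix_works[OF assms, of \<zeta>], of "\<lambda>x. x $ i"]
    by (simp add: matrix_vector_mult_def)
  then show ?thesis by (simp only:) (intro hom_polys_sum hom_polys_scale hom_polys_component)
qed

lemma hom_polys_comp:
  fixes A :: "complex^'d \<Rightarrow> complex^'e"
  assumes A: "\<And>i. (\<lambda>\<zeta>. A \<zeta> $ i) \<in> hom_polys k" and \<phi>: "\<phi> \<in> hom_polys l"
  shows "(\<lambda>\<zeta>. \<phi> (A \<zeta>)) \<in> hom_polys (l * k)"
proof -
  obtain f where f: "\<phi> = (\<lambda>\<zeta>. \<Sum>m | (\<Sum>i\<in>UNIV. m i) = l. f m * zmonom m \<zeta>)"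
    using \<phi> by (auto simp: hom_polys_def mpolys_iff)
  have "(\<lambda>\<zeta>. \<Prod>i\<in>UNIV. A \<zeta> $ i ^ m i) \<in> hom_polys (\<Sum>i\<in>UNIV. m i * k)" for m
    by (intro hom_polys_prod hom_polys_power A) auto
  then have "(\<lambda>\<zeta>. \<Prod>i\<in>UNIV. A \<zeta> $ i ^ m i) \<in> hom_polys ((\<Sum>i\<in>UNIV. m i) * k)" for m
    unfolding sum_distrib_right .
  then have "(\<lambda>\<zeta>. zmonom m (A \<zeta>)) \<in> hom_polys (l * k)" if "(\<Sum>i\<in>UNIV. m i) = l" for m
    using that unfolding zmonom_def by blast
  then show ?thesis unfolding f by (intro hom_polys_sum hom_polys_scale) auto
qed

lemma hom_polys_comp_clinear: "\<phi> \<in> hom_polys l \<Longrightarrow> clinear A \<Longrightarrow> (\<lambda>\<zeta>. \<phi> (A \<zeta>)) \<in> hom_polys l"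
  using hom_polys_comp[of A 1 \<phi> l] clinear_component_hom_poly[of A] by auto

lemma zmonom_scale: "zmonom m (t *s \<zeta>) = t ^ (\<Sum>i\<in>UNIV. m i) * zmonom m \<zeta>"
  by (simp add: zmonom_def power_mult_distrib prod.distrib power_sum)

lemma hom_polys_homogeneous: "\<phi> \<in> hom_polys l \<Longrightarrow> \<phi> (t *s \<zeta>) = t ^ l * \<phi> \<zeta>"
  unfolding hom_polys_def mpolys_iff
  by (auto simp: sum_distrib_left zmonom_scale mult.left_commute intro!: sum.cong)

lemma deg_polys_decompose:
  assumes "\<phi> \<in> deg_polys n"
  obtains \<psi> where "\<And>k. \<psi> k \<in> hom_polys k" "\<And>\<zeta>. \<phi> \<zeta> = (\<Sum>k\<le>n. \<psi> k \<zeta>)"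
proof -
  obtain f where f: "\<phi> = (\<lambda>\<zeta>. \<Sum>m | (\<Sum>i\<in>UNIV. m i) \<le> n. f m * zmonom m \<zeta>)"
    using assms by (auto simp: deg_polys_def mpolys_iff)
  define \<psi> where "\<psi> k \<zeta> = (\<Sum>m | (\<Sum>i\<in>UNIV. m i) = k. f m * zmonom m \<zeta>)" for k \<zeta>
  show ?thesis
  proof
    show "\<psi> k \<in> hom_polys k" for k
      unfolding \<psi>_def[abs_def] by (intro hom_polys_sum hom_polys_scale zmonom_in_hom_polys) auto
    show "\<phi> \<zeta> = (\<Sum>k\<le>n. \<psi> k \<zeta>)" for \<zeta>
    proof -
      have "\<phi> \<zeta> = (\<Sum>k\<in>{..n}. \<Sum>m | m \<in> {m. (\<Sum>i\<in>UNIV. m i) \<le> n} \<and> (\<Sum>i\<in>UNIV. m i) = k. f m * zmonom m \<zeta>)"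
        unfolding f by (rule sum.group[symmetric]) (auto intro: finite_multi_index_le)
      also have "\<dots> = (\<Sum>k\<le>n. \<psi> k \<zeta>)"
        unfolding \<psi>_def by (intro sum.cong) auto
      finally show ?thesis .
    qed
  qed
qed

lemma deg_polys_1_affine: "clinear (A :: complex^'d \<Rightarrow> complex^'e) \<Longrightarrow> (\<lambda>\<zeta>. c + A \<zeta> $ i) \<in> deg_polys 1"
  using deg_polys_add[of "\<lambda>_. c * 1" 1] deg_polys_scale[of "\<lambda>_. 1" 1 c] hom_polys_one
    hom_polys_subset_deg_polys[of 0 1] hom_polys_subset_deg_polys[of 1 1] clinear_component_hom_poly[of A i]
  by auto

text \<open>Homogenisation: the part of \<phi> of degree \<open>k\<close> contributes
  \<open>r ^ (n - k)\<close> times a polynomial of degree \<open>k\<close>, so the factor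
  \<open>r ^ n\<close> clears all denominators. The right side in the definition of
  \<open>beta_inv\<close> has this shape.\<close>

lemma deg_polys_fractional:
  assumes \<phi>: "\<phi> \<in> deg_polys n" and A: "clinear A" and r: "r \<in> deg_polys 1"
  obtains q where "q \<in> deg_polys n" "\<And>\<zeta>. r \<zeta> \<noteq> 0 \<Longrightarrow> q \<zeta> = r \<zeta> ^ n * \<phi> ((1 / r \<zeta>) *s A \<zeta>)"
proof -
  obtain \<psi> where \<psi>: "\<And>k. \<psi> k \<in> hom_polys k" "\<And>\<zeta>. \<phi> \<zeta> = (\<Sum>k\<le>n. \<psi> k \<zeta>)"
    using deg_polys_decompose[OF \<phi>] by blast
  show ?thesis
  proof
    show "(\<lambda>\<zeta>. \<Sum>k\<le>n. r \<zeta> ^ (n - k) * \<psi> k (A \<zeta>)) \<in> deg_polys n"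
    proof (rule deg_polys_sum)
      fix k assume k: "k \<in> {..n}"
      have "(\<lambda>\<zeta>. r \<zeta> ^ (n - k)) \<in> deg_polys (n - k)"
        using deg_polys_power[OF r, of "n - k"] by simp
      moreover have "(\<lambda>\<zeta>. \<psi> k (A \<zeta>)) \<in> deg_polys k"
        using hom_polys_comp_clinear[OF \<psi>(1) A] hom_polys_subset_deg_polys[of k k] by auto
      ultimately show "(\<lambda>\<zeta>. r \<zeta> ^ (n - k) * \<psi> k (A \<zeta>)) \<in> deg_polys n"
        using deg_polys_mult[of _ "n - k" _ k] k by fastforce
    qed
    fix \<zeta> assume nz: "r \<zeta> \<noteq> 0"
    have "r \<zeta> ^ (n - k) * \<psi> k (A \<zeta>) = r \<zeta> ^ n * \<psi> k ((1 / r \<zeta>) *s A \<zeta>)" if "k \<le> n" for k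
      using nz that by (simp add: hom_polys_homogeneous[OF \<psi>(1)] power_diff power_one_over)
    then show "(\<Sum>k\<le>n. r \<zeta> ^ (n - k) * \<psi> k (A \<zeta>)) = r \<zeta> ^ n * \<phi> ((1 / r \<zeta>) *s A \<zeta>)"
      unfolding \<psi>(2) sum_distrib_left by (intro sum.cong) auto
  qed
qed

lemma deg_polys_holomorphic_line:
  assumes "\<phi> \<in> deg_polys n"
  shows "(\<lambda>t. \<phi> (u + t *s v)) holomorphic_on S"
proof -
  obtain f where f: "\<phi> = (\<lambda>\<zeta>. \<Sum>m | (\<Sum>i\<in>UNIV. m i) \<le> n. f m * zmonom m \<zeta>)"
    using assms by (auto simp: deg_polys_def mpolys_iff)
  show ?thesis unfolding f zmonom_def by (simp, intro holomorphic_intros)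
qed

text \<open>On the complex line joining a point of \<open>S\<close> to \<zeta> both sides are entire
  functions of one variable agreeing on a nonempty open set. This uniqueness makes the description
  in \<open>poly_extension\<close> definite.\<close>

lemma deg_polys_eqI:
  assumes \<phi>: "\<phi> \<in> deg_polys n" and \<psi>: "\<psi> \<in> deg_polys n" and S: "open S" "S \<noteq> {}"
    and eq: "\<And>\<zeta>. \<zeta> \<in> S \<Longrightarrow> \<phi> \<zeta> = \<psi> \<zeta>"
  shows "\<phi> = \<psi>"
proof
  fix \<zeta>
  obtain u where u: "u \<in> S" using S by auto
  define v where "v = \<zeta> - u"
  let ?T = "(\<lambda>t. u + t *s v) -` S"
  have cont: "continuous_on UNIV (\<lambda>t. u + t *s v)"
    unfolding vector_scalar_mult_def by (intro continuous_intros)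
  have T: "open ?T" by (rule open_vimage[OF S(1) cont])
  have ne: "?T \<noteq> {}" using u by (metis add.right_neutral empty_iff vector_smult_lzero vimageI)
  have "(\<lambda>t. \<phi> (u + t *s v)) 1 = (\<lambda>t. \<psi> (u + t *s v)) 1"
    by (rule analytic_continuation_open[of ?T UNIV "\<lambda>t. \<phi> (u + t *s v)"
          "\<lambda>t. \<psi> (u + t *s v)" 1])
      (use ne T eq deg_polys_holomorphic_line[OF \<phi>] deg_polys_holomorphic_line[OF \<psi>] in
        \<open>simp_all add: vimage_def connected_UNIV\<close>)
  then show "\<phi> \<zeta> = \<psi> \<zeta>" by (simp add: v_def)
qed

lemma poly_extension_eqI:
  assumes "q \<in> deg_polys n" "\<And>\<zeta>. \<zeta> \<in> S \<Longrightarrow> q \<zeta> = f \<zeta>" "open S" "S \<noteq> {}"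
  shows "poly_extension n S f = q"
  unfolding poly_extension_def
proof (rule the_equality)
  fix q' assume q': "q' \<in> deg_polys n \<and> (\<forall>\<zeta>\<in>S. q' \<zeta> = f \<zeta>)"
  show "q' = q"
    by (rule deg_polys_eqI[OF _ assms(1) assms(3,4)]) (use assms q' in auto)
qed (use assms in auto)

text \<open>Coefficients of a polynomial of degree less than \<open>N\<close> in each variable are recovered by a
  discrete Fourier transform from the values at the points whose coordinates are
  \<open>N\<close>-th roots of unity.\<close>

definition grid :: "nat \<Rightarrow> ('d::finite \<Rightarrow> nat) set" where
  "grid N = PiE UNIV (\<lambda>_. {..<N})"

definition unit_root :: "nat \<Rightarrow> nat \<Rightarrow> complex" where
  "unit_root N k = cis (2 * pi * real k / real N)"

definition torus_point :: "nat \<Rightarrow> ('d \<Rightarrow> nat) \<Rightarrow> complex^'d" where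
  "torus_point N j = (\<chi> i. unit_root N (j i))"

text \<open>Being a fixed finite combination of point evaluations, a coefficient inherits
  holomorphy, continuity and bounds from the values of a family of polynomials.\<close>

definition pcoeff :: "nat \<Rightarrow> ('d::finite \<Rightarrow> nat) \<Rightarrow> (complex^'d \<Rightarrow> complex) \<Rightarrow> complex" where
  "pcoeff N m \<phi> = (\<Sum>j\<in>grid N. (\<Prod>i\<in>UNIV. cnj (unit_root N (j i)) ^ m i / of_nat N) * \<phi> (torus_point N j))"

lemma finite_grid [simp]: "finite (grid N)"
  by (simp add: grid_def finite_PiE)

lemma norm_unit_root [simp]: "cmod (unit_root N k) = 1"
  by (simp add: unit_root_def)

lemma unit_root_orthogonal:
  assumes "m < N" "m' < N"
  shows "(\<Sum>k<N. cnj (unit_root N k) ^ m / of_nat N * unit_root N k ^ m') = (if m = m' then 1 else 0)"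
proof -
  define w where "w = cis (2 * pi * (real m' - real m) / real N)"
  have w_pow: "cnj (unit_root N k) ^ m * unit_root N k ^ m' = w ^ k" for k
    by (simp add: unit_root_def w_def cis_cnj Complex.DeMoivre cis_mult algebra_simps diff_divide_distrib)
  have "(\<Sum>k<N. cnj (unit_root N k) ^ m / of_nat N * unit_root N k ^ m') = (\<Sum>k<N. w ^ k) / of_nat N"
    by (simp add: w_pow[symmetric] sum_divide_distrib)
  also have "\<dots> = (if m = m' then 1 else 0)"
  proof (cases "m = m'")
    case False
    \<comment> \<open>The exponents lie below \<open>N\<close>, so their difference can be a
      multiple of \<open>N\<close> only if it is zero.\<close>
    have "w \<noteq> 1"
    proof
      assume "w = 1"
      then obtain n :: int where n: "2 * pi * (real m' - real m) / real N = 2 * pi * of_int n"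
        unfolding w_def cis_conv_exp exp_eq_1 by (auto simp: mult_ac)
      then have "2 * pi * (real m' - real m) = 2 * pi * (of_int n * real N)"
        using assms by (simp add: field_simps)
      then have "real m' - real m = of_int n * real N" by simp
      then have "int m' - int m = n * int N" by (metis of_int_diff of_int_eq_iff of_int_mult of_int_of_nat_eq)
      moreover have "\<bar>int m' - int m\<bar> < int N" using assms by auto
      ultimately have "n = 0"
        by (metis abs_mult abs_of_nat mult.commute mult_cancel_left1 not_less of_nat_0_le_iff
            zero_less_abs_iff int_one_le_iff_zero_less mult_left_mono mult.right_neutral)
      then show False using \<open>int m' - int m = n * int N\<close> False by simp
    qed
    moreover have "w ^ N = 1"
    proof -
      have "w ^ N = cis (2 * pi * of_int (int m' - int m))"
        using assms by (simp add: w_def Complex.DeMoivre)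
      then show ?thesis by (simp only: cis_multiple_2pi[OF Ints_of_int])
    qed
    ultimately show ?thesis using False by (simp add: geometric_sum)
  next
    case True
    then have "w = 1" by (simp add: w_def)
    then show ?thesis using assms True by simp
  qed
  finally show ?thesis .
qed

lemma pcoeff_zmonom:
  fixes m m' :: "'d::finite \<Rightarrow> nat"
  assumes "\<And>i. m i < N" "\<And>i. m' i < N"
  shows "pcoeff N m (zmonom m') = (if m = m' then 1 else 0)"
proof -
  have "pcoeff N m (zmonom m') = (\<Sum>j\<in>PiE UNIV (\<lambda>_. {..<N}). \<Prod>i\<in>UNIV.
      cnj (unit_root N (j i)) ^ m i / of_nat N * unit_root N (j i) ^ m' i)"
    by (simp add: pcoeff_def grid_def zmonom_def torus_point_def prod.distrib prod_dividef)
  also have "\<dots> = (\<Prod>i\<in>UNIV. \<Sum>k<N. cnj (unit_root N k) ^ m i / of_nat N * unit_root N k ^ m' i)"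
    by (rule prod_sum_PiE[symmetric]) auto
  also have "\<dots> = (\<Prod>i\<in>UNIV. if m i = m' i then 1 else 0)"
    using assms by (intro prod.cong unit_root_orthogonal) auto
  also have "\<dots> = (if m = m' then 1 else 0)"
    by (auto simp: fun_eq_iff)
  finally show ?thesis .
qed

lemma pcoeff_sum: "pcoeff N m (\<lambda>\<zeta>. \<Sum>x\<in>X. a x * f x \<zeta>) = (\<Sum>x\<in>X. a x * pcoeff N m (f x))"
  unfolding pcoeff_def sum_distrib_left
  by (subst sum.swap) (simp add: mult_ac)

lemma mpolys_expansion:
  assumes \<phi>: "\<phi> \<in> mpolys M" and "finite M" and M: "\<And>m i. m \<in> M \<Longrightarrow> m i < N"
  shows "\<phi> \<zeta> = (\<Sum>m\<in>M. pcoeff N m \<phi> * zmonom m \<zeta>)"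
proof -
  obtain a where a: "\<phi> = (\<lambda>\<zeta>. \<Sum>m\<in>M. a m * zmonom m \<zeta>)" using \<phi> by (auto simp: mpolys_iff)
  have "pcoeff N m \<phi> = a m" if "m \<in> M" for m
  proof -
    have "pcoeff N m \<phi> = (\<Sum>m'\<in>M. if m = m' then a m' else 0)"
      unfolding a pcoeff_sum using M that by (intro sum.cong) (auto simp: pcoeff_zmonom)
    then show ?thesis using that \<open>finite M\<close> by simp
  qed
  then show ?thesis by (simp add: a)
qed

lemma hom_polys_expansion:
  "\<phi> \<in> hom_polys l \<Longrightarrow> \<phi> \<zeta> = (\<Sum>m | (\<Sum>i\<in>UNIV. m i) = l. pcoeff (Suc l) m \<phi> * zmonom m \<zeta>)"
  unfolding hom_polys_def
  by (rule mpolys_expansion) (auto intro: le_imp_less_Suc multi_index_le)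

lemma deg_polys_expansion:
  "\<phi> \<in> deg_polys n \<Longrightarrow> \<phi> \<zeta> = (\<Sum>m | (\<Sum>i\<in>UNIV. m i) \<le> n. pcoeff (Suc n) m \<phi> * zmonom m \<zeta>)"
  unfolding deg_polys_def
  by (rule mpolys_expansion) (auto intro: finite_multi_index_le le_imp_less_Suc order.trans[OF multi_index_le])

lemma norm_pcoeff_le:
  fixes m :: "'d::finite \<Rightarrow> nat"
  shows "cmod (pcoeff N m \<phi>) \<le> (\<Sum>j\<in>grid N. cmod (\<phi> (torus_point N j)))"
proof -
  have le1: "cmod (\<Prod>i\<in>UNIV. cnj (unit_root N (j i)) ^ m i / of_nat N) \<le> 1" for j
    unfolding prod_norm[symmetric]
    by (intro prod_le_1) (auto simp: norm_divide norm_power divide_le_eq_1)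
  have "cmod (pcoeff N m \<phi>) \<le> (\<Sum>j\<in>grid N. cmod ((\<Prod>i\<in>UNIV. cnj (unit_root N (j i)) ^ m i / of_nat N) * \<phi> (torus_point N j)))"
    unfolding pcoeff_def by (rule norm_sum)
  also have "\<dots> \<le> (\<Sum>j\<in>grid N. cmod (\<phi> (torus_point N j)))"
    unfolding norm_mult by (intro sum_mono mult_left_le_one_le) (auto simp: le1)
  finally show ?thesis .
qed

section \<open>Holomorphic functions of several variables\<close>

lemma holo_on_has_derivative:
  assumes "holo_on S f" "z \<in> S"
  shows "(f has_derivative frechet_derivative f (at z)) (at z)"
  using assms unfolding holo_on_def by (metis frechet_derivative_works differentiable_def)

lemma holo_on_frechet_scale:
  assumes "holo_on S f" "z \<in> S"
  shows "frechet_derivative f (at z) (a *s v) = a * frechet_derivative f (at z) v"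
  using assms unfolding holo_on_def by (metis frechet_derivative_at)

lemma holo_onI:
  assumes "\<And>z. z \<in> S \<Longrightarrow> (f has_derivative f' z) (at z)"
    and "\<And>z a v. z \<in> S \<Longrightarrow> f' z (a *s v) = a * f' z v"
  shows "holo_on S f"
  using assms unfolding holo_on_def by blast

lemma holo_on_continuous: "holo_on S f \<Longrightarrow> continuous_on S f"
  by (meson continuous_at_imp_continuous_on has_derivative_continuous holo_on_has_derivative)

lemma holo_on_cong:
  assumes "open S" "\<And>z. z \<in> S \<Longrightarrow> f z = g z"
  shows "holo_on S f \<longleftrightarrow> holo_on S g"
proof -
  have "(f has_derivative D) (at z) \<longleftrightarrow> (g has_derivative D) (at z)" if "z \<in> S" for z D
    using has_derivative_transform_within_open[OF _ assms(1) that] assms(2) by (metis (full_types))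
  then show ?thesis unfolding holo_on_def by blast
qed

lemma frechet_derivative_cong_open:
  assumes "open S" "z \<in> S" "\<And>w. w \<in> S \<Longrightarrow> f w = g w"
  shows "frechet_derivative f (at z) = frechet_derivative g (at z)"
proof -
  have "(f has_derivative D) (at z) \<longleftrightarrow> (g has_derivative D) (at z)" for D
    using has_derivative_transform_within_open[OF _ assms(1,2)] assms(3) by (metis (full_types))
  then show ?thesis unfolding frechet_derivative_def by simp
qed

lemma holo_on_const: "holo_on S (\<lambda>_. c)"
  by (rule holo_onI[where f' = "\<lambda>_ _. 0"]) auto

lemma holo_on_add: "holo_on S f \<Longrightarrow> holo_on S g \<Longrightarrow> holo_on S (\<lambda>z. f z + g z)"
  by (rule holo_onI, rule has_derivative_add[OF holo_on_has_derivative holo_on_has_derivative])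
    (auto simp: holo_on_frechet_scale distrib_left)

lemma holo_on_mult: "holo_on S f \<Longrightarrow> holo_on S g \<Longrightarrow> holo_on S (\<lambda>z. f z * g z)"
  by (rule holo_onI, rule has_derivative_mult[OF holo_on_has_derivative holo_on_has_derivative])
    (auto simp: holo_on_frechet_scale algebra_simps)

lemma holo_on_diff: "holo_on S f \<Longrightarrow> holo_on S g \<Longrightarrow> holo_on S (\<lambda>z. f z - g z)"
  by (rule holo_onI, rule has_derivative_diff[OF holo_on_has_derivative holo_on_has_derivative])
    (auto simp: holo_on_frechet_scale algebra_simps)

lemma holo_on_sum: "(\<And>x. x \<in> X \<Longrightarrow> holo_on S (f x)) \<Longrightarrow> holo_on S (\<lambda>z. \<Sum>x\<in>X. f x z)"
  by (induction X rule: infinite_finite_induct) (auto intro: holo_on_const holo_on_add)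

lemma holo_on_prod: "(\<And>x. x \<in> X \<Longrightarrow> holo_on S (f x)) \<Longrightarrow> holo_on S (\<lambda>z. \<Prod>x\<in>X. f x z)"
  by (induction X rule: infinite_finite_induct) (auto intro: holo_on_const holo_on_mult)

lemma holo_on_power: "holo_on S f \<Longrightarrow> holo_on S (\<lambda>z. f z ^ k)"
  by (induction k) (auto intro: holo_on_const holo_on_mult)

lemma holo_on_component: "holo_on S (\<lambda>z. z $ i)"
  by (rule holo_onI[where f' = "\<lambda>_ v. v $ i"])
    (auto intro!: bounded_linear_imp_has_derivative bounded_linear_vec_nth)

lemma holo_on_clinear: "clinear A \<Longrightarrow> holo_on S (\<lambda>z. A z $ i)"
proof -
  assume A: "clinear A"
  have "A z $ i = (\<Sum>j\<in>UNIV. matrix A $ i $ j * z $ j)" for z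
    using arg_cong[OF matrix_works[OF A, of z], of "\<lambda>x. x $ i"]
    by (simp add: matrix_vector_mult_def)
  then show ?thesis
    by (simp only:) (intro holo_on_sum holo_on_mult holo_on_const holo_on_component)
qed

lemma holo_on_compose_field:
  assumes "holo_on S f" "\<And>z. z \<in> S \<Longrightarrow> (h has_field_derivative h' (f z)) (at (f z))"
  shows "holo_on S (\<lambda>z. h (f z))"
proof (rule holo_onI)
  show "((\<lambda>z. h (f z)) has_derivative (\<lambda>v. h' (f z) * frechet_derivative f (at z) v)) (at z)" if "z \<in> S" for z
    using has_derivative_compose[OF holo_on_has_derivative[OF assms(1) that]
        assms(2)[OF that, unfolded has_field_derivative_def]] by simp
qed (auto simp: holo_on_frechet_scale[OF assms(1)])

section \<open>Vector-valued maps and restriction to complex lines\<close>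

lemma bounded_linear_smult_left: "bounded_linear (\<lambda>h. h *s (v :: complex^'d))"
proof (rule bounded_linear_intro[where K = "norm v"])
  show "(x + y) *s v = x *s v + y *s v" for x y by (rule vec.scale_left_distrib)
  show "(r *\<^sub>R x) *s v = r *\<^sub>R (x *s v)" for r x by (simp add: vec_eq_iff)
qed simp

lemma line_has_derivative: "((\<lambda>t. z + t *s (v :: complex^'d)) has_derivative (\<lambda>h. h *s v)) (at t)"
  using has_derivative_add[OF has_derivative_const bounded_linear_imp_has_derivative[OF bounded_linear_smult_left]]
  by fastforce

lemma continuous_on_line: "continuous_on S (\<lambda>t. z + t *s (v :: complex^'d))"
  by (rule continuous_at_imp_continuous_on) (auto intro: has_derivative_continuous[OF line_has_derivative])

lemma holo_map_has_derivative:
  fixes g :: "complex^'d \<Rightarrow> complex^'d"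
  assumes "holo_map_on S g" "z \<in> S"
  shows "(g has_derivative frechet_derivative g (at z)) (at z)" "clinear (frechet_derivative g (at z))"
proof -
  let ?D = "\<lambda>v. \<chi> i. frechet_derivative (\<lambda>z. g z $ i) (at z) v"
  have h: "holo_on S (\<lambda>z. g z $ i)" for i using assms by (simp add: holo_map_on_def)
  have D: "(g has_derivative ?D) (at z)"
  proof -
    have "((\<lambda>z. \<Sum>i\<in>UNIV. (g z $ i) *s axis i 1) has_derivative
        (\<lambda>v. \<Sum>i\<in>UNIV. frechet_derivative (\<lambda>z. g z $ i) (at z) v *s axis i 1)) (at z)"
      by (intro has_derivative_sum bounded_linear.has_derivative[OF bounded_linear_smult_left]
          holo_on_has_derivative[OF h assms(2)])
    moreover have "(\<Sum>i\<in>UNIV. frechet_derivative (\<lambda>z. g z $ i) (at z) v *s axis i 1) = ?D v" for v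
      using basis_expansion[of "?D v"] by simp
    ultimately show ?thesis by (simp only: basis_expansion)
  qed
  then have eq: "frechet_derivative g (at z) = ?D" by (rule frechet_derivative_at[symmetric])
  show "(g has_derivative frechet_derivative g (at z)) (at z)" using D eq by simp
  have lin: "linear ?D" using D by (rule has_derivative_linear)
  show "clinear (frechet_derivative g (at z))"
    unfolding eq
  proof (rule clinearI)
    show "?D (u + v) = ?D u + ?D v" for u v by (rule linear_add[OF lin])
    show "?D (a *s u) = a *s ?D u" for a u
      using holo_on_frechet_scale[OF h assms(2)] by (simp add: vec_eq_iff)
  qed
qed

lemma holo_on_compose_map:
  fixes g :: "complex^'d \<Rightarrow> complex^'d"
  assumes f: "holo_on T f" and g: "holo_map_on S g" and im: "\<And>z. z \<in> S \<Longrightarrow> g z \<in> T"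
  shows "holo_on S (\<lambda>z. f (g z))"
proof (rule holo_onI)
  show "((\<lambda>z. f (g z)) has_derivative (\<lambda>v. frechet_derivative f (at (g z)) (frechet_derivative g (at z) v))) (at z)"
    if "z \<in> S" for z
    by (rule has_derivative_compose[OF holo_map_has_derivative(1)[OF g that] holo_on_has_derivative[OF f im[OF that]]])
  show "frechet_derivative f (at (g z)) (frechet_derivative g (at z) (a *s v)) =
      a * frechet_derivative f (at (g z)) (frechet_derivative g (at z) v)" if "z \<in> S" for z a v
    using holo_map_has_derivative(2)[OF g that] holo_on_frechet_scale[OF f im[OF that]]
    by (simp add: clinear_scale)
qed

lemma holo_map_compose:
  fixes g :: "complex^'d \<Rightarrow> complex^'d"
  assumes "holo_map_on T f" "holo_map_on S g" "\<And>z. z \<in> S \<Longrightarrow> g z \<in> T"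
  shows "holo_map_on S (\<lambda>z. f (g z))"
proof -
  have "holo_on S (\<lambda>z. f (g z) $ i)" for i
    using holo_on_compose_map[of T "\<lambda>w. f w $ i" S g] assms by (simp add: holo_map_on_def[of T])
  then show ?thesis by (simp add: holo_map_on_def)
qed

lemma holo_map_clinear: "clinear A \<Longrightarrow> holo_map_on S A"
  by (simp add: holo_map_on_def holo_on_clinear)

lemma holo_on_line_deriv:
  assumes "holo_on S f" "z + t *s v \<in> S"
  shows "((\<lambda>t. f (z + t *s v)) has_field_derivative frechet_derivative f (at (z + t *s v)) v) (at t)"
proof -
  have "((\<lambda>t. f (z + t *s v)) has_derivative (\<lambda>h. frechet_derivative f (at (z + t *s v)) (h *s v))) (at t)"
    by (rule has_derivative_compose[OF line_has_derivative holo_on_has_derivative[OF assms]])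
  then show ?thesis
    by (simp add: has_field_derivative_def holo_on_frechet_scale[OF assms] mult_commute_abs)
qed

lemma holo_on_line:
  assumes "holo_on S f" "\<And>t. t \<in> T \<Longrightarrow> z + t *s v \<in> S"
  shows "(\<lambda>t. f (z + t *s v)) holomorphic_on T"
  unfolding holomorphic_on_def field_differentiable_def
  using holo_on_line_deriv[OF assms(1)] assms(2) has_field_derivative_at_within by blast

section \<open>Iterated directional derivatives of holomorphic functions\<close>

lemma zeta_d_eq_frechet:
  assumes "holo_on S f" "z \<in> S"
  shows "zeta_d \<zeta> f z = frechet_derivative f (at z) \<zeta>"
proof -
  let ?D = "frechet_derivative f (at z)"
  have lin: "linear ?D" using holo_on_has_derivative[OF assms] by (rule has_derivative_linear)
  have "hprod \<zeta> (axis i 1) = \<zeta> $ i" for i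
    by (simp add: hprod_def axis_def if_distrib[where f = cnj] if_distrib[where f = "\<lambda>x. _ * x"] cong: if_cong)
  then have "zeta_d \<zeta> f z = (\<Sum>i\<in>UNIV. ?D (\<zeta> $ i *s axis i 1))"
    by (simp add: zeta_d_def holo_on_frechet_scale[OF assms])
  also have "\<dots> = ?D (\<Sum>i\<in>UNIV. \<zeta> $ i *s axis i 1)" by (rule linear_sum[OF lin, symmetric])
  also have "(\<Sum>i\<in>UNIV. \<zeta> $ i *s axis i 1) = \<zeta>" by (rule basis_expansion)
  finally show ?thesis .
qed

text \<open>The derivative is a Cauchy integral over a circle, which can be differentiated
  under the integral sign.\<close>

lemma holo_on_Cauchy_local:
  fixes v :: "complex^'d"
  assumes S: "open S" and f: "holo_on S f" and z0: "z0 \<in> S"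
  shows "\<exists>r \<rho>. r > 0 \<and> \<rho> > 0 \<and> (\<forall>z t. z \<in> ball z0 r \<longrightarrow> cmod t \<le> \<rho> \<longrightarrow> z + t *s v \<in> S) \<and>
    (\<forall>z\<in>ball z0 r. frechet_derivative f (at z) v =
      integral (cbox 0 1) (\<lambda>x. f (z + (of_real \<rho> * exp (2 * of_real pi * \<i> * of_real x)) *s v) *
        (exp (- (2 * of_real pi * \<i> * of_real x)) / of_real \<rho>)))"
proof -
  obtain R where R: "R > 0" "ball z0 R \<subseteq> S" using S z0 open_contains_ball by blast
  \<comment> \<open>Half of \<open>R\<close> is kept for moving the base point and half for the
    displacement along \<open>v\<close>; the summand 1 covers \<open>v = 0\<close>.\<close>
  define \<rho> where "\<rho> = R / 2 / (norm v + 1)"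
  have \<rho>: "\<rho> > 0" using R by (simp add: \<rho>_def add_nonneg_pos)
  have in_S: "z + t *s v \<in> S" if "z \<in> ball z0 (R/2)" "cmod t \<le> \<rho>" for z t
  proof -
    have "cmod t * norm v \<le> \<rho> * norm v" using that by (intro mult_right_mono) auto
    also have "\<dots> \<le> \<rho> * (norm v + 1)" using \<rho> by auto
    also have "\<dots> = R / 2"
    proof -
      have "norm v + 1 \<noteq> 0" using norm_ge_zero[of v] by linarith
      moreover have "x / N * N = x" if "N \<noteq> 0" for x N :: real using that by simp
      ultimately show ?thesis unfolding \<rho>_def by blast
    qed
    finally have "dist z (z + t *s v) \<le> R / 2" by (simp add: dist_norm)
    moreover have "dist z0 z < R / 2" using that by simp
    ultimately have "dist z0 (z + t *s v) < R"
      using dist_triangle[of z0 "z + t *s v" z] by simp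
    then show ?thesis using R by auto
  qed
  show ?thesis
  proof (rule exI[of _ "R/2"], rule exI[of _ \<rho>], intro conjI allI ballI impI)
    fix z assume z: "z \<in> ball z0 (R/2)"
    let ?h = "\<lambda>t. f (z + t *s v)"
    have hol: "?h holomorphic_on cball 0 \<rho>"
      by (rule holo_on_line[OF f]) (use in_S[OF z] in auto)
    have zS: "z \<in> S" using in_S[OF z, of 0] \<rho> by simp
    have "?h field_differentiable at 0"
      using holo_on_line_deriv[OF f, of z 0 v] zS field_differentiable_def by auto
    have C: "(?h has_field_derivative 1 / (2 * of_real pi * \<i>) *
        contour_integral (circlepath 0 \<rho>) (\<lambda>u. ?h u / (u - 0)\<^sup>2)) (at 0)"
      by (rule Cauchy_derivative_integral_circlepath)
        (use hol \<rho> in \<open>auto intro: holomorphic_on_imp_continuous_on holomorphic_on_subset\<close>)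
    have "frechet_derivative f (at z) v = 1 / (2 * of_real pi * \<i>) *
        contour_integral (circlepath 0 \<rho>) (\<lambda>u. ?h u / (u - 0)\<^sup>2)"
      using DERIV_unique[OF holo_on_line_deriv[OF f, of z 0 v] ] C zS by simp
    also have "\<dots> = integral {0..1} (\<lambda>x. 1 / (2 * of_real pi * \<i>) * (?h (circlepath 0 \<rho> x) / (circlepath 0 \<rho> x)\<^sup>2 *
        vector_derivative (circlepath 0 \<rho>) (at x)))"
      unfolding contour_integral_integral integral_mult_right by simp
    also have "\<dots> = integral {0..1} (\<lambda>x. f (z + (of_real \<rho> * exp (2 * of_real pi * \<i> * of_real x)) *s v) *
        (exp (- (2 * of_real pi * \<i> * of_real x)) / of_real \<rho>))"
    proof (rule integral_cong)
      fix x :: real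
      have alg: "1 / c * (h / (r * e)\<^sup>2 * (c * r * e)) = h * (inverse e / r)" if "c \<noteq> 0" "e \<noteq> 0" "r \<noteq> 0"
        for c h r e :: complex
        using that by (simp add: divide_simps power2_eq_square)
      have c: "circlepath 0 \<rho> x = of_real \<rho> * exp (2 * of_real pi * \<i> * of_real x)"
        by (simp add: circlepath)
      show "1 / (2 * of_real pi * \<i>) * (?h (circlepath 0 \<rho> x) / (circlepath 0 \<rho> x)\<^sup>2 *
          vector_derivative (circlepath 0 \<rho>) (at x)) =
          f (z + (of_real \<rho> * exp (2 * of_real pi * \<i> * of_real x)) *s v) *
          (exp (- (2 * of_real pi * \<i> * of_real x)) / of_real \<rho>)"
        unfolding vector_derivative_circlepath c exp_minus of_real_mult of_real_numeral using \<rho> by (intro alg) auto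
    qed
    also have "\<dots> = integral (cbox 0 1) (\<lambda>x. f (z + (of_real \<rho> * exp (2 * of_real pi * \<i> * of_real x)) *s v) *
        (exp (- (2 * of_real pi * \<i> * of_real x)) / of_real \<rho>))" by simp
    finally show "frechet_derivative f (at z) v = integral (cbox 0 1)
        (\<lambda>x. f (z + (of_real \<rho> * exp (2 * of_real pi * \<i> * of_real x)) *s v) *
        (exp (- (2 * of_real pi * \<i> * of_real x)) / of_real \<rho>))" .
  qed (use R \<rho> in_S in auto)
qed

lemma continuous_smult: "continuous_on S a \<Longrightarrow> continuous_on S f \<Longrightarrow> continuous_on S (\<lambda>x. a x *s (f x :: complex^'d))"
  unfolding vector_scalar_mult_def by (intro continuous_intros)

text \<open>Continuity of the derivative precedes its differentiability because the Leibniz rule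
  used for the latter asks for a jointly continuous partial derivative of the integrand, and that
  partial derivative is again a derivative of \<open>f\<close>.\<close>

lemma holo_on_frechet_continuous:
  fixes v :: "complex^'d"
  assumes S: "open S" and f: "holo_on S f"
  shows "continuous_on S (\<lambda>z. frechet_derivative f (at z) v)"
proof (rule continuous_at_imp_continuous_on, rule ballI)
  fix z0 assume z0S: "z0 \<in> S"
  obtain r \<rho> where r: "r > 0" "\<rho> > 0"
    and in_S: "\<And>z t. z \<in> ball z0 r \<Longrightarrow> cmod t \<le> \<rho> \<Longrightarrow> z + t *s v \<in> S"
    and eq: "\<And>z. z \<in> ball z0 r \<Longrightarrow> frechet_derivative f (at z) v =
      integral (cbox 0 1) (\<lambda>x. f (z + (of_real \<rho> * exp (2 * of_real pi * \<i> * of_real x)) *s v) *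
        (exp (- (2 * of_real pi * \<i> * of_real x)) / of_real \<rho>))"
    using holo_on_Cauchy_local[OF S f z0S, of v] by blast
  have "continuous_on (ball z0 r \<times> cbox 0 1) (\<lambda>(z, x). f (z + (of_real \<rho> * exp (2 * of_real pi * \<i> * of_real x)) *s v) *
        (exp (- (2 * of_real pi * \<i> * of_real x)) / of_real \<rho>))"
    unfolding case_prod_unfold
    using r by (intro continuous_intros continuous_on_compose2[OF holo_on_continuous[OF f]] continuous_smult)
      (auto intro!: in_S simp: norm_mult)
  then have "continuous_on (ball z0 r) (\<lambda>z. integral (cbox 0 1) (\<lambda>x. f (z + (of_real \<rho> * exp (2 * of_real pi * \<i> * of_real x)) *s v) *
        (exp (- (2 * of_real pi * \<i> * of_real x)) / of_real \<rho>)))"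
    by (rule integral_continuous_on_param)
  then have "continuous_on (ball z0 r) (\<lambda>z. frechet_derivative f (at z) v)"
    by (rule continuous_on_eq) (simp add: eq)
  then show "isCont (\<lambda>z. frechet_derivative f (at z) v) z0"
    using r by (simp add: continuous_on_eq_continuous_at)
qed

text \<open>\<open>holo_on\<close> asks for a single complex derivative, so the operators
  \<open>zeta_d\<close> can be iterated only once derivatives are known to be holomorphic
  again.\<close>

lemma holo_on_frechet:
  fixes v :: "complex^'d"
  assumes S: "open S" and f: "holo_on S f"
  shows "holo_on S (\<lambda>z. frechet_derivative f (at z) v)"
  unfolding holo_on_def
proof
  fix z0 assume z0S: "z0 \<in> S"
  obtain r \<rho> where r: "r > 0" "\<rho> > 0"
    and in_S: "\<And>z t. z \<in> ball z0 r \<Longrightarrow> cmod t \<le> \<rho> \<Longrightarrow> z + t *s v \<in> S"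
    and eq: "\<And>z. z \<in> ball z0 r \<Longrightarrow> frechet_derivative f (at z) v =
      integral (cbox 0 1) (\<lambda>x. f (z + (of_real \<rho> * exp (2 * of_real pi * \<i> * of_real x)) *s v) *
        (exp (- (2 * of_real pi * \<i> * of_real x)) / of_real \<rho>))"
    using holo_on_Cauchy_local[OF S f z0S, of v] by blast
  define p where "p x = (of_real \<rho> * exp (2 * of_real pi * \<i> * of_real x)) *s v" for x :: real
  define w where "w x = exp (- (2 * of_real pi * \<i> * of_real x)) / of_real \<rho>" for x :: real
  have pS: "z + p x \<in> S" if "z \<in> ball z0 r" for z x
    unfolding p_def using r by (intro in_S that) (auto simp: norm_mult)
  have contp: "continuous_on X p" for X unfolding p_def by (intro continuous_intros continuous_smult)
  have contw: "continuous_on X w" for X unfolding w_def using r by (intro continuous_intros) auto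
  \<comment> \<open>The Leibniz rule takes the partial derivative as a family of bounded operators;
    joint continuity is then checked on each vector separately.\<close>
  define fx where "fx z x = Blinfun (\<lambda>u. frechet_derivative f (at (z + p x)) u * w x)" for z x
  have bl: "bounded_linear (\<lambda>u. frechet_derivative f (at (z + p x)) u * w x)" if "z \<in> ball z0 r" for z x
    by (intro bounded_linear_mult_const has_derivative_bounded_linear[OF holo_on_has_derivative[OF f pS[OF that]]])
  have fx: "blinfun_apply (fx z x) u = frechet_derivative f (at (z + p x)) u * w x" if "z \<in> ball z0 r" for z x u
    unfolding fx_def using bounded_linear_Blinfun_apply[OF bl[OF that]] by simp
  have contfx: "continuous_on (ball z0 r \<times> cbox 0 1) (\<lambda>(z, x). fx z x)"
  proof (rule continuous_on_blinfun_componentwise)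
    fix i :: "complex^'d"
    have "continuous_on (ball z0 r \<times> cbox 0 1) (\<lambda>y. frechet_derivative f (at (fst y + p (snd y))) i * w (snd y))"
      by (intro continuous_intros continuous_on_compose2[OF holo_on_frechet_continuous[OF S f]]
          continuous_on_compose2[OF contp[of UNIV]] continuous_on_compose2[OF contw[of UNIV]])
        (auto intro: pS)
    then show "continuous_on (ball z0 r \<times> cbox 0 1) (\<lambda>y. blinfun_apply (case y of (z, x) \<Rightarrow> fx z x) i)"
      by (rule continuous_on_eq) (auto simp: fx)
  qed
  let ?G = "\<lambda>z. integral (cbox 0 1) (\<lambda>x. f (z + p x) * w x)"
  let ?D = "blinfun_apply (integral (cbox 0 1) (fx z0))"
  have "(?G has_derivative ?D) (at z0 within ball z0 r)"
  proof (rule leibniz_rule[OF _ _ contfx])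
    show "((\<lambda>z. f (z + p x) * w x) has_derivative blinfun_apply (fx z x)) (at z within ball z0 r)"
      if "z \<in> ball z0 r" for z x
    proof -
      have a: "((\<lambda>z. z + p x) has_derivative (\<lambda>u. u)) (at z)" by (auto intro!: derivative_eq_intros)
      have "((\<lambda>z. f (z + p x) * w x) has_derivative (\<lambda>u. frechet_derivative f (at (z + p x)) u * w x)) (at z)"
        by (rule has_derivative_mult_left[OF has_derivative_compose[OF a holo_on_has_derivative[OF f pS[OF that, of x]]]])
      moreover have "blinfun_apply (fx z x) = (\<lambda>u. frechet_derivative f (at (z + p x)) u * w x)"
        using fx[OF that] by auto
      ultimately show ?thesis by (simp add: has_derivative_at_withinI)
    qed
    show "(\<lambda>x. f (z + p x) * w x) integrable_on cbox 0 1" if "z \<in> ball z0 r" for z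
      by (intro integrable_continuous continuous_intros contp contw continuous_on_compose2[OF holo_on_continuous[OF f]])
        (auto intro: pS that)
  qed (use r in auto)
  moreover have "at z0 within ball z0 r = at z0" by (rule at_within_open) (use r in auto)
  ultimately have G: "(?G has_derivative ?D) (at z0)" by (simp only:)
  have "((\<lambda>z. frechet_derivative f (at z) v) has_derivative ?D) (at z0)"
    by (rule has_derivative_transform_within_open[OF G, of "ball z0 r"]) (use r eq in \<open>auto simp: p_def w_def\<close>)
  moreover have "?D (a *s u) = a * ?D u" for a u
  proof -
    have z0: "z0 \<in> ball z0 r" using r by simp
    have "continuous_on (cbox 0 1) (fx z0)"
    proof -
      have "continuous_on (cbox 0 1) (\<lambda>x::real. (z0, x))" by (intro continuous_intros)
      moreover have "(\<lambda>x. (z0, x)) ` cbox 0 1 \<subseteq> ball z0 r \<times> cbox (0::real) 1" using z0 by blast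
      ultimately have "continuous_on (cbox 0 1) (\<lambda>x. case (z0, x) of (z, x) \<Rightarrow> fx z x)"
        by (rule continuous_on_compose2[OF contfx])
      then show ?thesis by simp
    qed
    then have int: "fx z0 integrable_on cbox 0 1" by (rule integrable_continuous)
    have D: "?D u = integral (cbox 0 1) (\<lambda>x. blinfun_apply (fx z0 x) u)" for u
      using integral_linear[OF int blinfun.bounded_linear_left[of u]] by (simp add: o_def)
    have "?D (a *s u) = integral (cbox 0 1) (\<lambda>x. a * blinfun_apply (fx z0 x) u)"
      unfolding D by (simp add: fx[OF z0] holo_on_frechet_scale[OF f pS[OF z0]] mult.assoc)
    then show ?thesis unfolding D by simp
  qed
  ultimately show "\<exists>f'. ((\<lambda>z. frechet_derivative f (at z) v) has_derivative f') (at z0) \<and> (\<forall>a v. f' (a *s v) = a * f' v)"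
    by blast
qed

lemma zeta_d_holo_on: "open S \<Longrightarrow> holo_on S f \<Longrightarrow> holo_on S (zeta_d \<zeta> f)"
  using holo_on_frechet[of S f \<zeta>] holo_on_cong[of S "zeta_d \<zeta> f" "\<lambda>z. frechet_derivative f (at z) \<zeta>"]
    zeta_d_eq_frechet[of S f] by auto

lemma zeta_d_cong:
  assumes "open S" "z \<in> S" "\<And>w. w \<in> S \<Longrightarrow> f w = g w"
  shows "zeta_d \<zeta> f z = zeta_d \<zeta> g z"
  by (simp only: zeta_d_def frechet_derivative_cong_open[OF assms])

text \<open>The vector \<zeta> is both the direction of differentiation and a frozen parameter, so
  powers of \<open>zeta_d\<close> are ordinary derivatives along one complex line. The statement is
  for all points of the line because the induction differentiates in \<open>t\<close>.\<close>

lemma zeta_d_pow_eq_deriv: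
  assumes S: "open S" and f: "holo_on S f" and z: "z + t *s \<zeta> \<in> S"
  shows "(zeta_d \<zeta> ^^ k) f (z + t *s \<zeta>) = (deriv ^^ k) (\<lambda>t. f (z + t *s \<zeta>)) t"
    and "holo_on S ((zeta_d \<zeta> ^^ k) f)"
proof -
  have hol: "holo_on S ((zeta_d \<zeta> ^^ k) f)" for k
    by (induction k) (auto intro: f zeta_d_holo_on[OF S])
  then show "holo_on S ((zeta_d \<zeta> ^^ k) f)" .
  have "\<forall>t. z + t *s \<zeta> \<in> S \<longrightarrow> (zeta_d \<zeta> ^^ k) f (z + t *s \<zeta>) = (deriv ^^ k) (\<lambda>t. f (z + t *s \<zeta>)) t"
  proof (induction k)
    case (Suc k)
    show ?case
    proof (intro allI impI)
      fix t assume t: "z + t *s \<zeta> \<in> S"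
      have op: "open ((\<lambda>t. z + t *s \<zeta>) -` S)" by (rule open_vimage[OF S continuous_on_line])
      have "(zeta_d \<zeta> ^^ Suc k) f (z + t *s \<zeta>) = deriv (\<lambda>t. (zeta_d \<zeta> ^^ k) f (z + t *s \<zeta>)) t"
        using zeta_d_eq_frechet[OF hol t] DERIV_imp_deriv[OF holo_on_line_deriv[OF hol t]] by simp
      also have "\<dots> = deriv ((deriv ^^ k) (\<lambda>t. f (z + t *s \<zeta>))) t"
        using Suc op t by (intro deriv_cong_ev) (auto simp: eventually_nhds)
      finally show "(zeta_d \<zeta> ^^ Suc k) f (z + t *s \<zeta>) = (deriv ^^ Suc k) (\<lambda>t. f (z + t *s \<zeta>)) t" by simp
    qed
  qed simp
  then show "(zeta_d \<zeta> ^^ k) f (z + t *s \<zeta>) = (deriv ^^ k) (\<lambda>t. f (z + t *s \<zeta>)) t" using z by blast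
qed

section \<open>Automorphisms of the ball\<close>

lemma holo_on_hprod: "holo_on S (\<lambda>z. hprod z b)"
  unfolding hprod_def by (intro holo_on_sum holo_on_mult holo_on_component holo_on_const)

lemma holo_on_hprod_map: "holo_map_on S h \<Longrightarrow> holo_on S (\<lambda>z. hprod (h z) b)"
  unfolding hprod_def holo_map_on_def by (intro holo_on_sum holo_on_mult holo_on_const) auto

lemma scaleR_smult: "r *\<^sub>R (x :: complex^'a) = of_real r *s x"
  unfolding vec_eq_iff vector_scaleR_component vector_smult_component by (simp add: scaleR_conv_of_real)

lemma bounded_linear_hprod: "bounded_linear (\<lambda>w. hprod w v)"
  by (rule bounded_linear_intro[where K = "norm v"])
    (simp_all add: hprod_add_left hprod_scale_left norm_hprod_le scaleR_smult scaleR_conv_of_real)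

lemma one_plus_hprod_nz: "z \<in> unit_ball \<Longrightarrow> b \<in> unit_ball \<Longrightarrow> 1 + hprod z b \<noteq> 0"
  using one_plus_hprod_nonzero[of z b] by (simp add: ball_iff)

lemma clinear_msqrt: "clinear (msqrt b)"
  by (rule clinearI) (auto simp: msqrt_add msqrt_scale)

lemma holo_map_mob:
  assumes b: "b \<in> unit_ball"
  shows "holo_map_on unit_ball (mob b)"
  unfolding holo_map_on_def
proof
  fix i
  have "holo_on unit_ball (\<lambda>z. 1 / (1 + hprod z b))"
  proof (rule holo_on_compose_field[OF holo_on_add[OF holo_on_const holo_on_hprod],
        where h = "\<lambda>w. 1 / w" and h' = "\<lambda>w. - 1 / w\<^sup>2"])
    fix z :: "complex^'a" assume "z \<in> unit_ball"
    then have "1 + hprod z b \<noteq> 0" using one_plus_hprod_nz b by blast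
    then show "((\<lambda>w. 1 / w) has_field_derivative - 1 / (1 + hprod z b)\<^sup>2) (at (1 + hprod z b))"
      by (auto intro!: derivative_eq_intros simp: power2_eq_square)
  qed
  then show "holo_on unit_ball (\<lambda>z. mob b z $ i)"
    unfolding mob_def vector_add_component vector_smult_component
    by (intro holo_on_add holo_on_mult holo_on_const holo_on_clinear clinear_msqrt)
qed

lemma unit_ball_open [simp]: "open (unit_ball :: (complex^'d) set)"
  by (simp add: unit_ball_eq_ball)

text \<open>Reduction of Schwarz's lemma to the disc: restrict \<open>h\<close> to the complex line
  through a unit vector \<open>e\<close> and pair the values with a unit vector
  \<open>v\<close>.\<close>

lemma holo_functional_line:
  fixes h :: "complex^'d \<Rightarrow> complex^'d"
  assumes h: "holo_map_on unit_ball h" "\<And>z. z \<in> unit_ball \<Longrightarrow> h z \<in> unit_ball" "h 0 = 0"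
    and e: "norm e = 1" and v: "norm v = 1"
  defines "f \<equiv> \<lambda>t. hprod (h (t *s e)) v"
  shows "f holomorphic_on ball 0 1" "f 0 = 0" "\<And>t. norm t < 1 \<Longrightarrow> norm (f t) < 1"
    "deriv f 0 = hprod (frechet_derivative h (at 0) e) v"
proof -
  have in_ball: "t *s e \<in> unit_ball" if "norm t < 1" for t using that e by (simp add: ball_iff)
  have hol: "holo_on unit_ball (\<lambda>z. hprod (h z) v)" by (rule holo_on_hprod_map[OF h(1)])
  have "(\<lambda>t. hprod (h (0 + t *s e)) v) holomorphic_on ball 0 1"
    by (rule holo_on_line[OF hol]) (simp add: in_ball)
  then show "f holomorphic_on ball 0 1" by (simp add: f_def)
  show "f 0 = 0" by (simp add: f_def h)
  show "norm (f t) < 1" if "norm t < 1" for t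
    unfolding f_def using hprod_less_1[OF h(2)[OF in_ball[OF that]], of v] v by simp
  have "((\<lambda>z. hprod (h z) v) has_derivative (\<lambda>u. hprod (frechet_derivative h (at 0) u) v)) (at 0)"
    by (rule bounded_linear.has_derivative[OF bounded_linear_hprod holo_map_has_derivative(1)[OF h(1)]]) simp
  then have "frechet_derivative (\<lambda>z. hprod (h z) v) (at 0) = (\<lambda>u. hprod (frechet_derivative h (at 0) u) v)"
    by (rule frechet_derivative_at[symmetric])
  moreover have "((\<lambda>t. hprod (h (0 + t *s e)) v) has_field_derivative
      frechet_derivative (\<lambda>z. hprod (h z) v) (at (0 + 0 *s e)) e) (at 0)"
    by (rule holo_on_line_deriv[OF hol]) simp
  ultimately show "deriv f 0 = hprod (frechet_derivative h (at 0) e) v"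
    by (intro DERIV_imp_deriv) (simp add: f_def)
qed

lemma normalize_vec:
  fixes z :: "complex^'d"
  assumes "z \<noteq> 0"
  shows "norm ((1 / of_real (norm z)) *s z) = 1" "z = of_real (norm z) *s ((1 / of_real (norm z)) *s z)"
  using assms by (simp_all add: norm_divide)

text \<open>The pairing direction is the normalised value \<open>h z\<close>, so the scalar slice
  attains the norm. If the norms of \<open>h z\<close> and \<open>z\<close> agree, the equality case
  on the disc makes that slice linear with slope 1; since the derivative at 0 is a contraction, it
  must map the direction of \<open>z\<close> to that of \<open>h z\<close>.\<close>

lemma Schwarz_ball:
  fixes h :: "complex^'d \<Rightarrow> complex^'d"
  assumes h: "holo_map_on unit_ball h" "\<And>z. z \<in> unit_ball \<Longrightarrow> h z \<in> unit_ball" "h 0 = 0"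
    and z: "z \<in> unit_ball"
  shows "norm (h z) \<le> norm z"
    and "norm (h z) = norm z \<Longrightarrow> h z = frechet_derivative h (at 0) z"
proof -
  define D where "D = frechet_derivative h (at 0)"
  have Dlin: "clinear D" using holo_map_has_derivative(2)[OF h(1), of 0] by (simp add: D_def)
  have D0: "D 0 = 0" using clinear_scale[OF Dlin, of 0 0] by simp
  have D_le: "norm (D e) \<le> 1" if e: "norm e = 1" for e
  proof (cases "D e = 0")
    case False
    define v where "v = (1 / of_real (norm (D e))) *s D e"
    have v: "norm v = 1" unfolding v_def by (rule normalize_vec(1)[OF False])
    note F = holo_functional_line[OF h e v]
    have "norm (hprod (D e) v) \<le> 1"
      using Schwarz_Lemma(2)[OF F(1-3), of 0] F(4) by (simp add: D_def)
    moreover have "hprod (D e) v = of_real (norm (D e))"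
      using False by (simp add: v_def hprod_simps hprod_self power2_eq_square)
    ultimately show ?thesis by simp
  qed simp
  have main: "norm (h z) \<le> norm z \<and> (norm (h z) = norm z \<longrightarrow> h z = D z)"
  proof (cases "z = 0 \<or> h z = 0")
    case True
    then show ?thesis using h(3) D0 by auto
  next
    case False
    define e where "e = (1 / of_real (norm z)) *s z"
    define v where "v = (1 / of_real (norm (h z))) *s h z"
    have e: "norm e = 1" and ze: "z = of_real (norm z) *s e"
      unfolding e_def using normalize_vec False by auto
    have v: "norm v = 1" and hv: "h z = of_real (norm (h z)) *s v"
      unfolding v_def using normalize_vec False by auto
    note F = holo_functional_line[OF h e v]
    have hz: "hprod (h z) v = of_real (norm (h z))"
      using False by (simp add: v_def hprod_simps hprod_self power2_eq_square)
    have nz: "norm (complex_of_real (norm z)) < 1" using z by (simp add: ball_iff)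
    have le: "norm (h z) \<le> norm z"
      using Schwarz_Lemma(1)[OF F(1-3) nz] hz ze[symmetric] by simp
    moreover have "h z = D z" if eq: "norm (h z) = norm z"
    proof -
      have "\<exists>w. norm w < 1 \<and> w \<noteq> 0 \<and> norm (hprod (h (w *s e)) v) = norm w"
        by (rule exI[of _ "of_real (norm z)"]) (use nz False hz ze[symmetric] eq in auto)
      then obtain \<alpha> where \<alpha>: "\<And>w. norm w < 1 \<Longrightarrow> hprod (h (w *s e)) v = \<alpha> * w"
        using Schwarz_Lemma(3)[OF F(1-3) nz] by blast
      have "\<alpha> * of_real (norm z) = of_real (norm z)"
        using \<alpha>[OF nz] hz ze[symmetric] eq by simp
      then have "\<alpha> = 1" using False by simp
      have "deriv (\<lambda>t. hprod (h (t *s e)) v) 0 = deriv (\<lambda>w. w) 0"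
        by (intro deriv_cong_ev eventually_nhds_in_open[of "ball 0 1", THEN eventually_mono])
          (use \<alpha> \<open>\<alpha> = 1\<close> in auto)
      then have De: "hprod (D e) v = 1" using F(4) by (simp add: D_def)
      then have De': "hprod v (D e) = 1" by (subst hprod_commute) simp
      \<comment> \<open>Expanding the square with both mixed terms equal to 1 leaves
        \<open>(norm (D e))\<^sup>2 - 1\<close>, which is at most 0.\<close>
      have "hprod (D e - v) (D e - v) = of_real ((norm (D e))\<^sup>2 - 1)"
        unfolding hprod_diff_left hprod_diff_right De De' by (simp add: hprod_self v)
      then have "(norm (D e - v))\<^sup>2 = (norm (D e))\<^sup>2 - 1"
        unfolding hprod_self of_real_eq_iff .
      also have "\<dots> \<le> 0" using D_le[OF e] by (simp add: abs_square_le_1)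
      finally have "D e = v" by simp
      then show ?thesis using hv eq ze clinear_scale[OF Dlin] by metis
    qed
    ultimately show ?thesis by blast
  qed
  show "norm (h z) \<le> norm z" using main by blast
  show "norm (h z) = norm z \<Longrightarrow> h z = frechet_derivative h (at 0) z" using main by (simp add: D_def)
qed

definition cisometry :: "(complex^'d \<Rightarrow> complex^'d) \<Rightarrow> bool" where
  "cisometry U \<longleftrightarrow> clinear U \<and> (\<forall>z. norm (U z) = norm z)"

text \<open>Schwarz's lemma for \<open>h\<close> and for its left inverse \<open>k\<close> gives
  opposite inequalities, so the equality case holds at every point.\<close>

lemma Cartan_linear:
  fixes h k :: "complex^'d \<Rightarrow> complex^'d"
  assumes h: "holo_map_on unit_ball h" "\<And>z. z \<in> unit_ball \<Longrightarrow> h z \<in> unit_ball" "h 0 = 0"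
    and k: "holo_map_on unit_ball k" "\<And>z. z \<in> unit_ball \<Longrightarrow> k z \<in> unit_ball"
    and kh: "\<And>z. z \<in> unit_ball \<Longrightarrow> k (h z) = z"
  shows "cisometry (frechet_derivative h (at 0))"
    and "z \<in> unit_ball \<Longrightarrow> h z = frechet_derivative h (at 0) z"
proof -
  let ?U = "frechet_derivative h (at 0)"
  have k0: "k 0 = 0" using kh[of 0] h(3) by simp
  have U: "h z = ?U z \<and> norm (h z) = norm z" if z: "z \<in> unit_ball" for z
  proof -
    have "norm z \<le> norm (h z)"
      using Schwarz_ball(1)[OF k k0 h(2)[OF z]] kh[OF z] by simp
    then have "norm (h z) = norm z" using Schwarz_ball(1)[OF h z] by simp
    then show ?thesis using Schwarz_ball(2)[OF h z] by simp
  qed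
  then show "z \<in> unit_ball \<Longrightarrow> h z = ?U z" by blast
  have lin: "clinear ?U" using holo_map_has_derivative(2)[OF h(1), of 0] by simp
  have "norm (?U z) = norm z" for z
  proof -
    \<comment> \<open>Any vector is scaled into the ball, where the norm identity is known;
      linearity removes the factor again.\<close>
    define r where "r = 1 / (norm z + 1)"
    have r: "0 < r" "r * norm z < 1" using norm_ge_zero[of z] by (auto simp: r_def add_nonneg_pos divide_less_eq)
    define a where "a = complex_of_real r"
    have a: "a \<noteq> 0" "a *s z \<in> unit_ball" using r by (auto simp: a_def ball_iff)
    have "norm (?U (a *s z)) = norm (a *s z)" using U[OF a(2)] by metis
    then show ?thesis using a(1) by (simp add: clinear_scale[OF lin])
  qed
  then show "cisometry ?U" using lin by (simp add: cisometry_def)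
qed

section \<open>Unitary maps\<close>

lemma clinear_imp_linear:
  fixes A :: "complex^'a \<Rightarrow> complex^'b"
  assumes "clinear A"
  shows "linear A"
proof (rule linearI)
  show "A (r *\<^sub>R x) = r *\<^sub>R A x" for r x
    by (simp only: scaleR_smult clinear_scale[OF assms])
qed (rule clinear_add[OF assms])

lemma cisometry_hprod:
  fixes U :: "complex^'d \<Rightarrow> complex^'d"
  assumes U: "cisometry U"
  shows "hprod (U x) (U y) = hprod x y"
proof -
  have lin: "clinear U" and n: "\<And>z. norm (U z) = norm z" using U by (auto simp: cisometry_def)
  have re: "Re (hprod (U x) (U y)) = Re (hprod x y)" for x y
    unfolding Re_hprod dot_norm n clinear_add[OF lin, symmetric] ..
  have im: "Im w = Re (- \<i> * w)" for w by simp
  have "Im (hprod (U x) (U y)) = Re (hprod (U ((- \<i>) *s x)) (U y))"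
    unfolding im clinear_scale[OF lin] hprod_scale_left ..
  also have "\<dots> = Im (hprod x y)" unfolding re hprod_scale_left im[symmetric] ..
  finally show ?thesis using re by (simp add: complex_eq_iff)
qed

lemma cisometry_surj:
  fixes U :: "complex^'d \<Rightarrow> complex^'d"
  assumes U: "cisometry U"
  shows "bij U"
proof -
  have lin: "linear U" using U clinear_imp_linear by (auto simp: cisometry_def)
  have "inj U"
    unfolding linear_injective_0[OF lin] using U by (metis cisometry_def norm_eq_zero)
  then show ?thesis using linear_injective_imp_surjective[OF lin] by (simp add: bij_def)
qed

lemma cisometry_inv:
  fixes U :: "complex^'d \<Rightarrow> complex^'d"
  assumes U: "cisometry U"
  shows "cisometry (inv U)"
proof -
  have UU: "U (inv U x) = x" "inv U (U x) = x" for x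
    using cisometry_surj[OF U] by (simp_all add: bij_def surj_f_inv_f)
  have lin: "clinear U" using U by (simp add: cisometry_def)
  have "clinear (inv U)"
  proof (rule clinearI)
    show "inv U (x + y) = inv U x + inv U y" for x y
      using clinear_add[OF lin, of "inv U x" "inv U y"] UU by metis
    show "inv U (a *s x) = a *s inv U x" for a x
      using clinear_scale[OF lin, of a "inv U x"] UU by metis
  qed
  moreover have "norm (inv U x) = norm x" for x using U UU by (metis cisometry_def)
  ultimately show ?thesis by (simp add: cisometry_def)
qed

lemma cisometry_ball: "cisometry U \<Longrightarrow> U z \<in> unit_ball \<longleftrightarrow> z \<in> unit_ball"
  by (simp add: cisometry_def ball_iff)

text \<open>Elements of \<open>ball_auts\<close> are extensional. Here values outside the ball are
  left free, so that \<open>mob b\<close> and compositions qualify directly, and the inverse is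
  carried along instead of being chosen.\<close>

definition ball_aut_pair :: "(complex^'d \<Rightarrow> complex^'d) \<Rightarrow> (complex^'d \<Rightarrow> complex^'d) \<Rightarrow> bool" where
  "ball_aut_pair g g' \<longleftrightarrow> holo_map_on unit_ball g \<and> holo_map_on unit_ball g' \<and>
     (\<forall>z\<in>unit_ball. g z \<in> unit_ball \<and> g' z \<in> unit_ball \<and> g' (g z) = z \<and> g (g' z) = z)"

lemma ball_aut_pair_sym: "ball_aut_pair g g' \<Longrightarrow> ball_aut_pair g' g"
  by (auto simp: ball_aut_pair_def)

lemma ball_aut_pair_compose:
  assumes f: "ball_aut_pair f f'" and g: "ball_aut_pair g g'"
  shows "ball_aut_pair (\<lambda>z. f (g z)) (\<lambda>z. g' (f' z))"
  unfolding ball_aut_pair_def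
proof (intro conjI ballI)
  show "holo_map_on unit_ball (\<lambda>z. f (g z))" "holo_map_on unit_ball (\<lambda>z. g' (f' z))"
    using f g by (auto simp: ball_aut_pair_def intro: holo_map_compose)
qed (use f g in \<open>simp_all add: ball_aut_pair_def\<close>)

lemma ball_aut_pair_mob: "b \<in> unit_ball \<Longrightarrow> ball_aut_pair (mob b) (mob (- b))"
  by (auto simp: ball_aut_pair_def holo_map_mob mob_in_ball mob_mob_minus mob_minus_mob)

lemma ball_aut_pair_fix0:
  assumes "ball_aut_pair h k" "h 0 = 0"
  shows "cisometry (frechet_derivative h (at 0))"
    and "z \<in> unit_ball \<Longrightarrow> h z = frechet_derivative h (at 0) z"
  using Cartan_linear[of h k] assms unfolding ball_aut_pair_def by blast+

lemma ball_aut_decompose: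
  assumes g: "ball_aut_pair g g'"
  obtains U where "cisometry U" "\<And>z. z \<in> unit_ball \<Longrightarrow> g z = mob (g 0) (U z)"
proof -
  have b: "g 0 \<in> unit_ball" using g zero_in_ball unfolding ball_aut_pair_def by blast
  let ?h = "\<lambda>z. mob (- g 0) (g z)"
  have h: "ball_aut_pair ?h (\<lambda>z. g' (mob (- (- g 0)) z))"
    by (rule ball_aut_pair_compose[OF ball_aut_pair_mob g]) (simp add: b)
  have h0: "?h 0 = 0" using mob_mob_minus[OF b zero_in_ball] by simp
  show ?thesis
  proof (rule that[OF ball_aut_pair_fix0(1)[OF h h0]])
    fix z :: "complex^'a" assume z: "z \<in> unit_ball"
    have "g z = mob (g 0) (?h z)"
      using mob_minus_mob[OF b, of "g z"] g z by (simp add: ball_aut_pair_def)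
    then show "g z = mob (g 0) (frechet_derivative ?h (at 0) z)"
      using ball_aut_pair_fix0(2)[OF h h0 z] by simp
  qed
qed

section \<open>Determinants of rank-one perturbations and Jacobians of automorphisms\<close>

lemma det_one_row_identity:
  fixes v :: "'a::field^'n" and u :: "'n \<Rightarrow> 'a"
  assumes "finite S" "k \<notin> S"
  shows "det (\<chi> i. if i = k then v else if i \<in> S then axis i 1 + u i *s v else axis i 1) = v $ k"
  using assms
proof (induction S rule: finite_induct)
  case empty
  have row: "row i (mat 1 :: 'a^'n^'n) = axis i 1" for i
    by (simp add: row_def mat_def axis_def vec_eq_iff eq_commute)
  have "det (\<chi> i. if i = k then \<Sum>j\<in>UNIV. v $ j *s row j (mat 1 :: 'a^'n^'n) else row i (mat 1)) = v $ k * det (mat 1 :: 'a^'n^'n)"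
    by (rule cramer_lemma_transpose)
  then show ?case unfolding row basis_expansion empty_iff if_False by simp
next
  case (insert j S)
  let ?A = "\<chi> i. if i = k then v else if i \<in> S then axis i 1 + u i *s v else axis i 1"
  have "(\<chi> i. if i = k then v else if i \<in> insert j S then axis i 1 + u i *s v else axis i 1) =
      (\<chi> i. if i = j then row j ?A + u j *s row k ?A else row i ?A)"
    using insert by (auto simp: vec_eq_iff row_def)
  then have "det (\<chi> i. if i = k then v else if i \<in> insert j S then axis i 1 + u i *s v else axis i 1) = det ?A"
    using det_row_operation[of j k ?A "u j"] insert by auto
  then show ?case using insert by simp
qed

text \<open>The matrix determinant lemma, by multilinearity one row at a time. It is stated over any
  field because both complex and real determinants of rank-one perturbations are taken
  later.\<close>

lemma det_identity_plus_rank_one: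
  fixes v :: "'a::field^'n" and u :: "'n \<Rightarrow> 'a"
  shows "det (\<chi> i. axis i 1 + u i *s v) = 1 + (\<Sum>i\<in>UNIV. u i * v $ i)"
proof -
  have "det (\<chi> i. if i \<in> S then axis i 1 + u i *s v else axis i 1) = 1 + (\<Sum>i\<in>S. u i * v $ i)" if "finite S" for S
    using that
  proof (induction S rule: finite_induct)
    case empty
    have "(\<chi> i. axis i 1) = (mat 1 :: 'a^'n^'n)"
      by (simp add: mat_def axis_def vec_eq_iff eq_commute)
    then show ?case by simp
  next
    case (insert k S)
    let ?c = "\<lambda>i. if i \<in> S then axis i 1 + u i *s v else axis i 1"
    have "(\<chi> i. if i \<in> insert k S then axis i 1 + u i *s v else axis i 1) =
        (\<chi> i. if i = k then axis k 1 + u k *s v else ?c i)"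
      by (auto simp: vec_eq_iff)
    then have "det (\<chi> i. if i \<in> insert k S then axis i 1 + u i *s v else axis i 1) =
        det (\<chi> i. if i = k then axis k 1 else ?c i) + det (\<chi> i. if i = k then u k *s v else ?c i)"
      using det_row_add[of k "\<lambda>_. axis k 1" "\<lambda>_. u k *s v" ?c] by simp
    also have "(\<chi> i. if i = k then axis k 1 else ?c i) = (\<chi> i. ?c i)"
      using insert by (auto simp: vec_eq_iff)
    also have "det (\<chi> i. if i = k then u k *s v else ?c i) = u k * det (\<chi> i. if i = k then v else ?c i)"
      using det_row_mul[of k "u k" "\<lambda>_. v" ?c] by simp
    also have "det (\<chi> i. if i = k then v else ?c i) = v $ k"
      by (rule det_one_row_identity) (use insert in auto)
    finally show ?case using insert by simp
  qed
  from this[of UNIV] show ?thesis by simp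
qed

lemma det_matrix_rank_one_update:
  "det (matrix (\<lambda>v. v - (c * hprod v b) *s w)) = 1 - c * hprod w b"
proof -
  have ax: "hprod (axis j 1) b = cnj (b $ j)" for j
    by (simp add: hprod_def axis_def if_distrib[where f = "\<lambda>x. x * _"] cong: if_cong)
  have "matrix (\<lambda>v. v - (c * hprod v b) *s w) = (\<chi> i. axis i 1 + (- c * w $ i) *s (\<chi> j. cnj (b $ j)))"
    by (simp add: matrix_def vec_eq_iff ax) (simp add: axis_def)
  then show ?thesis
    by (simp only: det_identity_plus_rank_one) (simp add: hprod_def sum_distrib_left sum_negf mult.assoc)
qed

lemma det_matrix_scale: "det (matrix (\<lambda>v::complex^'d. c *s v)) = c ^ CARD('d)"
proof -
  have "matrix (\<lambda>v::complex^'d. c *s v) $ i $ j = (if i = j then c else 0)" for i j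
    by (simp add: matrix_def axis_def)
  then show ?thesis by (subst det_diagonal) auto
qed

lemma clinear_rank_one_update: "clinear (\<lambda>v. v - (c * hprod v b) *s w)"
  by (rule clinearI) (auto simp: hprod_simps vec_eq_iff algebra_simps)

lemma clinear_smult: "clinear (\<lambda>v. c *s v)"
  by (rule clinearI) (auto simp: vec_eq_iff algebra_simps)

text \<open>The eigenvalues are \<open>s\<close> with multiplicity \<open>d - 1\<close> and
  \<open>s\<^sup>2\<close> once, so the exponent is \<open>d + 1\<close>, the genus. The proof pulls
  out the scalar \<open>s\<close> and evaluates the remaining rank-one perturbation.\<close>

lemma det_msqrt:
  fixes b :: "complex^'d"
  assumes b: "b \<in> unit_ball"
  shows "det (matrix (msqrt b)) = of_real (defect b) ^ Suc CARD('d)"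
proof -
  define s where "s = complex_of_real (defect b)"
  have nz: "1 + s \<noteq> 0" unfolding s_def
    using defect_pos[OF b] by (metis add_pos_pos of_real_1 of_real_add of_real_eq_0_iff order_less_irrefl zero_less_one)
  have "msqrt b = (\<lambda>v. s *s v) \<circ> (\<lambda>v. v - (1 / (1 + s) * hprod v b) *s b)"
    by (simp add: fun_eq_iff msqrt_def s_def vec_eq_iff algebra_simps)
  then have "det (matrix (msqrt b)) = s ^ CARD('d) * (1 - 1 / (1 + s) * hprod b b)"
    by (simp only: matrix_compose_gen[OF clinear_rank_one_update clinear_smult] det_mul
        det_matrix_scale det_matrix_rank_one_update)
  also have "1 - 1 / (1 + s) * hprod b b = s"
    unfolding hprod_self_defect[OF b] s_def[symmetric] using nz
    by (simp add: divide_simps) (simp add: algebra_simps power2_eq_square)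
  finally show ?thesis by (simp add: s_def)
qed

lemma norm_det_isometry:
  fixes U :: "complex^'d \<Rightarrow> complex^'d"
  assumes U: "cisometry U"
  shows "cmod (det (matrix U)) = 1"
proof -
  define A where "A = matrix U"
  define B where "B = (\<chi> i j. cnj (A $ i $ j))"
  have col: "U (axis i 1) $ k = A $ k $ i" for i k by (simp add: A_def matrix_def)
  have "(\<Sum>k\<in>UNIV. A $ k $ i * cnj (A $ k $ j)) = (if i = j then 1 else 0)" for i j
  proof -
    have "hprod (axis i 1 :: complex^'d) (axis j 1) = (if i = j then 1 else 0)"
      by (simp add: hprod_def axis_def if_distrib[where f = cnj] if_distrib[where f = "\<lambda>x. x * _"] cong: if_cong)
    then show ?thesis
      using cisometry_hprod[OF U, of "axis i 1" "axis j 1"] unfolding hprod_def[of "U _"] col by simp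
  qed
  then have "transpose A ** B = mat 1"
    by (simp add: matrix_matrix_mult_def transpose_def B_def mat_def vec_eq_iff)
  then have "det A * det B = 1" by (metis det_I det_mul det_transpose)
  moreover have "det B = cnj (det A)" by (simp add: det_def B_def cnj_sum cnj_prod of_int_def[symmetric])
  ultimately have "of_real ((cmod (det A))\<^sup>2) = (1::complex)" using complex_norm_square[of "det A"] by simp
  then have "(cmod (det A))\<^sup>2 = 1" using of_real_eq_1_iff by blast
  then show ?thesis unfolding A_def by (simp add: power2_eq_1_iff) (smt (verit) norm_ge_zero)
qed

lemma bounded_bilinear_smult: "bounded_bilinear (\<lambda>a (v :: complex^'d). a *s v)"
proof (rule bounded_bilinear.intro)
  show "\<exists>K. \<forall>a b. norm (a *s (b :: complex^'d)) \<le> norm a * norm b * K"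
    by (rule exI[of _ 1]) simp
qed (simp_all add: scaleR_smult, simp_all add: vec_eq_iff algebra_simps scaleR_conv_of_real)

lemma clinear_bounded_linear: "clinear (A :: complex^'a \<Rightarrow> complex^'b) \<Longrightarrow> bounded_linear A"
  by (simp add: clinear_imp_linear linear_conv_bounded_linear[symmetric])

lemma mob_has_derivative:
  assumes b: "b \<in> unit_ball" and w: "w \<in> unit_ball"
  defines "q \<equiv> 1 + hprod w b"
  shows "(mob b has_derivative (\<lambda>v. (1 / q) *s msqrt b (v - (1 / q * hprod v b) *s w))) (at w)"
proof -
  have q: "q \<noteq> 0" unfolding q_def using one_plus_hprod_nonzero[OF w] b by (simp add: ball_iff)
  have 1: "((\<lambda>w. 1 + hprod w b) has_derivative (\<lambda>v. hprod v b)) (at w)"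
    using has_derivative_add[OF has_derivative_const bounded_linear_imp_has_derivative[OF bounded_linear_hprod]]
    by fastforce
  have "((\<lambda>x. 1 / x) has_field_derivative - 1 / q\<^sup>2) (at (1 + hprod w b))"
    using q unfolding q_def[symmetric] by (auto intro!: derivative_eq_intros simp: power2_eq_square)
  then have 2: "((\<lambda>w. 1 / (1 + hprod w b)) has_derivative (\<lambda>v. - 1 / q\<^sup>2 * hprod v b)) (at w)"
    using has_derivative_compose[OF 1] unfolding has_field_derivative_def by blast
  have 3: "(msqrt b has_derivative msqrt b) (at w)"
    by (rule bounded_linear_imp_has_derivative[OF clinear_bounded_linear[OF clinear_msqrt]])
  have "((\<lambda>z. b + (1 / (1 + hprod z b)) *s msqrt b z) has_derivative
      (\<lambda>v. 0 + ((1 / (1 + hprod w b)) *s msqrt b v + (- 1 / q\<^sup>2 * hprod v b) *s msqrt b w))) (at w)"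
    by (rule has_derivative_add[OF has_derivative_const bounded_bilinear.FDERIV[OF bounded_bilinear_smult 2 3]])
  moreover have "0 + ((1 / (1 + hprod w b)) *s msqrt b v + (- 1 / q\<^sup>2 * hprod v b) *s msqrt b w) =
      (1 / q) *s msqrt b (v - (1 / q * hprod v b) *s w)" for v
    unfolding q_def[symmetric] msqrt_diff msqrt_scale using q
    by (simp add: vec_eq_iff field_simps power2_eq_square)
  ultimately show ?thesis unfolding mob_def[abs_def] by simp
qed

text \<open>The derivative factors into a scalar \<open>1 / q\<close>, the Bergman square root, a
  rank-one perturbation and \<open>U\<close>. The scalar contributes \<open>d\<close> powers of
  \<open>1 / q\<close> and the perturbation one more, which is why the Jacobian is a power of
  \<open>1 / q\<close> with exponent the genus.\<close>

lemma mob_isometry_derivative: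
  fixes U :: "complex^'d \<Rightarrow> complex^'d"
  assumes b: "b \<in> unit_ball" and U: "cisometry U" and z: "z \<in> unit_ball"
    and g: "\<And>z. z \<in> unit_ball \<Longrightarrow> g z = mob b (U z)"
  defines "q \<equiv> 1 + hprod (U z) b"
  shows "frechet_derivative g (at z) = (\<lambda>v. (1 / q) *s msqrt b (U v - (1 / q * hprod (U v) b) *s U z))"
    and "jac_det g z = of_real (defect b) ^ Suc CARD('d) * det (matrix U) / q ^ Suc CARD('d)"
proof -
  have lin: "clinear U" using U by (simp add: cisometry_def)
  have Uz: "U z \<in> unit_ball" using U z cisometry_ball by blast
  have q: "q \<noteq> 0" unfolding q_def using one_plus_hprod_nonzero[OF Uz] b by (simp add: ball_iff)
  have "((\<lambda>z. mob b (U z)) has_derivative (\<lambda>v. (1 / q) *s msqrt b (U v - (1 / q * hprod (U v) b) *s U z))) (at z)"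
    unfolding q_def
    by (rule has_derivative_compose[OF bounded_linear_imp_has_derivative[OF clinear_bounded_linear[OF lin]]
          mob_has_derivative[OF b Uz]])
  then have "(g has_derivative (\<lambda>v. (1 / q) *s msqrt b (U v - (1 / q * hprod (U v) b) *s U z))) (at z)"
    by (rule has_derivative_transform_within_open[OF _ unit_ball_open z]) (simp add: g)
  then show D: "frechet_derivative g (at z) = (\<lambda>v. (1 / q) *s msqrt b (U v - (1 / q * hprod (U v) b) *s U z))"
    by (rule frechet_derivative_at[symmetric])
  let ?R = "\<lambda>v. v - (1 / q * hprod v b) *s U z"
  have R: "clinear ?R" by (rule clinear_rank_one_update)
  have RU: "clinear (?R \<circ> U)" by (rule Vector_Spaces.linear_compose[OF lin R])
  have MRU: "clinear (msqrt b \<circ> (?R \<circ> U))" by (rule Vector_Spaces.linear_compose[OF RU clinear_msqrt])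
  have "frechet_derivative g (at z) = (\<lambda>v. (1 / q) *s v) \<circ> (msqrt b \<circ> (?R \<circ> U))"
    unfolding D by (simp add: fun_eq_iff)
  then have "jac_det g z = (1 / q) ^ CARD('d) * (of_real (defect b) ^ Suc CARD('d) *
      ((1 - 1 / q * hprod (U z) b) * det (matrix U)))"
    unfolding jac_det_def
    by (simp only: matrix_compose_gen[OF MRU clinear_smult] matrix_compose_gen[OF RU clinear_msqrt]
        matrix_compose_gen[OF lin R] det_mul det_matrix_scale det_msqrt[OF b] det_matrix_rank_one_update)
  also have "1 - 1 / q * hprod (U z) b = 1 / q"
    using q by (simp add: q_def field_simps)
  finally show "jac_det g z = of_real (defect b) ^ Suc CARD('d) * det (matrix U) / q ^ Suc CARD('d)"
    using q by (simp add: field_simps)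
qed

text \<open>\<open>1 + hprod (U z) b\<close> has positive real part, so its principal logarithm is
  continuous. Adding the right multiple of it to \<open>L\<close> gives a continuous function with
  constant exponential; its values differ by integer multiples of \<open>2 * pi * \<i>\<close>, so
  it is constant on the connected ball.\<close>

lemma log_branch_form:
  fixes U :: "complex^'d \<Rightarrow> complex^'d"
  assumes b: "b \<in> unit_ball" and U: "cisometry U"
    and g: "\<And>z. z \<in> unit_ball \<Longrightarrow> g z = mob b (U z)" and L: "log_branch g L"
  obtains C where "\<And>z. z \<in> unit_ball \<Longrightarrow> L z = C - of_nat (Suc CARD('d)) * Ln (1 + hprod (U z) b)"
    "exp (Re C) = defect b ^ Suc CARD('d)"
proof -
  define p where "p = Suc CARD('d)"
  define q where "q z = 1 + hprod (U z) b" for z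
  have Uz: "U z \<in> unit_ball" if "z \<in> unit_ball" for z using U that cisometry_ball by blast
  have Req: "0 < Re (q z)" if "z \<in> unit_ball" for z
    using hprod_less_1[OF Uz[OF that], of b] b abs_Re_le_cmod[of "hprod (U z) b"] by (auto simp: q_def ball_iff)
  have q0: "q z \<noteq> 0" if "z \<in> unit_ball" for z using Req[OF that] by auto
  have lin: "clinear U" using U by (simp add: cisometry_def)
  define E where "E z = L z + of_nat p * Ln (q z)" for z
  have "continuous_on unit_ball q"
    unfolding q_def using holo_on_continuous[OF holo_on_hprod_map[OF holo_map_clinear[OF lin]]]
    by (intro continuous_intros)
  then have contE: "continuous_on unit_ball E"
    unfolding E_def using L Req
    by (intro continuous_intros) (auto simp: log_branch_def complex_nonpos_Reals_iff dest: Req)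
  have expE: "exp (E z) = of_real (defect b) ^ p * det (matrix U)" if z: "z \<in> unit_ball" for z
  proof -
    have "exp (E z) = exp (L z) * q z ^ p"
      unfolding E_def exp_add exp_of_nat_mult using q0[OF z] by simp
    then show ?thesis
      using L z mob_isometry_derivative(2)[OF b U z g] q0[OF z]
      by (simp add: log_branch_def p_def q_def)
  qed
  have "E constant_on unit_ball"
  proof (rule continuous_discrete_range_constant[OF _ contE])
    show "connected unit_ball" by (simp add: unit_ball_eq_ball)
    fix x :: "complex^'d" assume x: "x \<in> unit_ball"
    have "2 * pi \<le> norm (E y - E x)" if y: "y \<in> unit_ball" "E y \<noteq> E x" for y
    proof -
      obtain n :: int where n: "E y = E x + (of_int (2 * n) * pi) * \<i>"
        using expE[OF x] expE[OF y(1)] unfolding exp_eq[symmetric] by (metis exp_eq)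
      then have "n \<noteq> 0" using y by auto
      then have "1 \<le> \<bar>real_of_int n\<bar>" by linarith
      then show ?thesis unfolding n by (simp add: norm_mult)
    qed
    then show "\<exists>e>0. \<forall>y. y \<in> unit_ball \<and> E y \<noteq> E x \<longrightarrow> e \<le> norm (E y - E x)"
      by (intro exI[of _ "2 * pi"]) auto
  qed
  then obtain C where C: "\<And>z. z \<in> unit_ball \<Longrightarrow> E z = C" by (auto simp: constant_on_def)
  show ?thesis
  proof
    show "L z = C - of_nat (Suc CARD('d)) * Ln (1 + hprod (U z) b)" if "z \<in> unit_ball" for z
      using C[OF that] by (simp add: E_def q_def p_def algebra_simps)
    have "cmod (exp C) = defect b ^ p"
      using expE[OF zero_in_ball] C[OF zero_in_ball] norm_det_isometry[OF U] defect_pos[OF b]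
      by (simp add: norm_mult norm_power)
    then show "exp (Re C) = defect b ^ Suc CARD('d)" by (simp add: p_def)
  qed
qed

section \<open>The intertwining identity on a complex line\<close>

text \<open>With \<open>w = 1 + \<gamma> * t\<close>, the coefficient of
  \<open>w powr (- \<mu> - k - j)\<close> times the \<open>j\<close>-th derivative of
  \<open>f\<close> at \<open>t / w\<close>, in the \<open>k\<close>-th derivative of
  \<open>w powr (- \<mu>) * f (t / w)\<close>.\<close>

definition bolcoeff :: "complex \<Rightarrow> complex \<Rightarrow> nat \<Rightarrow> nat \<Rightarrow> complex" where
  "bolcoeff \<mu> \<gamma> k j = of_nat (k choose j) * pochhammer (\<mu> + of_nat j) (k - j) * (- \<gamma>) ^ (k - j)"

lemma bolcoeff_Suc_0: "bolcoeff \<mu> \<gamma> (Suc k) 0 = - \<gamma> * (\<mu> + of_nat k) * bolcoeff \<mu> \<gamma> k 0"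
  by (simp add: bolcoeff_def pochhammer_Suc)

text \<open>This is the product rule for one further differentiation: the first summand comes from
  differentiating the power of \<open>w\<close> in the term \<open>Suc j\<close>, the second from
  differentiating the derivative of \<open>f\<close> in the term \<open>j\<close>.\<close>

lemma bolcoeff_Suc_Suc:
  assumes "j \<le> k"
  shows "bolcoeff \<mu> \<gamma> (Suc k) (Suc j) =
    - \<gamma> * (\<mu> + of_nat k + of_nat (Suc j)) * bolcoeff \<mu> \<gamma> k (Suc j) + bolcoeff \<mu> \<gamma> k j"
proof (cases "j = k")
  case True
  then show ?thesis by (simp add: bolcoeff_def)
next
  case False
  then obtain m where m: "k = Suc (j + m)" using assms less_imp_Suc_add[of j k] by auto
  define P where "P = pochhammer (\<mu> + of_nat (Suc j)) m"
  define A where "A = complex_of_nat (k choose Suc j)"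
  define B where "B = complex_of_nat (k choose j)"
  have "Suc j * (k choose Suc j) = (k - j) * (k choose j)"
    using binomial_absorb_comp[of k j] binomial_absorption[of j k] by (metis Suc_times_binomial_add add.commute binomial_absorption mult.commute diff_Suc_eq_diff_pred Suc_diff_Suc)
  then have AB: "of_nat (Suc j) * A = of_nat (Suc m) * B"
    unfolding A_def B_def of_nat_mult[symmetric] by (simp add: m)
  have p1: "pochhammer (\<mu> + of_nat (Suc j)) (Suc m) = P * (\<mu> + of_nat k)"
    by (simp add: P_def pochhammer_Suc m add_ac)
  have p2: "pochhammer (\<mu> + of_nat j) (Suc m) = (\<mu> + of_nat j) * P"
    by (simp add: P_def pochhammer_rec add_ac)
  have E: "(A + B) * (\<mu> + of_nat k) = (\<mu> + of_nat k + of_nat (Suc j)) * A + (\<mu> + of_nat j) * B"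
  proof -
    have "B * of_nat k = B * of_nat j + of_nat (Suc m) * B" by (simp add: m algebra_simps)
    moreover have "B + B * of_nat m = A + A * of_nat j" using AB by (simp add: algebra_simps)
    ultimately show ?thesis by (simp add: algebra_simps)
  qed
  have c1: "bolcoeff \<mu> \<gamma> (Suc k) (Suc j) = (A + B) * (\<mu> + of_nat k) * (P * (- \<gamma>) ^ Suc m)"
    unfolding bolcoeff_def using p1 by (simp add: A_def B_def m add.commute mult_ac)
  have c2: "bolcoeff \<mu> \<gamma> k (Suc j) = A * P * (- \<gamma>) ^ m"
    unfolding bolcoeff_def by (simp add: A_def P_def m)
  have c3: "bolcoeff \<mu> \<gamma> k j = B * ((\<mu> + of_nat j) * P) * (- \<gamma>) ^ Suc m"
    unfolding bolcoeff_def using p2 by (simp add: B_def m Suc_diff_le)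
  show ?thesis unfolding c1 c2 c3 E by (simp add: algebra_simps)
qed

text \<open>The formula is needed at \<open>t = 0\<close> but the induction differentiates in
  \<open>t\<close>, so it is proved on all of \<open>T\<close>. Differentiating the power lowers the
  exponent by 1 and differentiating \<open>f (t / w)\<close> lowers it by 2, which matches the
  exponent \<open>- \<mu> - k - j\<close>.\<close>

lemma bol_derivative:
  fixes f :: "complex \<Rightarrow> complex" and \<mu> \<gamma> :: complex
  assumes T: "open T" and W: "open W" and f: "f holomorphic_on W"
    and nonpos: "\<And>t. t \<in> T \<Longrightarrow> 1 + \<gamma> * t \<notin> \<real>\<^sub>\<le>\<^sub>0"
    and TW: "\<And>t. t \<in> T \<Longrightarrow> t / (1 + \<gamma> * t) \<in> W"
    and F: "\<And>t. t \<in> T \<Longrightarrow> F t = (1 + \<gamma> * t) powr (- \<mu>) * f (t / (1 + \<gamma> * t))"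
    and t: "t \<in> T"
  shows "(deriv ^^ k) F t = (\<Sum>j\<le>k. bolcoeff \<mu> \<gamma> k j *
      ((1 + \<gamma> * t) powr (- \<mu> - of_nat k - of_nat j) * (deriv ^^ j) f (t / (1 + \<gamma> * t))))"
  using t
proof (induction k arbitrary: t)
  case 0
  then show ?case by (simp add: F bolcoeff_def)
next
  case (Suc k)
  define w where "w = 1 + \<gamma> * t"
  have w: "w \<notin> \<real>\<^sub>\<le>\<^sub>0" using nonpos[OF Suc.prems] by (simp add: w_def)
  have w0: "w \<noteq> 0" using w by auto
  define X where "X j = w powr (- \<mu> - of_nat (Suc k) - of_nat j) * (deriv ^^ j) f (t / w)" for j
  have dw: "((\<lambda>t. 1 + \<gamma> * t) has_field_derivative \<gamma>) (at t)" by (auto intro!: derivative_eq_intros)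
  have dp: "((\<lambda>t. (1 + \<gamma> * t) powr a) has_field_derivative a * w powr (a - 1) * \<gamma>) (at t)" for a
    using DERIV_chain2[OF has_field_derivative_powr[OF w, of a, unfolded w_def] dw] by (simp add: w_def)
  have dt: "((\<lambda>t. t / (1 + \<gamma> * t)) has_field_derivative 1 / w\<^sup>2) (at t)"
    using w0 unfolding w_def by (auto intro!: derivative_eq_intros simp: power2_eq_square)
  have df: "((\<lambda>t. (deriv ^^ j) f (t / (1 + \<gamma> * t))) has_field_derivative (deriv ^^ Suc j) f (t / w) * (1 / w\<^sup>2)) (at t)" for j
  proof (rule DERIV_chain2[OF _ dt])
    have "(deriv ^^ j) f holomorphic_on W" by (rule holomorphic_higher_deriv[OF f W])
    then show "((deriv ^^ j) f has_field_derivative (deriv ^^ Suc j) f (t / w)) (at (t / (1 + \<gamma> * t)))"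
      using holomorphic_derivI[OF _ W] TW[OF Suc.prems] by (simp add: w_def)
  qed
  have pw: "w powr (a - 1) * (1 / w) = w powr (a - 2)" "w powr a * (1 / w\<^sup>2) = w powr (a - 2)" for a
    using w0 powr_diff[of w a 1] powr_diff[of w a 2] powr_diff[of w "a - 1" 1]
    by (simp_all add: power2_eq_square powr_diff)
  have "((\<lambda>t. \<Sum>j\<le>k. bolcoeff \<mu> \<gamma> k j *
      ((1 + \<gamma> * t) powr (- \<mu> - of_nat k - of_nat j) * (deriv ^^ j) f (t / (1 + \<gamma> * t)))) has_field_derivative
      (\<Sum>j\<le>k. bolcoeff \<mu> \<gamma> k j *
        ((- \<mu> - of_nat k - of_nat j) * w powr (- \<mu> - of_nat k - of_nat j - 1) * \<gamma> * (deriv ^^ j) f (t / (1 + \<gamma> * t)) +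
        (deriv ^^ Suc j) f (t / w) * (1 / w\<^sup>2) * (1 + \<gamma> * t) powr (- \<mu> - of_nat k - of_nat j)))) (at t)"
    by (intro DERIV_sum DERIV_cmult DERIV_mult dp df)
  moreover have "bolcoeff \<mu> \<gamma> k j *
        ((- \<mu> - of_nat k - of_nat j) * w powr (- \<mu> - of_nat k - of_nat j - 1) * \<gamma> * (deriv ^^ j) f (t / (1 + \<gamma> * t)) +
        (deriv ^^ Suc j) f (t / w) * (1 / w\<^sup>2) * (1 + \<gamma> * t) powr (- \<mu> - of_nat k - of_nat j)) =
      - \<gamma> * (\<mu> + of_nat k + of_nat j) * bolcoeff \<mu> \<gamma> k j * X j + bolcoeff \<mu> \<gamma> k j * X (Suc j)" for j
  proof -
    have e1: "w powr (- \<mu> - of_nat k - of_nat j - 1) = w powr (- \<mu> - of_nat (Suc k) - of_nat j)"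
      by (rule arg_cong[where f = "\<lambda>a. w powr a"]) simp
    have e2: "w powr (- \<mu> - of_nat k - of_nat j) * (1 / w\<^sup>2) = w powr (- \<mu> - of_nat (Suc k) - of_nat (Suc j))"
      unfolding pw by (rule arg_cong[where f = "\<lambda>a. w powr a"]) simp
    show ?thesis
      unfolding X_def w_def[symmetric] e1 e2[symmetric] by (simp add: algebra_simps)
  qed
  ultimately have D: "((\<lambda>t. \<Sum>j\<le>k. bolcoeff \<mu> \<gamma> k j *
      ((1 + \<gamma> * t) powr (- \<mu> - of_nat k - of_nat j) * (deriv ^^ j) f (t / (1 + \<gamma> * t)))) has_field_derivative
      (\<Sum>j\<le>k. - \<gamma> * (\<mu> + of_nat k + of_nat j) * bolcoeff \<mu> \<gamma> k j * X j + bolcoeff \<mu> \<gamma> k j * X (Suc j))) (at t)"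
    by simp
  have "(deriv ^^ Suc k) F t = deriv ((deriv ^^ k) F) t" by simp
  also have "\<dots> = deriv (\<lambda>t. \<Sum>j\<le>k. bolcoeff \<mu> \<gamma> k j *
      ((1 + \<gamma> * t) powr (- \<mu> - of_nat k - of_nat j) * (deriv ^^ j) f (t / (1 + \<gamma> * t)))) t"
    using T Suc by (intro deriv_cong_ev) (auto simp: eventually_nhds)
  also have "\<dots> = (\<Sum>j\<le>k. - \<gamma> * (\<mu> + of_nat k + of_nat j) * bolcoeff \<mu> \<gamma> k j * X j + bolcoeff \<mu> \<gamma> k j * X (Suc j))"
    by (rule DERIV_imp_deriv[OF D])
  \<comment> \<open>The added term \<open>j = Suc k\<close> vanishes with its binomial coefficient;
    it lets both sums be aligned by splitting off \<open>j = 0\<close>.\<close>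
  also have "\<dots> = (\<Sum>j\<le>Suc k. - \<gamma> * (\<mu> + of_nat k + of_nat j) * bolcoeff \<mu> \<gamma> k j * X j) + (\<Sum>j\<le>k. bolcoeff \<mu> \<gamma> k j * X (Suc j))"
  proof -
    have "bolcoeff \<mu> \<gamma> k (Suc k) = 0" by (simp add: bolcoeff_def binomial_eq_0)
    then show ?thesis by (simp only: sum.distrib sum.atMost_Suc mult_zero_right mult_zero_left add_0_right)
  qed
  also have "\<dots> = - \<gamma> * (\<mu> + of_nat k) * bolcoeff \<mu> \<gamma> k 0 * X 0 +
      (\<Sum>j\<le>k. (- \<gamma> * (\<mu> + of_nat k + of_nat (Suc j)) * bolcoeff \<mu> \<gamma> k (Suc j) + bolcoeff \<mu> \<gamma> k j) * X (Suc j))"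
    unfolding sum.atMost_Suc_shift by (simp only: sum.distrib distrib_right of_nat_0 add_0_right add.assoc)
  also have "\<dots> = bolcoeff \<mu> \<gamma> (Suc k) 0 * X 0 + (\<Sum>j\<le>k. bolcoeff \<mu> \<gamma> (Suc k) (Suc j) * X (Suc j))"
    unfolding bolcoeff_Suc_0 by (intro arg_cong2[where f = "(+)"] refl sum.cong) (simp add: bolcoeff_Suc_Suc)
  also have "\<dots> = (\<Sum>j\<le>Suc k. bolcoeff \<mu> \<gamma> (Suc k) j * X j)"
    unfolding sum.atMost_Suc_shift ..
  finally show ?case by (simp add: X_def w_def)
qed

text \<open>This explains the denominators of the operator: the Pochhammer symbol of
  \<open>\<mu>\<close> of length \<open>m + j\<close> splits into one of length \<open>j\<close> and
  the symbol occurring in \<open>bolcoeff\<close>, which cancels. Regrouping the product of the two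
  binomial coefficients then leaves the expansion of
  \<open>(1 + \<gamma>) ^ (N - j)\<close>.\<close>

lemma bol_coefficient_identity:
  fixes \<mu> \<gamma> :: complex
  assumes nz: "\<And>k. k \<le> N \<Longrightarrow> pochhammer \<mu> k \<noteq> 0" and j: "j \<le> N"
  shows "(\<Sum>k\<in>{j..N}. (-1) ^ k / pochhammer \<mu> k * of_nat (N choose k) * bolcoeff \<mu> \<gamma> k j) =
    (-1) ^ j / pochhammer \<mu> j * of_nat (N choose j) * (1 + \<gamma>) ^ (N - j)"
proof -
  have "(\<Sum>k\<in>{j..N}. (-1) ^ k / pochhammer \<mu> k * of_nat (N choose k) * bolcoeff \<mu> \<gamma> k j) =
      (\<Sum>m\<le>N - j. (-1) ^ (m + j) / pochhammer \<mu> (m + j) * of_nat (N choose (m + j)) * bolcoeff \<mu> \<gamma> (m + j) j)"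
    using sum.shift_bounds_cl_nat_ivl[of "\<lambda>k. (-1) ^ k / pochhammer \<mu> k * of_nat (N choose k) * bolcoeff \<mu> \<gamma> k j" 0 j "N - j"] j
    by (simp add: atLeast0AtMost)
  also have "\<dots> = (\<Sum>m\<le>N - j. (-1) ^ j / pochhammer \<mu> j * of_nat (N choose j) * (of_nat ((N - j) choose m) * \<gamma> ^ m))"
  proof (rule sum.cong[OF refl])
    fix m assume "m \<in> {..N - j}"
    then have m: "m + j \<le> N" using j by auto
    have p: "pochhammer \<mu> (m + j) = pochhammer \<mu> j * pochhammer (\<mu> + of_nat j) m"
      using pochhammer_product[of j "m + j" \<mu>] by simp
    then have pn: "pochhammer (\<mu> + of_nat j) m \<noteq> 0" "pochhammer \<mu> j \<noteq> 0" using nz[OF m] by auto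
    have "(N choose (m + j)) * ((m + j) choose j) = (N choose j) * ((N - j) choose m)"
      using choose_mult[of j "m + j" N] m by simp
    then have c: "of_nat (N choose (m + j)) * complex_of_nat ((m + j) choose j) =
        of_nat (N choose j) * of_nat ((N - j) choose m)"
      by (metis of_nat_mult)
    have "(-1) ^ (m + j) / pochhammer \<mu> (m + j) * of_nat (N choose (m + j)) * bolcoeff \<mu> \<gamma> (m + j) j =
        (-1) ^ j / pochhammer \<mu> j * ((-1) ^ m * (- \<gamma>) ^ m) * (of_nat (N choose (m + j)) * of_nat ((m + j) choose j))"
      unfolding bolcoeff_def p using pn by (simp add: power_add divide_simps)
    also have "(-1) ^ m * (- \<gamma>) ^ m = \<gamma> ^ m" by (simp add: power_mult_distrib[symmetric])
    finally show "(-1) ^ (m + j) / pochhammer \<mu> (m + j) * of_nat (N choose (m + j)) * bolcoeff \<mu> \<gamma> (m + j) j =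
        (-1) ^ j / pochhammer \<mu> j * of_nat (N choose j) * (of_nat ((N - j) choose m) * \<gamma> ^ m)"
      unfolding c by simp
  qed
  also have "\<dots> = (-1) ^ j / pochhammer \<mu> j * of_nat (N choose j) * (1 + \<gamma>) ^ (N - j)"
    unfolding sum_distrib_left[symmetric] binomial_ring[of 1 \<gamma>] add.commute[of 1 \<gamma>] by (simp add: binomial_ring[of \<gamma> 1])
  finally show ?thesis .
qed

lemma bol_sum_identity:
  fixes \<mu> \<gamma> :: complex
  assumes "\<And>k. k \<le> N \<Longrightarrow> pochhammer \<mu> k \<noteq> 0"
  shows "(\<Sum>k\<le>N. (-1) ^ k / pochhammer \<mu> k * of_nat (N choose k) * (\<Sum>j\<le>k. bolcoeff \<mu> \<gamma> k j * X j)) =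
    (\<Sum>j\<le>N. (-1) ^ j / pochhammer \<mu> j * of_nat (N choose j) * ((1 + \<gamma>) ^ (N - j) * X j))"
proof -
  let ?a = "\<lambda>k. (-1) ^ k / pochhammer \<mu> k * of_nat (N choose k)"
  have "(\<Sum>k\<le>N. ?a k * (\<Sum>j\<le>k. bolcoeff \<mu> \<gamma> k j * X j)) = (\<Sum>k\<le>N. \<Sum>j\<le>k. ?a k * bolcoeff \<mu> \<gamma> k j * X j)"
    by (simp add: sum_distrib_left mult.assoc)
  also have "\<dots> = (\<Sum>j\<le>N. \<Sum>k\<in>{j..N}. ?a k * bolcoeff \<mu> \<gamma> k j * X j)"
    by (subst sum.Sigma[OF finite_atMost], simp, subst sum.Sigma[OF finite_atMost], simp)
      (rule sum.reindex_bij_witness[of _ "\<lambda>(a, b). (b, a)" "\<lambda>(a, b). (b, a)"], auto)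
  also have "\<dots> = (\<Sum>j\<le>N. ?a j * ((1 + \<gamma>) ^ (N - j) * X j))"
  proof (rule sum.cong[OF refl])
    fix j assume "j \<in> {..N}"
    then show "(\<Sum>k\<in>{j..N}. ?a k * bolcoeff \<mu> \<gamma> k j * X j) = ?a j * ((1 + \<gamma>) ^ (N - j) * X j)"
      unfolding sum_distrib_right[symmetric] using bol_coefficient_identity[OF assms, where j = j and \<gamma> = \<gamma> and N = N]
      by (simp only: atMost_iff mult.assoc)
  qed
  finally show ?thesis .
qed

section \<open>The group actions and the operators\<close>

lemma holo_mapsD:
  assumes "\<Phi> \<in> holo_maps V"
  shows "z \<in> unit_ball \<Longrightarrow> \<Phi> z \<in> V" "z \<notin> unit_ball \<Longrightarrow> \<Phi> z = (\<lambda>_. 0)"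
    "holo_on unit_ball (\<lambda>z. \<Phi> z \<zeta>)"
  using assms by (auto simp: holo_maps_def)

lemma pcoeff_holo:
  assumes "\<Phi> \<in> holo_maps V"
  shows "holo_on unit_ball (\<lambda>z. pcoeff N m (\<Phi> z))"
  unfolding pcoeff_def using holo_mapsD(3)[OF assms]
  by (intro holo_on_sum holo_on_mult holo_on_const)

section \<open>Powers of the directional derivative on polynomial-valued maps\<close>

lemma frechet_component:
  fixes g :: "complex^'d \<Rightarrow> complex^'d"
  assumes "holo_map_on S g" "z \<in> S"
  shows "frechet_derivative g (at z) v $ i = frechet_derivative (\<lambda>z. g z $ i) (at z) v"
proof -
  have "((\<lambda>z. g z $ i) has_derivative (\<lambda>v. frechet_derivative g (at z) v $ i)) (at z)"
    by (rule bounded_linear.has_derivative[OF bounded_linear_vec_nth holo_map_has_derivative(1)[OF assms]])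
  then show ?thesis using frechet_derivative_at by metis
qed

text \<open>In the monomial expansion the differentiation falls on the holomorphic coefficients
  \<open>pcoeff\<close>, and each coordinate direction brings one factor of \<zeta>, so the degree
  rises by one. Values outside the ball are cut off to meet the convention of
  \<open>holo_maps\<close>.\<close>

lemma zeta_d_holo_maps:
  fixes \<Phi> :: "complex^'d \<Rightarrow> complex^'d \<Rightarrow> complex"
  assumes \<Phi>: "\<Phi> \<in> holo_maps (hom_polys l)"
  shows "(\<lambda>z \<zeta>. if z \<in> unit_ball then zeta_d \<zeta> (\<lambda>w. \<Phi> w \<zeta>) z else 0) \<in> holo_maps (hom_polys (Suc l))"
proof -
  have hol: "holo_on unit_ball (zeta_d \<zeta> (\<lambda>w. \<Phi> w \<zeta>))" for \<zeta>
    by (rule zeta_d_holo_on[OF unit_ball_open holo_mapsD(3)[OF \<Phi>]])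
  have "(\<lambda>\<zeta>. zeta_d \<zeta> (\<lambda>w. \<Phi> w \<zeta>) z) \<in> hom_polys (1 + l)" if z: "z \<in> unit_ball" for z
  proof -
    let ?M = "{m :: 'd \<Rightarrow> nat. (\<Sum>i\<in>UNIV. m i) = l}"
    let ?c = "\<lambda>m w. pcoeff (Suc l) m (\<Phi> w)"
    have c: "holo_on unit_ball (?c m)" for m by (rule pcoeff_holo[OF \<Phi>])
    have "frechet_derivative (\<lambda>w. \<Phi> w \<zeta>) (at z) v =
        (\<Sum>m\<in>?M. frechet_derivative (?c m) (at z) v * zmonom m \<zeta>)" for \<zeta> v
    proof -
      have "frechet_derivative (\<lambda>w. \<Phi> w \<zeta>) (at z) =
          frechet_derivative (\<lambda>w. \<Sum>m\<in>?M. ?c m w * zmonom m \<zeta>) (at z)"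
        by (rule frechet_derivative_cong_open[OF unit_ball_open z])
          (rule hom_polys_expansion[OF holo_mapsD(1)[OF \<Phi>]])
      also have "\<dots> = (\<lambda>v. \<Sum>m\<in>?M. frechet_derivative (?c m) (at z) v * zmonom m \<zeta>)"
        by (rule frechet_derivative_at[symmetric], intro has_derivative_sum has_derivative_mult_left
            holo_on_has_derivative[OF c z])
      finally show ?thesis by simp
    qed
    then have "(\<lambda>\<zeta>. zeta_d \<zeta> (\<lambda>w. \<Phi> w \<zeta>) z) =
        (\<lambda>\<zeta>. \<Sum>i\<in>UNIV. \<zeta> $ i * (\<Sum>m\<in>?M. frechet_derivative (?c m) (at z) (axis i 1) * zmonom m \<zeta>))"
      by (simp add: zeta_d_def fun_eq_iff hprod_def axis_def if_distrib[where f = cnj]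
          if_distrib[where f = "\<lambda>x. _ * x"] cong: if_cong)
    also have "\<dots> \<in> hom_polys (1 + l)"
      by (intro hom_polys_sum hom_polys_mult hom_polys_scale hom_polys_component zmonom_in_hom_polys) auto
    finally show ?thesis .
  qed
  moreover have "holo_on unit_ball (\<lambda>z. if z \<in> unit_ball then zeta_d \<zeta> (\<lambda>w. \<Phi> w \<zeta>) z else 0)" for \<zeta>
    using hol[of \<zeta>] by (subst holo_on_cong[OF unit_ball_open]) auto
  ultimately show ?thesis by (auto simp: holo_maps_def)
qed

lemma zeta_d_pow_holo_maps:
  fixes \<Phi> :: "complex^'d \<Rightarrow> complex^'d \<Rightarrow> complex"
  assumes \<Phi>: "\<Phi> \<in> holo_maps (hom_polys l)"
  shows "(\<lambda>z \<zeta>. if z \<in> unit_ball then zeta_d_pow k \<Phi> z \<zeta> else 0) \<in> holo_maps (hom_polys (l + k))"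
proof (induction k)
  case 0
  have "(\<lambda>z \<zeta>. if z \<in> unit_ball then zeta_d_pow 0 \<Phi> z \<zeta> else 0) = \<Phi>"
    using holo_mapsD(2)[OF \<Phi>] by (auto simp: zeta_d_pow_def fun_eq_iff)
  then show ?case using \<Phi> by simp
next
  case (Suc k)
  have "(\<lambda>z \<zeta>. if z \<in> unit_ball then zeta_d_pow (Suc k) \<Phi> z \<zeta> else 0) =
      (\<lambda>z \<zeta>. if z \<in> unit_ball then zeta_d \<zeta> (\<lambda>w. if w \<in> unit_ball then zeta_d_pow k \<Phi> w \<zeta> else 0) z else 0)"
    by (intro ext if_cong refl) (auto simp: zeta_d_pow_def intro!: zeta_d_cong[OF unit_ball_open])
  then show ?case using zeta_d_holo_maps[OF Suc] by simp
qed

lemma zeta_d_pow_hom_polys: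
  assumes "\<Phi> \<in> holo_maps (hom_polys l)" "z \<in> unit_ball"
  shows "zeta_d_pow k \<Phi> z \<in> hom_polys (l + k)"
  using holo_mapsD(1)[OF zeta_d_pow_holo_maps[OF assms(1), of k] assms(2)] assms(2) by simp

lemma zeta_d_pow_line:
  assumes \<Phi>: "\<Phi> \<in> holo_maps V" and z: "z \<in> unit_ball"
  shows "zeta_d_pow k \<Phi> z \<zeta> = (deriv ^^ k) (\<lambda>t. \<Phi> (z + t *s \<zeta>) \<zeta>) 0"
  using zeta_d_pow_eq_deriv(1)[OF unit_ball_open holo_mapsD(3)[OF \<Phi>], of z 0 \<zeta> k \<zeta>] z
  by (simp add: zeta_d_pow_def)

definition I_coeff :: "real \<Rightarrow> nat \<Rightarrow> nat \<Rightarrow> nat \<Rightarrow> complex" where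
  "I_coeff \<nu> n l k = (-1) ^ k / of_real (pochhammer (2 * real l + \<nu>) k) * of_nat ((n - l) choose k)"

lemma I_op_eq: "z \<in> unit_ball \<Longrightarrow> I_op \<nu> n l \<Phi> z \<zeta> = (\<Sum>k\<le>n - l. I_coeff \<nu> n l k * zeta_d_pow k \<Phi> z \<zeta>)"
  by (simp add: I_op_def I_coeff_def atLeast0AtMost)

lemma I_op_outside: "z \<notin> unit_ball \<Longrightarrow> I_op \<nu> n l \<Phi> z = (\<lambda>_. 0)"
  by (simp add: I_op_def)

lemma I_op_holo_maps:
  fixes \<Phi> :: "complex^'d \<Rightarrow> complex^'d \<Rightarrow> complex"
  assumes \<Phi>: "\<Phi> \<in> holo_maps (hom_polys l)" and l: "l \<le> n"
  shows "I_op \<nu> n l \<Phi> \<in> holo_maps (deg_polys n)"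
proof -
  have "I_op \<nu> n l \<Phi> z \<in> deg_polys n" if z: "z \<in> unit_ball" for z
  proof -
    have "(\<lambda>\<zeta>. \<Sum>k\<le>n - l. I_coeff \<nu> n l k * zeta_d_pow k \<Phi> z \<zeta>) \<in> deg_polys n"
    proof (intro deg_polys_sum deg_polys_scale)
      fix k assume "k \<in> {..n - l}"
      then have "l + k \<le> n" using l by auto
      then show "zeta_d_pow k \<Phi> z \<in> deg_polys n"
        using zeta_d_pow_hom_polys[OF \<Phi> z, of k] hom_polys_subset_deg_polys by blast
    qed
    moreover have "I_op \<nu> n l \<Phi> z = (\<lambda>\<zeta>. \<Sum>k\<le>n - l. I_coeff \<nu> n l k * zeta_d_pow k \<Phi> z \<zeta>)"
      by (rule ext) (rule I_op_eq[OF z])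
    ultimately show ?thesis by simp
  qed
  moreover have "holo_on unit_ball (\<lambda>z. I_op \<nu> n l \<Phi> z \<zeta>)" for \<zeta>
  proof -
    have "holo_on unit_ball (\<lambda>z. \<Sum>k\<le>n - l. I_coeff \<nu> n l k * (if z \<in> unit_ball then zeta_d_pow k \<Phi> z \<zeta> else 0))"
      by (intro holo_on_sum holo_on_mult holo_on_const holo_mapsD(3)[OF zeta_d_pow_holo_maps[OF \<Phi>]])
    then show ?thesis
      by (subst holo_on_cong[OF unit_ball_open, of _ "\<lambda>z. \<Sum>k\<le>n - l. I_coeff \<nu> n l k * (if z \<in> unit_ball then zeta_d_pow k \<Phi> z \<zeta> else 0)"])
        (auto simp: I_op_eq)
  qed
  ultimately show ?thesis using I_op_outside by (auto simp: holo_maps_def)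
qed

section \<open>Automorphisms in normal form and the action on homogeneous maps\<close>

definition moebius_form ::
  "(complex^'d \<Rightarrow> complex^'d) \<Rightarrow> complex^'d \<Rightarrow> (complex^'d \<Rightarrow> complex^'d) \<Rightarrow> (complex^'d \<Rightarrow> complex) \<Rightarrow> bool" where
  "moebius_form g b U L \<longleftrightarrow> b \<in> unit_ball \<and> cisometry U \<and> (\<forall>z\<in>unit_ball. g z = mob b (U z)) \<and> log_branch g L"

lemma moebius_formD:
  assumes "moebius_form g b U L"
  shows "b \<in> unit_ball" "cisometry U" "clinear U" "\<And>z. z \<in> unit_ball \<Longrightarrow> g z = mob b (U z)" "log_branch g L"
    "\<And>z. z \<in> unit_ball \<Longrightarrow> U z \<in> unit_ball" "\<And>z. z \<in> unit_ball \<Longrightarrow> g z \<in> unit_ball"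
    "\<And>z. z \<in> unit_ball \<Longrightarrow> 1 + hprod (U z) b \<noteq> 0" "\<And>z. z \<in> unit_ball \<Longrightarrow> 0 < Re (1 + hprod (U z) b)"
proof -
  show 1: "b \<in> unit_ball" "cisometry U" "clinear U" "\<And>z. z \<in> unit_ball \<Longrightarrow> g z = mob b (U z)" "log_branch g L"
    using assms by (auto simp: moebius_form_def cisometry_def)
  show 2: "U z \<in> unit_ball" if "z \<in> unit_ball" for z using that 1(2) cisometry_ball by blast
  show "g z \<in> unit_ball" if "z \<in> unit_ball" for z using mob_in_ball[OF 1(1) 2[OF that]] 1(4)[OF that] by simp
  show "1 + hprod (U z) b \<noteq> 0" if "z \<in> unit_ball" for z using one_plus_hprod_nz[OF 2[OF that] 1(1)] .
  show "0 < Re (1 + hprod (U z) b)" if "z \<in> unit_ball" for z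
    using hprod_less_1[OF 2[OF that], of b] 1(1) abs_Re_le_cmod[of "hprod (U z) b"] by (auto simp: ball_iff)
qed

lemma moebius_form_holo:
  assumes "moebius_form g b U L"
  shows "holo_map_on unit_ball g"
proof -
  note M = moebius_formD[OF assms]
  have "holo_map_on unit_ball (\<lambda>z. mob b (U z))"
    by (rule holo_map_compose[OF holo_map_mob[OF M(1)] holo_map_clinear[OF M(3)] M(6)])
  then show ?thesis
    unfolding holo_map_on_def using holo_on_cong[OF unit_ball_open] M(4) by (metis (no_types, lifting))
qed

lemma moebius_form_frechet:
  assumes "moebius_form g b U L" "z \<in> unit_ball"
  shows "frechet_derivative g (at z) v = (1 / (1 + hprod (U z) b)) *s
    msqrt b (U v - (1 / (1 + hprod (U z) b) * hprod (U v) b) *s U z)"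
  using fun_cong[OF mob_isometry_derivative(1)[OF moebius_formD(1,2)[OF assms(1)] assms(2) moebius_formD(4)[OF assms(1)]], of v] .

text \<open>One constant \<open>C\<close> serves all real powers of the Jacobian. The modulus of
  \<open>exp C\<close> is fixed by \<open>b\<close>, while its phase depends on the determinant of
  the unitary part.\<close>

lemma log_branch_power:
  fixes g :: "complex^'d \<Rightarrow> complex^'d"
  assumes M: "moebius_form g b U L"
  shows "\<exists>C. (\<forall>z\<in>unit_ball. \<forall>a. exp (of_real (a / genus TYPE('d)) * L z) =
      exp (of_real (a / genus TYPE('d)) * C) * (1 + hprod (U z) b) powr (- of_real a)) \<and>
    exp (Re C) = defect b ^ Suc CARD('d) \<and> holo_on unit_ball L"
proof -
  note D = moebius_formD[OF M]
  obtain C where C: "\<And>z. z \<in> unit_ball \<Longrightarrow> L z = C - of_nat (Suc CARD('d)) * Ln (1 + hprod (U z) b)"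
    and exp: "exp (Re C) = defect b ^ Suc CARD('d)"
    using log_branch_form[OF D(1,2,4,5)] by blast
  have p: "genus TYPE('d) = real (Suc CARD('d))" by (simp add: genus_def)
  show ?thesis
  proof (intro exI[of _ C] conjI ballI allI exp)
    fix z :: "complex^'d" and a assume z: "z \<in> unit_ball"
    have "of_real (a / real (Suc CARD('d))) * complex_of_nat (Suc CARD('d)) = of_real a"
      by (metis nonzero_divide_eq_eq of_nat_eq_0_iff nat.distinct(1) of_real_mult of_real_of_nat_eq)
    then have "of_real (a / genus TYPE('d)) * L z = of_real (a / genus TYPE('d)) * C - of_real a * Ln (1 + hprod (U z) b)"
      unfolding C[OF z] p by (metis (no_types, lifting) mult.assoc right_diff_distrib)
    then show "exp (of_real (a / genus TYPE('d)) * L z) =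
      exp (of_real (a / genus TYPE('d)) * C) * (1 + hprod (U z) b) powr (- of_real a)"
      using D(8)[OF z] by (simp add: powr_def exp_diff exp_minus divide_inverse)
  next
    have "holo_on unit_ball (\<lambda>z. Ln (1 + hprod (U z) b))"
    proof (rule holo_on_compose_field[OF holo_on_add[OF holo_on_const holo_on_hprod_map[OF holo_map_clinear[OF D(3)]]],
          where h' = inverse])
      fix z :: "complex^'d" assume "z \<in> unit_ball"
      then show "(Ln has_field_derivative inverse (1 + hprod (U z) b)) (at (1 + hprod (U z) b))"
        using D(9) by (intro has_field_derivative_Ln) (auto simp: complex_nonpos_Reals_iff dest: D(9))
    qed
    then have "holo_on unit_ball (\<lambda>z. C - of_nat (Suc CARD('d)) * Ln (1 + hprod (U z) b))"
      by (intro holo_on_diff holo_on_mult holo_on_const)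
    then show "holo_on unit_ball L"
      using holo_on_cong[OF unit_ball_open, of L "\<lambda>z. C - of_nat (Suc CARD('d)) * Ln (1 + hprod (U z) b)"] C by blast
  qed
qed

lemma alpha_inv_holo_maps:
  fixes \<Phi> :: "complex^'d \<Rightarrow> complex^'d \<Rightarrow> complex"
  assumes M: "moebius_form g b U L" and \<Phi>: "\<Phi> \<in> holo_maps (hom_polys l)"
  shows "alpha_inv \<nu> g L \<Phi> \<in> holo_maps (hom_polys l)"
proof -
  note D = moebius_formD[OF M]
  note hg = moebius_form_holo[OF M]
  have lin: "clinear (frechet_derivative g (at z))" if "z \<in> unit_ball" for z
    by (rule holo_map_has_derivative(2)[OF hg that])
  have "alpha_inv \<nu> g L \<Phi> z \<in> hom_polys l" if z: "z \<in> unit_ball" for z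
    unfolding alpha_inv_def using z
    by (simp, intro hom_polys_scale hom_polys_comp_clinear[OF holo_mapsD(1)[OF \<Phi> D(7)] lin])
  moreover have "holo_on unit_ball (\<lambda>z. alpha_inv \<nu> g L \<Phi> z \<zeta>)" for \<zeta>
  proof -
    let ?f = "\<lambda>z. exp (of_real (\<nu> / genus TYPE('d)) * L z) * (\<Sum>m | (\<Sum>i\<in>UNIV. m i) = l.
      pcoeff (Suc l) m (\<Phi> (g z)) * (\<Prod>i\<in>UNIV. frechet_derivative (\<lambda>z. g z $ i) (at z) \<zeta> ^ m i))"
    have "holo_on unit_ball L" using log_branch_power[OF M] by (elim exE conjE)
    then have "holo_on unit_ball (\<lambda>z. exp (of_real (\<nu> / genus TYPE('d)) * L z))"
      by (intro holo_on_compose_field[OF holo_on_mult[OF holo_on_const], where h' = exp]) (auto intro: DERIV_exp)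
    moreover have "holo_on unit_ball (\<lambda>z. pcoeff (Suc l) m (\<Phi> (g z)))" for m
      by (rule holo_on_compose_map[OF pcoeff_holo[OF \<Phi>] hg D(7)])
    moreover have "holo_on unit_ball (\<lambda>z. frechet_derivative (\<lambda>z. g z $ i) (at z) \<zeta>)" for i
      using hg by (intro holo_on_frechet) (auto simp: holo_map_on_def)
    ultimately have "holo_on unit_ball ?f"
      by (intro holo_on_mult holo_on_sum holo_on_prod holo_on_power)
    moreover have "alpha_inv \<nu> g L \<Phi> z \<zeta> = ?f z" if z: "z \<in> unit_ball" for z
      using z hom_polys_expansion[OF holo_mapsD(1)[OF \<Phi> D(7)[OF z]]]
      by (simp add: alpha_inv_def zmonom_def frechet_component[OF hg z])
    ultimately show ?thesis
      using holo_on_cong[OF unit_ball_open, of "\<lambda>z. alpha_inv \<nu> g L \<Phi> z \<zeta>" ?f] by blast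
  qed
  ultimately show ?thesis by (auto simp: holo_maps_def alpha_inv_def)
qed

section \<open>The intertwining relation at a point\<close>

lemma funpow_deriv_cong:
  assumes "open T" "\<And>t. t \<in> T \<Longrightarrow> F t = G t" "t \<in> T"
  shows "(deriv ^^ k) F t = (deriv ^^ k) G t"
  using assms(3)
proof (induction k arbitrary: t)
  case (Suc k)
  then have "\<forall>\<^sub>F x in nhds t. (deriv ^^ k) F x = (deriv ^^ k) G x"
    unfolding eventually_nhds using assms(1) by blast
  then show ?case by (auto intro!: deriv_cong_ev)
qed (simp add: assms(2))

text \<open>The denominators of \<open>g\<close> at \<open>z\<close> and at
  \<open>z + t *s \<zeta>\<close> differ by the factor \<open>w\<close>, which is affine in
  \<open>t\<close>. The last equation is the derivative in \<open>t\<close> of the one before it,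
  since \<open>t / w\<close> has derivative \<open>1 / w\<^sup>2\<close>.\<close>

lemma moebius_line:
  fixes g :: "complex^'d \<Rightarrow> complex^'d"
  assumes M: "moebius_form g b U L" and z: "z \<in> unit_ball" and t: "z + t *s \<zeta> \<in> unit_ball"
  defines "q \<equiv> 1 + hprod (U z) b"
  defines "w \<equiv> 1 + hprod (U \<zeta>) b / q * t"
  shows "1 + hprod (U (z + t *s \<zeta>)) b = q * w"
    and "w \<notin> \<real>\<^sub>\<le>\<^sub>0" and "(q * w) powr a = q powr a * w powr a"
    and "g (z + t *s \<zeta>) = g z + (t / w) *s frechet_derivative g (at z) \<zeta>"
    and "frechet_derivative g (at (z + t *s \<zeta>)) \<zeta> = (1 / w\<^sup>2) *s frechet_derivative g (at z) \<zeta>"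
proof -
  note D = moebius_formD[OF M]
  define r where "r = hprod (U \<zeta>) b"
  have q: "q \<noteq> 0" using D(8)[OF z] by (simp add: q_def)
  have Ut: "U (z + t *s \<zeta>) = U z + t *s U \<zeta>" by (simp add: clinear_add[OF D(3)] clinear_scale[OF D(3)])
  show qw: "1 + hprod (U (z + t *s \<zeta>)) b = q * w"
    using q by (simp add: Ut hprod_simps w_def q_def field_simps)
  have qw': "1 + hprod (U z + t *s U \<zeta>) b = q * w" using qw unfolding Ut .
  have w0: "w \<noteq> 0" using D(8)[OF t] qw by auto
  have Re: "0 < Re q" "0 < Re (q * w)" using D(9)[OF z] D(9)[OF t] qw by (auto simp: q_def)
  \<comment> \<open>Both \<open>q\<close> and \<open>q * w\<close> have positive real part, so
    \<open>w\<close> cannot be a nonpositive real multiple of 1.\<close>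
  show nonpos: "w \<notin> \<real>\<^sub>\<le>\<^sub>0"
  proof
    assume "w \<in> \<real>\<^sub>\<le>\<^sub>0"
    then obtain x where x: "w = of_real x" "x \<le> 0" by (auto elim: nonpos_Reals_cases)
    then have "Re (q * w) = Re q * x" by simp
    then show False using Re x(2) by (simp add: zero_less_mult_iff)
  qed
  \<comment> \<open>The arguments of \<open>q\<close> and \<open>q * w\<close> lie strictly between
    \<open>- pi / 2\<close> and \<open>pi / 2\<close>, so the argument of their quotient
    \<open>w\<close> stays in the principal range and no correction by a multiple of
    \<open>2 * pi * \<i>\<close> occurs.\<close>
  have "Ln (q * w) = Ln q + Ln w"
  proof -
    have "\<bar>Im (Ln (q * w))\<bar> < pi / 2" "\<bar>Im (Ln q)\<bar> < pi / 2"
      using Re_Ln_pos_lt[of "q * w"] Re_Ln_pos_lt[of q] Re q w0 mult_eq_0_iff by blast+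
    moreover have q': "q \<notin> \<real>\<^sub>\<le>\<^sub>0" using Re(1) by (auto simp: complex_nonpos_Reals_iff)
    ultimately have "Ln ((q * w) * inverse q) = Ln (q * w) + Ln (inverse q)"
      using q w0 by (intro Ln_times_simple) (auto simp: Ln_inverse[OF q'])
    moreover have "q * w * inverse q = w" using q by simp
    ultimately show ?thesis by (simp add: Ln_inverse[OF q'])
  qed
  then show "(q * w) powr a = q powr a * w powr a"
    using q w0 by (simp add: powr_def exp_add[symmetric] distrib_left)
  have Dz: "frechet_derivative g (at z) \<zeta> = (1 / q) *s (msqrt b (U \<zeta>) - (r / q) *s msqrt b (U z))"
    unfolding moebius_form_frechet[OF M z] q_def r_def by (simp add: msqrt_diff msqrt_scale)
  show "g (z + t *s \<zeta>) = g z + (t / w) *s frechet_derivative g (at z) \<zeta>"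
  proof -
    have rw: "r * t = q * w - q" using q by (simp add: w_def r_def field_simps)
    have alg: "1 / (q * w) * (x + t * y) = 1 / q * x + t / w * (1 / q * (y - r / q * x))" for x y
    proof -
      have "1 / q * x + t / w * (1 / q * (y - r / q * x)) = (q * w * x + t * q * y - r * t * x) / (q * q * w)"
        using q w0 by (simp add: divide_simps) (simp add: algebra_simps)
      also have "\<dots> = 1 / (q * w) * (x + t * y)"
        unfolding rw using q w0 by (simp add: divide_simps) (simp add: algebra_simps)
      finally show ?thesis by simp
    qed
    show ?thesis
      unfolding D(4)[OF t] D(4)[OF z] Dz mob_def q_def[symmetric] Ut qw'
      by (simp only: vec_eq_iff vector_add_component vector_smult_component vector_minus_component
          msqrt_add msqrt_scale alg add.assoc simp_thms)
  qed
  show "frechet_derivative g (at (z + t *s \<zeta>)) \<zeta> = (1 / w\<^sup>2) *s frechet_derivative g (at z) \<zeta>"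
  proof -
    have rw: "r * t = q * w - q" using q by (simp add: w_def r_def field_simps)
    have alg: "1 / (q * w) * (y - 1 / (q * w) * r * (x + t * y)) = 1 / w\<^sup>2 * (1 / q * (y - r / q * x))" for x y
    proof -
      have "1 / (q * w) * (y - 1 / (q * w) * r * (x + t * y)) = (q * w * y - r * x - r * t * y) / (q * w)\<^sup>2"
        using q w0 by (simp add: divide_simps power2_eq_square) (simp add: algebra_simps)
      also have "\<dots> = 1 / w\<^sup>2 * (1 / q * (y - r / q * x))"
        unfolding rw using q w0 by (simp add: divide_simps power2_eq_square) (simp add: algebra_simps)
      finally show ?thesis .
    qed
    show ?thesis
      unfolding moebius_form_frechet[OF M t] Dz Ut qw' r_def[symmetric]
      by (simp only: vec_eq_iff vector_add_component vector_smult_component vector_minus_component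
          msqrt_add msqrt_scale msqrt_diff alg simp_thms)
  qed
qed

lemma moebius_line_exp:
  fixes g :: "complex^'d \<Rightarrow> complex^'d"
  assumes M: "moebius_form g b U L" and z: "z \<in> unit_ball" and t: "z + t *s \<zeta> \<in> unit_ball"
  defines "q \<equiv> 1 + hprod (U z) b"
  shows "exp (of_real (a / genus TYPE('d)) * L (z + t *s \<zeta>)) =
      exp (of_real (a / genus TYPE('d)) * L z) * (1 + hprod (U \<zeta>) b / q * t) powr (- of_real a)"
proof -
  obtain C where C: "\<And>z a. z \<in> unit_ball \<Longrightarrow> exp (of_real (a / genus TYPE('d)) * L z) =
      exp (of_real (a / genus TYPE('d)) * C) * (1 + hprod (U z) b) powr (- of_real a)"
    using log_branch_power[OF M] by (elim exE conjE) (rule that, blast)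
  note line = moebius_line[OF M z t, folded q_def]
  show ?thesis
    unfolding C[OF t] C[OF z] line(1) line(3) q_def[symmetric] by simp
qed

text \<open>The point \<open>z + \<zeta>\<close> is the value \<open>t = 1\<close> on the line
  through \<open>z\<close>. It is assumed in the ball so that \<open>g\<close> and \<open>L\<close>
  are under control there; the relation for all \<zeta> follows by polynomial extension.\<close>

lemma intertwining_pointwise:
  fixes \<Phi> :: "complex^'d \<Rightarrow> complex^'d \<Rightarrow> complex"
  assumes M: "moebius_form g b U L" and \<Phi>: "\<Phi> \<in> holo_maps (hom_polys l)" and l: "l \<le> n" and \<nu>: "0 < \<nu>"
    and z: "z \<in> unit_ball" and z\<zeta>: "z + \<zeta> \<in> unit_ball"
  shows "I_op \<nu> n l (alpha_inv \<nu> g L \<Phi>) z \<zeta> = exp (of_real ((\<nu> + real n) / genus TYPE('d)) * L z) *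
      exp (of_real (- real n / genus TYPE('d)) * L (z + \<zeta>)) * I_op \<nu> n l \<Phi> (g z) (g (z + \<zeta>) - g z)"
proof -
  note D = moebius_formD[OF M]
  define q where "q = 1 + hprod (U z) b"
  define \<gamma> where "\<gamma> = hprod (U \<zeta>) b / q"
  define v where "v = frechet_derivative g (at z) \<zeta>"
  \<comment> \<open>The part \<nu> comes from the Jacobian power and \<open>2 * l\<close> from
    homogeneity of degree \<open>l\<close>, because the derivative of \<open>g\<close> along the
    line carries the factor \<open>1 / w\<^sup>2\<close>.\<close>
  define \<mu> where "\<mu> = complex_of_real (2 * real l + \<nu>)"
  define f where "f s = \<Phi> (g z + s *s v) v" for s
  define T where "T = (\<lambda>t. z + t *s \<zeta>) -` unit_ball"
  define W where "W = (\<lambda>s. g z + s *s v) -` unit_ball"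
  define E where "E = exp (of_real (\<nu> / genus TYPE('d)) * L z)"
  define F where "F t = (1 + \<gamma> * t) powr (- \<mu>) * f (t / (1 + \<gamma> * t))" for t
  have q: "q \<noteq> 0" using D(8)[OF z] by (simp add: q_def)
  have oT: "open T" unfolding T_def by (rule open_vimage[OF unit_ball_open continuous_on_line])
  have oW: "open W" unfolding W_def by (rule open_vimage[OF unit_ball_open continuous_on_line])
  have 0: "0 \<in> T" and 1: "1 \<in> T" using z z\<zeta> by (auto simp: T_def)
  have fhol: "f holomorphic_on W"
    unfolding f_def by (rule holo_on_line[OF holo_mapsD(3)[OF \<Phi>]]) (simp add: W_def)
  have inT: "z + t *s \<zeta> \<in> unit_ball" if "t \<in> T" for t using that by (simp add: T_def)
  note line = moebius_line[OF M z inT, folded q_def, folded \<gamma>_def, folded v_def]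
  have w0: "1 + \<gamma> * t \<noteq> 0" if "t \<in> T" for t using line(2)[OF that] by auto
  have TW: "t / (1 + \<gamma> * t) \<in> W" if "t \<in> T" for t
    using D(7)[OF inT[OF that]] line(4)[OF that] by (simp add: W_def)
  note expL = moebius_line_exp[OF M z inT, folded q_def, folded \<gamma>_def]
  note \<alpha> = alpha_inv_holo_maps[OF M \<Phi>, of \<nu>]
  have alpha: "alpha_inv \<nu> g L \<Phi> (z + t *s \<zeta>) \<zeta> = E * F t" if t: "t \<in> T" for t
  proof -
    let ?w = "1 + \<gamma> * t"
    have "alpha_inv \<nu> g L \<Phi> (z + t *s \<zeta>) \<zeta> =
        E * ?w powr (- of_real \<nu>) * \<Phi> (g z + (t / ?w) *s v) ((1 / ?w\<^sup>2) *s v)"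
      using inT[OF t] expL[OF t, of \<nu>] line(4,5)[OF t] by (simp add: alpha_inv_def E_def)
    also have "\<dots> = E * (?w powr (- of_real \<nu>) * (1 / ?w\<^sup>2) ^ l) * f (t / ?w)"
      using hom_polys_homogeneous[OF holo_mapsD(1)[OF \<Phi>], of "g z + (t / ?w) *s v" "1 / ?w\<^sup>2" v] TW[OF t]
      by (simp add: f_def W_def)
    also have "?w powr (- of_real \<nu>) * (1 / ?w\<^sup>2) ^ l = ?w powr (- \<mu>)"
    proof -
      have "?w powr (of_nat (2 * l)) = (?w\<^sup>2) ^ l"
        using powr_nat[of ?w "2 * l"] w0[OF t] by (simp only: power_mult if_False)
      moreover have "- \<mu> = - of_real \<nu> - of_nat (2 * l)" by (simp add: \<mu>_def)
      ultimately show ?thesis using w0[OF t] by (simp only: powr_diff power_one_over) simp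
    qed
    finally show ?thesis by (simp add: F_def)
  qed
  have fj: "(deriv ^^ j) f 0 = zeta_d_pow j \<Phi> (g z) v" for j
    unfolding f_def[abs_def] using zeta_d_pow_line[OF \<Phi> D(7)[OF z]] by simp
  have Fhol: "F holomorphic_on T"
  proof -
    have "(\<lambda>t. f (t / (1 + \<gamma> * t))) holomorphic_on T"
      by (rule holomorphic_on_compose_gen[of _ T f W, unfolded o_def, OF _ fhol])
        (use TW w0 in \<open>auto intro!: holomorphic_intros\<close>)
    then show ?thesis unfolding F_def[abs_def] using line(2)
      by (intro holomorphic_intros) auto
  qed
  have dk: "zeta_d_pow k (alpha_inv \<nu> g L \<Phi>) z \<zeta> = E * (\<Sum>j\<le>k. bolcoeff \<mu> \<gamma> k j * zeta_d_pow j \<Phi> (g z) v)" for k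
  proof -
    have "zeta_d_pow k (alpha_inv \<nu> g L \<Phi>) z \<zeta> = (deriv ^^ k) (\<lambda>t. alpha_inv \<nu> g L \<Phi> (z + t *s \<zeta>) \<zeta>) 0"
      by (rule zeta_d_pow_line[OF \<alpha> z])
    also have "\<dots> = (deriv ^^ k) (\<lambda>t. E * F t) 0"
      by (rule funpow_deriv_cong[OF oT alpha 0])
    also have "\<dots> = E * (deriv ^^ k) F 0"
      by (rule higher_deriv_cmult[OF Fhol 0 oT])
    also have "(deriv ^^ k) F 0 = (\<Sum>j\<le>k. bolcoeff \<mu> \<gamma> k j * zeta_d_pow j \<Phi> (g z) v)"
      using bol_derivative[OF oT oW fhol line(2) TW F_def 0] by (simp add: fj)
    finally show ?thesis .
  qed
  have pn: "pochhammer \<mu> k = of_real (pochhammer (2 * real l + \<nu>) k)" for k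
    unfolding \<mu>_def by (rule pochhammer_of_real)
  have nz: "pochhammer \<mu> k \<noteq> 0" for k
    unfolding pn of_real_eq_0_iff using pochhammer_pos[of "2 * real l + \<nu>" k] \<nu> by simp
  have "I_op \<nu> n l (alpha_inv \<nu> g L \<Phi>) z \<zeta> = E * (\<Sum>k\<le>n - l. I_coeff \<nu> n l k *
      (\<Sum>j\<le>k. bolcoeff \<mu> \<gamma> k j * zeta_d_pow j \<Phi> (g z) v))"
    unfolding I_op_eq[OF z] dk by (simp add: sum_distrib_left mult_ac)
  also have "\<dots> = E * (\<Sum>j\<le>n - l. I_coeff \<nu> n l j * ((1 + \<gamma>) ^ (n - l - j) * zeta_d_pow j \<Phi> (g z) v))"
    using bol_sum_identity[OF nz, of "n - l" \<gamma> "\<lambda>j. zeta_d_pow j \<Phi> (g z) v"] by (simp add: I_coeff_def pn)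
  \<comment> \<open>\<open>(1 + \<gamma>) ^ (n - l - j)\<close> is \<open>(1 + \<gamma>) ^ n\<close>
    divided by \<open>(1 + \<gamma>) ^ (l + j)\<close>. The \<open>j\<close>-th derivative is
    homogeneous of degree \<open>l + j\<close> in its vector argument, so the quotient can be
    absorbed there, and the vector becomes \<open>g (z + \<zeta>) - g z\<close>.\<close>
  also have "\<dots> = E * (1 + \<gamma>) ^ n * (\<Sum>j\<le>n - l. I_coeff \<nu> n l j * zeta_d_pow j \<Phi> (g z) ((1 / (1 + \<gamma>)) *s v))"
  proof -
    have key: "(1 + \<gamma>) ^ n * (I_coeff \<nu> n l j * zeta_d_pow j \<Phi> (g z) ((1 / (1 + \<gamma>)) *s v)) =
        I_coeff \<nu> n l j * ((1 + \<gamma>) ^ (n - l - j) * zeta_d_pow j \<Phi> (g z) v)" if "j \<le> n - l" for j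
    proof -
      have "n = (n - l - j) + (l + j)" using that l by simp
      then have "(1 + \<gamma>) ^ n = (1 + \<gamma>) ^ (n - l - j) * (1 + \<gamma>) ^ (l + j)" by (metis power_add)
      then show ?thesis
        using hom_polys_homogeneous[OF zeta_d_pow_hom_polys[OF \<Phi> D(7)[OF z], of j]] w0[OF 1]
        by (simp add: power_one_over)
    qed
    show ?thesis unfolding mult.assoc sum_distrib_left[of "(1 + \<gamma>) ^ n"]
      by (intro arg_cong[where f = "\<lambda>x. E * x"] sum.cong refl key[symmetric]) simp
  qed
  also have "(\<Sum>j\<le>n - l. I_coeff \<nu> n l j * zeta_d_pow j \<Phi> (g z) ((1 / (1 + \<gamma>)) *s v)) =
      I_op \<nu> n l \<Phi> (g z) (g (z + \<zeta>) - g z)"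
    unfolding I_op_eq[OF D(7)[OF z]] using line(4)[OF 1] by simp
  also have "E * (1 + \<gamma>) ^ n = exp (of_real ((\<nu> + real n) / genus TYPE('d)) * L z) *
      exp (of_real (- real n / genus TYPE('d)) * L (z + \<zeta>))"
  proof -
    have "exp (of_real (- real n / genus TYPE('d)) * L (z + \<zeta>)) =
        exp (of_real (- real n / genus TYPE('d)) * L z) * (1 + \<gamma>) ^ n"
      using expL[OF 1, of "- real n"] powr_nat[of "1 + \<gamma>" n] w0[OF 1] by simp
    moreover have "exp (of_real ((\<nu> + real n) / genus TYPE('d)) * L z) * exp (of_real (- real n / genus TYPE('d)) * L z) = E"
      unfolding E_def exp_add[symmetric] by (simp add: add_divide_distrib distrib_right)
    ultimately show ?thesis by (metis mult.assoc)
  qed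
  finally show ?thesis .
qed

lemma intertwining_identity:
  fixes \<Phi> :: "complex^'d \<Rightarrow> complex^'d \<Rightarrow> complex"
  assumes M: "moebius_form g b U L" and \<Phi>: "\<Phi> \<in> holo_maps (hom_polys l)" and l: "l \<le> n" and \<nu>: "0 < \<nu>"
  shows "beta_inv \<nu> n g L (I_op \<nu> n l \<Phi>) = I_op \<nu> n l (alpha_inv \<nu> g L \<Phi>)"
proof
  fix z :: "complex^'d"
  show "beta_inv \<nu> n g L (I_op \<nu> n l \<Phi>) z = I_op \<nu> n l (alpha_inv \<nu> g L \<Phi>) z"
  proof (cases "z \<in> unit_ball")
    case True
    have "open {\<zeta>. z + \<zeta> \<in> unit_ball}"
      using open_vimage[OF unit_ball_open, of "\<lambda>\<zeta>. z + \<zeta>"] by (simp add: vimage_def continuous_intros)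
    moreover have "{\<zeta>. z + \<zeta> \<in> unit_ball} \<noteq> {}" using True by (auto intro: exI[of _ 0])
    moreover have "I_op \<nu> n l (alpha_inv \<nu> g L \<Phi>) z \<in> deg_polys n"
      by (rule holo_mapsD(1)[OF I_op_holo_maps[OF alpha_inv_holo_maps[OF M \<Phi>] l] True])
    ultimately have "poly_extension n {\<zeta>. z + \<zeta> \<in> unit_ball}
       (\<lambda>\<zeta>. exp (of_real ((\<nu> + real n) / genus TYPE('d)) * L z) *
             exp (of_real (- real n / genus TYPE('d)) * L (z + \<zeta>)) *
             I_op \<nu> n l \<Phi> (g z) (g (z + \<zeta>) - g z)) = I_op \<nu> n l (alpha_inv \<nu> g L \<Phi>) z"
      by (intro poly_extension_eqI intertwining_pointwise[OF M \<Phi> l \<nu> True]) simp_all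
    then show ?thesis unfolding beta_inv_def by (simp only: True if_True)
  qed (simp add: beta_inv_def I_op_outside)
qed

section \<open>Change of variables\<close>

text \<open>The library's change of variables theorem is stated for \<open>real^'n\<close> with a well-ordered
  index type, so every finite type is given a well-ordered copy.\<close>

typedef 'a wcopy = "UNIV :: 'a set" ..

instantiation wcopy :: (finite) wellorder
begin

definition less_eq_wcopy :: "'a wcopy \<Rightarrow> 'a wcopy \<Rightarrow> bool" where
  "less_eq_wcopy x y \<longleftrightarrow> to_nat (Rep_wcopy x) \<le> to_nat (Rep_wcopy y)"

definition less_wcopy :: "'a wcopy \<Rightarrow> 'a wcopy \<Rightarrow> bool" where
  "less_wcopy x y \<longleftrightarrow> to_nat (Rep_wcopy x) < to_nat (Rep_wcopy y)"

instance
proof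
  fix x y z :: "'a wcopy" and P :: "'a wcopy \<Rightarrow> bool"
  show "(x < y) = (x \<le> y \<and> \<not> y \<le> x)" by (auto simp: less_eq_wcopy_def less_wcopy_def)
  show "x \<le> x" "x \<le> y \<or> y \<le> x" by (auto simp: less_eq_wcopy_def)
  show "x \<le> y \<Longrightarrow> y \<le> z \<Longrightarrow> x \<le> z" by (simp add: less_eq_wcopy_def)
  show "x \<le> y \<Longrightarrow> y \<le> x \<Longrightarrow> x = y" by (simp add: less_eq_wcopy_def Rep_wcopy_inject)
  assume step: "\<And>x. (\<And>y. y < x \<Longrightarrow> P y) \<Longrightarrow> P x"
  show "P z"
  proof (induction z rule: measure_induct_rule[of "\<lambda>x. to_nat (Rep_wcopy x)"])
    case (less x)
    show ?case by (rule step, rule less) (simp only: less_wcopy_def)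
  qed
qed

end

lemma range_Abs_wcopy: "range Abs_wcopy = UNIV"
  by (metis (no_types) Rep_wcopy_inverse UNIV_I surj_def)

instance wcopy :: (finite) finite
  by standard (metis range_Abs_wcopy finite_class.finite_UNIV finite_imageI)

lemma card_wcopy: "CARD('a::finite wcopy) = CARD('a)"
  by (metis (full_types) Abs_wcopy_inject UNIV_I card_image inj_onI range_Abs_wcopy)

lemma wcopy_pair_cases: "\<exists>i c. k = Abs_wcopy (i, c)"
  by (metis Rep_wcopy_inverse surj_pair)

section \<open>Real coordinates\<close>

definition toR :: "complex^'d \<Rightarrow> real^(('d \<times> bool) wcopy)" where
  "toR z = (\<chi> k. case Rep_wcopy k of (i, c) \<Rightarrow> if c then Im (z $ i) else Re (z $ i))"

definition fromR :: "real^(('d::finite \<times> bool) wcopy) \<Rightarrow> complex^'d" where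
  "fromR x = (\<chi> i. Complex (x $ Abs_wcopy (i, False)) (x $ Abs_wcopy (i, True)))"

lemma fromR_toR [simp]: "fromR (toR z) = z"
  by (simp add: fromR_def toR_def vec_eq_iff Abs_wcopy_inverse)

lemma toR_fromR [simp]: "toR (fromR x) = x"
proof -
  have "toR (fromR x) $ k = x $ k" for k
  proof -
    obtain i c where "k = Abs_wcopy (i, c)" using wcopy_pair_cases[of k] by blast
    then show ?thesis by (cases c) (simp_all add: toR_def fromR_def Abs_wcopy_inverse)
  qed
  then show ?thesis by (simp add: vec_eq_iff)
qed

lemma linear_toR: "linear toR"
  by (rule linearI) (auto simp: toR_def vec_eq_iff split: prod.splits)

lemma linear_fromR: "linear fromR"
  by (rule linearI) (auto simp: fromR_def vec_eq_iff complex_eq_iff)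

lemma sum_wcopy: "(\<Sum>k\<in>UNIV. f k) = (\<Sum>p\<in>UNIV. f (Abs_wcopy p))" for f :: "'a::finite wcopy \<Rightarrow> 'b::comm_monoid_add"
  by (rule sum.reindex_bij_witness[of _ Abs_wcopy Rep_wcopy]) (auto simp: Abs_wcopy_inverse Rep_wcopy_inverse)

lemma inner_toR: "toR x \<bullet> toR y = x \<bullet> y"
proof -
  have "toR x \<bullet> toR y = (\<Sum>p\<in>UNIV \<times> UNIV. toR x $ Abs_wcopy p * toR y $ Abs_wcopy p)"
    by (simp add: inner_vec_def sum_wcopy)
  also have "\<dots> = (\<Sum>i\<in>UNIV. \<Sum>c\<in>UNIV. toR x $ Abs_wcopy (i, c) * toR y $ Abs_wcopy (i, c))"
    by (simp add: sum.cartesian_product)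
  also have "\<dots> = x \<bullet> y"
    by (simp add: UNIV_bool toR_def Abs_wcopy_inverse inner_vec_def inner_complex_def add.commute)
  finally show ?thesis .
qed

lemma norm_toR: "norm (toR x) = norm x"
  by (simp add: norm_eq_sqrt_inner inner_toR)

lemma toR_axis: "toR (axis i 1) = axis (Abs_wcopy (i, False)) 1" "toR (axis i \<i>) = axis (Abs_wcopy (i, True)) 1"
proof -
  have "toR (axis i 1) $ k = axis (Abs_wcopy (i, False)) 1 $ k \<and> toR (axis i \<i>) $ k = axis (Abs_wcopy (i, True)) 1 $ k" for k
    using wcopy_pair_cases[of k] by (auto simp: toR_def axis_def Abs_wcopy_inverse Abs_wcopy_inject)
  then show "toR (axis i 1) = axis (Abs_wcopy (i, False)) 1" "toR (axis i \<i>) = axis (Abs_wcopy (i, True)) 1"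
    by (simp_all add: vec_eq_iff)
qed

lemma bij_betw_toR_Basis: "bij_betw (toR :: complex^'d \<Rightarrow> _) Basis Basis"
proof (rule bij_betwI')
  show "(toR x = toR y) = (x = y)" for x y :: "complex^'d" by (metis fromR_toR)
  show "toR x \<in> Basis" if "x \<in> Basis" for x :: "complex^'d"
    using that by (auto simp: Basis_vec_def Basis_complex_def toR_axis)
  show "\<exists>x\<in>Basis. y = toR x" if y: "y \<in> Basis" for y :: "real^(('d \<times> bool) wcopy)"
  proof -
    obtain k where k: "y = axis k 1" using y by (auto simp: Basis_vec_def)
    obtain i c where "k = Abs_wcopy (i, c)" using wcopy_pair_cases[of k] by blast
    then have "y = toR (axis i (if c then \<i> else 1))" using k by (cases c) (simp_all add: toR_axis)
    moreover have "axis i (if c then \<i> else 1) \<in> (Basis :: (complex^'d) set)"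
      by (auto simp: Basis_vec_def Basis_complex_def)
    ultimately show ?thesis by blast
  qed
qed

lemma borel_measurable_fromR [measurable]: "fromR \<in> borel_measurable borel"
  using linear_fromR by (intro borel_measurable_continuous_onI linear_continuous_on) (simp add: linear_conv_bounded_linear)

lemma lborel_distr_fromR: "distr lborel borel fromR = (lborel :: (complex^'d) measure)"
proof (rule lborel_eqI[symmetric])
  fix l u :: "complex^'d"
  assume le: "\<And>b. b \<in> Basis \<Longrightarrow> l \<bullet> b \<le> u \<bullet> b"
  have surj: "toR ` Basis = (Basis :: (real^(('d \<times> bool) wcopy)) set)"
    using bij_betw_toR_Basis by (rule bij_betw_imp_surj_on)
  have inner: "fromR x \<bullet> b = x \<bullet> toR b" for x :: "real^(('d \<times> bool) wcopy)" and b
    by (metis inner_toR toR_fromR)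
  have "fromR -` box l u = box (toR l) (toR u)"
    unfolding box_def surj[symmetric] by (auto simp: inner inner_toR)
  then have "emeasure (distr lborel borel fromR) (box l u) = emeasure lborel (box (toR l) (toR u))"
    by (subst emeasure_distr) auto
  also have "\<dots> = ennreal (\<Prod>b\<in>Basis. (toR u - toR l) \<bullet> b)"
    using le by (subst emeasure_lborel_box) (auto simp: surj[symmetric] inner_toR)
  also have "(\<Prod>b\<in>Basis. (toR u - toR l) \<bullet> b) = (\<Prod>b\<in>Basis. (u - l) \<bullet> b)"
    using prod.reindex_bij_betw[OF bij_betw_toR_Basis, of "\<lambda>b. (toR u - toR l) \<bullet> b"]
    by (simp add: linear_diff[OF linear_toR, symmetric] inner_toR)
  finally show "emeasure (distr lborel borel fromR) (box l u) = ennreal (\<Prod>b\<in>Basis. (u - l) \<bullet> b)" .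
qed simp

section \<open>Real Jacobian determinants of automorphisms\<close>

definition real_det :: "(complex^'d \<Rightarrow> complex^'d) \<Rightarrow> real" where
  "real_det A = det (matrix (toR \<circ> A \<circ> fromR))"

lemma linear_conj: "linear A \<Longrightarrow> linear (toR \<circ> A \<circ> fromR)"
  by (intro linear_compose linear_toR linear_fromR)

lemma real_det_compose:
  assumes "linear A" "linear B"
  shows "real_det (A \<circ> B) = real_det A * real_det B"
proof -
  have "toR \<circ> (A \<circ> B) \<circ> fromR = (toR \<circ> A \<circ> fromR) \<circ> (toR \<circ> B \<circ> fromR)" by (auto simp: fun_eq_iff)
  then show ?thesis
    unfolding real_det_def using matrix_compose[OF linear_conj[OF assms(2)] linear_conj[OF assms(1)]]
    by (simp add: det_mul)
qed

lemma abs_real_det_isometry: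
  fixes U :: "complex^'d \<Rightarrow> complex^'d"
  assumes U: "cisometry U"
  shows "\<bar>real_det U\<bar> = 1"
proof -
  have lin: "linear U" using U clinear_imp_linear by (auto simp: cisometry_def)
  have norm_from: "norm (fromR x) = norm x" for x :: "real^(('d \<times> bool) wcopy)" by (metis norm_toR toR_fromR)
  have "orthogonal_transformation (toR \<circ> U \<circ> fromR)"
    unfolding orthogonal_transformation using linear_conj[OF lin] U
    by (simp add: norm_toR norm_from cisometry_def)
  then show ?thesis
    unfolding real_det_def by simp
qed

lemma det_rank_one_real:
  fixes \<beta> :: "real^'n"
  shows "det (matrix (\<lambda>x. x - (c * (x \<bullet> \<beta>)) *\<^sub>R \<beta>)) = 1 - c * (\<beta> \<bullet> \<beta>)"
proof -
  have ax: "axis j 1 \<bullet> \<beta> = \<beta> $ j" for j by (simp add: inner_axis')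
  have "matrix (\<lambda>x. x - (c * (x \<bullet> \<beta>)) *\<^sub>R \<beta>) = (\<chi> i. axis i 1 + (- c * \<beta> $ i) *s \<beta>)"
    by (simp add: matrix_def vec_eq_iff ax) (simp add: axis_def)
  then show ?thesis
    by (simp only: det_identity_plus_rank_one) (simp add: inner_vec_def sum_distrib_left sum_negf mult.assoc)
qed

text \<open>As a real operator \<open>msqrt b\<close> is the scalar \<open>s\<close> times two
  rank-one perturbations, along \<open>b\<close> and along \<open>\<i> *s b\<close>. Each
  perturbation has determinant \<open>s\<close>, which together with the scalar gives
  \<open>s ^ (2 * (d + 1))\<close>.\<close>

lemma real_det_msqrt:
  fixes b :: "complex^'d"
  assumes b: "b \<in> unit_ball"
  shows "real_det (msqrt b) = (1 - (norm b)\<^sup>2) ^ Suc CARD('d)"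
proof -
  define s where "s = defect b"
  define c where "c = 1 / (1 + s)"
  define \<beta> where "\<beta> = toR b"
  \<comment> \<open>The complex pairing with \<open>b\<close> has real part the inner product with
    \<open>b\<close> and imaginary part the inner product with \<open>\<i> *s b\<close>. These two
    vectors are orthogonal, so the two perturbations do not interact.\<close>
  define \<beta>' where "\<beta>' = toR (\<i> *s b)"
  have s: "0 < s" "s\<^sup>2 = 1 - (norm b)\<^sup>2" using defect_pos[OF b] defect_sq[OF b] by (simp_all add: s_def)
  have inner: "fromR x \<bullet> y = x \<bullet> toR y" for x :: "real^(('d \<times> bool) wcopy)" and y
    by (metis inner_toR toR_fromR)
  have ortho: "\<beta> \<bullet> \<beta>' = 0"
    unfolding \<beta>_def \<beta>'_def inner_toR Re_hprod[symmetric] hprod_scale_right by (simp add: hprod_self)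
  have n: "\<beta> \<bullet> \<beta> = (norm b)\<^sup>2" "\<beta>' \<bullet> \<beta>' = (norm b)\<^sup>2"
    unfolding \<beta>_def \<beta>'_def inner_toR by (simp_all add: power2_norm_eq_inner[symmetric])
  have "(toR \<circ> msqrt b \<circ> fromR) x = s *\<^sub>R ((x - (c * (x \<bullet> \<beta>)) *\<^sub>R \<beta>) - (c * ((x - (c * (x \<bullet> \<beta>)) *\<^sub>R \<beta>) \<bullet> \<beta>')) *\<^sub>R \<beta>')" for x
  proof -
    define z where "z = fromR x"
    have x: "x = toR z" by (simp add: z_def)
    have "hprod z b = of_real (z \<bullet> b) + \<i> * of_real (z \<bullet> (\<i> *s b))"
      unfolding Re_hprod[symmetric] hprod_scale_right by (simp add: complex_eq_iff)
    then have "msqrt b z = of_real s *s z - (of_real (s * c * (z \<bullet> b))) *s b - (of_real (s * c * (z \<bullet> (\<i> *s b)))) *s (\<i> *s b)"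
      unfolding msqrt_def s_def[symmetric] c_def by (simp add: vec_eq_iff algebra_simps add_divide_distrib)
    also have "\<dots> = s *\<^sub>R (z - (c * (z \<bullet> b)) *\<^sub>R b - (c * (z \<bullet> (\<i> *s b))) *\<^sub>R (\<i> *s b))"
      by (simp add: scaleR_smult vec_eq_iff algebra_simps)
    finally have "toR (msqrt b z) = s *\<^sub>R (toR z - (c * (z \<bullet> b)) *\<^sub>R \<beta> - (c * (z \<bullet> (\<i> *s b))) *\<^sub>R \<beta>')"
      by (simp add: \<beta>_def \<beta>'_def linear_diff[OF linear_toR] linear_scale[OF linear_toR])
    moreover have "z \<bullet> b = x \<bullet> \<beta>" "z \<bullet> (\<i> *s b) = (x - (c * (x \<bullet> \<beta>)) *\<^sub>R \<beta>) \<bullet> \<beta>'"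
      using ortho by (simp_all add: x \<beta>_def \<beta>'_def inner_toR inner_diff_left)
    ultimately show ?thesis by (simp add: x)
  qed
  then have "toR \<circ> msqrt b \<circ> fromR = (\<lambda>x. s *\<^sub>R x) \<circ> ((\<lambda>x. x - (c * (x \<bullet> \<beta>')) *\<^sub>R \<beta>') \<circ> (\<lambda>x. x - (c * (x \<bullet> \<beta>)) *\<^sub>R \<beta>))"
    by (auto simp: fun_eq_iff)
  moreover have lin: "linear (\<lambda>x. x - (c * (x \<bullet> \<beta>)) *\<^sub>R \<beta>)" for \<beta> :: "real^(('d \<times> bool) wcopy)"
    by (rule linearI) (auto simp: inner_add_left algebra_simps)
  moreover have lin2: "linear ((\<lambda>x. x - (c * (x \<bullet> \<beta>')) *\<^sub>R \<beta>') \<circ> (\<lambda>x. x - (c * (x \<bullet> \<beta>)) *\<^sub>R \<beta>))"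
    by (rule linear_compose[OF lin lin])
  moreover have "linear (\<lambda>x::real^(('d \<times> bool) wcopy). s *\<^sub>R x)" by (rule linear_scaleR)
  ultimately have "real_det (msqrt b) = det (matrix (\<lambda>x::real^(('d \<times> bool) wcopy). s *\<^sub>R x)) * ((1 - c * (\<beta>' \<bullet> \<beta>')) * (1 - c * (\<beta> \<bullet> \<beta>)))"
    unfolding real_det_def by (simp only: matrix_compose det_mul det_rank_one_real)
  also have "det (matrix (\<lambda>x::real^(('d \<times> bool) wcopy). s *\<^sub>R x)) = s ^ (2 * CARD('d))"
    by (simp add: det_matrix_scaleR card_wcopy mult.commute)
  finally have d: "real_det (msqrt b) = s ^ (2 * CARD('d)) * ((1 - c * (\<beta>' \<bullet> \<beta>')) * (1 - c * (\<beta> \<bullet> \<beta>)))" .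
  have cs: "1 - c * (norm b)\<^sup>2 = s"
  proof -
    have "(norm b)\<^sup>2 = (1 + s) * (1 - s)" using s by (simp add: algebra_simps power2_eq_square)
    then show ?thesis using s by (simp add: c_def)
  qed
  show ?thesis
    unfolding d n cs s(2)[symmetric] power_mult[symmetric] by (simp add: mult_ac)
qed

text \<open>Moving \<open>x\<close> and \<open>g x\<close> to the origin by Moebius maps turns
  \<open>g\<close> into an automorphism fixing 0, hence into a linear isometry \<open>V\<close>.
  Comparing derivatives at 0 gives the factorisation, which drives both the change of variables and
  the invariance of the norm.\<close>

lemma ball_aut_frechet_msqrt:
  assumes g: "ball_aut_pair g g'" and x: "x \<in> unit_ball"
  obtains V where "cisometry V" "frechet_derivative g (at x) \<circ> msqrt x = msqrt (g x) \<circ> V"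
proof -
  have gx: "g x \<in> unit_ball" using g x by (simp add: ball_aut_pair_def)
  let ?h = "\<lambda>z. mob (- g x) (g (mob x z))"
  have h: "ball_aut_pair ?h (\<lambda>z. mob (- x) (g' (mob (- (- g x)) z)))"
    using ball_aut_pair_compose[OF ball_aut_pair_mob[of "- g x"] ball_aut_pair_compose[OF g ball_aut_pair_mob[OF x]]] gx
    by simp
  have h0: "?h 0 = 0" using mob_mob_minus[OF gx zero_in_ball] by simp
  define V where "V = frechet_derivative ?h (at 0)"
  have V: "cisometry V" "\<And>z. z \<in> unit_ball \<Longrightarrow> ?h z = V z"
    using ball_aut_pair_fix0[OF h h0] by (simp_all add: V_def)
  have linV: "clinear V" using V(1) by (simp add: cisometry_def)
  have eq: "g (mob x z) = mob (g x) (V z)" if z: "z \<in> unit_ball" for z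
  proof -
    have "g (mob x z) \<in> unit_ball" using g mob_in_ball[OF x z] by (simp add: ball_aut_pair_def)
    then show ?thesis using mob_minus_mob[OF gx, of "g (mob x z)"] V(2)[OF z] by simp
  qed
  have dmob: "(mob b has_derivative msqrt b) (at 0)" if "b \<in> unit_ball" for b :: "complex^'a"
    using mob_has_derivative[OF that zero_in_ball] by simp
  have 1: "((\<lambda>z. g (mob x z)) has_derivative (\<lambda>v. frechet_derivative g (at x) (msqrt x v))) (at 0)"
    using has_derivative_compose[OF dmob[OF x], of g "frechet_derivative g (at x)"]
      holo_map_has_derivative(1)[of unit_ball g x] g x by (simp add: ball_aut_pair_def)
  have V0: "V 0 = 0" using clinear_scale[OF linV, of 0 0] by simp
  have "((\<lambda>z. mob (g x) (V z)) has_derivative (\<lambda>v. msqrt (g x) (V v))) (at 0)"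
    using has_derivative_compose[OF bounded_linear_imp_has_derivative[OF clinear_bounded_linear[OF linV]],
        of "mob (g x)" "msqrt (g x)" 0 UNIV] dmob[OF gx] by (simp add: V0)
  then have 2: "((\<lambda>z. g (mob x z)) has_derivative (\<lambda>v. msqrt (g x) (V v))) (at 0)"
    by (rule has_derivative_transform_within_open[OF _ unit_ball_open zero_in_ball]) (simp add: eq)
  have "frechet_derivative g (at x) \<circ> msqrt x = msqrt (g x) \<circ> V"
    using has_derivative_unique[OF 1 2] by (simp add: o_def)
  then show ?thesis using that V(1) by blast
qed

text \<open>Take determinants in the factorisation of \<open>ball_aut_frechet_msqrt\<close>; the
  isometry contributes modulus 1.\<close>

lemma abs_real_det_aut:
  fixes g :: "complex^'d \<Rightarrow> complex^'d"
  assumes g: "ball_aut_pair g g'" and x: "x \<in> unit_ball"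
  shows "\<bar>real_det (frechet_derivative g (at x))\<bar> = ((1 - (norm (g x))\<^sup>2) / (1 - (norm x)\<^sup>2)) ^ Suc CARD('d)"
proof -
  have gx: "g x \<in> unit_ball" using g x by (simp add: ball_aut_pair_def)
  obtain V where V: "cisometry V" "frechet_derivative g (at x) \<circ> msqrt x = msqrt (g x) \<circ> V"
    by (rule ball_aut_frechet_msqrt[OF g x])
  have "linear (frechet_derivative g (at x))"
    using holo_map_has_derivative(2)[of unit_ball g x] g x clinear_imp_linear by (auto simp: ball_aut_pair_def)
  moreover have "linear V" using V(1) clinear_imp_linear by (auto simp: cisometry_def)
  moreover have "linear (msqrt b)" for b :: "complex^'d" by (rule clinear_imp_linear[OF clinear_msqrt])
  ultimately have "real_det (frechet_derivative g (at x)) * real_det (msqrt x) = real_det (msqrt (g x)) * real_det V"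
    using V(2) by (metis real_det_compose)
  then have "\<bar>real_det (frechet_derivative g (at x))\<bar> * \<bar>real_det (msqrt x)\<bar> = \<bar>real_det (msqrt (g x))\<bar>"
    by (metis abs_mult abs_real_det_isometry[OF V(1)] mult.right_neutral)
  moreover have pos: "0 < 1 - (norm y)\<^sup>2" if "y \<in> unit_ball" for y :: "complex^'d"
    using that by (simp add: ball_iff abs_square_less_1)
  ultimately show ?thesis
    using pos[OF x] pos[OF gx] unfolding real_det_msqrt[OF x] real_det_msqrt[OF gx]
    by (simp add: power_divide field_simps)
qed

section \<open>Lebesgue measure and the invariant measure under automorphisms\<close>

lemma ennreal_lmeasure_borel:
  assumes "X \<in> sets borel" "X \<in> lmeasurable"
  shows "ennreal (measure lebesgue X) = emeasure lborel X"
proof -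
  have "emeasure lebesgue X = ennreal (measure lebesgue X)" by (rule emeasure_eq_measure2[OF assms(2)])
  moreover have "emeasure lebesgue X = emeasure lborel X"
    using assms(1) by simp
  ultimately show ?thesis by (simp only:)
qed

lemma emeasure_image_aut:
  fixes g :: "complex^'d \<Rightarrow> complex^'d"
  assumes g: "ball_aut_pair g g'" and A: "A \<in> sets borel" "A \<subseteq> unit_ball"
  defines "J \<equiv> \<lambda>x. ((1 - (norm (g x))\<^sup>2) / (1 - (norm x)\<^sup>2)) ^ Suc CARD('d)"
  shows "emeasure lborel A = (\<integral>\<^sup>+x. ennreal (J x) * indicator {x \<in> unit_ball. g x \<in> A} x \<partial>lborel)"
proof -
  let ?S = "{x \<in> unit_ball. g x \<in> A}"
  have gball: "\<And>x. x \<in> unit_ball \<Longrightarrow> g x \<in> unit_ball \<and> g' x \<in> unit_ball \<and> g' (g x) = x \<and> g (g' x) = x"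
    using g by (simp add: ball_aut_pair_def)
  have cont: "continuous_on unit_ball g"
    using g holo_map_has_derivative(1) by (meson ball_aut_pair_def continuous_at_imp_continuous_on has_derivative_continuous)
  have measg: "g \<in> borel_measurable (restrict_space borel unit_ball)"
    by (rule borel_measurable_continuous_on_restrict[OF cont])
  have S: "?S \<in> sets borel"
  proof -
    have "g -` A \<inter> space (restrict_space borel unit_ball) \<in> sets (restrict_space borel unit_ball)"
      by (rule measurable_sets[OF measg A(1)])
    then show ?thesis
      by (subst (asm) sets_restrict_space_iff) (auto simp: space_restrict_space vimage_def Int_def conj_commute)
  qed
  have gS: "g ` ?S = A" using gball A(2) by force
  let ?G = "toR \<circ> g \<circ> fromR"
  let ?D = "\<lambda>y. toR \<circ> frechet_derivative g (at (fromR y)) \<circ> fromR"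
  have fS: "fromR -` ?S \<in> sets borel"
    using measurable_sets[OF borel_measurable_fromR S] by simp
  have fA: "fromR -` A \<in> sets borel"
    using measurable_sets[OF borel_measurable_fromR A(1)] by simp
  have der: "(?G has_derivative ?D y) (at y within fromR -` ?S)" if "y \<in> fromR -` ?S" for y
  proof -
    have "fromR y \<in> unit_ball" using that by simp
    then have d: "(g has_derivative frechet_derivative g (at (fromR y))) (at (fromR y))"
      using g holo_map_has_derivative(1)[of unit_ball g "fromR y"] by (simp add: ball_aut_pair_def)
    have f: "(fromR has_derivative fromR) (at y)"
      using linear_fromR linear_conv_bounded_linear bounded_linear_imp_has_derivative by blast
    have t: "(toR has_derivative toR) (at (g (fromR y)))"
      using linear_toR linear_conv_bounded_linear bounded_linear_imp_has_derivative by blast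
    have "((\<lambda>y. toR (g (fromR y))) has_derivative (\<lambda>v. toR (frechet_derivative g (at (fromR y)) (fromR v)))) (at y)"
      by (rule has_derivative_compose[OF has_derivative_compose[OF f d] t])
    then show ?thesis by (simp add: o_def has_derivative_at_withinI)
  qed
  have inj: "inj_on ?G (fromR -` ?S)"
  proof (rule inj_onI)
    fix y y' assume *: "y \<in> fromR -` ?S" "y' \<in> fromR -` ?S" "?G y = ?G y'"
    then have "g (fromR y) = g (fromR y')" by (metis comp_apply fromR_toR)
    then have "fromR y = fromR y'" using * gball by (metis (mono_tags, lifting) mem_Collect_eq vimageE)
    then show "y = y'" by (metis toR_fromR)
  qed
  have image: "?G ` (fromR -` ?S) = fromR -` A"
  proof
    show "?G ` (fromR -` ?S) \<subseteq> fromR -` A" by auto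
    show "fromR -` A \<subseteq> ?G ` (fromR -` ?S)"
    proof
      fix y assume "y \<in> fromR -` A"
      then have "fromR y \<in> g ` ?S" using gS by simp
      then obtain x where "x \<in> ?S" "fromR y = g x" by blast
      then have "toR x \<in> fromR -` ?S" "y = ?G (toR x)" by (simp, metis comp_apply fromR_toR toR_fromR)
      then show "y \<in> ?G ` (fromR -` ?S)" by blast
    qed
  qed
  \<comment> \<open>Boundedness gives finite measure, so that the area of the image is a real number
    as the change of variables theorem expects.\<close>
  have bdd: "fromR -` A \<subseteq> ball 0 1"
  proof
    fix y assume "y \<in> fromR -` A"
    then have "norm (fromR y) < 1" using A(2) by (auto simp: ball_iff)
    then show "y \<in> ball 0 1" by (metis mem_ball_0 norm_toR toR_fromR)
  qed
  then have lmA: "fromR -` A \<in> lmeasurable"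
    by (intro bounded_set_imp_lmeasurable bounded_subset[OF bounded_ball bdd]) (use fA in auto)
  have "((\<lambda>y. \<bar>det (matrix (?D y))\<bar>) has_integral measure lebesgue (fromR -` A)) (fromR -` ?S)"
    using has_measure_differentiable_image[of "fromR -` ?S" ?G ?D "measure lebesgue (fromR -` A)", OF _ der inj] fS lmA
    by (simp only: image) simp
  then have "(\<integral>\<^sup>+y. ennreal \<bar>det (matrix (?D y))\<bar> * indicator (fromR -` ?S) y \<partial>lborel) = ennreal (measure lebesgue (fromR -` A))"
    by (intro nn_integral_has_integral_lebesgue') auto
  also have "\<dots> = emeasure lborel (fromR -` A)"
    by (rule ennreal_lmeasure_borel[OF fA lmA])
  also have "\<dots> = emeasure (distr lborel borel fromR) A"
    using A(1) by (subst emeasure_distr) auto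
  finally have "emeasure lborel A = (\<integral>\<^sup>+y. ennreal \<bar>det (matrix (?D y))\<bar> * indicator (fromR -` ?S) y \<partial>lborel)"
    unfolding lborel_distr_fromR by simp
  also have "\<dots> = (\<integral>\<^sup>+y. ennreal (J (fromR y)) * indicator ?S (fromR y) \<partial>lborel)"
    by (intro nn_integral_cong) (auto simp: indicator_def J_def abs_real_det_aut[OF g, unfolded real_det_def])
  also have "\<dots> = (\<integral>\<^sup>+x. ennreal (J x) * indicator ?S x \<partial>distr lborel borel fromR)"
  proof (rule nn_integral_distr[symmetric])
    have "continuous_on unit_ball J"
      unfolding J_def using cont by (intro continuous_intros) (auto simp: ball_iff abs_square_eq_1)
    then have "(\<lambda>x. indicator unit_ball x *\<^sub>R J x) \<in> borel_measurable borel"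
      by (intro borel_measurable_continuous_on_indicator) auto
    then have "(\<lambda>x. ennreal (indicator unit_ball x *\<^sub>R J x) * indicator ?S x) \<in> borel_measurable borel"
      using S by measurable
    moreover have "(\<lambda>x. ennreal (indicator unit_ball x *\<^sub>R J x) * indicator ?S x) = (\<lambda>x. ennreal (J x) * indicator ?S x)"
      by (auto simp: indicator_def fun_eq_iff)
    ultimately show "(\<lambda>x. ennreal (J x) * indicator ?S x) \<in> borel_measurable (distr lborel borel fromR)" by simp
  qed simp
  finally show ?thesis unfolding lborel_distr_fromR .
qed

abbreviation ball_lborel :: "(complex^'d) measure" where
  "ball_lborel \<equiv> restrict_space lborel unit_ball"

lemma space_ball_lborel [simp]: "space ball_lborel = unit_ball"
  by (simp add: space_restrict_space)

lemma sets_ball_lborel: "A \<in> sets ball_lborel \<longleftrightarrow> A \<in> sets borel \<and> A \<subseteq> unit_ball"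
  by (subst sets_restrict_space_iff) auto

lemma measurable_ball_lborel_cong: "borel_measurable ball_lborel = borel_measurable (restrict_space borel unit_ball)"
  by (rule measurable_cong_sets) (auto simp: sets_restrict_space)

lemma measurable_ball_continuous: "continuous_on unit_ball f \<Longrightarrow> f \<in> borel_measurable ball_lborel"
  unfolding measurable_ball_lborel_cong by (rule borel_measurable_continuous_on_restrict)

lemma ball_aut_continuous: "ball_aut_pair g g' \<Longrightarrow> continuous_on unit_ball g"
  using holo_map_has_derivative(1)
  by (meson ball_aut_pair_def continuous_at_imp_continuous_on has_derivative_continuous)

lemma ball_aut_measurable:
  assumes "ball_aut_pair g g'"
  shows "g \<in> measurable ball_lborel ball_lborel"
proof -
  have "g \<in> measurable ball_lborel (restrict_space borel unit_ball)"
    using assms measurable_ball_continuous[OF ball_aut_continuous[OF assms]]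
    by (intro measurable_restrict_space2) (auto simp: ball_aut_pair_def)
  then show ?thesis
    by (simp add: measurable_cong_sets[OF refl, of ball_lborel "restrict_space borel unit_ball"] sets_restrict_space)
qed

text \<open>The formula for measures of sets says that Lebesgue measure on the ball is the image
  under \<open>g\<close> of the measure with density \<open>J\<close>. The formula for integrands
  then follows from the rules for image measures and densities.\<close>

lemma nn_integral_aut:
  fixes g :: "complex^'d \<Rightarrow> complex^'d"
  assumes g: "ball_aut_pair g g'" and H: "H \<in> borel_measurable ball_lborel"
  defines "J \<equiv> \<lambda>x. ((1 - (norm (g x))\<^sup>2) / (1 - (norm x)\<^sup>2)) ^ Suc CARD('d)"
  shows "(\<integral>\<^sup>+x. H x \<partial>ball_lborel) = (\<integral>\<^sup>+x. ennreal (J x) * H (g x) \<partial>ball_lborel)"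
proof -
  have "continuous_on unit_ball J"
    unfolding J_def using ball_aut_continuous[OF g] by (intro continuous_intros) (auto simp: ball_iff abs_square_eq_1)
  then have J: "(\<lambda>x. ennreal (J x)) \<in> borel_measurable ball_lborel"
    by (intro measurable_compose[OF measurable_ball_continuous measurable_ennreal])
  note gm = ball_aut_measurable[OF g]
  have gm': "g \<in> measurable (density ball_lborel (\<lambda>x. ennreal (J x))) ball_lborel" using gm by simp
  have eq: "ball_lborel = distr (density ball_lborel (\<lambda>x. ennreal (J x))) ball_lborel g"
  proof (rule measure_eqI)
    fix A :: "(complex^'d) set" assume A: "A \<in> sets ball_lborel"
    then have A': "A \<in> sets borel" "A \<subseteq> unit_ball" by (auto simp: sets_ball_lborel)
    have S: "g -` A \<inter> unit_ball \<in> sets ball_lborel" using measurable_sets[OF gm A] by simp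
    have "emeasure (distr (density ball_lborel (\<lambda>x. ennreal (J x))) ball_lborel g) A =
        (\<integral>\<^sup>+x. ennreal (J x) * indicator (g -` A \<inter> unit_ball) x \<partial>ball_lborel)"
      using emeasure_distr[OF gm' A] emeasure_density[OF J S] by simp
    also have "\<dots> = (\<integral>\<^sup>+x. ennreal (J x) * indicator (g -` A \<inter> unit_ball) x * indicator unit_ball x \<partial>lborel)"
      by (rule nn_integral_restrict_space) simp
    also have "\<dots> = (\<integral>\<^sup>+x. ennreal (J x) * indicator {x \<in> unit_ball. g x \<in> A} x \<partial>lborel)"
      by (intro nn_integral_cong) (auto simp: indicator_def)
    also have "\<dots> = emeasure lborel A" unfolding J_def by (rule emeasure_image_aut[OF g A', symmetric])
    also have "\<dots> = emeasure ball_lborel A" using A' by (subst emeasure_restrict_space) auto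
    finally show "emeasure ball_lborel A = emeasure (distr (density ball_lborel (\<lambda>x. ennreal (J x))) ball_lborel g) A" by simp
  qed simp
  have Hg: "(\<lambda>x. H (g x)) \<in> borel_measurable ball_lborel" by (rule measurable_compose[OF gm H])
  have "(\<integral>\<^sup>+x. H x \<partial>ball_lborel) = (\<integral>\<^sup>+x. H x \<partial>distr (density ball_lborel (\<lambda>x. ennreal (J x))) ball_lborel g)"
    using eq by simp
  also have "\<dots> = (\<integral>\<^sup>+x. H (g x) \<partial>density ball_lborel (\<lambda>x. ennreal (J x)))"
    by (rule nn_integral_distr[OF gm']) (simp add: H)
  also have "\<dots> = (\<integral>\<^sup>+x. ennreal (J x) * H (g x) \<partial>ball_lborel)"
    by (rule nn_integral_density[OF J Hg])
  finally show ?thesis .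
qed

text \<open>The density of the invariant measure with a natural exponent, \<open>d + 1\<close> being
  the genus; this avoids real powers in the change of variables.\<close>

definition inv_weight :: "real \<Rightarrow> complex^'d \<Rightarrow> real" where
  "inv_weight c x = c / (1 - (norm x)\<^sup>2) ^ Suc CARD('d)"

lemma inv_weight_measurable: "(\<lambda>x. ennreal (inv_weight c x)) \<in> borel_measurable ball_lborel"
  unfolding inv_weight_def
  by (intro measurable_compose[OF measurable_ball_continuous measurable_ennreal] continuous_intros)
    (auto simp: ball_iff abs_square_eq_1)

lemma inv_weight_nonneg: "c > 0 \<Longrightarrow> x \<in> unit_ball \<Longrightarrow> 0 \<le> inv_weight c x"
  by (simp add: inv_weight_def ball_iff abs_square_le_1)

lemma inv_measure_eq:
  "inv_measure c = density (ball_lborel :: (complex^'d) measure) (\<lambda>x. ennreal (inv_weight c x))"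
  unfolding inv_measure_def
proof (rule density_cong)
  show "(\<lambda>x. ennreal (inv_weight c x)) \<in> borel_measurable (ball_lborel :: (complex^'d) measure)"
    by (rule inv_weight_measurable)
  have *: "ennreal (c * Re (Delta x x) powr - genus TYPE('d)) = ennreal (inv_weight c x)" if "x \<in> unit_ball" for x :: "complex^'d"
  proof -
    have pos: "0 < 1 - (norm x)\<^sup>2" using that by (simp add: ball_iff abs_square_less_1)
    have "genus TYPE('d) = real (Suc CARD('d))" by (simp add: genus_def)
    then have "(1 - (norm x)\<^sup>2) powr - genus TYPE('d) = inverse ((1 - (norm x)\<^sup>2) ^ Suc CARD('d))"
      by (simp only: powr_minus powr_realpow[OF pos])
    then show ?thesis by (simp add: Re_Delta inv_weight_def divide_inverse)
  qed
  then show "AE x in (ball_lborel :: (complex^'d) measure). ennreal (c * Re (Delta x x) powr - genus TYPE('d)) = ennreal (inv_weight c x)"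
    by (intro AE_I2) simp
  show "(\<lambda>x. ennreal (c * Re (Delta x x) powr - genus TYPE('d))) \<in> borel_measurable (ball_lborel :: (complex^'d) measure)"
    by (rule measurable_cong[THEN iffD2, OF _ inv_weight_measurable[of c]]) (simp only: space_ball_lborel *)
qed

lemma sets_inv_measure: "sets (inv_measure c) = sets ball_lborel" and
  space_inv_measure [simp]: "space (inv_measure c) = unit_ball"
  by (simp_all add: inv_measure_eq)

lemma measurable_inv_measure: "measurable (inv_measure c) N = measurable ball_lborel N"
  by (rule measurable_cong_sets) (simp_all add: sets_inv_measure)

lemma nn_integral_inv_measure:
  "f \<in> borel_measurable ball_lborel \<Longrightarrow>
    (\<integral>\<^sup>+x. f x \<partial>inv_measure c) = (\<integral>\<^sup>+x. ennreal (inv_weight c x) * f x \<partial>ball_lborel)"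
  unfolding inv_measure_eq by (rule nn_integral_density[OF inv_weight_measurable])

text \<open>The Jacobian is the quotient of the defects at \<open>g x\<close> and at
  \<open>x\<close> to the power \<open>d + 1\<close>, exactly the factor by which
  \<open>inv_weight\<close> changes.\<close>

lemma nn_integral_inv_measure_aut:
  fixes g :: "complex^'d \<Rightarrow> complex^'d"
  assumes g: "ball_aut_pair g g'" and H: "H \<in> borel_measurable ball_lborel" and c: "c > 0"
  shows "(\<integral>\<^sup>+x. H (g x) \<partial>inv_measure c) = (\<integral>\<^sup>+x. H x \<partial>inv_measure c)"
proof -
  have Hg: "(\<lambda>x. H (g x)) \<in> borel_measurable ball_lborel"
    by (rule measurable_compose[OF ball_aut_measurable[OF g] H])
  have w: "ennreal (inv_weight c x) = ennreal (((1 - (norm (g x))\<^sup>2) / (1 - (norm x)\<^sup>2)) ^ Suc CARD('d)) *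
      ennreal (inv_weight c (g x))" if x: "x \<in> unit_ball" for x
  proof -
    have gx: "g x \<in> unit_ball" using g x by (simp add: ball_aut_pair_def)
    have pos: "0 < 1 - (norm y)\<^sup>2" if "y \<in> unit_ball" for y :: "complex^'d"
      using that by (simp add: ball_iff abs_square_less_1)
    have "inv_weight c x = ((1 - (norm (g x))\<^sup>2) / (1 - (norm x)\<^sup>2)) ^ Suc CARD('d) * inv_weight c (g x)"
      using pos[OF x] pos[OF gx] unfolding inv_weight_def by (simp add: power_divide del: power_Suc)
    then show ?thesis
      using inv_weight_nonneg[OF c gx] pos[OF x] pos[OF gx] by (simp add: ennreal_mult del: power_Suc)
  qed
  have "(\<integral>\<^sup>+x. H x \<partial>inv_measure c) = (\<integral>\<^sup>+x. ennreal (inv_weight c x) * H x \<partial>ball_lborel)"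
    by (rule nn_integral_inv_measure[OF H])
  also have "\<dots> = (\<integral>\<^sup>+x. ennreal (((1 - (norm (g x))\<^sup>2) / (1 - (norm x)\<^sup>2)) ^ Suc CARD('d)) *
      (ennreal (inv_weight c (g x)) * H (g x)) \<partial>ball_lborel)"
    by (rule nn_integral_aut[OF g]) (use H inv_weight_measurable in measurable)
  also have "\<dots> = (\<integral>\<^sup>+x. ennreal (inv_weight c x) * H (g x) \<partial>ball_lborel)"
    by (rule nn_integral_cong) (simp add: w mult.assoc)
  also have "\<dots> = (\<integral>\<^sup>+x. H (g x) \<partial>inv_measure c)"
    by (rule nn_integral_inv_measure[OF Hg, symmetric])
  finally show ?thesis by simp
qed

text \<open>In real coordinates a unitary map is an orthogonal transformation, which preserves
  Lebesgue measure; boxes suffice to identify the image measure.\<close>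

lemma lborel_isometry:
  fixes V :: "complex^'d \<Rightarrow> complex^'d"
  assumes V: "cisometry V"
  shows "distr lborel borel V = lborel"
proof (rule lborel_eqI[symmetric])
  fix l u :: "complex^'d"
  assume le: "\<And>b. b \<in> Basis \<Longrightarrow> l \<bullet> b \<le> u \<bullet> b"
  have lin: "linear V" and bij: "bij V"
    using V clinear_imp_linear cisometry_surj by (auto simp: cisometry_def)
  have V': "V (inv V x) = x" "inv V (V x) = x" for x
    using bij by (simp_all add: bij_def surj_f_inv_f)
  have meas: "V \<in> borel_measurable borel"
    using lin by (intro borel_measurable_continuous_onI linear_continuous_on) (simp add: linear_conv_bounded_linear)
  \<comment> \<open>The inverse is transported because the preimage of a box under \<open>V\<close>
    has to be written as the image of a box.\<close>
  define T where "T = toR \<circ> inv V \<circ> fromR"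
  have norm_from: "norm (fromR x) = norm x" for x :: "real^(('d \<times> bool) wcopy)" by (metis norm_toR toR_fromR)
  have orth: "orthogonal_transformation T"
    unfolding orthogonal_transformation T_def using cisometry_inv[OF V] linear_conj[of "inv V"]
    by (auto simp: norm_toR norm_from cisometry_def intro: clinear_imp_linear)
  have trans: "emeasure lborel A = emeasure lborel (fromR -` A)" if "A \<in> sets borel" for A :: "(complex^'d) set"
    using emeasure_distr[OF _ that, of fromR lborel] unfolding lborel_distr_fromR by simp
  have lm: "fromR -` box l u \<in> lmeasurable"
  proof (rule bounded_set_imp_lmeasurable)
    have "fromR -` box l u = toR ` box l u"
      by (auto simp: image_iff) (metis toR_fromR)
    then show "bounded (fromR -` box l u)"
      using bounded_linear_image[OF bounded_box, of toR] linear_toR by (simp add: linear_conv_bounded_linear)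
    show "fromR -` box l u \<in> sets lebesgue"
      using measurable_sets[OF borel_measurable_fromR, of "box l u"] by simp
  qed
  have sets: "V -` box l u \<in> sets borel" using measurable_sets[OF meas, of "box l u"] by simp
  have im: "fromR -` (V -` box l u) = T ` (fromR -` box l u)"
  proof
    show "T ` (fromR -` box l u) \<subseteq> fromR -` (V -` box l u)" by (auto simp: T_def V')
    show "fromR -` (V -` box l u) \<subseteq> T ` (fromR -` box l u)"
    proof
      fix x assume "x \<in> fromR -` (V -` box l u)"
      then have "toR (V (fromR x)) \<in> fromR -` box l u" "x = T (toR (V (fromR x)))" by (simp_all add: T_def V')
      then show "x \<in> T ` (fromR -` box l u)" by blast
    qed
  qed
  have lmT: "T ` (fromR -` box l u) \<in> lmeasurable"
    by (rule measurable_orthogonal_image[OF orth lm])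
  have sT: "T ` (fromR -` box l u) \<in> sets borel"
    unfolding im[symmetric] using measurable_sets[OF borel_measurable_fromR sets] by simp
  have "emeasure (distr lborel borel V) (box l u) = emeasure lborel (V -` box l u)"
    using meas by (subst emeasure_distr) auto
  also have "\<dots> = emeasure lborel (T ` (fromR -` box l u))" unfolding trans[OF sets] im ..
  also have "\<dots> = ennreal (measure lebesgue (T ` (fromR -` box l u)))"
    by (rule ennreal_lmeasure_borel[OF sT lmT, symmetric])
  also have "\<dots> = ennreal (measure lebesgue (fromR -` box l u))"
    by (simp add: measure_orthogonal_image[OF orth lm])
  also have "\<dots> = emeasure lborel (fromR -` box l u)"
    by (rule ennreal_lmeasure_borel[OF _ lm]) (use measurable_sets[OF borel_measurable_fromR, of "box l u"] in simp)
  also have "\<dots> = emeasure lborel (box l u)" by (rule trans[symmetric]) simp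
  also have "\<dots> = ennreal (\<Prod>b\<in>Basis. (u - l) \<bullet> b)" using le by (rule emeasure_lborel_box)
  finally show "emeasure (distr lborel borel V) (box l u) = ennreal (\<Prod>b\<in>Basis. (u - l) \<bullet> b)" .
qed simp

section \<open>The Fischer inner product\<close>

definition gauss :: "complex^'d \<Rightarrow> real" where
  "gauss \<omega> = pi powr (- real CARD('d)) * exp (- (norm \<omega>)\<^sup>2)"

lemma fischer_eq: "fischer \<phi> \<psi> = (LINT \<omega>|lborel. of_real (gauss \<omega>) * cnj (\<phi> \<omega>) * \<psi> \<omega>)"
  by (simp add: fischer_def gauss_def hprod_self)

lemma gauss_pos: "0 < gauss \<omega>"
  by (simp add: gauss_def)

lemma nn_integral_exp_abs_finite: "(\<integral>\<^sup>+x. ennreal (exp (- \<bar>x\<bar>)) \<partial>lborel) < \<infinity>"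
proof -
  have half: "(\<integral>\<^sup>+x. ennreal (exp (- x)) * indicator {0..} x \<partial>lborel) = ennreal 1"
    using nn_integral_has_integral_lebesgue'[OF _ has_integral_exp_minus_to_infinity[of 1 0]] by simp
  have half': "(\<integral>\<^sup>+x. ennreal (exp x) * indicator {0..} (- x) \<partial>lborel) = ennreal 1"
    using half nn_integral_real_affine[of "\<lambda>x. ennreal (exp (- x)) * indicator {0..} x" "-1" 0] by simp
  have "(\<integral>\<^sup>+x. ennreal (exp (- \<bar>x\<bar>)) \<partial>lborel) \<le>
      (\<integral>\<^sup>+x. ennreal (exp (- x)) * indicator {0..} x + ennreal (exp x) * indicator {0..} (- x) \<partial>lborel)"
    by (intro nn_integral_mono) (auto simp: indicator_def abs_if)
  also have "\<dots> = ennreal 1 + ennreal 1"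
    by (subst nn_integral_add) (simp_all add: half half')
  also have "\<dots> < \<infinity>" by simp
  finally show ?thesis .
qed

text \<open>The Gaussian beats every exponential of the norm. Trading it for the exponential of
  minus the sum of the absolute real coordinates gives a product of one-variable integrable
  functions as a majorant.\<close>

lemma gauss_integrable:
  fixes h :: "complex^'d \<Rightarrow> complex"
  assumes meas: "h \<in> borel_measurable borel" and bound: "\<And>\<omega>. cmod (h \<omega>) \<le> exp (k * norm \<omega>)"
  shows "integrable lborel (\<lambda>\<omega>. of_real (gauss \<omega>) * h \<omega>)"
proof (rule integrableI_bounded)
  have "continuous_on UNIV (gauss :: complex^'d \<Rightarrow> real)"
    unfolding gauss_def by (intro continuous_intros)
  then have "(gauss :: complex^'d \<Rightarrow> real) \<in> borel_measurable borel" by (rule borel_measurable_continuous_onI)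
  then show "(\<lambda>\<omega>. of_real (gauss \<omega>) * h \<omega>) \<in> borel_measurable lborel" using meas by measurable
  define N where "N = real (DIM(complex^'d))"
  define C where "C = pi powr (- real CARD('d)) * exp ((k + N)\<^sup>2 / 4)"
  have C: "0 \<le> C" by (simp add: C_def)
  have le: "norm (of_real (gauss \<omega>) * h \<omega>) \<le> C * (\<Prod>b\<in>Basis. exp (- \<bar>\<omega> \<bullet> b\<bar>))" for \<omega> :: "complex^'d"
  proof -
    have sum: "(\<Sum>b\<in>Basis. \<bar>\<omega> \<bullet> b\<bar>) \<le> N * norm \<omega>"
      unfolding N_def by (rule order.trans[OF sum_bounded_above[of _ _ "norm \<omega>"]]) (auto intro: Basis_le_norm)
    have "norm (of_real (gauss \<omega>) * h \<omega>) \<le> gauss \<omega> * exp (k * norm \<omega>)"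
      using bound[of \<omega>] gauss_pos[of \<omega>] by (simp add: norm_mult mult_left_mono)
    also have "\<dots> = pi powr (- real CARD('d)) * exp (k * norm \<omega> - (norm \<omega>)\<^sup>2)"
      by (simp add: gauss_def exp_diff exp_minus field_simps)
    also have "\<dots> \<le> pi powr (- real CARD('d)) * exp ((k + N)\<^sup>2 / 4 - N * norm \<omega>)"
    proof -
      \<comment> \<open>Completing the square bounds the exponent by a constant minus
        \<open>N * norm \<omega>\<close>, and \<open>N * norm \<omega>\<close> dominates the sum of
        the \<open>N\<close> absolute coordinates.\<close>
      have "0 \<le> (norm \<omega> - (k + N) / 2)\<^sup>2" by simp
      then have "k * norm \<omega> - (norm \<omega>)\<^sup>2 \<le> (k + N)\<^sup>2 / 4 - N * norm \<omega>"
        by (simp add: power2_eq_square field_simps)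
      then show ?thesis by (intro mult_left_mono) auto
    qed
    also have "\<dots> \<le> pi powr (- real CARD('d)) * exp ((k + N)\<^sup>2 / 4 - (\<Sum>b\<in>Basis. \<bar>\<omega> \<bullet> b\<bar>))"
      using sum by (intro mult_left_mono) auto
    also have "\<dots> = C * (\<Prod>b\<in>Basis. exp (- \<bar>\<omega> \<bullet> b\<bar>))"
      using exp_sum[OF finite_Basis, of "\<lambda>b. - \<bar>\<omega> \<bullet> b\<bar>"]
      by (simp only: C_def exp_diff sum_negf exp_minus[of "sum _ _"] divide_inverse mult.assoc)
    finally show ?thesis .
  qed
  have "(\<integral>\<^sup>+\<omega>. ennreal (norm (of_real (gauss \<omega>) * h \<omega>)) \<partial>lborel) \<le>
      (\<integral>\<^sup>+\<omega>. ennreal C * (\<Prod>b\<in>Basis. ennreal (exp (- \<bar>\<omega> \<bullet> b\<bar>))) \<partial>(lborel :: (complex^'d) measure))"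
  proof (rule nn_integral_mono)
    fix \<omega> :: "complex^'d"
    have "ennreal C * (\<Prod>b\<in>Basis. ennreal (exp (- \<bar>\<omega> \<bullet> b\<bar>))) = ennreal (C * (\<Prod>b\<in>Basis. exp (- \<bar>\<omega> \<bullet> b\<bar>)))"
      using C by (simp add: prod_ennreal ennreal_mult prod_nonneg)
    then show "ennreal (norm (of_real (gauss \<omega>) * h \<omega>)) \<le> ennreal C * (\<Prod>b\<in>Basis. ennreal (exp (- \<bar>\<omega> \<bullet> b\<bar>)))"
      using le[of \<omega>] by (simp only: ennreal_leI)
  qed
  also have "\<dots> = ennreal C * (\<integral>\<^sup>+\<omega>. (\<Prod>b\<in>Basis. ennreal (exp (- \<bar>\<omega> \<bullet> b\<bar>))) \<partial>(lborel :: (complex^'d) measure))"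
    by (rule nn_integral_cmult) measurable
  also have "(\<integral>\<^sup>+\<omega>. (\<Prod>b\<in>Basis. ennreal (exp (- \<bar>\<omega> \<bullet> b\<bar>))) \<partial>(lborel :: (complex^'d) measure)) =
      (\<Prod>b\<in>(Basis :: (complex^'d) set). (\<integral>\<^sup>+x. ennreal (exp (- \<bar>x\<bar>)) \<partial>lborel))"
    by (rule nn_integral_lborel_prod) auto
  also have "ennreal C * \<dots> < \<infinity>"
    using nn_integral_exp_abs_finite by (simp add: ennreal_mult_less_top power_less_top_ennreal)
  finally show "(\<integral>\<^sup>+\<omega>. ennreal (norm (of_real (gauss \<omega>) * h \<omega>)) \<partial>lborel) < \<infinity>" .
qed

lemma norm_zmonom_le: "cmod (zmonom m \<zeta>) \<le> norm \<zeta> ^ (\<Sum>i\<in>UNIV. m i)"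
  unfolding zmonom_def power_sum prod_norm[symmetric]
  by (intro prod_mono) (auto simp: norm_power intro!: power_mono Finite_Cartesian_Product.norm_nth_le)

lemma continuous_zmonom: "continuous_on S f \<Longrightarrow> continuous_on S (\<lambda>x. zmonom m (f x))"
  unfolding zmonom_def by (intro continuous_intros)

lemma zmonom_gauss_integrable:
  "integrable lborel (\<lambda>\<omega>. of_real (gauss \<omega>) * cnj (zmonom m \<omega>) * zmonom m' (\<omega> :: complex^'d))"
proof -
  define k where "k = (\<Sum>i\<in>UNIV. m i) + (\<Sum>i\<in>UNIV. m' i)"
  have "integrable lborel (\<lambda>\<omega>. of_real (gauss \<omega>) * (cnj (zmonom m \<omega>) * zmonom m' (\<omega> :: complex^'d)))"
  proof (rule gauss_integrable)
    show "(\<lambda>\<omega>. cnj (zmonom m \<omega>) * zmonom m' (\<omega> :: complex^'d)) \<in> borel_measurable borel"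
      by (intro borel_measurable_continuous_onI continuous_intros continuous_zmonom)
    fix \<omega> :: "complex^'d"
    have "norm \<omega> \<le> exp (norm \<omega>)" using exp_ge_add_one_self[of "norm \<omega>"] by linarith
    then have "norm \<omega> ^ k \<le> exp (norm \<omega>) ^ k" by (intro power_mono) auto
    then have *: "norm \<omega> ^ k \<le> exp (real k * norm \<omega>)" by (simp add: exp_of_nat_mult)
    have "cmod (cnj (zmonom m \<omega>) * zmonom m' \<omega>) \<le> norm \<omega> ^ (\<Sum>i\<in>UNIV. m i) * norm \<omega> ^ (\<Sum>i\<in>UNIV. m' i)"
      unfolding norm_mult complex_mod_cnj by (intro mult_mono norm_zmonom_le) auto
    then show "cmod (cnj (zmonom m \<omega>) * zmonom m' \<omega>) \<le> exp (real k * norm \<omega>)"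
      using * by (simp add: k_def power_add)
  qed
  then show ?thesis by (simp add: mult.assoc)
qed

lemma fischer_isometry:
  fixes V :: "complex^'d \<Rightarrow> complex^'d"
  assumes V: "cisometry V" and meas: "\<phi> \<in> borel_measurable borel" "\<psi> \<in> borel_measurable borel"
  shows "fischer (\<lambda>\<zeta>. \<phi> (V \<zeta>)) (\<lambda>\<zeta>. \<psi> (V \<zeta>)) = fischer \<phi> \<psi>"
proof -
  have "linear V" using V clinear_imp_linear by (auto simp: cisometry_def)
  then have mV: "V \<in> borel_measurable borel"
    by (intro borel_measurable_continuous_onI linear_continuous_on) (simp add: linear_conv_bounded_linear)
  have "continuous_on UNIV (gauss :: complex^'d \<Rightarrow> real)"
    unfolding gauss_def by (intro continuous_intros)
  then have mg: "(gauss :: complex^'d \<Rightarrow> real) \<in> borel_measurable borel" by (rule borel_measurable_continuous_onI)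
  have g: "gauss (V \<omega>) = gauss \<omega>" for \<omega> using V by (simp add: gauss_def cisometry_def)
  have "fischer \<phi> \<psi> = (LINT \<omega>|distr lborel borel V. of_real (gauss \<omega>) * cnj (\<phi> \<omega>) * \<psi> \<omega>)"
    unfolding lborel_isometry[OF V] fischer_eq ..
  also have "\<dots> = (LINT \<omega>|lborel. of_real (gauss (V \<omega>)) * cnj (\<phi> (V \<omega>)) * \<psi> (V \<omega>))"
  proof (rule integral_distr)
    have "(\<lambda>\<omega>. cnj (\<phi> \<omega>)) \<in> borel_measurable borel"
      by (rule measurable_compose[OF meas(1) borel_measurable_continuous_onI]) (intro continuous_intros)
    then show "(\<lambda>\<omega>. of_real (gauss \<omega>) * cnj (\<phi> \<omega>) * \<psi> \<omega>) \<in> borel_measurable borel"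
      using meas(2) mg by measurable
  qed (use mV in simp)
  finally show ?thesis by (simp add: fischer_eq g)
qed

lemma borel_measurable_hom_poly: "\<phi> \<in> hom_polys l \<Longrightarrow> \<phi> \<in> borel_measurable borel"
  unfolding hom_polys_def mpolys_iff
  by (auto intro!: borel_measurable_continuous_onI continuous_intros continuous_zmonom)

text \<open>Rotate one coordinate in which the exponents differ. The angle \<theta> is chosen so
  that the integrand acquires the factor \<open>-1\<close>; invariance under the rotation then
  forces the integral to vanish.\<close>

lemma fischer_zmonom_orthogonal:
  fixes m m' :: "'d::finite \<Rightarrow> nat"
  assumes "m \<noteq> m'"
  shows "fischer (zmonom m) (zmonom m' :: complex^'d \<Rightarrow> complex) = 0"
proof -
  obtain i where i: "m i \<noteq> m' i" using assms by auto
  define \<theta> where "\<theta> = pi / (real (m' i) - real (m i))"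
  define V :: "complex^'d \<Rightarrow> complex^'d" where "V \<zeta> = (\<chi> j. (if j = i then cis \<theta> else 1) * \<zeta> $ j)" for \<zeta>
  have "clinear V" by (rule clinearI) (auto simp: V_def vec_eq_iff algebra_simps)
  moreover have "norm (V \<zeta>) = norm \<zeta>" for \<zeta>
    unfolding norm_vec_def L2_set_def
    by (intro arg_cong[where f = sqrt] sum.cong) (auto simp: V_def norm_mult)
  ultimately have V: "cisometry V" by (simp add: cisometry_def)
  have mV: "zmonom k (V \<zeta>) = cis \<theta> ^ k i * zmonom k \<zeta>" for k \<zeta>
  proof -
    have "(\<Prod>j\<in>UNIV. (if j = i then cis \<theta> else 1) ^ k j) = (\<Prod>j\<in>UNIV. if j = i then cis \<theta> ^ k i else 1)"
      by (intro prod.cong) auto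
    then show ?thesis by (simp add: zmonom_def V_def power_mult_distrib prod.distrib)
  qed
  have c: "cnj (cis \<theta> ^ m i) * cis \<theta> ^ m' i = -1"
  proof -
    have "(real (m' i) - real (m i)) * \<theta> = pi" using i by (simp add: \<theta>_def)
    then have "cis (- (real (m i) * \<theta>) + real (m' i) * \<theta>) = -1"
      by (simp add: left_diff_distrib)
    then show ?thesis by (simp add: Complex.DeMoivre cis_cnj cis_mult)
  qed
  have "fischer (zmonom m) (zmonom m' :: complex^'d \<Rightarrow> complex) = fischer (\<lambda>\<zeta>. zmonom m (V \<zeta>)) (\<lambda>\<zeta>. zmonom m' (V \<zeta>))"
    by (rule fischer_isometry[OF V, symmetric])
      (intro borel_measurable_continuous_onI continuous_zmonom continuous_intros)+
  also have "\<dots> = (LINT \<omega>|lborel. (cnj (cis \<theta> ^ m i) * cis \<theta> ^ m' i) *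
      (of_real (gauss \<omega>) * cnj (zmonom m \<omega>) * zmonom m' (\<omega> :: complex^'d)))"
    unfolding fischer_eq mV by (simp add: mult_ac)
  also have "\<dots> = - fischer (zmonom m) (zmonom m' :: complex^'d \<Rightarrow> complex)"
    unfolding c fischer_eq by simp
  finally show ?thesis by simp
qed

text \<open>The squared Fischer norm of a monomial, classically the product of the factorials of the
  exponents.\<close>

definition fnorm :: "('d::finite \<Rightarrow> nat) \<Rightarrow> real" where
  "fnorm m = (LINT \<omega>|lborel. gauss \<omega> * (cmod (zmonom m (\<omega> :: complex^'d)))\<^sup>2)"

lemma fischer_zmonom_self: "fischer (zmonom m) (zmonom m :: complex^'d \<Rightarrow> complex) = of_real (fnorm m)"
proof -
  have "of_real (gauss \<omega>) * cnj (zmonom m \<omega>) * zmonom m \<omega> = complex_of_real (gauss \<omega> * (cmod (zmonom m \<omega>))\<^sup>2)"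
    for \<omega> :: "complex^'d"
    using complex_norm_square[of "zmonom m \<omega>"] by (simp add: mult_ac)
  then show ?thesis unfolding fischer_eq fnorm_def by (simp del: of_real_mult)
qed

lemma fnorm_pos: "0 < fnorm (m :: 'd::finite \<Rightarrow> nat)"
proof -
  have int: "integrable lborel (\<lambda>\<omega>. gauss \<omega> * (cmod (zmonom m (\<omega> :: complex^'d)))\<^sup>2)"
  proof -
    have "norm (of_real (gauss \<omega>) * cnj (zmonom m \<omega>) * zmonom m \<omega>) = gauss \<omega> * (cmod (zmonom m \<omega>))\<^sup>2"
      for \<omega> :: "complex^'d"
      using gauss_pos[of \<omega>] by (simp add: norm_mult power2_eq_square)
    then show ?thesis using integrable_norm[OF zmonom_gauss_integrable[of m m]] by simp
  qed
  have nn: "0 \<le> gauss \<omega> * (cmod (zmonom m (\<omega> :: complex^'d)))\<^sup>2" for \<omega>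
    using gauss_pos[of \<omega>] by simp
  have "fnorm m \<noteq> 0"
  proof
    assume "fnorm m = 0"
    then have "AE \<omega> in lborel. gauss \<omega> * (cmod (zmonom m (\<omega> :: complex^'d)))\<^sup>2 = 0"
      unfolding fnorm_def using integral_nonneg_eq_0_iff_AE[OF int] nn by simp
    then have "AE \<omega> in lborel. zmonom m (\<omega> :: complex^'d) = 0"
      by (rule AE_mp) (use gauss_pos in \<open>auto intro!: AE_I2 simp: less_le\<close>)
    \<comment> \<open>A vanishing integral would make the set where the monomial is nonzero a null
      set, but this set is open and contains the vector with all coordinates 1.\<close>
    moreover have op: "open {\<omega> :: complex^'d. zmonom m \<omega> \<noteq> 0}"
      by (intro open_Collect_neq continuous_zmonom continuous_intros)
    ultimately have null: "{\<omega> :: complex^'d. zmonom m \<omega> \<noteq> 0} \<in> null_sets lborel"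
      using AE_iff_null[of lborel "\<lambda>\<omega> :: complex^'d. zmonom m \<omega> = 0"] borel_open[OF op] by simp
    note op
    moreover have "(\<chi> i. 1) \<in> {\<omega> :: complex^'d. zmonom m \<omega> \<noteq> 0}" by (simp add: zmonom_def)
    ultimately show False using null open_not_negligible null_sets_completionI[OF null] negligible_iff_null_sets by blast
  qed
  moreover have "0 \<le> fnorm m" unfolding fnorm_def using nn by (intro integral_nonneg_AE) auto
  ultimately show ?thesis by simp
qed

lemma fischer_expand:
  fixes a b :: "('d::finite \<Rightarrow> nat) \<Rightarrow> complex"
  assumes "finite M"
  shows "fischer (\<lambda>\<zeta> :: complex^'d. \<Sum>m\<in>M. a m * zmonom m \<zeta>) (\<lambda>\<zeta>. \<Sum>m\<in>M. b m * zmonom m \<zeta>) =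
    (\<Sum>m\<in>M. cnj (a m) * b m * of_real (fnorm m))"
proof -
  have "fischer (\<lambda>\<zeta> :: complex^'d. \<Sum>m\<in>M. a m * zmonom m \<zeta>) (\<lambda>\<zeta>. \<Sum>m\<in>M. b m * zmonom m \<zeta>) =
      (LINT \<omega>|lborel. (\<Sum>m\<in>M. \<Sum>m'\<in>M. (cnj (a m) * b m') * (of_real (gauss \<omega>) * cnj (zmonom m \<omega>) * zmonom m' (\<omega> :: complex^'d))))"
    unfolding fischer_eq by (intro Bochner_Integration.integral_cong refl)
      (simp add: sum_product sum_distrib_left mult_ac)
  also have "\<dots> = (\<Sum>m\<in>M. \<Sum>m'\<in>M. (cnj (a m) * b m') * fischer (zmonom m) (zmonom m' :: complex^'d \<Rightarrow> complex))"
    unfolding fischer_eq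
    by (subst Bochner_Integration.integral_sum, intro Bochner_Integration.integrable_sum integrable_mult_right zmonom_gauss_integrable)
      (intro sum.cong refl, subst Bochner_Integration.integral_sum,
        auto intro!: integrable_mult_right zmonom_gauss_integrable)
  also have "\<dots> = (\<Sum>m\<in>M. cnj (a m) * b m * of_real (fnorm m))"
  proof (rule sum.cong[OF refl])
    fix m assume m: "m \<in> M"
    have "(\<Sum>m'\<in>M. (cnj (a m) * b m') * fischer (zmonom m) (zmonom m' :: complex^'d \<Rightarrow> complex)) =
        (\<Sum>m'\<in>M. if m = m' then cnj (a m) * b m' * of_real (fnorm m) else 0)"
      by (intro sum.cong refl) (auto simp: fischer_zmonom_self fischer_zmonom_orthogonal)
    then show "(\<Sum>m'\<in>M. (cnj (a m) * b m') * fischer (zmonom m) (zmonom m' :: complex^'d \<Rightarrow> complex)) =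
        cnj (a m) * b m * of_real (fnorm m)"
      using m assms by simp
  qed
  finally show ?thesis .
qed

text \<open>The squared Fischer norm on homogeneous polynomials as a finite sum over coefficients,
  so that nonnegativity, continuity in parameters and estimates need no further Gaussian
  integrals.\<close>

definition hnorm :: "nat \<Rightarrow> (complex^'d \<Rightarrow> complex) \<Rightarrow> real" where
  "hnorm l \<phi> = (\<Sum>m | (\<Sum>i\<in>UNIV. m i) = l. (cmod (pcoeff (Suc l) m \<phi>))\<^sup>2 * fnorm m)"

lemma fischer_self:
  assumes "\<phi> \<in> hom_polys l"
  shows "fischer \<phi> \<phi> = of_real (hnorm l \<phi>)"
proof -
  let ?M = "{m. (\<Sum>i\<in>UNIV. m i) = l}"
  have \<phi>: "\<phi> = (\<lambda>\<zeta>. \<Sum>m\<in>?M. pcoeff (Suc l) m \<phi> * zmonom m \<zeta>)"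
    by (rule ext) (rule hom_polys_expansion[OF assms])
  have "fischer \<phi> \<phi> = (\<Sum>m\<in>?M. cnj (pcoeff (Suc l) m \<phi>) * pcoeff (Suc l) m \<phi> * of_real (fnorm m))"
    by (subst (1 2) \<phi>) (rule fischer_expand, simp)
  also have "\<dots> = of_real (hnorm l \<phi>)"
    unfolding hnorm_def by (simp add: complex_norm_square mult.commute[of "cnj _"] del: of_real_power)
  finally show ?thesis .
qed

lemma hnorm_nonneg: "0 \<le> hnorm l \<phi>"
  unfolding hnorm_def by (intro sum_nonneg mult_nonneg_nonneg) (auto intro: less_imp_le fnorm_pos)

lemma hnorm_isometry:
  fixes V :: "complex^'d \<Rightarrow> complex^'d"
  assumes V: "cisometry V" and \<phi>: "\<phi> \<in> hom_polys l"
  shows "hnorm l (\<lambda>\<zeta>. \<phi> (V \<zeta>)) = hnorm l \<phi>"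
proof -
  have "(\<lambda>\<zeta>. \<phi> (V \<zeta>)) \<in> hom_polys l"
    using V by (intro hom_polys_comp_clinear[OF \<phi>]) (simp add: cisometry_def)
  then have "complex_of_real (hnorm l (\<lambda>\<zeta>. \<phi> (V \<zeta>))) = of_real (hnorm l \<phi>)"
    using fischer_isometry[OF V, of \<phi> \<phi>] borel_measurable_hom_poly[OF \<phi>] fischer_self[OF \<phi>] fischer_self by metis
  then show ?thesis unfolding of_real_eq_iff .
qed

lemma pcoeff_scale: "pcoeff N m (\<lambda>\<zeta>. a * \<phi> \<zeta>) = a * pcoeff N m \<phi>"
  by (simp add: pcoeff_def sum_distrib_left mult_ac)

lemma hnorm_scale: "hnorm l (\<lambda>\<zeta>. a * \<phi> \<zeta>) = (cmod a)\<^sup>2 * hnorm l \<phi>"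
  by (simp add: hnorm_def pcoeff_scale norm_mult power_mult_distrib sum_distrib_left mult_ac)

text \<open>Point evaluation is bounded in the Fischer norm: Cauchy-Schwarz over the coefficients,
  each weighted by the norm of its monomial. The summand 1 in \<open>C\<close> makes it positive at
  sight.\<close>

lemma hnorm_bounds_value:
  obtains C where "C > 0" "\<And>(\<phi> :: complex^'d \<Rightarrow> complex) \<zeta>. \<phi> \<in> hom_polys l \<Longrightarrow>
    (cmod (\<phi> \<zeta>))\<^sup>2 \<le> C * norm \<zeta> ^ (2 * l) * hnorm l \<phi>"
proof -
  let ?M = "{m :: 'd \<Rightarrow> nat. (\<Sum>i\<in>UNIV. m i) = l}"
  define C where "C = 1 + (\<Sum>m\<in>?M. 1 / fnorm m)"
  have fp: "0 < fnorm m" for m :: "'d \<Rightarrow> nat" by (rule fnorm_pos)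
  have "0 \<le> (\<Sum>m\<in>?M. 1 / fnorm m)" using fp by (intro sum_nonneg) (auto intro: less_imp_le)
  then have C: "C > 0" by (simp add: C_def)
  show ?thesis
  proof (rule that[OF C])
    fix \<phi> :: "complex^'d \<Rightarrow> complex" and \<zeta> :: "complex^'d" assume \<phi>: "\<phi> \<in> hom_polys l"
    let ?a = "\<lambda>m. cmod (pcoeff (Suc l) m \<phi>)"
    have "cmod (\<phi> \<zeta>) \<le> (\<Sum>m\<in>?M. ?a m * norm \<zeta> ^ l)"
    proof -
      have "cmod (\<phi> \<zeta>) \<le> (\<Sum>m\<in>?M. cmod (pcoeff (Suc l) m \<phi> * zmonom m \<zeta>))"
        by (subst hom_polys_expansion[OF \<phi>]) (rule norm_sum)
      also have "\<dots> \<le> (\<Sum>m\<in>?M. ?a m * norm \<zeta> ^ l)"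
        unfolding norm_mult by (intro sum_mono mult_left_mono) (auto intro: order.trans[OF norm_zmonom_le])
      finally show ?thesis .
    qed
    then have "cmod (\<phi> \<zeta>) \<le> norm \<zeta> ^ l * (\<Sum>m\<in>?M. ?a m)"
      by (simp add: sum_distrib_left mult.commute)
    then have "(cmod (\<phi> \<zeta>))\<^sup>2 \<le> (norm \<zeta> ^ l * (\<Sum>m\<in>?M. ?a m))\<^sup>2"
      by (rule power_mono) simp
    also have "\<dots> = norm \<zeta> ^ (2 * l) * (\<Sum>m\<in>?M. (?a m * sqrt (fnorm m)) * sqrt (1 / fnorm m))\<^sup>2"
      using fp by (simp add: power_mult_distrib power_mult[symmetric] mult.commute real_sqrt_divide less_imp_neq[symmetric])
    also have "\<dots> \<le> norm \<zeta> ^ (2 * l) * ((\<Sum>m\<in>?M. (?a m * sqrt (fnorm m))\<^sup>2) * (\<Sum>m\<in>?M. (sqrt (1 / fnorm m))\<^sup>2))"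
      by (intro mult_left_mono Cauchy_Schwarz_ineq_sum) auto
    also have "\<dots> = norm \<zeta> ^ (2 * l) * (hnorm l \<phi> * (\<Sum>m\<in>?M. 1 / fnorm m))"
      using fp by (simp add: hnorm_def power_mult_distrib less_imp_le)
    also have "\<dots> \<le> norm \<zeta> ^ (2 * l) * (hnorm l \<phi> * C)"
      unfolding C_def by (intro mult_left_mono hnorm_nonneg) auto
    finally show "(cmod (\<phi> \<zeta>))\<^sup>2 \<le> C * norm \<zeta> ^ (2 * l) * hnorm l \<phi>" by (simp add: mult_ac)
  qed
qed

text \<open>A complex Householder reflection diagonalises \<open>msqrt b\<close>.\<close>

lemma householder:
  fixes b :: "complex^'d"
  obtains W c i where "cisometry W" "\<And>z. W (W z) = z" "W b = c *s axis i 1" "\<And>u v. hprod (W u) v = hprod u (W v)"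
proof -
  define i :: 'd where "i = (SOME i. True)"
  \<comment> \<open>\<eta> is the phase of the coordinate \<open>b $ i\<close>. It makes the pairing
    of \<open>b\<close> with its intended image \<open>t\<close> real, which is needed for the
    reflection along \<open>b - t\<close> to exchange the two vectors over the complex
    numbers.\<close>
  define \<eta> where "\<eta> = (if b $ i = 0 then 1 else b $ i / of_real (cmod (b $ i)))"
  define t where "t = (\<eta> * of_real (norm b)) *s axis i 1"
  define u where "u = b - t"
  have ax: "hprod z (axis i 1) = z $ i" "hprod (axis i 1) z = cnj (z $ i)" for z :: "complex^'d"
    by (simp_all add: hprod_def axis_def if_distrib[where f = cnj] if_distrib[where f = "\<lambda>x. _ * x"]
        if_distrib[where f = "\<lambda>x. x * _"] cong: if_cong)
  have \<eta>: "cmod \<eta> = 1" by (simp add: \<eta>_def norm_divide)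
  have \<eta>b: "b $ i * cnj \<eta> = of_real (cmod (b $ i))"
    by (simp add: \<eta>_def complex_norm_square[symmetric] power2_eq_square)
  define \<beta> where "\<beta> = complex_of_real (norm b * cmod (b $ i))"
  have bt: "hprod b t = \<beta>"
    unfolding t_def hprod_scale_right ax \<beta>_def using \<eta>b by (simp add: mult_ac)
  have tb: "hprod t b = \<beta>" using bt hprod_commute[of t b] by (simp add: \<beta>_def)
  have tt: "hprod t t = hprod b b"
  proof -
    have "norm (axis i 1 :: complex^'d) = 1" by simp
    then show ?thesis using \<eta> by (simp add: t_def hprod_self norm_mult)
  qed
  have uu: "hprod u u = 2 * hprod b u"
    by (simp add: u_def hprod_diff_left hprod_diff_right bt tb tt)
  show ?thesis
  proof (cases "u = 0")
    case True
    have "cisometry (\<lambda>z :: complex^'d. z)" by (auto simp: cisometry_def intro: clinearI)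
    then show ?thesis
      using that[of "\<lambda>z. z" "\<eta> * of_real (norm b)" i] True by (simp add: u_def t_def)
  next
    case False
    define k where "k = 2 / hprod u u"
    have uu0: "hprod u u \<noteq> 0" using False by (simp add: hprod_self)
    have ck: "cnj k = k" by (simp add: k_def hprod_self)
    define W where "W z = z - (k * hprod z u) *s u" for z
    have lin: "clinear W" unfolding W_def[abs_def] by (rule clinear_rank_one_update)
    have WW: "W (W z) = z" for z
    proof -
      have "k * hprod u u = 2" using uu0 by (simp add: k_def)
      then have "hprod (W z) u = - hprod z u" by (simp add: W_def hprod_simps algebra_simps)
      then show ?thesis unfolding W_def[of "W z"] by (simp add: W_def)
    qed
    have adj: "hprod (W x) y = hprod x (W y)" for x y
      by (simp add: W_def hprod_diff_left hprod_diff_right hprod_scale_left hprod_scale_right ck)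
        (metis hprod_commute mult.assoc mult.commute)
    have "norm (W z) = norm z" for z
    proof -
      have "hprod (W z) (W z) = hprod z z" by (simp add: adj WW)
      then have "(norm (W z))\<^sup>2 = (norm z)\<^sup>2" unfolding hprod_self of_real_eq_iff .
      then show ?thesis by (simp add: power2_eq_iff_nonneg)
    qed
    then have "cisometry W" using lin by (simp add: cisometry_def)
    moreover have "W b = t"
    proof -
      have "k * hprod b u = 1" using uu uu0 by (simp add: k_def)
      then show ?thesis by (simp add: W_def u_def)
    qed
    ultimately show ?thesis using that[of W "\<eta> * of_real (norm b)" i] WW adj by (simp add: t_def)
  qed
qed

text \<open>After a unitary change of variables the Bergman square root is a real diagonal map,
  which multiplies each monomial by a real number. Monomials are orthogonal, so one of the two
  factors can be moved to the left argument, leaving the squared norm of a single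
  polynomial.\<close>

lemma fischer_Bergman:
  fixes x :: "complex^'d"
  assumes x: "x \<in> unit_ball" and \<phi>: "\<phi> \<in> hom_polys l"
  shows "fischer \<phi> (\<phi> \<circ> Bergman_op x x) = of_real (hnorm l (\<lambda>\<zeta>. \<phi> (msqrt x \<zeta>)))"
proof -
  obtain W c i where W: "cisometry W" and WW: "\<And>z. W (W z) = z" and Wx: "W x = c *s axis i 1"
    and adj: "\<And>u v. hprod (W u) v = hprod u (W v)"
    using householder[of x] by blast
  define s where "s = defect x"
  define \<delta> where "\<delta> j = (if j = i then s - s / (1 + s) * (cmod c)\<^sup>2 else s)" for j
  define D :: "complex^'d \<Rightarrow> complex^'d" where "D v = (\<chi> j. of_real (\<delta> j) * v $ j)" for v
  define \<Delta> where "\<Delta> m = (\<Prod>j\<in>UNIV. \<delta> j ^ m j)" for m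
  have linW: "clinear W" using W by (simp add: cisometry_def)
  have TW: "msqrt x (W v) = W (D v)" for v
  proof -
    have ax: "hprod v (axis i 1) = v $ i" for v :: "complex^'d"
      by (simp add: hprod_def axis_def if_distrib[where f = cnj] if_distrib[where f = "\<lambda>x. _ * x"] cong: if_cong)
    have xW: "x = W (c *s axis i 1)" using WW[of x] Wx by simp
    have "hprod (W v) x = cnj c * v $ i" unfolding adj Wx by (simp add: hprod_simps ax)
    then have "msqrt x (W v) = of_real s *s W v - (of_real (s / (1 + s)) * (cnj c * v $ i)) *s W (c *s axis i 1)"
      unfolding msqrt_def s_def using xW by simp
    also have "\<dots> = W (of_real s *s v - (of_real (s / (1 + s)) * (cnj c * v $ i)) *s (c *s axis i 1))"
    proof -
      have dif: "W (u - v) = W u - W v" for u v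
        using clinear_add[OF linW, of "u - v" v] by (simp add: algebra_simps)
      show ?thesis by (simp only: dif clinear_scale[OF linW])
    qed
    also have "of_real s *s v - (of_real (s / (1 + s)) * (cnj c * v $ i)) *s (c *s axis i 1) = D v"
      using complex_norm_square[of c] by (simp add: vec_eq_iff D_def \<delta>_def axis_def algebra_simps)
    finally show ?thesis .
  qed
  define \<chi>' where "\<chi>' \<zeta> = \<phi> (W \<zeta>)" for \<zeta>
  have \<chi>': "\<chi>' \<in> hom_polys l" unfolding \<chi>'_def[abs_def] by (rule hom_polys_comp_clinear[OF \<phi> linW])
  have linT: "clinear (msqrt x)" by (rule clinear_msqrt)
  let ?M = "{m :: 'd \<Rightarrow> nat. (\<Sum>i\<in>UNIV. m i) = l}"
  define a where "a m = pcoeff (Suc l) m \<chi>'" for m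
  have mD: "zmonom m (D \<zeta>) = of_real (\<Delta> m) * zmonom m \<zeta>" for m \<zeta>
    by (simp add: zmonom_def D_def \<Delta>_def power_mult_distrib prod.distrib)
  have e0: "\<chi>' = (\<lambda>\<zeta>. \<Sum>m\<in>?M. a m * zmonom m \<zeta>)"
    unfolding a_def by (rule ext) (rule hom_polys_expansion[OF \<chi>'])
  have e1: "(\<lambda>\<zeta>. \<chi>' (D \<zeta>)) = (\<lambda>\<zeta>. \<Sum>m\<in>?M. (a m * of_real (\<Delta> m)) * zmonom m \<zeta>)"
    by (subst e0) (simp add: mD mult.assoc)
  have e2: "(\<lambda>\<zeta>. \<chi>' (D (D \<zeta>))) = (\<lambda>\<zeta>. \<Sum>m\<in>?M. (a m * of_real (\<Delta> m) * of_real (\<Delta> m)) * zmonom m \<zeta>)"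
    by (subst e0) (simp add: mD mult.assoc)
  have "\<phi> \<circ> Bergman_op x x \<in> hom_polys l"
    unfolding Bergman_op_eq[OF x] o_def
    by (rule hom_polys_comp_clinear[OF _ linT, of "\<lambda>\<zeta>. \<phi> (msqrt x \<zeta>)"]) (rule hom_polys_comp_clinear[OF \<phi> linT])
  then have "fischer \<phi> (\<phi> \<circ> Bergman_op x x) = fischer (\<lambda>\<zeta>. \<phi> (W \<zeta>)) (\<lambda>\<zeta>. (\<phi> \<circ> Bergman_op x x) (W \<zeta>))"
    using \<phi> by (intro fischer_isometry[OF W, symmetric] borel_measurable_hom_poly)
  also have "\<dots> = fischer \<chi>' (\<lambda>\<zeta>. \<chi>' (D (D \<zeta>)))"
    unfolding Bergman_op_eq[OF x] o_def TW \<chi>'_def ..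
  also have "\<dots> = (\<Sum>m\<in>?M. cnj (a m) * (a m * of_real (\<Delta> m) * of_real (\<Delta> m)) * of_real (fnorm m))"
    unfolding e2 by (subst e0) (rule fischer_expand, simp)
  also have "\<dots> = (\<Sum>m\<in>?M. cnj (a m * of_real (\<Delta> m)) * (a m * of_real (\<Delta> m)) * of_real (fnorm m))"
    by (intro sum.cong) (auto simp: mult_ac)
  also have "\<dots> = fischer (\<lambda>\<zeta>. \<chi>' (D \<zeta>)) (\<lambda>\<zeta>. \<chi>' (D \<zeta>))"
    unfolding e1 by (rule fischer_expand[symmetric]) simp
  also have "\<dots> = fischer (\<lambda>\<zeta>. \<phi> (msqrt x (W \<zeta>))) (\<lambda>\<zeta>. \<phi> (msqrt x (W \<zeta>)))"
    unfolding TW \<chi>'_def ..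
  also have "\<dots> = fischer (\<lambda>\<zeta>. \<phi> (msqrt x \<zeta>)) (\<lambda>\<zeta>. \<phi> (msqrt x \<zeta>))"
    by (intro fischer_isometry[OF W, of "\<lambda>\<zeta>. \<phi> (msqrt x \<zeta>)" "\<lambda>\<zeta>. \<phi> (msqrt x \<zeta>)"]
        borel_measurable_hom_poly[of _ l] hom_polys_comp_clinear[OF \<phi> linT])
  also have "\<dots> = of_real (hnorm l (\<lambda>\<zeta>. \<phi> (msqrt x \<zeta>)))"
    by (rule fischer_self[OF hom_polys_comp_clinear[OF \<phi> linT]])
  finally show ?thesis .
qed

section \<open>Invariance of the Hilbert spaces\<close>

text \<open>The diagonal integrand of the source norm rewritten as a visibly nonnegative real
  function, with the Bergman operator split evenly between the two arguments.\<close>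

definition hom_density :: "real \<Rightarrow> nat \<Rightarrow> (complex^'d \<Rightarrow> complex^'d \<Rightarrow> complex) \<Rightarrow> complex^'d \<Rightarrow> real" where
  "hom_density \<nu> l \<Phi> x = (1 - (norm x)\<^sup>2) powr \<nu> * hnorm l (\<lambda>\<zeta>. \<Phi> x (msqrt x \<zeta>))"

lemma hom_density_nonneg: "0 \<le> hom_density \<nu> l \<Phi> x"
  by (simp add: hom_density_def hnorm_nonneg)

lemma hom_integrand_eq:
  "\<Phi> \<in> holo_maps (hom_polys l) \<Longrightarrow> x \<in> unit_ball \<Longrightarrow> hom_integrand \<nu> \<Phi> \<Phi> x = of_real (hom_density \<nu> l \<Phi> x)"
  using fischer_Bergman[of x "\<Phi> x" l] holo_mapsD(1)[of \<Phi> "hom_polys l" x]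
  by (simp add: hom_integrand_def hom_density_def Re_Delta)

lemma continuous_holo_maps_eval:
  assumes \<Phi>: "\<Phi> \<in> holo_maps (hom_polys l)" and \<xi>: "continuous_on unit_ball \<xi>"
  shows "continuous_on unit_ball (\<lambda>x. \<Phi> x (\<xi> x))"
proof -
  have "continuous_on unit_ball (\<lambda>x. \<Sum>m | (\<Sum>i\<in>UNIV. m i) = l. pcoeff (Suc l) m (\<Phi> x) * zmonom m (\<xi> x))"
    by (intro continuous_intros continuous_zmonom \<xi> holo_on_continuous[OF pcoeff_holo[OF \<Phi>]])
  then show ?thesis
    by (rule continuous_on_eq) (rule hom_polys_expansion[OF holo_mapsD(1)[OF \<Phi>], symmetric])
qed

lemma continuous_hprod: "continuous_on S f \<Longrightarrow> continuous_on S g \<Longrightarrow> continuous_on S (\<lambda>x. hprod (f x) (g x))"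
  unfolding hprod_def by (intro continuous_intros)

lemma continuous_msqrt: "continuous_on unit_ball (\<lambda>x. msqrt x \<zeta>)"
proof -
  have "1 + defect x \<noteq> 0" if "x \<in> unit_ball" for x :: "complex^'a" using defect_pos[OF that] by linarith
  moreover have "continuous_on unit_ball (defect :: complex^'a \<Rightarrow> real)"
    unfolding defect_def[abs_def] by (intro continuous_intros)
  ultimately show ?thesis
    unfolding msqrt_def by (intro continuous_intros continuous_smult continuous_hprod) auto
qed

lemma hom_density_continuous:
  assumes \<Phi>: "\<Phi> \<in> holo_maps (hom_polys l)"
  shows "continuous_on unit_ball (hom_density \<nu> l \<Phi>)"
  unfolding hom_density_def[abs_def] hnorm_def pcoeff_def
  by (intro continuous_intros continuous_holo_maps_eval[OF \<Phi>] continuous_msqrt) (auto simp: ball_iff abs_square_eq_1)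

lemma hom_density_measurable:
  "\<Phi> \<in> holo_maps (hom_polys l) \<Longrightarrow> (\<lambda>x. ennreal (hom_density \<nu> l \<Phi> x)) \<in> borel_measurable ball_lborel"
  by (rule measurable_compose[OF measurable_ball_continuous[OF hom_density_continuous] measurable_ennreal])

text \<open>Integrability becomes finiteness of a nonnegative integral, to which invariance of the
  measure and Tonelli's theorem apply.\<close>

lemma H2_hom_iff:
  "\<Phi> \<in> H2_hom c \<nu> l \<longleftrightarrow> \<Phi> \<in> holo_maps (hom_polys l) \<and>
    (\<integral>\<^sup>+x. ennreal (hom_density \<nu> l \<Phi> x) \<partial>inv_measure c) < \<infinity>"
proof (cases "\<Phi> \<in> holo_maps (hom_polys l)")
  case True
  have eq: "hom_integrand \<nu> \<Phi> \<Phi> x = of_real (hom_density \<nu> l \<Phi> x)" if "x \<in> space (inv_measure c)" for x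
    using hom_integrand_eq[OF True] that by simp
  have m: "(\<lambda>x. complex_of_real (hom_density \<nu> l \<Phi> x)) \<in> borel_measurable (inv_measure c)"
    unfolding measurable_inv_measure
    by (intro measurable_ball_continuous continuous_intros hom_density_continuous[OF True])
  have "integrable (inv_measure c) (hom_integrand \<nu> \<Phi> \<Phi>) \<longleftrightarrow>
      integrable (inv_measure c) (\<lambda>x. complex_of_real (hom_density \<nu> l \<Phi> x))"
    by (rule Bochner_Integration.integrable_cong) (auto simp: eq)
  also have "\<dots> \<longleftrightarrow> (\<integral>\<^sup>+x. ennreal (hom_density \<nu> l \<Phi> x) \<partial>inv_measure c) < \<infinity>"
    unfolding integrable_iff_bounded using m by (simp add: abs_of_nonneg[OF hom_density_nonneg])
  finally show ?thesis using True by (simp add: H2_hom_def)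
qed (simp add: H2_hom_def)

text \<open>Taking moduli removes the phase left open by the branch and by the unitary part. Since
  the modulus of \<open>exp C\<close> is \<open>defect b\<close> to the power genus, the claim is
  the logarithm of \<open>Delta_mob\<close> multiplied by \<nu>.\<close>

lemma norm_exp_log_branch:
  fixes g :: "complex^'d \<Rightarrow> complex^'d"
  assumes M: "moebius_form g b U L" and x: "x \<in> unit_ball"
  shows "(cmod (exp (of_real (\<nu> / genus TYPE('d)) * L x)))\<^sup>2 * (1 - (norm x)\<^sup>2) powr \<nu> = (1 - (norm (g x))\<^sup>2) powr \<nu>"
proof -
  note D = moebius_formD[OF M]
  define q where "q = 1 + hprod (U x) b"
  have q: "q \<noteq> 0" using D(8)[OF x] by (simp add: q_def)
  have s: "0 < defect b" by (rule defect_pos[OF D(1)])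
  have r: "0 < 1 - (norm x)\<^sup>2" using x by (simp add: ball_iff abs_square_less_1)
  obtain C where C0: "\<forall>z\<in>unit_ball. \<forall>a. exp (of_real (a / genus TYPE('d)) * L z) =
      exp (of_real (a / genus TYPE('d)) * C) * (1 + hprod (U z) b) powr (- of_real a)"
    and C2: "exp (Re C) = defect b ^ Suc CARD('d)"
    using log_branch_power[OF M] by (elim exE conjE) (rule that)
  have C1: "exp (of_real (\<nu> / genus TYPE('d)) * L x) =
      exp (of_real (\<nu> / genus TYPE('d)) * C) * q powr (- of_real \<nu>)"
    using bspec[OF C0 x] unfolding q_def by (rule spec)
  have p: "genus TYPE('d) = real (Suc CARD('d))" by (simp add: genus_def)
  have ReC: "Re C = real (Suc CARD('d)) * ln (defect b)"
    using arg_cong[OF C2, of ln] s by (simp only: ln_exp ln_realpow)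
  have "cmod (exp (of_real (\<nu> / genus TYPE('d)) * C)) = exp (\<nu> * ln (defect b))"
    unfolding norm_exp_eq_Re p by (simp add: ReC del: of_nat_Suc)
  moreover have "cmod (q powr (- of_real \<nu>)) = exp (- \<nu> * ln (cmod q))"
    using q by (simp add: powr_def norm_exp_eq_Re Re_Ln)
  ultimately have "(cmod (exp (of_real (\<nu> / genus TYPE('d)) * L x)))\<^sup>2 * (1 - (norm x)\<^sup>2) powr \<nu> =
      exp (\<nu> * (2 * ln (defect b) + ln (1 - (norm x)\<^sup>2) - 2 * ln (cmod q)))"
    unfolding C1 norm_mult using r
    by (simp add: powr_def power2_eq_square exp_add[symmetric] algebra_simps)
  also have "2 * ln (defect b) + ln (1 - (norm x)\<^sup>2) - 2 * ln (cmod q) = ln (1 - (norm (g x))\<^sup>2)"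
  proof -
    have "1 - (norm (g x))\<^sup>2 = (defect b)\<^sup>2 * (1 - (norm x)\<^sup>2) / (cmod q)\<^sup>2"
      using Delta_mob[OF D(1) D(6)[OF x]] D(2,4) x by (simp add: q_def cisometry_def)
    then show ?thesis using s r q by (simp add: ln_div ln_mult ln_realpow)
  qed
  also have "exp (\<nu> * ln (1 - (norm (g x))\<^sup>2)) = (1 - (norm (g x))\<^sup>2) powr \<nu>"
    using D(7)[OF x] by (simp add: powr_def ball_iff abs_square_eq_1)
  finally show ?thesis .
qed

text \<open>The Jacobian power adjusts the weight, and \<open>ball_aut_frechet_msqrt\<close>
  replaces the derivative at \<open>x\<close> by the square root at \<open>g x\<close> up to an
  isometry, under which the Fischer norm is invariant.\<close>

lemma hom_density_alpha_inv:
  fixes \<Phi> :: "complex^'d \<Rightarrow> complex^'d \<Rightarrow> complex"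
  assumes M: "moebius_form g b U L" and g: "ball_aut_pair g g'" and \<Phi>: "\<Phi> \<in> holo_maps (hom_polys l)"
    and x: "x \<in> unit_ball"
  shows "hom_density \<nu> l (alpha_inv \<nu> g L \<Phi>) x = hom_density \<nu> l \<Phi> (g x)"
proof -
  define E where "E = exp (of_real (\<nu> / genus TYPE('d)) * L x)"
  obtain V where V: "cisometry V" "frechet_derivative g (at x) \<circ> msqrt x = msqrt (g x) \<circ> V"
    by (rule ball_aut_frechet_msqrt[OF g x])
  have gx: "g x \<in> unit_ball" by (rule moebius_formD(7)[OF M x])
  have "(\<lambda>\<zeta>. alpha_inv \<nu> g L \<Phi> x (msqrt x \<zeta>)) = (\<lambda>\<zeta>. E * \<Phi> (g x) (msqrt (g x) (V \<zeta>)))"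
    using fun_cong[OF V(2)] x by (simp add: alpha_inv_def E_def)
  then have "hnorm l (\<lambda>\<zeta>. alpha_inv \<nu> g L \<Phi> x (msqrt x \<zeta>)) =
      (cmod E)\<^sup>2 * hnorm l (\<lambda>\<zeta>. \<Phi> (g x) (msqrt (g x) \<zeta>))"
    using hnorm_isometry[OF V(1) hom_polys_comp_clinear[OF holo_mapsD(1)[OF \<Phi> gx] clinear_msqrt]]
    by (simp add: hnorm_scale)
  then show ?thesis
    unfolding hom_density_def norm_exp_log_branch[OF M x, of \<nu>, folded E_def, symmetric]
    by (simp only: mult_ac)
qed

lemma alpha_inv_H2_hom:
  fixes \<Phi> :: "complex^'d \<Rightarrow> complex^'d \<Rightarrow> complex"
  assumes M: "moebius_form g b U L" and g: "ball_aut_pair g g'" and c: "c > 0" and \<Phi>: "\<Phi> \<in> H2_hom c \<nu> l"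
  shows "alpha_inv \<nu> g L \<Phi> \<in> H2_hom c \<nu> l"
proof -
  have hol: "\<Phi> \<in> holo_maps (hom_polys l)" using \<Phi> by (simp add: H2_hom_iff)
  have "(\<integral>\<^sup>+x. ennreal (hom_density \<nu> l (alpha_inv \<nu> g L \<Phi>) x) \<partial>inv_measure c) =
      (\<integral>\<^sup>+x. ennreal (hom_density \<nu> l \<Phi> (g x)) \<partial>inv_measure c)"
    by (intro nn_integral_cong) (simp add: hom_density_alpha_inv[OF M g hol])
  also have "\<dots> = (\<integral>\<^sup>+x. ennreal (hom_density \<nu> l \<Phi> x) \<partial>inv_measure c)"
    by (rule nn_integral_inv_measure_aut[OF g hom_density_measurable[OF hol] c])
  finally show ?thesis using \<Phi> alpha_inv_holo_maps[OF M hol] by (simp add: H2_hom_iff)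
qed

section \<open>Inverting the group actions\<close>

lemma ball_aut_frechet_inverse:
  fixes g :: "complex^'d \<Rightarrow> complex^'d"
  assumes g: "ball_aut_pair g g'" and z: "z \<in> unit_ball"
  shows "frechet_derivative g' (at (g z)) (frechet_derivative g (at z) v) = v"
    and "jac_det g' (g z) * jac_det g z = 1"
proof -
  have h: "holo_map_on unit_ball g" "holo_map_on unit_ball g'" and gz: "g z \<in> unit_ball"
    and gg: "\<And>z. z \<in> unit_ball \<Longrightarrow> g' (g z) = z"
    using g z by (auto simp: ball_aut_pair_def)
  let ?A = "frechet_derivative g (at z)" and ?B = "frechet_derivative g' (at (g z))"
  have "((\<lambda>z. g' (g z)) has_derivative (\<lambda>v. ?B (?A v))) (at z)"
    by (rule has_derivative_compose[OF holo_map_has_derivative(1)[OF h(1) z] holo_map_has_derivative(1)[OF h(2) gz]])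
  then have "((\<lambda>z. z) has_derivative (\<lambda>v. ?B (?A v))) (at z)"
    by (rule has_derivative_transform_within_open[OF _ unit_ball_open z gg])
  then have eq: "(\<lambda>v. ?B (?A v)) = (\<lambda>v. v)"
    by (rule has_derivative_unique) (rule has_derivative_ident)
  then show "?B (?A v) = v" by (rule fun_cong)
  have "matrix (?B \<circ> ?A) = mat 1" using eq by (simp add: o_def matrix_id_mat_1[unfolded id_def])
  then show "jac_det g' (g z) * jac_det g z = 1"
    unfolding jac_det_def
    using matrix_compose_gen[OF holo_map_has_derivative(2)[OF h(1) z] holo_map_has_derivative(2)[OF h(2) gz]]
    by (metis det_I det_mul)
qed

text \<open>With this branch the scalar factors of the actions of \<open>g\<close> and of its
  inverse cancel exactly, not only up to a unimodular constant.\<close>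

lemma log_branch_inverse:
  fixes g :: "complex^'d \<Rightarrow> complex^'d"
  assumes g: "ball_aut_pair g g'" and L: "log_branch g L"
  shows "log_branch g' (\<lambda>w. - L (g' w))"
  unfolding log_branch_def
proof (intro conjI ballI)
  have g'b: "g' w \<in> unit_ball" "g (g' w) = w" if "w \<in> unit_ball" for w using g that by (auto simp: ball_aut_pair_def)
  have "continuous_on unit_ball L" using L by (simp add: log_branch_def)
  moreover have "g' ` unit_ball \<subseteq> unit_ball" using g'b(1) by blast
  ultimately show "continuous_on unit_ball (\<lambda>w. - L (g' w))"
    by (intro continuous_on_minus continuous_on_compose2[OF _ ball_aut_continuous[OF ball_aut_pair_sym[OF g]]])
  fix w :: "complex^'d" assume w: "w \<in> unit_ball"
  have "jac_det g' w * exp (L (g' w)) = 1"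
    using ball_aut_frechet_inverse(2)[OF g g'b(1)[OF w]] g'b[OF w] L by (simp add: log_branch_def)
  then show "exp (- L (g' w)) = jac_det g' w"
    by (simp add: exp_minus field_simps)
qed

lemma moebius_form_exists:
  assumes "ball_aut_pair g g'" "log_branch g L"
  obtains b U where "moebius_form g b U L"
proof -
  have g0: "g 0 \<in> unit_ball" using assms(1) zero_in_ball unfolding ball_aut_pair_def by blast
  have "\<exists>U. moebius_form g (g 0) U L"
  proof (rule ball_aut_decompose[OF assms(1)])
    fix U assume U: "cisometry U" "\<And>z. z \<in> unit_ball \<Longrightarrow> g z = mob (g 0) (U z)"
    have "moebius_form g (g 0) U L"
      unfolding moebius_form_def using U assms(2) g0 by (intro conjI ballI)
    then show ?thesis by (rule exI[of _ U])
  qed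
  then show ?thesis by (elim exE) (rule that)
qed

lemma alpha_inv_inverse:
  fixes \<Phi> :: "complex^'d \<Rightarrow> complex^'d \<Rightarrow> complex"
  assumes g: "ball_aut_pair g g'" and \<Phi>: "\<Phi> \<in> holo_maps V"
  shows "alpha_inv \<nu> g L (alpha_inv \<nu> g' (\<lambda>w. - L (g' w)) \<Phi>) = \<Phi>"
    and "alpha_inv \<nu> g' (\<lambda>w. - L (g' w)) (alpha_inv \<nu> g L \<Phi>) = \<Phi>"
proof -
  have gb: "\<And>z. z \<in> unit_ball \<Longrightarrow> g z \<in> unit_ball \<and> g' z \<in> unit_ball \<and> g' (g z) = z \<and> g (g' z) = z"
    using g by (simp add: ball_aut_pair_def)
  have out: "\<Phi> z \<zeta> = 0" if "z \<notin> unit_ball" for z \<zeta> using holo_mapsD(2)[OF \<Phi> that] by simp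
  show "alpha_inv \<nu> g L (alpha_inv \<nu> g' (\<lambda>w. - L (g' w)) \<Phi>) = \<Phi>"
    using gb out ball_aut_frechet_inverse(1)[OF g] by (auto simp: alpha_inv_def fun_eq_iff exp_minus)
  have "frechet_derivative g (at (g' w)) (frechet_derivative g' (at w) v) = v" if "w \<in> unit_ball" for w v
    using ball_aut_frechet_inverse(1)[OF ball_aut_pair_sym[OF g] that] .
  then show "alpha_inv \<nu> g' (\<lambda>w. - L (g' w)) (alpha_inv \<nu> g L \<Phi>) = \<Phi>"
    using gb out by (auto simp: alpha_inv_def fun_eq_iff exp_minus)
qed

text \<open>\<open>alpha\<close> is defined through \<open>the_inv_into\<close>, whose value is
  meaningful only on the image of an injective map. The action of the inverse automorphism preserves
  the space and supplies both the preimage and injectivity.\<close>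

lemma alpha_eq:
  fixes \<Phi> :: "complex^'d \<Rightarrow> complex^'d \<Rightarrow> complex"
  assumes g: "ball_aut_pair g g'" and L: "log_branch g L" and c: "c > 0" and \<Phi>: "\<Phi> \<in> H2_hom c \<nu> l"
  shows "alpha c \<nu> l g L \<Phi> \<in> H2_hom c \<nu> l" and "alpha_inv \<nu> g L (alpha c \<nu> l g L \<Phi>) = \<Phi>"
proof -
  let ?\<Psi> = "alpha_inv \<nu> g' (\<lambda>w. - L (g' w)) \<Phi>"
  have hol: "\<Psi> \<in> holo_maps (hom_polys l)" if "\<Psi> \<in> H2_hom c \<nu> l" for \<Psi> using that by (simp add: H2_hom_iff)
  obtain b' U' where "moebius_form g' b' U' (\<lambda>w. - L (g' w))"
    by (rule moebius_form_exists[OF ball_aut_pair_sym[OF g] log_branch_inverse[OF g L]])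
  then have \<Psi>: "?\<Psi> \<in> H2_hom c \<nu> l" by (rule alpha_inv_H2_hom[OF _ ball_aut_pair_sym[OF g] c \<Phi>])
  have inv: "alpha_inv \<nu> g L ?\<Psi> = \<Phi>" by (rule alpha_inv_inverse(1)[OF g hol[OF \<Phi>]])
  have "inj_on (alpha_inv \<nu> g L) (H2_hom c \<nu> l)"
    by (rule inj_on_inverseI[of _ "alpha_inv \<nu> g' (\<lambda>w. - L (g' w))"]) (rule alpha_inv_inverse(2)[OF g hol])
  then have "alpha c \<nu> l g L \<Phi> = ?\<Psi>"
    unfolding alpha_def using the_inv_into_f_f[of "alpha_inv \<nu> g L" _ ?\<Psi>] \<Psi> inv by simp
  then show "alpha c \<nu> l g L \<Phi> \<in> H2_hom c \<nu> l" "alpha_inv \<nu> g L (alpha c \<nu> l g L \<Phi>) = \<Phi>"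
    using \<Psi> inv by simp_all
qed

lemma open_translate_ball: "open {\<zeta>. z + \<zeta> \<in> unit_ball}"
  using open_vimage[OF unit_ball_open, of "\<lambda>\<zeta>. z + \<zeta>"] by (simp add: vimage_def continuous_intros)

text \<open>Shows that the transformed map really is polynomial in the vector variable, so that
  \<open>poly_extension\<close> returns the intended value. Arbitrary maps in
  \<open>holo_maps (deg_polys n)\<close> are allowed because injectivity of \<open>beta_inv\<close>
  is deduced from it.\<close>

lemma beta_inv_formula:
  fixes \<Phi> :: "complex^'d \<Rightarrow> complex^'d \<Rightarrow> complex"
  assumes M: "moebius_form g b U L" and \<Phi>: "\<Phi> \<in> holo_maps (deg_polys n)"
    and z: "z \<in> unit_ball" and z\<zeta>: "z + \<zeta> \<in> unit_ball"
  shows "beta_inv \<nu> n g L \<Phi> z \<zeta> = exp (of_real ((\<nu> + real n) / genus TYPE('d)) * L z) *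
             exp (of_real (- real n / genus TYPE('d)) * L (z + \<zeta>)) * \<Phi> (g z) (g (z + \<zeta>) - g z)"
proof -
  let ?f = "\<lambda>\<zeta>. exp (of_real ((\<nu> + real n) / genus TYPE('d)) * L z) *
             exp (of_real (- real n / genus TYPE('d)) * L (z + \<zeta>)) * \<Phi> (g z) (g (z + \<zeta>) - g z)"
  note D = moebius_formD[OF M]
  define q where "q = 1 + hprod (U z) b"
  define A where "A = frechet_derivative g (at z)"
  define E where "E = exp (of_real ((\<nu> + real n) / genus TYPE('d)) * L z) * exp (of_real (- real n / genus TYPE('d)) * L z)"
  have linA: "clinear A" unfolding A_def by (rule holo_map_has_derivative(2)[OF moebius_form_holo[OF M] z])
  \<comment> \<open>The scalar linear form is packaged as a vector-valued map along one fixed axis,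
    because the lemma on affine functions speaks of components of complex-linear maps.\<close>
  have lin: "clinear (\<lambda>\<zeta>. (hprod (U \<zeta>) b / q) *s axis undefined (1::complex) :: complex^'d)"
    by (rule clinearI) (auto simp: clinear_add[OF D(3)] clinear_scale[OF D(3)] hprod_simps vec_eq_iff add_divide_distrib algebra_simps)
  have "(\<lambda>\<zeta>. 1 + ((hprod (U \<zeta>) b / q) *s axis undefined (1::complex) :: complex^'d) $ undefined) \<in> deg_polys 1"
    by (rule deg_polys_1_affine[OF lin])
  then have r: "(\<lambda>\<zeta>. 1 + hprod (U \<zeta>) b / q) \<in> deg_polys 1" by (simp add: axis_def)
  obtain p where p: "p \<in> deg_polys n" "\<And>\<zeta>. 1 + hprod (U \<zeta>) b / q \<noteq> 0 \<Longrightarrow>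
      p \<zeta> = (1 + hprod (U \<zeta>) b / q) ^ n * \<Phi> (g z) ((1 / (1 + hprod (U \<zeta>) b / q)) *s A \<zeta>)"
    using deg_polys_fractional[OF holo_mapsD(1)[OF \<Phi> D(7)[OF z]] linA r] by blast
  have eq: "E * p \<zeta> = ?f \<zeta>" if \<zeta>: "z + \<zeta> \<in> unit_ball" for \<zeta>
  proof -
    let ?w = "1 + hprod (U \<zeta>) b / q * 1"
    have 1: "z + 1 *s \<zeta> \<in> unit_ball" using \<zeta> by simp
    note line = moebius_line[OF M z 1, folded q_def A_def]
    have w: "?w \<noteq> 0" using line(2) by auto
    have "exp (of_real (- real n / genus TYPE('d)) * L (z + \<zeta>)) =
        exp (of_real (- real n / genus TYPE('d)) * L z) * ?w ^ n"
      using moebius_line_exp[OF M z 1, folded q_def, of "- real n"] powr_nat[of ?w n] w by simp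
    moreover have "g (z + \<zeta>) - g z = (1 / ?w) *s A \<zeta>" using line(4) by simp
    moreover have "p \<zeta> = ?w ^ n * \<Phi> (g z) ((1 / ?w) *s A \<zeta>)" using p(2)[of \<zeta>] w by simp
    ultimately show ?thesis by (simp add: E_def mult.assoc)
  qed
  have "poly_extension n {\<zeta>. z + \<zeta> \<in> unit_ball} ?f = (\<lambda>\<zeta>. E * p \<zeta>)"
  proof (rule poly_extension_eqI[OF deg_polys_scale[OF p(1)] _ open_translate_ball])
    show "{\<zeta>. z + \<zeta> \<in> unit_ball} \<noteq> {}" using z by (auto intro: exI[of _ 0])
  qed (simp add: eq)
  then have "beta_inv \<nu> n g L \<Phi> z = (\<lambda>\<zeta>. E * p \<zeta>)" unfolding beta_inv_def by (simp only: z if_True)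
  then show ?thesis using eq[OF z\<zeta>] by simp
qed

text \<open>The exponential factors never vanish, so the transformed map determines the original one
  at the arguments reached through \<open>g\<close>. These form an open set for each base point, and
  polynomials are determined there.\<close>

lemma beta_inv_inj:
  fixes g :: "complex^'d \<Rightarrow> complex^'d"
  assumes M: "moebius_form g b U L" and g: "ball_aut_pair g g'"
  shows "inj_on (beta_inv \<nu> n g L) (holo_maps (deg_polys n))"
proof (rule inj_onI)
  fix \<Phi> \<Psi> :: "complex^'d \<Rightarrow> complex^'d \<Rightarrow> complex"
  assume \<Phi>: "\<Phi> \<in> holo_maps (deg_polys n)" and \<Psi>: "\<Psi> \<in> holo_maps (deg_polys n)"
    and eq: "beta_inv \<nu> n g L \<Phi> = beta_inv \<nu> n g L \<Psi>"
  have gb: "\<And>z. z \<in> unit_ball \<Longrightarrow> g z \<in> unit_ball \<and> g' z \<in> unit_ball \<and> g' (g z) = z \<and> g (g' z) = z"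
    using g by (simp add: ball_aut_pair_def)
  show "\<Phi> = \<Psi>"
  proof
    fix w :: "complex^'d"
    show "\<Phi> w = \<Psi> w"
    proof (cases "w \<in> unit_ball")
      case True
      have z: "g' w \<in> unit_ball" "g (g' w) = w" using gb[OF True] by auto
      show ?thesis
      proof (rule deg_polys_eqI[OF holo_mapsD(1)[OF \<Phi> True] holo_mapsD(1)[OF \<Psi> True] open_translate_ball])
        show "{\<zeta>. w + \<zeta> \<in> unit_ball} \<noteq> {}" using True by (auto intro: exI[of _ 0])
        fix \<zeta> assume "\<zeta> \<in> {\<zeta>. w + \<zeta> \<in> unit_ball}"
        then have \<eta>: "w + \<zeta> \<in> unit_ball" by simp
        \<comment> \<open>Chosen so that \<open>g\<close> carries the displacement \<xi> at
          \<open>g' w\<close> to the displacement \<zeta> at \<open>w\<close>.\<close>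
        define \<xi> where "\<xi> = g' (w + \<zeta>) - g' w"
        have \<xi>: "g' w + \<xi> \<in> unit_ball" "g (g' w + \<xi>) - w = \<zeta>"
          using gb[OF \<eta>] z by (simp_all add: \<xi>_def)
        show "\<Phi> w \<zeta> = \<Psi> w \<zeta>"
          using beta_inv_formula[OF M \<Phi> z(1) \<xi>(1), of \<nu>] beta_inv_formula[OF M \<Psi> z(1) \<xi>(1), of \<nu>] eq
          unfolding z(2) \<xi>(2) by simp
      qed
    qed (simp add: holo_mapsD(2)[OF \<Phi>] holo_mapsD(2)[OF \<Psi>])
  qed
qed

lemma ball_auts_pair:
  assumes "g \<in> ball_auts"
  shows "ball_aut_pair g (inv_into unit_ball g)"
proof -
  have bij: "bij_betw g unit_ball unit_ball" using assms by (simp add: ball_auts_def)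
  then have "inv_into unit_ball g z \<in> unit_ball" "g (inv_into unit_ball g z) = z" "inv_into unit_ball g (g z) = z"
    "g z \<in> unit_ball" if "z \<in> unit_ball" for z
    using that by (auto simp: bij_betw_def inv_into_into f_inv_into_f inv_into_f_f)
  then show ?thesis using assms by (simp add: ball_aut_pair_def ball_auts_def)
qed

lemma G_group_subset: "G_group \<subseteq> ball_auts"
proof -
  have "topspace aut_topology \<subseteq> ball_auts"
    unfolding aut_topology_def topology_generated_by_topspace by auto
  then show ?thesis
    unfolding G_group_def by (rule order.trans[OF connected_component_of_subset_topspace])
qed

text \<open>For \<open>\<nu> \<le> 0\<close> the constant map is not square integrable: on the outer
  shell of radii from \<open>t\<close> to 1 the density is at least a constant times
  \<open>1 / (1 - t\<^sup>2)\<^sup>2\<close>, while the shell has volume at least a constant times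
  \<open>1 - t\<close>. The product is unbounded as \<open>t\<close> tends to 1.\<close>

lemma square_integrable_weight_pos:
  assumes c: "c > 0" and sub: "polynomial_maps (hom_polys 0) \<subseteq> (H2_hom c \<nu> 0 :: (complex^'d \<Rightarrow> complex^'d \<Rightarrow> complex) set)"
  shows "0 < \<nu>"
proof (rule ccontr)
  assume "\<not> 0 < \<nu>"
  then have \<nu>: "\<nu> \<le> 0" by simp
  define \<Phi> :: "complex^'d \<Rightarrow> complex^'d \<Rightarrow> complex" where "\<Phi> z = (if z \<in> unit_ball then (\<lambda>_. 1) else (\<lambda>_. 0))" for z
  have "\<Phi> \<in> polynomial_maps (hom_polys 0)"
    unfolding polynomial_maps_def \<Phi>_def using hom_polys_one hom_polys_subset_deg_polys[of 0 0]
    by (auto intro!: exI[of _ 0] bexI[of _ "\<lambda>_. 1"])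
  then have \<Phi>: "\<Phi> \<in> holo_maps (hom_polys 0)"
    and fin: "(\<integral>\<^sup>+x. ennreal (hom_density \<nu> 0 \<Phi> x) \<partial>inv_measure c) < \<infinity>"
    using sub by (auto simp: H2_hom_iff)
  define h where "h = hnorm 0 (\<lambda>_ :: complex^'d. 1)"
  have h: "0 < h"
  proof -
    have "pcoeff 1 (\<lambda>_. 0) (\<lambda>_ :: complex^'d. 1) = 1"
      using pcoeff_zmonom[of "\<lambda>_. 0" 1 "\<lambda>_. 0"] by simp
    moreover have "{m :: 'd \<Rightarrow> nat. (\<Sum>i\<in>UNIV. m i) = 0} = {\<lambda>_. 0}" by auto
    ultimately show ?thesis unfolding h_def hnorm_def using fnorm_pos by simp
  qed
  define V where "V = unit_ball_vol (real DIM(complex^'d))"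
  have V: "0 < V" by (simp add: V_def)
  define I where "I = (\<integral>\<^sup>+x. ennreal (inv_weight c x) * ennreal (hom_density \<nu> 0 \<Phi> x) \<partial>(ball_lborel :: (complex^'d) measure))"
  have fin': "I < \<infinity>" using fin unfolding I_def by (simp add: nn_integral_inv_measure[OF hom_density_measurable[OF \<Phi>]])
  have lower: "ennreal (c * h / (4 * (1 - t)) * V) \<le> I" if t: "0 < t" "t < 1" for t
  proof -
    define S where "S = unit_ball - ball (0 :: complex^'d) t"
    have S: "S \<in> sets borel" "S \<subseteq> unit_ball" by (auto simp: S_def unit_ball_eq_ball)
    \<comment> \<open>The power of \<open>t\<close> in the volume of the inner ball is replaced by
      \<open>t\<close> itself, which bounds the shell volume below by
      \<open>V * (1 - t)\<close>.\<close>
    have "t ^ DIM(complex^'d) \<le> t ^ 1" using t by (intro power_decreasing) (auto simp: Suc_leI)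
    then have "V * t ^ DIM(complex^'d) \<le> V * t" using V by (intro mult_left_mono) (simp_all only: power_one_right less_imp_le)
    then have le: "V * (1 - t) \<le> V * 1 ^ DIM(complex^'d) - V * t ^ DIM(complex^'d)"
      unfolding power_one right_diff_distrib by linarith
    have "emeasure lborel S = emeasure lborel (ball (0 :: complex^'d) 1) - emeasure lborel (ball (0 :: complex^'d) t)"
      unfolding S_def unit_ball_eq_ball using t by (intro emeasure_Diff) (auto simp: emeasure_ball)
    also have "\<dots> = ennreal (V * 1 ^ DIM(complex^'d) - V * t ^ DIM(complex^'d))"
      using t V by (simp add: emeasure_ball V_def ennreal_minus)
    finally have emS: "ennreal (V * (1 - t)) \<le> emeasure lborel S" using le by (simp add: ennreal_leI)
    have pt: "c * h / (1 - t\<^sup>2)\<^sup>2 \<le> inv_weight c x * hom_density \<nu> 0 \<Phi> x" if x: "x \<in> S" for x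
    proof -
      define r where "r = 1 - (norm x)\<^sup>2"
      have xb: "norm x < 1" "t \<le> norm x" using x S(2) by (auto simp: S_def ball_iff)
      have r: "0 < r" "r \<le> 1" "r \<le> 1 - t\<^sup>2" using xb t by (auto simp: r_def abs_square_less_1 power_mono)
      have "inv_weight c x * hom_density \<nu> 0 \<Phi> x = c / r ^ Suc CARD('d) * (r powr \<nu> * h)"
        using S(2) x by (simp add: inv_weight_def hom_density_def r_def h_def \<Phi>_def subset_iff)
      moreover have "1 \<le> r powr \<nu>"
        using r \<nu> powr_mono'[of \<nu> 0 r] by simp
      \<comment> \<open>The exponent \<open>d + 1\<close> is at least 2, and two powers of the small
        defect already outweigh the single factor \<open>1 - t\<close> from the volume.\<close>
      moreover have "r ^ Suc CARD('d) \<le> (1 - t\<^sup>2)\<^sup>2"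
      proof -
        have "r ^ Suc CARD('d) \<le> r ^ 2" using r by (intro power_decreasing) auto
        also have "\<dots> \<le> (1 - t\<^sup>2)\<^sup>2" using r by (intro power_mono) auto
        finally show ?thesis .
      qed
      moreover have "c * h / (1 - t\<^sup>2)\<^sup>2 \<le> c * h / r ^ Suc CARD('d)" if "r ^ Suc CARD('d) \<le> (1 - t\<^sup>2)\<^sup>2"
        using that c h r by (intro divide_left_mono mult_pos_pos) (auto simp del: power_Suc)
      moreover have "c * h / r ^ Suc CARD('d) * 1 \<le> c * h / r ^ Suc CARD('d) * r powr \<nu>" if "1 \<le> r powr \<nu>"
        using that c h r by (intro mult_left_mono) (auto simp del: power_Suc)
      ultimately show ?thesis by (simp add: mult_ac del: power_Suc)
    qed
    have "c * h / (4 * (1 - t)) * V \<le> c * h / (1 - t\<^sup>2)\<^sup>2 * (V * (1 - t))"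
    proof -
      have "(1 - t\<^sup>2)\<^sup>2 = (1 - t)\<^sup>2 * (1 + t)\<^sup>2" by (simp add: power2_eq_square algebra_simps)
      then have "c * h / (1 - t\<^sup>2)\<^sup>2 * (V * (1 - t)) = c * h * V / ((1 - t) * (1 + t)\<^sup>2)"
        using t by (simp add: power2_eq_square)
      moreover have "(1 - t) * (1 + t)\<^sup>2 \<le> (1 - t) * 4"
        using t power_mono[of "1 + t" 2 2] by (intro mult_left_mono) auto
      then have "c * h * V / ((1 - t) * 4) \<le> c * h * V / ((1 - t) * (1 + t)\<^sup>2)"
        using t c h V by (intro divide_left_mono) auto
      ultimately show ?thesis by (simp add: mult_ac)
    qed
    then have "ennreal (c * h / (4 * (1 - t)) * V) \<le> ennreal (c * h / (1 - t\<^sup>2)\<^sup>2) * ennreal (V * (1 - t))"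
      using t c h V by (subst ennreal_mult[symmetric]) (auto intro: ennreal_leI)
    also have "\<dots> \<le> ennreal (c * h / (1 - t\<^sup>2)\<^sup>2) * emeasure lborel S" by (intro mult_left_mono emS) auto
    also have "\<dots> = (\<integral>\<^sup>+x. ennreal (c * h / (1 - t\<^sup>2)\<^sup>2) * indicator S x \<partial>lborel)"
      using S by (simp add: nn_integral_cmult_indicator)
    also have "\<dots> \<le> (\<integral>\<^sup>+x. ennreal (inv_weight c x) * ennreal (hom_density \<nu> 0 \<Phi> x) * indicator unit_ball x \<partial>lborel)"
    proof (rule nn_integral_mono)
      fix x :: "complex^'d"
      show "ennreal (c * h / (1 - t\<^sup>2)\<^sup>2) * indicator S x \<le>
          ennreal (inv_weight c x) * ennreal (hom_density \<nu> 0 \<Phi> x) * indicator unit_ball x"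
        using pt[of x] S(2) inv_weight_nonneg[OF c, of x] hom_density_nonneg[of \<nu> 0 \<Phi> x]
        by (auto simp: indicator_def ennreal_mult[symmetric] intro: ennreal_leI)
    qed
    also have "\<dots> = I"
      unfolding I_def by (rule nn_integral_restrict_space[symmetric]) simp
    finally show ?thesis .
  qed
  obtain B where B: "I = ennreal B" "0 \<le> B" using fin' by (cases I) auto
  define k where "k = c * h * V / 4"
  have k: "0 < k" using c h V by (simp add: k_def)
  \<comment> \<open>Solves \<open>k / (1 - t) = B + k + 1\<close>, so that the lower bound exceeds
    the supposed value \<open>B\<close> of the integral.\<close>
  define t where "t = 1 - k / (B + k + 1)"
  have t: "0 < t" "t < 1" using k B by (auto simp: t_def divide_less_eq)
  have "1 - t = k / (B + k + 1)" by (simp add: t_def)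
  then have "k / (1 - t) = B + k + 1" using k B by simp
  moreover have "c * h / (4 * (1 - t)) * V = k / (1 - t)" by (simp add: k_def)
  ultimately have "c * h / (4 * (1 - t)) * V = B + k + 1" by (simp only:)
  then have "B + k + 1 \<le> B" using lower[OF t] B k by (simp add: ennreal_le_iff)
  then show False using k by simp
qed

section \<open>Square integrability of the image\<close>

definition circle_point :: "real \<Rightarrow> complex" where
  "circle_point x = exp (2 * of_real pi * \<i> * of_real x)"

lemma norm_circle_point [simp]: "cmod (circle_point x) = 1"
  by (simp add: circle_point_def)

lemma continuous_circle_point: "continuous_on S circle_point"
  unfolding circle_point_def[abs_def] by (intro continuous_intros)

text \<open>Cauchy's formula is applied to the square of \<open>f\<close>, which yields the
  inequality for the squared modulus directly.\<close>

lemma circle_mean_value: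
  assumes hol: "f holomorphic_on cball 0 1"
  shows "ennreal ((cmod (f 0))\<^sup>2) \<le> (\<integral>\<^sup>+x. ennreal ((cmod (f (circle_point x)))\<^sup>2) * indicator {0..1} x \<partial>lborel)"
proof -
  define F where "F z = (f z)\<^sup>2" for z
  have holF: "F holomorphic_on cball 0 1" unfolding F_def[abs_def] by (intro holomorphic_intros hol)
  have contF: "continuous_on {0..1} (\<lambda>x. F (circle_point x))"
    by (rule continuous_on_compose2[OF holomorphic_on_imp_continuous_on[OF holF] continuous_circle_point]) auto
  have "((\<lambda>u. F u / (u - 0)) has_contour_integral (2 * of_real pi * \<i> * F 0)) (circlepath 0 1)"
    by (rule Cauchy_integral_circlepath_simple[OF holF]) simp
  then have "((\<lambda>x. F (circlepath 0 1 x) / (circlepath 0 1 x - 0) * vector_derivative (circlepath 0 1) (at x within {0..1}))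
      has_integral 2 * of_real pi * \<i> * F 0) {0..1}"
    unfolding has_contour_integral_def .
  then have "((\<lambda>x. 2 * of_real pi * \<i> * F (circle_point x)) has_integral 2 * of_real pi * \<i> * F 0) {0..1}"
  proof (rule has_integral_eq[rotated])
    fix x :: real assume x: "x \<in> {0..1}"
    have "circlepath 0 1 x = circle_point x" by (simp add: circlepath circle_point_def)
    moreover have "vector_derivative (circlepath 0 1) (at x within {0..1}) = 2 * of_real pi * \<i> * circle_point x"
      using x by (simp add: vector_derivative_circlepath01 circle_point_def)
    moreover have "circle_point x \<noteq> 0" by (simp add: circle_point_def)
    ultimately show "F (circlepath 0 1 x) / (circlepath 0 1 x - 0) * vector_derivative (circlepath 0 1) (at x within {0..1}) =
        2 * of_real pi * \<i> * F (circle_point x)" by simp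
  qed
  then have int: "((\<lambda>x. F (circle_point x)) has_integral F 0) {0..1}"
    using has_integral_mult_right[of "\<lambda>x. 2 * of_real pi * \<i> * F (circle_point x)" "2 * of_real pi * \<i> * F 0" "{0..1}" "1 / (2 * of_real pi * \<i>)"]
    by simp
  have cont: "continuous_on {0..1} (\<lambda>x. cmod (F (circle_point x)))" by (intro continuous_intros contF)
  have "cmod (integral {0..1} (\<lambda>x. F (circle_point x))) \<le> integral {0..1} (\<lambda>x. cmod (F (circle_point x)))"
    using int cont by (intro integral_norm_bound_integral) (auto intro: integrable_continuous_interval)
  then have "cmod (F 0) \<le> integral {0..1} (\<lambda>x. cmod (F (circle_point x)))" using integral_unique[OF int] by simp
  then have "ennreal (cmod (F 0)) \<le> ennreal (integral {0..1} (\<lambda>x. cmod (F (circle_point x))))" by (rule ennreal_leI)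
  also have "\<dots> = (\<integral>\<^sup>+x. ennreal (cmod (F (circle_point x))) * indicator {0..1} x \<partial>lborel)"
    by (rule nn_integral_has_integral_lebesgue'[symmetric])
      (auto intro: integrable_integral integrable_continuous_interval cont)
  finally show ?thesis by (simp add: F_def norm_power)
qed

text \<open>For each displacement \<open>u\<close> in the ball the circle inequality is used on the
  line through \<open>u\<close>, then integrated over \<open>u\<close>. After exchanging the
  integrals, each rotation by a point of the circle preserves Lebesgue measure and drops
  out.\<close>

lemma ball_mean_value:
  fixes F :: "complex^'d \<Rightarrow> complex"
  assumes F: "holo_on unit_ball F" and y: "norm y + \<rho> \<le> 1"
  shows "ennreal ((cmod (F y))\<^sup>2) * emeasure lborel (ball (0 :: complex^'d) \<rho>) \<le>
    (\<integral>\<^sup>+w. ennreal ((cmod (F w))\<^sup>2) * indicator (ball y \<rho>) w \<partial>lborel)"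
proof -
  let ?B = "ball (0 :: complex^'d) \<rho>"
  define k where "k u x = ennreal ((cmod (F (y + circle_point x *s u)))\<^sup>2) * indicator ?B u" for u x
  define k0 where "k0 u = ennreal ((cmod (F (y + u)))\<^sup>2) * indicator ?B u" for u
  have in_ball: "y + t *s u \<in> unit_ball" if "norm u < \<rho>" "cmod t \<le> 1" for t u
  proof -
    have "norm (t *s u) \<le> norm u" using that(2) by (simp add: mult_left_le_one_le)
    then show ?thesis using norm_triangle_ineq[of y "t *s u"] y that(1) by (simp add: ball_iff)
  qed
  have sub: "ball y \<rho> \<subseteq> unit_ball"
  proof
    fix w assume "w \<in> ball y \<rho>"
    then show "w \<in> unit_ball" using in_ball[of "w - y" 1] by (simp add: dist_norm norm_minus_commute)
  qed
  have cont: "continuous_on (?B \<times> UNIV) (\<lambda>p. (cmod (F (y + circle_point (snd p) *s fst p)))\<^sup>2)"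
    by (intro continuous_intros continuous_on_compose2[OF holo_on_continuous[OF F]] continuous_smult
        continuous_on_compose2[OF continuous_circle_point[of UNIV]]) (auto intro!: in_ball)
  have "(\<lambda>p. indicator (?B \<times> UNIV) p *\<^sub>R (cmod (F (y + circle_point (snd p) *s fst p)))\<^sup>2) \<in> borel_measurable borel"
    using borel_measurable_continuous_on_indicator[OF _ cont] by (simp add: borel_open open_Times)
  then have m1: "(\<lambda>p. ennreal (indicator (?B \<times> UNIV) p *\<^sub>R (cmod (F (y + circle_point (snd p) *s fst p)))\<^sup>2)) \<in> borel_measurable borel"
    by measurable
  have eq1: "(\<lambda>p. ennreal (indicator (?B \<times> UNIV) p *\<^sub>R (cmod (F (y + circle_point (snd p) *s fst p)))\<^sup>2)) = (\<lambda>(u, x). k u x)"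
    by (auto simp: k_def fun_eq_iff indicator_def)
  have "(\<lambda>(u, x). k u x) \<in> borel_measurable (borel \<Otimes>\<^sub>M borel)" using m1 by (simp only: eq1 borel_prod)
  then have mk: "(\<lambda>(u, x). k u x) \<in> borel_measurable ((lborel :: (complex^'d) measure) \<Otimes>\<^sub>M lborel)"
    by (simp add: measurable_cong_sets[OF sets_pair_measure_cong[OF sets_lborel sets_lborel] refl])
  have mk': "(\<lambda>(u, x). k u x * indicator {0..1} x) \<in> borel_measurable ((lborel :: (complex^'d) measure) \<Otimes>\<^sub>M lborel)"
    using mk by measurable
  have "ennreal ((cmod (F y))\<^sup>2) * emeasure lborel ?B = (\<integral>\<^sup>+u. ennreal ((cmod (F y))\<^sup>2) * indicator ?B u \<partial>lborel)"
    by (simp add: nn_integral_cmult_indicator)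
  also have "\<dots> \<le> (\<integral>\<^sup>+u. (\<integral>\<^sup>+x. k u x * indicator {0..1} x \<partial>lborel) \<partial>lborel)"
  proof (rule nn_integral_mono)
    fix u :: "complex^'d"
    show "ennreal ((cmod (F y))\<^sup>2) * indicator ?B u \<le> (\<integral>\<^sup>+x. k u x * indicator {0..1} x \<partial>lborel)"
    proof (cases "u \<in> ?B")
      case True
      have "(\<lambda>t. F (y + t *s u)) holomorphic_on cball 0 1"
        by (rule holo_on_line[OF F]) (use True in_ball in auto)
      from circle_mean_value[OF this] show ?thesis using True by (simp add: k_def)
    qed simp
  qed
  also have "\<dots> = (\<integral>\<^sup>+x. (\<integral>\<^sup>+u. k u x * indicator {0..1} x \<partial>lborel) \<partial>lborel)"
    by (rule lborel_pair.Fubini'[OF mk', symmetric])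
  also have "\<dots> = (\<integral>\<^sup>+x. (\<integral>\<^sup>+u. k0 u \<partial>lborel) * indicator {0..1} (x :: real) \<partial>lborel)"
  proof (rule nn_integral_cong)
    fix x :: real
    define V where "V u = circle_point x *s u" for u :: "complex^'d"
    have V: "cisometry V" unfolding V_def[abs_def] by (auto simp: cisometry_def intro: clinear_smult)
    have "linear V" using V clinear_imp_linear by (auto simp: cisometry_def)
    then have mV: "V \<in> borel_measurable borel"
      by (intro borel_measurable_continuous_onI linear_continuous_on) (simp add: linear_conv_bounded_linear)
    have "continuous_on ?B (\<lambda>u. (cmod (F (y + u)))\<^sup>2)"
      by (intro continuous_intros continuous_on_compose2[OF holo_on_continuous[OF F]]) (use sub in \<open>auto simp: subset_eq\<close>)
    then have "(\<lambda>u. indicator ?B u *\<^sub>R (cmod (F (y + u)))\<^sup>2) \<in> borel_measurable borel"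
      by (intro borel_measurable_continuous_on_indicator) auto
    then have m0: "(\<lambda>u. ennreal (indicator ?B u *\<^sub>R (cmod (F (y + u)))\<^sup>2)) \<in> borel_measurable borel" by measurable
    have eq0: "(\<lambda>u. ennreal (indicator ?B u *\<^sub>R (cmod (F (y + u)))\<^sup>2)) = k0"
      by (auto simp: k0_def fun_eq_iff indicator_def)
    have mk0: "k0 \<in> borel_measurable borel" using m0 by (simp only: eq0)
    have kV: "k u x = k0 (V u)" for u by (simp add: k_def k0_def V_def indicator_def)
    have "(\<integral>\<^sup>+u. k u x * indicator {0..1} x \<partial>lborel) = (\<integral>\<^sup>+u. k0 (V u) \<partial>lborel) * indicator {0..1} x"
      unfolding kV by (rule nn_integral_multc) (use measurable_compose[OF mV mk0] in simp)
    also have "(\<integral>\<^sup>+u. k0 (V u) \<partial>lborel) = (\<integral>\<^sup>+u. k0 u \<partial>distr lborel borel V)"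
      by (rule nn_integral_distr[symmetric]) (use mV mk0 in auto)
    also have "distr lborel borel V = lborel" by (rule lborel_isometry[OF V])
    finally show "(\<integral>\<^sup>+u. k u x * indicator {0..1} x \<partial>lborel) = (\<integral>\<^sup>+u. k0 u \<partial>lborel) * indicator {0..1} x" .
  qed
  also have "\<dots> = (\<integral>\<^sup>+u. k0 u \<partial>lborel)" by (simp add: nn_integral_cmult_indicator)
  also have "\<dots> = (\<integral>\<^sup>+w. ennreal ((cmod (F w))\<^sup>2) * indicator (ball y \<rho>) w \<partial>distr lborel borel ((+) y))"
  proof -
    have "continuous_on (ball y \<rho>) (\<lambda>w. (cmod (F w))\<^sup>2)"
      by (intro continuous_intros continuous_on_subset[OF holo_on_continuous[OF F]] sub)
    then have "(\<lambda>w. indicator (ball y \<rho>) w *\<^sub>R (cmod (F w))\<^sup>2) \<in> borel_measurable borel"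
      by (intro borel_measurable_continuous_on_indicator) auto
    then have m2: "(\<lambda>w. ennreal (indicator (ball y \<rho>) w *\<^sub>R (cmod (F w))\<^sup>2)) \<in> borel_measurable borel" by measurable
    have eq2: "(\<lambda>w. ennreal (indicator (ball y \<rho>) w *\<^sub>R (cmod (F w))\<^sup>2)) =
        (\<lambda>w. ennreal ((cmod (F w))\<^sup>2) * indicator (ball y \<rho>) w)"
      by (auto simp: fun_eq_iff indicator_def)
    have "(\<lambda>w. ennreal ((cmod (F w))\<^sup>2) * indicator (ball y \<rho>) w) \<in> borel_measurable (distr lborel borel ((+) y))"
      using m2 by (simp only: eq2 measurable_distr_eq1)
    then have "(\<integral>\<^sup>+w. ennreal ((cmod (F w))\<^sup>2) * indicator (ball y \<rho>) w \<partial>distr lborel borel ((+) y)) =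
        (\<integral>\<^sup>+u. ennreal ((cmod (F (y + u)))\<^sup>2) * indicator (ball y \<rho>) (y + u) \<partial>lborel)"
      by (intro nn_integral_distr) auto
    moreover have "indicator (ball y \<rho>) (y + u) = (indicator ?B u :: ennreal)" for u by (simp add: indicator_def dist_norm)
    ultimately show ?thesis by (simp add: k0_def)
  qed
  finally show ?thesis unfolding lborel_distr_plus .
qed

text \<open>The squared norm of \<open>msqrt w u\<close> is \<open>s\<^sup>2\<close> times the
  squared norm of \<open>u\<close> minus the squared modulus of its pairing with \<open>w\<close>;
  Cauchy-Schwarz leaves a second factor \<open>s\<^sup>2\<close>.\<close>

lemma msqrt_bounded_below:
  assumes w: "w \<in> unit_ball"
  shows "(1 - (norm w)\<^sup>2) * norm u \<le> norm (msqrt w u)"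
proof -
  define s where "s = defect w"
  have s: "s\<^sup>2 = 1 - (norm w)\<^sup>2" using defect_sq[OF w] by (simp add: s_def)
  have "hprod (msqrt w u) (msqrt w u) = hprod u (msqrt w (msqrt w u))" by (rule msqrt_self_adjoint)
  also have "\<dots> = (of_real s)\<^sup>2 * (hprod u u - hprod u w * cnj (hprod u w))"
    unfolding msqrt_msqrt[OF w] hprod_scale_right hprod_diff_right by (simp add: s_def mult.commute)
  also have "\<dots> = of_real (s\<^sup>2 * ((norm u)\<^sup>2 - (cmod (hprod u w))\<^sup>2))"
    unfolding hprod_self complex_norm_square[symmetric] by simp
  finally have "hprod (msqrt w u) (msqrt w u) = of_real (s\<^sup>2 * ((norm u)\<^sup>2 - (cmod (hprod u w))\<^sup>2))" .
  then have "(norm (msqrt w u))\<^sup>2 = s\<^sup>2 * ((norm u)\<^sup>2 - (cmod (hprod u w))\<^sup>2)"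
    unfolding hprod_self of_real_eq_iff .
  also have "\<dots> \<ge> s\<^sup>2 * ((norm u)\<^sup>2 - (norm u * norm w)\<^sup>2)"
    by (intro mult_left_mono diff_left_mono power_mono norm_hprod_le) auto
  also have "s\<^sup>2 * ((norm u)\<^sup>2 - (norm u * norm w)\<^sup>2) = (s\<^sup>2 * norm u)\<^sup>2"
    unfolding s by (simp add: power2_eq_square algebra_simps)
  finally have "(s\<^sup>2 * norm u)\<^sup>2 \<le> (norm (msqrt w u))\<^sup>2" .
  then show ?thesis unfolding s[symmetric] by (rule power2_le_imp_le) simp
qed

lemma msqrt_surj_bound:
  fixes w \<zeta> :: "complex^'d"
  assumes w: "w \<in> unit_ball"
  obtains \<xi> where "msqrt w \<xi> = \<zeta>" "(1 - (norm w)\<^sup>2) * norm \<xi> \<le> norm \<zeta>"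
proof -
  have lin: "linear (msqrt w)" by (rule clinear_imp_linear[OF clinear_msqrt])
  have pos: "0 < 1 - (norm w)\<^sup>2" using w by (simp add: ball_iff abs_square_less_1)
  have "inj (msqrt w)"
    unfolding linear_injective_0[OF lin]
  proof (intro allI impI)
    fix u assume "msqrt w u = 0"
    then have "(1 - (norm w)\<^sup>2) * norm u \<le> 0" using msqrt_bounded_below[OF w, of u] by simp
    then show "u = 0" using pos by (simp add: mult_le_0_iff)
  qed
  then have "surj (msqrt w)" by (simp add: linear_injective_imp_surjective[OF lin])
  then obtain \<xi> where "msqrt w \<xi> = \<zeta>" by (metis surjD)
  then show ?thesis using that msqrt_bounded_below[OF w, of \<xi>] by simp
qed

text \<open>On the ball of radius 1/2 the vector \<zeta> is \<open>msqrt w \<xi>\<close> with the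
  norm of \<xi> at most twice that of \<zeta>, because \<open>1 - (norm w)\<^sup>2\<close> is at
  least 1/2. The value is then a point evaluation of the polynomial in the density. The factor
  \<open>2 powr \<nu>\<close> pays for the weight and \<open>1 / c\<close> for the invariant
  measure.\<close>

lemma pointwise_density_bound:
  assumes c: "c > 0" and \<nu>: "0 < \<nu>"
  obtains K where "K \<ge> 0" "\<And>(\<Psi> :: complex^'d \<Rightarrow> complex^'d \<Rightarrow> complex) w. \<Psi> \<in> holo_maps (hom_polys l) \<Longrightarrow> w \<in> ball 0 (1/2) \<Longrightarrow>
    (cmod (\<Psi> w \<zeta>))\<^sup>2 \<le> K * (inv_weight c w * hom_density \<nu> l \<Psi> w)"
proof -
  obtain C where C: "C > 0" "\<And>(\<phi> :: complex^'d \<Rightarrow> complex) \<zeta>. \<phi> \<in> hom_polys l \<Longrightarrow>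
    (cmod (\<phi> \<zeta>))\<^sup>2 \<le> C * norm \<zeta> ^ (2 * l) * hnorm l \<phi>"
    by (rule hnorm_bounds_value[of l]) blast
  define N where "N = (2 * norm \<zeta>) ^ (2 * l)"
  define K where "K = C * N * 2 powr \<nu> / c"
  have N: "0 \<le> N" by (simp add: N_def)
  show ?thesis
  proof (rule that[of K])
    show "K \<ge> 0" using C c N by (simp add: K_def)
    fix \<Psi> :: "complex^'d \<Rightarrow> complex^'d \<Rightarrow> complex" and w :: "complex^'d"
    assume \<Psi>: "\<Psi> \<in> holo_maps (hom_polys l)" and w: "w \<in> ball 0 (1/2)"
    have wb: "w \<in> unit_ball" using w by (simp add: ball_iff)
    define r where "r = 1 - (norm w)\<^sup>2"
    have "(norm w)\<^sup>2 \<le> (1/2)\<^sup>2" using w by (intro power_mono) auto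
    then have r: "1/2 \<le> r" "r \<le> 1" by (auto simp: r_def power2_eq_square)
    obtain \<xi> where \<xi>: "msqrt w \<xi> = \<zeta>" "r * norm \<xi> \<le> norm \<zeta>"
      unfolding r_def by (rule msqrt_surj_bound[OF wb])
    have "1/2 * norm \<xi> \<le> r * norm \<xi>" using r by (intro mult_right_mono) auto
    then have n\<xi>: "norm \<xi> \<le> 2 * norm \<zeta>" using \<xi>(2) by linarith
    let ?h = "hnorm l (\<lambda>\<xi>. \<Psi> w (msqrt w \<xi>))"
    have hom: "(\<lambda>\<xi>. \<Psi> w (msqrt w \<xi>)) \<in> hom_polys l"
      by (rule hom_polys_comp_clinear[OF holo_mapsD(1)[OF \<Psi> wb] clinear_msqrt])
    have "(cmod (\<Psi> w \<zeta>))\<^sup>2 \<le> C * norm \<xi> ^ (2 * l) * ?h" using C(2)[OF hom, of \<xi>] \<xi>(1) by simp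
    also have "\<dots> \<le> C * N * ?h"
      unfolding N_def using C n\<xi> by (intro mult_right_mono mult_left_mono power_mono hnorm_nonneg) auto
    also have "\<dots> \<le> C * N * (2 powr \<nu> * hom_density \<nu> l \<Psi> w)"
    proof -
      have "1 = (2 * (1/2)) powr \<nu>" by simp
      also have "\<dots> \<le> (2 * r) powr \<nu>" using r \<nu> by (intro powr_mono2) auto
      also have "\<dots> = 2 powr \<nu> * r powr \<nu>" using r by (simp add: powr_mult)
      finally have "1 * ?h \<le> (2 powr \<nu> * r powr \<nu>) * ?h" by (intro mult_right_mono hnorm_nonneg)
      then show ?thesis using C N by (intro mult_left_mono) (simp_all add: hom_density_def r_def mult.assoc)
    qed
    also have "\<dots> = K * (c * hom_density \<nu> l \<Psi> w)" using c by (simp add: K_def)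
    also have "\<dots> \<le> K * (inv_weight c w * hom_density \<nu> l \<Psi> w)"
    proof -
      have "r ^ Suc CARD('d) \<le> 1" using r by (intro power_le_one) auto
      then have "c \<le> inv_weight c w" unfolding inv_weight_def r_def[symmetric] using c r
        by (simp add: le_divide_eq del: power_Suc)
      then show ?thesis using C c N hom_density_nonneg
        by (intro mult_left_mono mult_right_mono) (auto simp: K_def)
    qed
    finally show "(cmod (\<Psi> w \<zeta>))\<^sup>2 \<le> K * (inv_weight c w * hom_density \<nu> l \<Psi> w)" .
  qed
qed

text \<open>Cauchy's inequality along the line through \<open>\<zeta>\<close>, combined with the mean value property.\<close>

lemma I_op_local_bound:
  assumes c: "c > 0" and \<nu>: "0 < \<nu>"
  obtains K where "K \<ge> 0" "\<And>(\<Psi> :: complex^'d \<Rightarrow> complex^'d \<Rightarrow> complex). \<Psi> \<in> holo_maps (hom_polys l) \<Longrightarrow>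
    ennreal ((cmod (I_op \<nu> n l \<Psi> 0 \<zeta>))\<^sup>2) \<le>
      ennreal K * (\<integral>\<^sup>+w. ennreal (hom_density \<nu> l \<Psi> w) * indicator (ball 0 (1/2)) w \<partial>inv_measure c)"
proof -
  obtain K0 where K0: "K0 \<ge> 0" "\<And>(\<Psi> :: complex^'d \<Rightarrow> complex^'d \<Rightarrow> complex) w. \<Psi> \<in> holo_maps (hom_polys l) \<Longrightarrow> w \<in> ball 0 (1/2) \<Longrightarrow>
    (cmod (\<Psi> w \<zeta>))\<^sup>2 \<le> K0 * (inv_weight c w * hom_density \<nu> l \<Psi> w)"
    by (rule pointwise_density_bound[OF c \<nu>, of l \<zeta>]) blast
  \<comment> \<open>The disc of radius \<open>r\<close> along \<zeta> stays within norm 1/4, so that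
    balls of radius 1/4 about its points remain inside the ball of radius 1/2.\<close>
  define r where "r = 1 / (4 * (norm \<zeta> + 1))"
  have nz: "0 < norm \<zeta> + 1" by (simp add: add_nonneg_pos)
  have r: "0 < r" using nz by (simp add: r_def)
  have r\<zeta>: "r * norm \<zeta> \<le> 1/4"
  proof -
    have "r * norm \<zeta> \<le> r * (norm \<zeta> + 1)" using r by simp
    also have "\<dots> = 1/4" using nz by (simp add: r_def)
    finally show ?thesis .
  qed
  define S0 where "S0 = (\<Sum>k\<le>n - l. cmod (I_coeff \<nu> n l k) * (fact k / r ^ k))"
  \<comment> \<open>The summand 1 keeps \<open>S\<close> positive, so the right side is infinite
    whenever \<open>A\<close> is.\<close>
  define S where "S = S0 + 1"
  have "0 \<le> S0" unfolding S0_def using r by (intro sum_nonneg) auto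
  then have S: "0 < S" by (simp add: S_def)
  define v where "v = measure lborel (ball (0 :: complex^'d) (1/4))"
  have v: "0 < v" by (simp add: v_def)
  have emv: "emeasure lborel (ball (0 :: complex^'d) (1/4)) = ennreal v"
    unfolding v_def by (rule emeasure_eq_ennreal_measure) (simp add: emeasure_ball)
  show ?thesis
  proof (rule that[of "S\<^sup>2 / v * K0"])
    show "S\<^sup>2 / v * K0 \<ge> 0" using v K0 by simp
    fix \<Psi> :: "complex^'d \<Rightarrow> complex^'d \<Rightarrow> complex"
    assume \<Psi>: "\<Psi> \<in> holo_maps (hom_polys l)"
    note hol = holo_mapsD(3)[OF \<Psi>, of \<zeta>]
    define H where "H = (\<integral>\<^sup>+w. ennreal (hom_density \<nu> l \<Psi> w) * indicator (ball 0 (1/2)) w \<partial>inv_measure c)"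
    define A where "A = (\<integral>\<^sup>+w. ennreal ((cmod (\<Psi> w \<zeta>))\<^sup>2) * indicator (ball 0 (1/2)) w \<partial>lborel)"
    have AH: "A \<le> ennreal K0 * H"
    proof -
      have ball_sub: "ball (0 :: complex^'d) (1/2) \<subseteq> unit_ball" by (auto simp: ball_iff)
      have m: "(\<lambda>w. ennreal (hom_density \<nu> l \<Psi> w) * indicator (ball 0 (1/2)) w) \<in> borel_measurable ball_lborel"
        using hom_density_measurable[OF \<Psi>] ball_sub
        by (intro borel_measurable_times_ennreal borel_measurable_indicator) (auto simp: sets_ball_lborel)
      have "A \<le> (\<integral>\<^sup>+w. ennreal K0 * (ennreal (inv_weight c w) * (ennreal (hom_density \<nu> l \<Psi> w) *
          indicator (ball 0 (1/2)) w)) * indicator unit_ball w \<partial>lborel)"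
        unfolding A_def
      proof (rule nn_integral_mono)
        fix w :: "complex^'d"
        show "ennreal ((cmod (\<Psi> w \<zeta>))\<^sup>2) * indicator (ball 0 (1/2)) w \<le> ennreal K0 * (ennreal (inv_weight c w) *
            (ennreal (hom_density \<nu> l \<Psi> w) * indicator (ball 0 (1/2)) w)) * indicator unit_ball w"
        proof (cases "w \<in> ball 0 (1/2)")
          case True
          then have wb: "w \<in> unit_ball" using ball_sub by blast
          have "ennreal K0 * (ennreal (inv_weight c w) * ennreal (hom_density \<nu> l \<Psi> w)) =
              ennreal (K0 * (inv_weight c w * hom_density \<nu> l \<Psi> w))"
            using K0(1) inv_weight_nonneg[OF c wb] hom_density_nonneg[of \<nu> l \<Psi> w] by (simp add: ennreal_mult)
          then show ?thesis using True wb ennreal_leI[OF K0(2)[OF \<Psi> True]] by simp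
        qed simp
      qed
      also have "\<dots> = (\<integral>\<^sup>+w. ennreal K0 * (ennreal (inv_weight c w) * (ennreal (hom_density \<nu> l \<Psi> w) *
          indicator (ball 0 (1/2)) w)) \<partial>ball_lborel)"
        by (rule nn_integral_restrict_space[symmetric]) simp
      also have "\<dots> = ennreal K0 * (\<integral>\<^sup>+w. ennreal (inv_weight c w) * (ennreal (hom_density \<nu> l \<Psi> w) *
          indicator (ball 0 (1/2)) w) \<partial>ball_lborel)"
        by (rule nn_integral_cmult) (intro borel_measurable_times_ennreal inv_weight_measurable m)
      also have "\<dots> = ennreal K0 * H" unfolding H_def by (simp only: nn_integral_inv_measure[OF m])
      finally show ?thesis .
    qed
    have "ennreal ((cmod (I_op \<nu> n l \<Psi> 0 \<zeta>))\<^sup>2) \<le> ennreal (S\<^sup>2 / v) * A"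
    proof (cases "A = \<infinity>")
      case True
      then show ?thesis using v S by (simp add: ennreal_mult_top)
    next
      case False
      then obtain a where a: "A = ennreal a" "0 \<le> a" by (cases A) auto
      define B where "B = sqrt (a / v)"
      \<comment> \<open>The mean value inequality over the ball of radius 1/4 about \<open>y\<close>
        supplies the uniform bound required by Cauchy's inequality.\<close>
      have bound: "cmod (\<Psi> y \<zeta>) \<le> B" if y: "norm y \<le> 1/4" for y
      proof -
        have "ennreal ((cmod (\<Psi> y \<zeta>))\<^sup>2) * ennreal v \<le> (\<integral>\<^sup>+w. ennreal ((cmod (\<Psi> w \<zeta>))\<^sup>2) * indicator (ball y (1/4)) w \<partial>lborel)"
          unfolding emv[symmetric] by (rule ball_mean_value[OF hol]) (use y in simp)
        also have "\<dots> \<le> A"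
          unfolding A_def
        proof (intro nn_integral_mono mult_left_mono)
          fix w
          have "ball y (1/4) \<subseteq> ball 0 (1/2)"
            using y by (auto simp: dist_norm) (smt (verit) norm_triangle_ineq4 norm_minus_commute diff_add_cancel norm_triangle_sub)
          then show "indicator (ball y (1/4)) w \<le> (indicator (ball 0 (1/2)) w :: ennreal)"
            by (auto simp: indicator_def)
        qed simp
        finally have "(cmod (\<Psi> y \<zeta>))\<^sup>2 * v \<le> a"
          unfolding a using v a(2) by (simp add: ennreal_mult[symmetric] ennreal_le_iff)
        then have "(cmod (\<Psi> y \<zeta>))\<^sup>2 \<le> a / v" using v by (simp add: pos_le_divide_eq)
        then show ?thesis unfolding B_def by (rule real_le_rsqrt)
      qed
      have zk: "cmod (zeta_d_pow k \<Psi> 0 \<zeta>) \<le> fact k / r ^ k * B" for k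
      proof -
        have in_ball: "0 + t *s \<zeta> \<in> unit_ball \<and> norm (t *s \<zeta>) \<le> 1/4" if "cmod t \<le> r" for t
        proof -
          have "cmod t * norm \<zeta> \<le> r * norm \<zeta>" using that by (intro mult_right_mono) auto
          then show ?thesis using r\<zeta> by (simp add: ball_iff)
        qed
        have h: "(\<lambda>t. \<Psi> (0 + t *s \<zeta>) \<zeta>) holomorphic_on cball 0 r"
          by (rule holo_on_line[OF hol]) (use in_ball in auto)
        have "cmod ((deriv ^^ k) (\<lambda>t. \<Psi> (0 + t *s \<zeta>) \<zeta>) 0) \<le> fact k * B / r ^ k"
        proof (rule Cauchy_inequality[OF _ _ r])
          show "(\<lambda>t. \<Psi> (0 + t *s \<zeta>) \<zeta>) holomorphic_on ball 0 r" by (rule holomorphic_on_subset[OF h]) auto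
          show "continuous_on (cball 0 r) (\<lambda>t. \<Psi> (0 + t *s \<zeta>) \<zeta>)" by (rule holomorphic_on_imp_continuous_on[OF h])
          show "cmod (\<Psi> (0 + t *s \<zeta>) \<zeta>) \<le> B" if "cmod (0 - t) = r" for t
            using bound[of "t *s \<zeta>"] in_ball[of t] that by simp
        qed
        then show ?thesis unfolding zeta_d_pow_line[OF \<Psi> zero_in_ball] by simp
      qed
      have "cmod (I_op \<nu> n l \<Psi> 0 \<zeta>) \<le> (\<Sum>k\<le>n - l. cmod (I_coeff \<nu> n l k) * (fact k / r ^ k * B))"
        unfolding I_op_eq[OF zero_in_ball]
        by (rule order.trans[OF norm_sum]) (unfold norm_mult, intro sum_mono mult_left_mono zk norm_ge_zero)
      also have "\<dots> = S0 * B" by (simp add: S0_def sum_distrib_right mult.assoc)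
      also have "\<dots> \<le> S * B" using a v by (intro mult_right_mono) (auto simp: S_def B_def)
      finally have "(cmod (I_op \<nu> n l \<Psi> 0 \<zeta>))\<^sup>2 \<le> (S * B)\<^sup>2" by (rule power_mono) simp
      also have "\<dots> = S\<^sup>2 / v * a" using a v by (simp add: B_def power_mult_distrib)
      finally show ?thesis unfolding a(1) using v a(2) by (simp add: ennreal_mult[symmetric] ennreal_leI)
    qed
    also have "\<dots> \<le> ennreal (S\<^sup>2 / v) * (ennreal K0 * H)" by (intro mult_left_mono AH) simp
    also have "\<dots> = ennreal (S\<^sup>2 / v * K0) * H"
    proof -
      have "ennreal (S\<^sup>2 / v * K0) = ennreal (S\<^sup>2 / v) * ennreal K0" using v K0(1) by (intro ennreal_mult) auto
      then show ?thesis by (simp only: mult.assoc)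
    qed
    finally show "ennreal ((cmod (I_op \<nu> n l \<Psi> 0 \<zeta>))\<^sup>2) \<le> ennreal (S\<^sup>2 / v * K0) *
        (\<integral>\<^sup>+w. ennreal (hom_density \<nu> l \<Psi> w) * indicator (ball 0 (1/2)) w \<partial>inv_measure c)"
      unfolding H_def .
  qed
qed

section \<open>Moving the local estimate from the origin to an arbitrary point\<close>

definition mob_log :: "complex^'d \<Rightarrow> complex^'d \<Rightarrow> complex" where
  "mob_log x z = of_real (genus TYPE('d)) * (of_real (ln (defect x)) - Ln (1 + hprod z x))"

lemma moebius_form_mob:
  fixes x :: "complex^'d"
  assumes x: "x \<in> unit_ball"
  shows "moebius_form (mob x) x (\<lambda>z. z) (mob_log x)"
proof -
  have id: "cisometry (\<lambda>z :: complex^'d. z)" by (auto simp: cisometry_def intro: clinearI)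
  have Re: "0 < Re (1 + hprod z x)" if "z \<in> unit_ball" for z
    using hprod_less_1[OF that, of x] x abs_Re_le_cmod[of "hprod z x"] by (auto simp: ball_iff)
  have p: "complex_of_real (genus TYPE('d)) = of_nat (Suc CARD('d))" by (simp add: genus_def)
  have "log_branch (mob x) (mob_log x)"
    unfolding log_branch_def
  proof (intro conjI ballI)
    show "continuous_on unit_ball (mob_log x)"
      unfolding mob_log_def[abs_def]
      by (intro continuous_intros holo_on_continuous[OF holo_on_hprod])
        (auto simp: complex_nonpos_Reals_iff dest: Re)
    fix z :: "complex^'d" assume z: "z \<in> unit_ball"
    have "exp (of_real (ln (defect x)) - Ln (1 + hprod z x)) = of_real (defect x) / (1 + hprod z x)"
      using one_plus_hprod_nz[OF z x] defect_pos[OF x] by (simp add: exp_diff exp_of_real)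
    then have "exp (mob_log x z) = (of_real (defect x) / (1 + hprod z x)) ^ Suc CARD('d)"
      unfolding mob_log_def p exp_of_nat_mult by (simp only:)
    moreover have "det (matrix (\<lambda>z :: complex^'d. z)) = 1" by (simp add: matrix_id_mat_1[unfolded id_def])
    ultimately show "exp (mob_log x z) = jac_det (mob x) z"
      using mob_isometry_derivative(2)[OF x id z, of "mob x"] by (simp only: power_divide mult_1_right)
  qed
  then show ?thesis using x id by (simp add: moebius_form_def)
qed

text \<open>The polynomial \<open>\<Delta>\<^bsub>\<zeta>,-x\<^esub>\<^sup>n (\<I>\<Phi>)\<^sub>x(B\<^bsub>x,x\<^esub>\<^bsup>1/2\<^esup> \<zeta>\<^bsup>-x\<^esup>)\<close> of the norm on the target space,
  with the denominators \<open>1 + (\<zeta>|x)\<close> cleared so that it also makes sense at their zeros.\<close>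

definition I_frame :: "real \<Rightarrow> nat \<Rightarrow> nat \<Rightarrow> (complex^'d \<Rightarrow> complex^'d \<Rightarrow> complex) \<Rightarrow> complex^'d \<Rightarrow> complex^'d \<Rightarrow> complex" where
  "I_frame \<nu> n l \<Phi> x \<zeta> = (\<Sum>k\<le>n - l. I_coeff \<nu> n l k * ((1 + hprod \<zeta> x) ^ (n - l - k) * zeta_d_pow k \<Phi> x (msqrt x \<zeta>)))"

lemma I_frame_eq:
  assumes \<Phi>: "\<Phi> \<in> holo_maps (hom_polys l)" and l: "l \<le> n" and x: "x \<in> unit_ball" and r: "1 + hprod \<zeta> x \<noteq> 0"
  shows "(1 + hprod \<zeta> x) ^ n * I_op \<nu> n l \<Phi> x ((1 / (1 + hprod \<zeta> x)) *s msqrt x \<zeta>) = I_frame \<nu> n l \<Phi> x \<zeta>"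
proof -
  let ?r = "1 + hprod \<zeta> x"
  have "?r ^ n * (I_coeff \<nu> n l k * zeta_d_pow k \<Phi> x ((1 / ?r) *s msqrt x \<zeta>)) =
      I_coeff \<nu> n l k * (?r ^ (n - l - k) * zeta_d_pow k \<Phi> x (msqrt x \<zeta>))" if "k \<le> n - l" for k
  proof -
    have "n = (n - l - k) + (l + k)" using that l by simp
    then have "?r ^ n = ?r ^ (n - l - k) * ?r ^ (l + k)" by (metis power_add)
    then show ?thesis
      using hom_polys_homogeneous[OF zeta_d_pow_hom_polys[OF \<Phi> x, of k]] r by (simp add: power_one_over)
  qed
  then show ?thesis unfolding I_frame_def I_op_eq[OF x] sum_distrib_left by (intro sum.cong refl) simp
qed

lemma deg_polys_hprod: "(\<lambda>\<zeta>. 1 + hprod \<zeta> x) \<in> deg_polys 1"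
proof -
  have "clinear (\<lambda>\<zeta>. hprod \<zeta> x *s (axis undefined 1 :: complex^'a))"
    by (rule clinearI) (auto simp: hprod_simps vec_eq_iff algebra_simps)
  from deg_polys_1_affine[OF this, of 1 undefined] show ?thesis by (simp add: axis_def)
qed

lemma I_frame_deg_polys:
  assumes \<Phi>: "\<Phi> \<in> holo_maps (hom_polys l)" and l: "l \<le> n" and x: "x \<in> unit_ball"
  shows "I_frame \<nu> n l \<Phi> x \<in> deg_polys n"
  unfolding I_frame_def[abs_def]
proof (intro deg_polys_sum deg_polys_scale)
  fix k assume k: "k \<in> {..n - l}"
  have "(\<lambda>\<zeta>. (1 + hprod \<zeta> x) ^ (n - l - k)) \<in> deg_polys (n - l - k)"
    using deg_polys_power[OF deg_polys_hprod[of x], of "n - l - k"] by simp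
  moreover have "(\<lambda>\<zeta>. zeta_d_pow k \<Phi> x (msqrt x \<zeta>)) \<in> deg_polys (l + k)"
    using hom_polys_comp_clinear[OF zeta_d_pow_hom_polys[OF \<Phi> x] clinear_msqrt] hom_polys_subset_deg_polys by blast
  ultimately have "(\<lambda>\<zeta>. (1 + hprod \<zeta> x) ^ (n - l - k) * zeta_d_pow k \<Phi> x (msqrt x \<zeta>)) \<in> deg_polys (n - l - k + (l + k))"
    by (rule deg_polys_mult)
  moreover have "n - l - k + (l + k) = n" using k l by simp
  ultimately show "(\<lambda>\<zeta>. (1 + hprod \<zeta> x) ^ (n - l - k) * zeta_d_pow k \<Phi> x (msqrt x \<zeta>)) \<in> deg_polys n" by (simp only:)
qed

lemma translate_poly_I_op:
  fixes \<Phi> :: "complex^'d \<Rightarrow> complex^'d \<Rightarrow> complex"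
  assumes \<Phi>: "\<Phi> \<in> holo_maps (hom_polys l)" and l: "l \<le> n" and x: "x \<in> unit_ball"
  shows "translate_poly n x (I_op \<nu> n l \<Phi> x) = I_frame \<nu> n l \<Phi> x"
  unfolding translate_poly_def pos_sqrt_Bergman[OF x]
proof (rule poly_extension_eqI[OF I_frame_deg_polys[OF \<Phi> l x]])
  have D: "Delta \<zeta> (- x) = 1 + hprod \<zeta> x" for \<zeta> by (simp add: Delta_def hprod_simps)
  show "I_frame \<nu> n l \<Phi> x \<zeta> = Delta \<zeta> (- x) ^ n * I_op \<nu> n l \<Phi> x (msqrt x (quasi_inverse \<zeta> (- x)))"
    if "\<zeta> \<in> {\<zeta>. Delta \<zeta> (- x) \<noteq> 0}" for \<zeta>
    using I_frame_eq[OF \<Phi> l x, of \<zeta> \<nu>] that by (simp add: D quasi_inverse_def hprod_simps msqrt_scale)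
  have "continuous_on UNIV (\<lambda>\<zeta> :: complex^'d. 1 + hprod \<zeta> x)" by (intro continuous_intros continuous_hprod)
  then show "open {\<zeta>. Delta \<zeta> (- x) \<noteq> 0}"
    unfolding D by (intro open_Collect_neq) auto
  show "{\<zeta>. Delta \<zeta> (- x) \<noteq> 0} \<noteq> {}" unfolding D by (auto intro: exI[of _ 0])
qed

text \<open>The intertwining relation for \<open>mob x\<close>, read at the origin: this map sends 0
  to \<open>x\<close> with derivative \<open>msqrt x\<close>, so the target integrand at
  \<open>x\<close> becomes a value at 0 of the operator applied to a transformed map. Equality on
  the ball of vectors extends to all \<zeta> by polynomiality.\<close>

lemma I_frame_eq_alpha_inv:
  fixes \<Phi> :: "complex^'d \<Rightarrow> complex^'d \<Rightarrow> complex"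
  assumes \<Phi>: "\<Phi> \<in> holo_maps (hom_polys l)" and l: "l \<le> n" and \<nu>: "0 < \<nu>" and x: "x \<in> unit_ball"
  shows "(1 - (norm x)\<^sup>2) powr \<nu> * (cmod (I_frame \<nu> n l \<Phi> x \<zeta>))\<^sup>2 =
    (cmod (I_op \<nu> n l (alpha_inv \<nu> (mob x) (mob_log x) \<Phi>) 0 \<zeta>))\<^sup>2"
proof -
  define s where "s = defect x"
  have s: "0 < s" "s\<^sup>2 = 1 - (norm x)\<^sup>2" using defect_pos[OF x] defect_sq[OF x] by (simp_all add: s_def)
  note M = moebius_form_mob[OF x]
  let ?P = "I_op \<nu> n l (alpha_inv \<nu> (mob x) (mob_log x) \<Phi>) 0"
  have p0: "genus TYPE('d) \<noteq> 0" by (simp add: genus_def)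
  have ex: "exp (of_real (a / genus TYPE('d)) * mob_log x z) = of_real (s powr a) * (1 + hprod z x) powr (- of_real a)"
    if "z \<in> unit_ball" for a z
  proof -
    have "of_real (a / genus TYPE('d)) * mob_log x z = of_real (a * ln s) - of_real a * Ln (1 + hprod z x)"
      using p0 by (simp add: mob_log_def s_def algebra_simps)
    then show ?thesis
      using s one_plus_hprod_nz[OF that x] by (simp add: exp_diff powr_def exp_of_real[symmetric] exp_minus divide_inverse)
  qed
  have "?P = (\<lambda>\<zeta>. of_real (s powr \<nu>) * I_frame \<nu> n l \<Phi> x \<zeta>)"
  proof (rule deg_polys_eqI[OF _ deg_polys_scale[OF I_frame_deg_polys[OF \<Phi> l x]] unit_ball_open])
    show "?P \<in> deg_polys n"
      by (rule holo_mapsD(1)[OF I_op_holo_maps[OF alpha_inv_holo_maps[OF M \<Phi>] l] zero_in_ball])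
    show "unit_ball \<noteq> ({} :: (complex^'d) set)" using zero_in_ball by blast
    fix \<zeta> :: "complex^'d" assume \<zeta>: "\<zeta> \<in> unit_ball"
    let ?r = "1 + hprod \<zeta> x"
    have r: "?r \<noteq> 0" by (rule one_plus_hprod_nz[OF \<zeta> x])
    have "?P \<zeta> = exp (of_real ((\<nu> + real n) / genus TYPE('d)) * mob_log x 0) *
        exp (of_real (- real n / genus TYPE('d)) * mob_log x \<zeta>) * I_op \<nu> n l \<Phi> x ((1 / ?r) *s msqrt x \<zeta>)"
      using intertwining_pointwise[OF M \<Phi> l \<nu> zero_in_ball, of \<zeta>] \<zeta> by (simp add: mob_def[of x \<zeta>])
    \<comment> \<open>At 0 the denominator \<open>1 + hprod 0 x\<close> is 1, so only powers of
      \<open>s\<close> remain there: exponent \<open>\<nu> + n\<close> from the first factor and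
      \<open>- n\<close> from the second.\<close>
    also have "exp (of_real ((\<nu> + real n) / genus TYPE('d)) * mob_log x 0) *
        exp (of_real (- real n / genus TYPE('d)) * mob_log x \<zeta>) = of_real (s powr \<nu>) * ?r ^ n"
      unfolding ex[OF zero_in_ball] ex[OF \<zeta>] using s r powr_nat[of ?r n]
      by (simp add: powr_add powr_minus powr_realpow field_simps)
    finally show "?P \<zeta> = of_real (s powr \<nu>) * I_frame \<nu> n l \<Phi> x \<zeta>"
      unfolding I_frame_eq[OF \<Phi> l x r, symmetric] by (simp only: mult.assoc)
  qed
  then have "(cmod (?P \<zeta>))\<^sup>2 = (s powr \<nu>)\<^sup>2 * (cmod (I_frame \<nu> n l \<Phi> x \<zeta>))\<^sup>2"
    by (simp add: norm_mult power_mult_distrib)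
  moreover have "(s powr \<nu>)\<^sup>2 = (1 - (norm x)\<^sup>2) powr \<nu>"
    unfolding s(2)[symmetric] using powr_mult[of s s \<nu>] s(1) by (simp only: power2_eq_square less_imp_le)
  ultimately show ?thesis by (simp only:)
qed

lemma I_frame_continuous:
  assumes \<Phi>: "\<Phi> \<in> holo_maps (hom_polys l)"
  shows "continuous_on unit_ball (\<lambda>x. I_frame \<nu> n l \<Phi> x \<zeta>)"
proof -
  have "continuous_on unit_ball (\<lambda>x. zeta_d_pow k \<Phi> x (msqrt x \<zeta>))" for k
  proof (rule continuous_on_eq[OF continuous_holo_maps_eval[OF zeta_d_pow_holo_maps[OF \<Phi>] continuous_msqrt]])
  qed simp
  then show ?thesis unfolding I_frame_def by (intro continuous_intros continuous_hprod)
qed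

text \<open>Pairs of points at Bergman distance less than that of \<open>0\<close> to a point of norm \<open>1/2\<close>.\<close>

definition bergman_near :: "((complex^'d) \<times> (complex^'d)) set" where
  "bergman_near = {(x, w). 3/4 * (cmod (1 - hprod w x))\<^sup>2 < (1 - (norm x)\<^sup>2) * (1 - (norm w)\<^sup>2)}"

lemma bergman_near_sym: "(x, w) \<in> bergman_near \<longleftrightarrow> (w, x) \<in> bergman_near"
proof -
  have "1 - hprod w x = cnj (1 - hprod x w)" using hprod_commute[of w x] by simp
  then have "cmod (1 - hprod w x) = cmod (1 - hprod x w)" by (simp only: complex_mod_cnj)
  then show ?thesis by (simp add: bergman_near_def mult.commute)
qed

text \<open>\<open>Delta_mob\<close> for the inverse map expresses the defect of \<open>y\<close>
  through \<open>x\<close> and \<open>mob x y\<close>. The constant 3/4 is the defect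
  \<open>1 - (1/2)\<^sup>2\<close> at radius 1/2.\<close>

lemma bergman_near_mob:
  assumes x: "x \<in> unit_ball" and y: "y \<in> unit_ball"
  shows "(x, mob x y) \<in> bergman_near \<longleftrightarrow> y \<in> ball 0 (1/2)"
proof -
  let ?w = "mob x y"
  have w: "?w \<in> unit_ball" by (rule mob_in_ball[OF x y])
  have q: "0 < (cmod (1 - hprod ?w x))\<^sup>2"
    using one_plus_hprod_nz[OF w, of "- x"] x by (simp add: hprod_simps)
  have "1 - (norm y)\<^sup>2 = (1 - (norm x)\<^sup>2) * (1 - (norm ?w)\<^sup>2) / (cmod (1 - hprod ?w x))\<^sup>2"
    using Delta_mob[of "- x" ?w] x w defect_sq[of "- x"] mob_mob_minus[OF x y] by (simp add: hprod_simps)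
  then have "(x, ?w) \<in> bergman_near \<longleftrightarrow> 3/4 < 1 - (norm y)\<^sup>2"
    using q by (simp add: bergman_near_def pos_less_divide_eq)
  also have "\<dots> \<longleftrightarrow> (norm y)\<^sup>2 < (1/2)\<^sup>2" by (auto simp: power2_eq_square)
  also have "\<dots> \<longleftrightarrow> norm y < 1/2"
    using power_less_imp_less_base[of "norm y" 2 "1/2"] power_strict_mono[of "norm y" "1/2" 2] by auto
  finally show ?thesis by simp
qed

lemma sigma_finite_inv_measure: "sigma_finite_measure (inv_measure c :: (complex^'d) measure)"
proof -
  have "sigma_finite_measure (ball_lborel :: (complex^'d) measure)"
    by (rule sigma_finite_measure_restrict_space[OF sigma_finite_lborel]) simp
  then interpret sigma_finite_measure "ball_lborel :: (complex^'d) measure" .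
  show ?thesis
    unfolding inv_measure_eq by (subst sigma_finite_iff_density_finite[OF inv_weight_measurable]) simp
qed

lemma half_ball_finite:
  assumes c: "c > 0"
  shows "(\<integral>\<^sup>+y. indicator (ball 0 (1/2)) (y :: complex^'d) \<partial>inv_measure c) < \<infinity>"
proof -
  have sub: "ball (0 :: complex^'d) (1/2) \<subseteq> unit_ball" by (auto simp: ball_iff)
  have m: "(indicator (ball 0 (1/2)) :: complex^'d \<Rightarrow> ennreal) \<in> borel_measurable ball_lborel"
    using sub by (intro borel_measurable_indicator) (auto simp: sets_ball_lborel)
  have "(\<integral>\<^sup>+y. indicator (ball 0 (1/2)) (y :: complex^'d) \<partial>inv_measure c) =
      (\<integral>\<^sup>+y. ennreal (inv_weight c y) * indicator (ball 0 (1/2)) y * indicator unit_ball (y :: complex^'d) \<partial>lborel)"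
    unfolding nn_integral_inv_measure[OF m] by (rule nn_integral_restrict_space) simp
  also have "\<dots> \<le> (\<integral>\<^sup>+y. ennreal (c / (3/4) ^ Suc CARD('d)) * indicator (ball 0 (1/2)) (y :: complex^'d) \<partial>lborel)"
  proof (rule nn_integral_mono)
    fix y :: "complex^'d"
    have "inv_weight c y \<le> c / (3/4) ^ Suc CARD('d)" if "norm y < 1/2"
    proof -
      have "(norm y)\<^sup>2 \<le> (1/2)\<^sup>2" using that by (intro power_mono) auto
      then have "3/4 \<le> 1 - (norm y)\<^sup>2" by (simp add: power2_eq_square)
      then show ?thesis
        unfolding inv_weight_def using c by (intro divide_left_mono mult_pos_pos zero_less_power power_mono) auto
    qed
    then show "ennreal (inv_weight c y) * indicator (ball 0 (1/2)) y * indicator unit_ball y \<le>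
        ennreal (c / (3/4) ^ Suc CARD('d)) * indicator (ball 0 (1/2)) y"
      by (auto simp: indicator_def intro: ennreal_leI)
  qed
  also have "\<dots> = ennreal (c / (3/4) ^ Suc CARD('d)) * emeasure lborel (ball (0 :: complex^'d) (1/2))"
    by (simp add: nn_integral_cmult_indicator)
  also have "\<dots> < \<infinity>" by (simp add: emeasure_ball ennreal_mult_less_top)
  finally show ?thesis .
qed

text \<open>The group moves the local estimate at \<open>0\<close> to every point \<open>x\<close>; the relation
  \<open>w \<in> mob x ` ball 0 (1/2)\<close> is symmetric in \<open>x\<close> and \<open>w\<close>, so Tonelli's theorem applies.\<close>

lemma I_frame_integral_finite:
  fixes \<Phi> :: "complex^'d \<Rightarrow> complex^'d \<Rightarrow> complex"
  assumes c: "c > 0" and \<nu>: "0 < \<nu>" and l: "l \<le> n" and \<Phi>: "\<Phi> \<in> H2_hom c \<nu> l"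
  shows "(\<integral>\<^sup>+x. ennreal ((1 - (norm x)\<^sup>2) powr \<nu> * (cmod (I_frame \<nu> n l \<Phi> x \<zeta>))\<^sup>2) \<partial>inv_measure c) < \<infinity>"
proof -
  have hol: "\<Phi> \<in> holo_maps (hom_polys l)" using \<Phi> by (simp add: H2_hom_iff)
  let ?d = "\<lambda>w. ennreal (hom_density \<nu> l \<Phi> w)"
  let ?\<mu> = "inv_measure c :: (complex^'d) measure"
  obtain K where K: "K \<ge> 0" "\<And>(\<Psi> :: complex^'d \<Rightarrow> complex^'d \<Rightarrow> complex). \<Psi> \<in> holo_maps (hom_polys l) \<Longrightarrow>
    ennreal ((cmod (I_op \<nu> n l \<Psi> 0 \<zeta>))\<^sup>2) \<le>
      ennreal K * (\<integral>\<^sup>+w. ennreal (hom_density \<nu> l \<Psi> w) * indicator (ball 0 (1/2)) w \<partial>inv_measure c)"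
    by (rule I_op_local_bound[OF c \<nu>, of l n \<zeta>]) blast
  define k where "k x w = ?d w * indicator bergman_near (x, w)" for x w
  interpret sigma_finite_measure ?\<mu> by (rule sigma_finite_inv_measure)
  interpret pair: pair_sigma_finite ?\<mu> ?\<mu> ..
  have dm: "?d \<in> borel_measurable ?\<mu>" unfolding measurable_inv_measure by (rule hom_density_measurable[OF hol])
  have idm: "(\<lambda>x. x) \<in> measurable ?\<mu> borel"
    unfolding measurable_inv_measure by (intro measurable_ball_continuous continuous_intros)
  have Kset: "bergman_near \<in> sets (borel :: ((complex^'d) \<times> (complex^'d)) measure)"
  proof -
    have "open (bergman_near :: ((complex^'d) \<times> (complex^'d)) set)"
      unfolding bergman_near_def case_prod_unfold
      by (intro open_Collect_less continuous_intros continuous_hprod)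
    then show ?thesis by (rule borel_open)
  qed
  have "(\<lambda>p. (fst p, snd p)) \<in> measurable (?\<mu> \<Otimes>\<^sub>M ?\<mu>) (borel \<Otimes>\<^sub>M borel)"
    by (intro measurable_Pair measurable_compose[OF measurable_fst idm] measurable_compose[OF measurable_snd idm])
  then have "(\<lambda>p. p) \<in> measurable (?\<mu> \<Otimes>\<^sub>M ?\<mu>) borel" by (simp add: borel_prod)
  then have "(\<lambda>p. indicator bergman_near p :: ennreal) \<in> borel_measurable (?\<mu> \<Otimes>\<^sub>M ?\<mu>)"
    by (rule measurable_compose[OF _ borel_measurable_indicator[OF Kset]])
  then have km: "case_prod k \<in> borel_measurable (?\<mu> \<Otimes>\<^sub>M ?\<mu>)"
    unfolding k_def case_prod_unfold prod.collapse
    by (intro borel_measurable_times_ennreal measurable_compose[OF measurable_snd dm])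
  have kx: "(\<lambda>w. k x w) \<in> borel_measurable ball_lborel" if "x \<in> unit_ball" for x
    using measurable_Pair2[OF km, of x] that by (simp add: measurable_inv_measure)
  have ind_m: "(\<lambda>x. indicator bergman_near (w, x) :: ennreal) \<in> borel_measurable ball_lborel" for w :: "complex^'d"
  proof -
    have "(\<lambda>x. (w, x)) \<in> measurable ?\<mu> borel"
      unfolding measurable_inv_measure by (intro measurable_ball_continuous continuous_intros)
    from measurable_compose[OF this borel_measurable_indicator[OF Kset]] show ?thesis
      by (simp add: measurable_inv_measure)
  qed
  define m0 where "m0 = (\<integral>\<^sup>+y. indicator (ball 0 (1/2)) y \<partial>?\<mu>)"
  \<comment> \<open>By symmetry and invariance every Bergman ball of this radius has the same
    measure as the one about 0.\<close>
  have inner: "(\<integral>\<^sup>+x. indicator bergman_near (x, w) \<partial>?\<mu>) = m0" if w: "w \<in> unit_ball" for w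
  proof -
    have "(\<integral>\<^sup>+x. indicator bergman_near (x, w) \<partial>?\<mu>) = (\<integral>\<^sup>+x. indicator bergman_near (w, x) \<partial>?\<mu>)"
      by (intro nn_integral_cong) (simp add: indicator_def bergman_near_sym[of _ w])
    also have "\<dots> = (\<integral>\<^sup>+y. indicator bergman_near (w, mob w y) \<partial>?\<mu>)"
      by (rule nn_integral_inv_measure_aut[OF ball_aut_pair_mob[OF w] ind_m c, symmetric])
    also have "\<dots> = m0"
      unfolding m0_def by (intro nn_integral_cong) (simp add: indicator_def bergman_near_mob[OF w])
    finally show ?thesis .
  qed
  \<comment> \<open>The substitution \<open>w = mob x y\<close> carries the ball of radius 1/2 to
    the Bergman ball about \<open>x\<close>, and the density of the transformed map at
    \<open>y\<close> is that of \<Phi> at \<open>mob x y\<close>.\<close>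
  have step: "ennreal ((1 - (norm x)\<^sup>2) powr \<nu> * (cmod (I_frame \<nu> n l \<Phi> x \<zeta>))\<^sup>2) \<le> ennreal K * (\<integral>\<^sup>+w. k x w \<partial>?\<mu>)"
    if x: "x \<in> unit_ball" for x
  proof -
    note M = moebius_form_mob[OF x] and g = ball_aut_pair_mob[OF x]
    have "ennreal ((1 - (norm x)\<^sup>2) powr \<nu> * (cmod (I_frame \<nu> n l \<Phi> x \<zeta>))\<^sup>2) \<le>
        ennreal K * (\<integral>\<^sup>+y. ennreal (hom_density \<nu> l (alpha_inv \<nu> (mob x) (mob_log x) \<Phi>) y) * indicator (ball 0 (1/2)) y \<partial>?\<mu>)"
      unfolding I_frame_eq_alpha_inv[OF hol l \<nu> x] by (rule K(2)[OF alpha_inv_holo_maps[OF M hol]])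
    also have "(\<integral>\<^sup>+y. ennreal (hom_density \<nu> l (alpha_inv \<nu> (mob x) (mob_log x) \<Phi>) y) * indicator (ball 0 (1/2)) y \<partial>?\<mu>) =
        (\<integral>\<^sup>+y. k x (mob x y) \<partial>?\<mu>)"
      by (intro nn_integral_cong)
        (simp add: k_def hom_density_alpha_inv[OF M g hol] indicator_def bergman_near_mob[OF x])
    also have "\<dots> = (\<integral>\<^sup>+w. k x w \<partial>?\<mu>)" by (rule nn_integral_inv_measure_aut[OF g kx[OF x] c])
    finally show ?thesis .
  qed
  have "(\<integral>\<^sup>+x. ennreal ((1 - (norm x)\<^sup>2) powr \<nu> * (cmod (I_frame \<nu> n l \<Phi> x \<zeta>))\<^sup>2) \<partial>?\<mu>) \<le>
      (\<integral>\<^sup>+x. ennreal K * (\<integral>\<^sup>+w. k x w \<partial>?\<mu>) \<partial>?\<mu>)"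
    by (intro nn_integral_mono) (simp add: step)
  also have "\<dots> = ennreal K * (\<integral>\<^sup>+x. (\<integral>\<^sup>+w. k x w \<partial>?\<mu>) \<partial>?\<mu>)"
    using borel_measurable_nn_integral[OF km] by (intro nn_integral_cmult) simp
  also have "(\<integral>\<^sup>+x. (\<integral>\<^sup>+w. k x w \<partial>?\<mu>) \<partial>?\<mu>) = (\<integral>\<^sup>+w. (\<integral>\<^sup>+x. k x w \<partial>?\<mu>) \<partial>?\<mu>)"
    by (rule pair.Fubini'[OF km, symmetric])
  also have "\<dots> = (\<integral>\<^sup>+w. ?d w * m0 \<partial>?\<mu>)"
  proof (rule nn_integral_cong)
    fix w assume "w \<in> space ?\<mu>"
    then have w: "w \<in> unit_ball" by simp
    have m: "(\<lambda>x. indicator bergman_near (x, w) :: ennreal) \<in> borel_measurable ?\<mu>"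
      using ind_m[of w] unfolding measurable_inv_measure indicator_def by (simp add: bergman_near_sym[of _ w])
    have "(\<integral>\<^sup>+x. k x w \<partial>?\<mu>) = ?d w * (\<integral>\<^sup>+x. indicator bergman_near (x, w) \<partial>?\<mu>)"
      unfolding k_def by (rule nn_integral_cmult[OF m])
    then show "(\<integral>\<^sup>+x. k x w \<partial>?\<mu>) = ?d w * m0" by (simp only: inner[OF w])
  qed
  also have "\<dots> = (\<integral>\<^sup>+w. ?d w \<partial>?\<mu>) * m0" by (rule nn_integral_multc[OF dm])
  also have "ennreal K * \<dots> < \<infinity>"
  proof -
    have "(\<integral>\<^sup>+w. ?d w \<partial>?\<mu>) < \<infinity>" using \<Phi> by (simp only: H2_hom_iff)
    moreover have "m0 < \<infinity>" unfolding m0_def by (rule half_ball_finite[OF c])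
    ultimately have "(\<integral>\<^sup>+w. ?d w \<partial>?\<mu>) * m0 < \<infinity>" by (simp add: ennreal_mult_less_top)
    then show ?thesis by (simp only: ennreal_mult_less_top infinity_ennreal_def ennreal_less_top simp_thms)
  qed
  finally show ?thesis .
qed

text \<open>Reduces an arbitrary inner product to its finite Gram matrix on monomials, so that
  measurability and bounds follow from those of the coefficients.\<close>

lemma K_invariant_inner_expand:
  fixes ip :: "(complex^'d \<Rightarrow> complex) \<Rightarrow> (complex^'d \<Rightarrow> complex) \<Rightarrow> complex"
  assumes ip: "K_invariant_inner n ip" and \<phi>: "\<phi> \<in> deg_polys n"
  shows "ip \<phi> \<phi> = (\<Sum>m\<in>{m :: 'd \<Rightarrow> nat. (\<Sum>i\<in>UNIV. m i) \<le> n}. \<Sum>m'\<in>{m. (\<Sum>i\<in>UNIV. m i) \<le> n}.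
    cnj (pcoeff (Suc n) m \<phi>) * pcoeff (Suc n) m' \<phi> * ip (zmonom m) (zmonom m'))"
proof -
  have add: "ip \<phi> (\<lambda>\<zeta>. \<psi> \<zeta> + \<rho> \<zeta>) = ip \<phi> \<psi> + ip \<phi> \<rho>"
    and sc: "ip \<phi> (\<lambda>\<zeta>. a * \<psi> \<zeta>) = a * ip \<phi> \<psi>" and sym: "ip \<psi> \<phi> = cnj (ip \<phi> \<psi>)"
    if "\<phi> \<in> deg_polys n" "\<psi> \<in> deg_polys n" "\<rho> \<in> deg_polys n" for \<phi> \<psi> \<rho> a
    using ip that unfolding K_invariant_inner_def by blast+
  have sum: "ip \<phi> (\<lambda>\<zeta>. \<Sum>m\<in>X. a m * f m \<zeta>) = (\<Sum>m\<in>X. a m * ip \<phi> (f m))"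
    if "\<phi> \<in> deg_polys n" "\<And>m. m \<in> X \<Longrightarrow> f m \<in> deg_polys n" "finite X" for \<phi> f a X
    using that(3,2)
  proof (induction X rule: finite_induct)
    case empty
    show ?case using sc[OF that(1) that(1) that(1), of 0] by simp
  next
    case (insert m X)
    have "(\<lambda>\<zeta>. \<Sum>m\<in>X. a m * f m \<zeta>) \<in> deg_polys n"
      using insert by (intro deg_polys_sum deg_polys_scale) auto
    then show ?case
      using insert add[OF that(1) deg_polys_scale[of "f m" n "a m"]] sc[OF that(1), of "f m" "f m" "a m"] by simp
  qed
  let ?M = "{m :: 'd \<Rightarrow> nat. (\<Sum>i\<in>UNIV. m i) \<le> n}"
  let ?c = "\<lambda>m. pcoeff (Suc n) m \<phi>"
  have mm: "m \<in> ?M \<Longrightarrow> zmonom m \<in> deg_polys n" for m by (auto intro: zmonom_in_deg_polys)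
  have ex: "\<phi> = (\<lambda>\<zeta>. \<Sum>m\<in>?M. ?c m * zmonom m \<zeta>)" by (rule ext) (rule deg_polys_expansion[OF \<phi>])
  have e: "ip \<psi> \<phi> = (\<Sum>m\<in>?M. ?c m * ip \<psi> (zmonom m))" if "\<psi> \<in> deg_polys n" for \<psi>
    by (subst ex) (rule sum[OF that mm finite_multi_index_le])
  have "ip \<phi> \<phi> = (\<Sum>m'\<in>?M. ?c m' * ip \<phi> (zmonom m'))" by (rule e[OF \<phi>])
  also have "\<dots> = (\<Sum>m'\<in>?M. \<Sum>m\<in>?M. cnj (?c m) * ?c m' * ip (zmonom m) (zmonom m'))"
  proof (rule sum.cong[OF refl])
    fix m' assume m': "m' \<in> ?M"
    \<comment> \<open>Linearity is given in the second argument only; conjugate symmetry transfers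
      it to the first.\<close>
    have "ip \<phi> (zmonom m') = cnj (ip (zmonom m') \<phi>)" by (rule sym[OF mm[OF m'] \<phi> \<phi>])
    also have "\<dots> = (\<Sum>m\<in>?M. cnj (?c m) * ip (zmonom m) (zmonom m'))"
      unfolding e[OF mm[OF m']] cnj_sum
      by (intro sum.cong refl) (simp add: sym[OF mm[OF m'] mm \<phi>])
    finally show "?c m' * ip \<phi> (zmonom m') = (\<Sum>m\<in>?M. cnj (?c m) * ?c m' * ip (zmonom m) (zmonom m'))"
      by (simp add: sum_distrib_left mult_ac)
  qed
  finally show ?thesis by (subst sum.swap)
qed

text \<open>The coefficients of the translated polynomial are bounded by its values at the finitely
  many torus points. The target integrand is therefore dominated by a multiple of the sum of the
  integrands in \<open>I_frame_integral_finite\<close>, one for each torus point.\<close>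

lemma I_op_H2_deg:
  fixes \<Phi> :: "complex^'d \<Rightarrow> complex^'d \<Rightarrow> complex"
  assumes ip: "K_invariant_inner n ip" and c: "c > 0" and \<nu>: "0 < \<nu>" and l: "l \<le> n" and \<Phi>: "\<Phi> \<in> H2_hom c \<nu> l"
  shows "I_op \<nu> n l \<Phi> \<in> H2_deg c ip \<nu> n"
proof -
  have hol: "\<Phi> \<in> holo_maps (hom_polys l)" using \<Phi> by (simp add: H2_hom_iff)
  let ?M = "{m :: 'd \<Rightarrow> nat. (\<Sum>i\<in>UNIV. m i) \<le> n}"
  let ?T = "I_frame \<nu> n l \<Phi>"
  let ?c = "\<lambda>x m. pcoeff (Suc n) m (?T x)"
  let ?\<mu> = "inv_measure c :: (complex^'d) measure"
  let ?G = "grid (Suc n) :: ('d \<Rightarrow> nat) set"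
  let ?t = "torus_point (Suc n) :: ('d \<Rightarrow> nat) \<Rightarrow> complex^'d"
  define f where "f x = complex_of_real ((1 - (norm x)\<^sup>2) powr \<nu>) *
      (\<Sum>m\<in>?M. \<Sum>m'\<in>?M. cnj (?c x m) * ?c x m' * ip (zmonom m) (zmonom m'))" for x
  have eq: "deg_integrand ip \<nu> n (I_op \<nu> n l \<Phi>) (I_op \<nu> n l \<Phi>) x = f x" if x: "x \<in> unit_ball" for x
    unfolding deg_integrand_def translate_poly_I_op[OF hol l x] f_def Re_Delta
    by (subst K_invariant_inner_expand[OF ip I_frame_deg_polys[OF hol l x]]) simp
  have "continuous_on unit_ball (\<lambda>x. ?c x m)" for m
    unfolding pcoeff_def by (intro continuous_intros I_frame_continuous[OF hol])
  then have "continuous_on unit_ball f"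
    unfolding f_def by (intro continuous_intros) (auto simp: ball_iff abs_square_eq_1)
  then have fm: "f \<in> borel_measurable ?\<mu>"
    unfolding measurable_inv_measure by (rule measurable_ball_continuous)
  define K where "K = (\<Sum>m\<in>?M. \<Sum>m'\<in>?M. cmod (ip (zmonom m) (zmonom m')))"
  have K: "0 \<le> K" unfolding K_def by (intro sum_nonneg) auto
  define h where "h x j = (1 - (norm x)\<^sup>2) powr \<nu> * (cmod (?T x (?t j)))\<^sup>2" for x j
  have h0: "0 \<le> h x j" for x j by (simp add: h_def)
  have bound: "cmod (f x) \<le> K * real (card ?G) * (\<Sum>j\<in>?G. h x j)" for x
  proof -
    define S where "S = (\<Sum>j\<in>?G. cmod (?T x (?t j)))"
    have c_le: "cmod (?c x m) \<le> S" for m unfolding S_def by (rule norm_pcoeff_le)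
    have S: "0 \<le> S" unfolding S_def by (intro sum_nonneg) auto
    have "cmod (f x) = (1 - (norm x)\<^sup>2) powr \<nu> *
        cmod (\<Sum>m\<in>?M. \<Sum>m'\<in>?M. cnj (?c x m) * ?c x m' * ip (zmonom m) (zmonom m'))"
      by (simp add: f_def norm_mult)
    also have "\<dots> \<le> (1 - (norm x)\<^sup>2) powr \<nu> * (\<Sum>m\<in>?M. \<Sum>m'\<in>?M. S * S * cmod (ip (zmonom m) (zmonom m')))"
    proof (intro mult_left_mono sum_norm_le)
      fix m m'
      have "cmod (?c x m) * cmod (?c x m') \<le> S * S" using c_le S by (intro mult_mono) auto
      then show "cmod (cnj (?c x m) * ?c x m' * ip (zmonom m) (zmonom m')) \<le> S * S * cmod (ip (zmonom m) (zmonom m'))"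
        unfolding norm_mult complex_mod_cnj by (intro mult_right_mono) auto
    qed simp
    also have "\<dots> = (1 - (norm x)\<^sup>2) powr \<nu> * (S\<^sup>2 * K)"
      unfolding K_def sum_distrib_left power2_eq_square by simp
    also have "\<dots> \<le> (1 - (norm x)\<^sup>2) powr \<nu> * (((\<Sum>j\<in>?G. (cmod (?T x (?t j)))\<^sup>2) * real (card ?G)) * K)"
      unfolding S_def using K by (intro mult_left_mono mult_right_mono sum_squared_le_sum_of_squares) auto
    also have "\<dots> = K * real (card ?G) * (\<Sum>j\<in>?G. h x j)"
      by (simp add: h_def sum_distrib_left[symmetric])
    finally show ?thesis .
  qed
  have hm: "(\<lambda>x. ennreal (h x j)) \<in> borel_measurable ?\<mu>" for j
    unfolding measurable_inv_measure h_def
    by (intro measurable_compose[OF measurable_ball_continuous measurable_ennreal] continuous_intros I_frame_continuous[OF hol])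
      (auto simp: ball_iff abs_square_eq_1)
  have "(\<integral>\<^sup>+x. ennreal (cmod (f x)) \<partial>?\<mu>) \<le> (\<integral>\<^sup>+x. ennreal (K * real (card ?G)) * (\<Sum>j\<in>?G. ennreal (h x j)) \<partial>?\<mu>)"
  proof (rule nn_integral_mono)
    fix x
    have "ennreal (K * real (card ?G)) * (\<Sum>j\<in>?G. ennreal (h x j)) = ennreal (K * real (card ?G) * (\<Sum>j\<in>?G. h x j))"
      using K h0 by (simp add: sum_ennreal ennreal_mult sum_nonneg)
    then show "ennreal (cmod (f x)) \<le> ennreal (K * real (card ?G)) * (\<Sum>j\<in>?G. ennreal (h x j))"
      using ennreal_leI[OF bound[of x]] by (simp only:)
  qed
  also have "\<dots> = ennreal (K * real (card ?G)) * (\<Sum>j\<in>?G. (\<integral>\<^sup>+x. ennreal (h x j) \<partial>?\<mu>))"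
    using hm by (simp add: nn_integral_cmult nn_integral_sum)
  also have "\<dots> < \<infinity>"
    using I_frame_integral_finite[OF c \<nu> l \<Phi>] unfolding h_def
    by (simp add: ennreal_mult_less_top)
  finally have "integrable ?\<mu> f" using fm by (intro integrableI_bounded) auto
  then have "integrable ?\<mu> (deg_integrand ip \<nu> n (I_op \<nu> n l \<Phi>) (I_op \<nu> n l \<Phi>))"
    by (rule Bochner_Integration.integrable_cong[THEN iffD1, rotated 2]) (auto simp: eq)
  then show ?thesis using I_op_holo_maps[OF hol l] by (simp add: H2_deg_def)
qed

section \<open>Linearity, the alternative coefficients and the final relation\<close>

lemma zeta_d_pow_linear:
  assumes \<Phi>: "\<Phi> \<in> holo_maps (hom_polys l)" and \<Psi>: "\<Psi> \<in> holo_maps (hom_polys l)" and z: "z \<in> unit_ball"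
  shows "zeta_d_pow k (\<lambda>z \<zeta>. \<Phi> z \<zeta> + \<Psi> z \<zeta>) z \<zeta> = zeta_d_pow k \<Phi> z \<zeta> + zeta_d_pow k \<Psi> z \<zeta>"
    and "zeta_d_pow k (\<lambda>z \<zeta>. a * \<Phi> z \<zeta>) z \<zeta> = a * zeta_d_pow k \<Phi> z \<zeta>"
proof -
  let ?T = "(\<lambda>t. z + t *s \<zeta>) -` unit_ball"
  have T: "open ?T" "0 \<in> ?T" using open_vimage[OF unit_ball_open continuous_on_line] z by auto
  have hol: "(\<lambda>t. \<Phi> (z + t *s \<zeta>) \<zeta>) holomorphic_on ?T" "(\<lambda>t. \<Psi> (z + t *s \<zeta>) \<zeta>) holomorphic_on ?T"
    by (intro holo_on_line[OF holo_mapsD(3)[OF \<Phi>]] holo_on_line[OF holo_mapsD(3)[OF \<Psi>]], simp)+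
  have "(\<lambda>z \<zeta>. \<Phi> z \<zeta> + \<Psi> z \<zeta>) \<in> holo_maps (hom_polys l)" "(\<lambda>z \<zeta>. a * \<Phi> z \<zeta>) \<in> holo_maps (hom_polys l)"
    using \<Phi> \<Psi> by (auto simp: holo_maps_def intro: hom_polys_add hom_polys_scale holo_on_add holo_on_mult holo_on_const)
  note lines = zeta_d_pow_line[OF this(1) z] zeta_d_pow_line[OF this(2) z] zeta_d_pow_line[OF \<Phi> z] zeta_d_pow_line[OF \<Psi> z]
  show "zeta_d_pow k (\<lambda>z \<zeta>. \<Phi> z \<zeta> + \<Psi> z \<zeta>) z \<zeta> = zeta_d_pow k \<Phi> z \<zeta> + zeta_d_pow k \<Psi> z \<zeta>"
    unfolding lines by (rule higher_deriv_add[OF hol T])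
  show "zeta_d_pow k (\<lambda>z \<zeta>. a * \<Phi> z \<zeta>) z \<zeta> = a * zeta_d_pow k \<Phi> z \<zeta>"
    unfolding lines by (rule higher_deriv_cmult[OF hol(1) T(2,1)])
qed

lemma I_op_linear:
  assumes \<Phi>: "\<Phi> \<in> holo_maps (hom_polys l)" and \<Psi>: "\<Psi> \<in> holo_maps (hom_polys l)"
  shows "I_op \<nu> n l (\<lambda>z \<zeta>. \<Phi> z \<zeta> + \<Psi> z \<zeta>) = (\<lambda>z \<zeta>. I_op \<nu> n l \<Phi> z \<zeta> + I_op \<nu> n l \<Psi> z \<zeta>)"
    and "I_op \<nu> n l (\<lambda>z \<zeta>. a * \<Phi> z \<zeta>) = (\<lambda>z \<zeta>. a * I_op \<nu> n l \<Phi> z \<zeta>)"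
proof -
  have "I_op \<nu> n l (\<lambda>z \<zeta>. \<Phi> z \<zeta> + \<Psi> z \<zeta>) z \<zeta> = I_op \<nu> n l \<Phi> z \<zeta> + I_op \<nu> n l \<Psi> z \<zeta> \<and>
      I_op \<nu> n l (\<lambda>z \<zeta>. a * \<Phi> z \<zeta>) z \<zeta> = a * I_op \<nu> n l \<Phi> z \<zeta>" for z \<zeta>
  proof (cases "z \<in> unit_ball")
    case True
    show ?thesis
      unfolding I_op_eq[OF True] zeta_d_pow_linear[OF \<Phi> \<Psi> True]
      by (simp add: distrib_left sum.distrib sum_distrib_left mult.left_commute)
  qed (simp add: I_op_outside)
  then show "I_op \<nu> n l (\<lambda>z \<zeta>. \<Phi> z \<zeta> + \<Psi> z \<zeta>) = (\<lambda>z \<zeta>. I_op \<nu> n l \<Phi> z \<zeta> + I_op \<nu> n l \<Psi> z \<zeta>)"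
    "I_op \<nu> n l (\<lambda>z \<zeta>. a * \<Phi> z \<zeta>) = (\<lambda>z \<zeta>. a * I_op \<nu> n l \<Phi> z \<zeta>)"
    by (simp_all add: fun_eq_iff)
qed

text \<open>Reversing signs in the falling factorial turns \<open>(-1) ^ k\<close> times the
  binomial coefficient of \<open>n - l\<close> over \<open>k\<close> into the rising factorial of
  \<open>l - n\<close> divided by \<open>fact k\<close>.\<close>

lemma I_op_coefficient:
  assumes "l \<le> n"
  shows "(-1) ^ k / of_real (pochhammer (2 * real l + \<nu>) k) * of_nat ((n - l) choose k) * (x :: complex) =
    of_real (pochhammer (real l - real n) k / pochhammer (2 * real l + \<nu>) k) * (x / fact k)"
proof -
  have "real ((n - l) choose k) = (-1) ^ k * pochhammer (real l - real n) k / fact k"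
    using gbinomial_pochhammer[of "real (n - l)" k] assms by (simp add: binomial_gbinomial of_nat_diff)
  then have "pochhammer (real l - real n) k = (-1) ^ k * fact k * real ((n - l) choose k)"
    by (simp add: power_mult_distrib[symmetric] flip: mult.assoc)
  then show ?thesis by (simp add: divide_simps)
qed

text \<open>The identity for \<open>alpha_inv\<close> and \<open>beta_inv\<close> is applied to the
  preimage \<open>alpha c \<nu> l g L \<Phi>\<close>. Its image under the operator lies in
  \<open>H2_deg\<close>, so injectivity of \<open>beta_inv\<close> there identifies it with the
  value of \<open>beta\<close>.\<close>

lemma I_op_intertwines:
  fixes \<Phi> :: "complex^'d \<Rightarrow> complex^'d \<Rightarrow> complex"
  assumes ip: "K_invariant_inner n ip" and c: "c > 0" and \<nu>: "0 < \<nu>" and l: "l \<le> n" and \<Phi>: "\<Phi> \<in> H2_hom c \<nu> l"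
    and g: "g \<in> G_group" and L: "log_branch g L"
  shows "beta c ip \<nu> n g L (I_op \<nu> n l \<Phi>) = I_op \<nu> n l (alpha c \<nu> l g L \<Phi>)"
proof -
  have pair: "ball_aut_pair g (inv_into unit_ball g)" using g G_group_subset by (blast intro: ball_auts_pair)
  obtain b U where M: "moebius_form g b U L" by (rule moebius_form_exists[OF pair L])
  let ?\<Psi> = "alpha c \<nu> l g L \<Phi>"
  have \<Psi>: "?\<Psi> \<in> H2_hom c \<nu> l" "alpha_inv \<nu> g L ?\<Psi> = \<Phi>" by (rule alpha_eq[OF pair L c \<Phi>])+
  have hol: "?\<Psi> \<in> holo_maps (hom_polys l)" using \<Psi>(1) by (simp add: H2_hom_iff)
  have "beta_inv \<nu> n g L (I_op \<nu> n l ?\<Psi>) = I_op \<nu> n l \<Phi>"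
    using intertwining_identity[OF M hol l \<nu>] \<Psi>(2) by simp
  moreover have "I_op \<nu> n l ?\<Psi> \<in> H2_deg c ip \<nu> n" by (rule I_op_H2_deg[OF ip c \<nu> l \<Psi>(1)])
  moreover have "inj_on (beta_inv \<nu> n g L) (H2_deg c ip \<nu> n)"
    by (rule inj_on_subset[OF beta_inv_inj[OF M pair]]) (auto simp: H2_deg_def)
  ultimately show ?thesis unfolding beta_def by (metis the_inv_into_f_f)
qed

theorem theorem3p3:
  fixes ip :: "(complex^'d \<Rightarrow> complex) \<Rightarrow> (complex^'d \<Rightarrow> complex) \<Rightarrow> complex"
    and c \<nu> :: real and n :: nat
  assumes "c > 0"
    and "K_invariant_inner n ip"
    and "\<And>l. l \<le> n \<Longrightarrow>
           polynomial_maps (hom_polys l) \<subseteq> (H2_hom c \<nu> l :: (complex^'d \<Rightarrow> complex^'d \<Rightarrow> complex) set)"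
    and "polynomial_maps (deg_polys n) \<subseteq> H2_deg c ip \<nu> n"
  shows "\<forall>l\<le>n.
     (\<forall>\<Phi>\<in>H2_hom c \<nu> l. \<forall>z\<in>unit_ball. \<forall>\<zeta> :: complex^'d.
        I_op \<nu> n l \<Phi> z \<zeta> =
          (\<Sum>k=0..n - l. of_real (pochhammer (real l - real n) k / pochhammer (2 * real l + \<nu>) k) *
             (zeta_d_pow k \<Phi> z \<zeta> / fact k)) \<and>
        I_op \<nu> n l \<Phi> z \<zeta> =
          (\<Sum>k=0..n - l. of_real (pochhammer (real l - real n) k / pochhammer (2 * real l + \<nu>) k) *
             cal_E k \<Phi> z \<zeta>)) \<and>
     intertwiner (H2_hom c \<nu> l) (H2_deg c ip \<nu> n) (alpha c \<nu> l) (beta c ip \<nu> n) (I_op \<nu> n l)"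
proof (intro allI impI conjI)
  fix l assume l: "l \<le> n"
  \<comment> \<open>The space of homogeneous polynomials of degree 0 contains the constants, so the
    largeness assumption is used at \<open>l = 0\<close>.\<close>
  have \<nu>: "0 < \<nu>" by (rule square_integrable_weight_pos[OF assms(1) assms(3)[of 0]]) simp
  show "\<forall>\<Phi>\<in>H2_hom c \<nu> l. \<forall>z\<in>unit_ball. \<forall>\<zeta> :: complex^'d.
        I_op \<nu> n l \<Phi> z \<zeta> =
          (\<Sum>k=0..n - l. of_real (pochhammer (real l - real n) k / pochhammer (2 * real l + \<nu>) k) *
             (zeta_d_pow k \<Phi> z \<zeta> / fact k)) \<and>
        I_op \<nu> n l \<Phi> z \<zeta> =
          (\<Sum>k=0..n - l. of_real (pochhammer (real l - real n) k / pochhammer (2 * real l + \<nu>) k) *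
             cal_E k \<Phi> z \<zeta>)"
    unfolding I_op_def cal_E_def I_op_coefficient[OF l] by simp
  have hol: "\<Phi> \<in> holo_maps (hom_polys l)" if "\<Phi> \<in> H2_hom c \<nu> l" for \<Phi> :: "complex^'d \<Rightarrow> complex^'d \<Rightarrow> complex"
    using that by (simp add: H2_hom_iff)
  show "intertwiner (H2_hom c \<nu> l) (H2_deg c ip \<nu> n) (alpha c \<nu> l) (beta c ip \<nu> n) (I_op \<nu> n l)"
    unfolding intertwiner_def
    by (intro conjI ballI allI impI I_op_H2_deg[OF assms(2,1) \<nu> l] I_op_linear hol
        I_op_intertwines[OF assms(2,1) \<nu> l])
qed

end
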